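(* Let $\mathfrak{m}_{PDT}$ be a Poisson-Delaunay tessellation of intensity $\gamma=1$ in $\mathbf{R}^2$. Let $A_{\min,PDT}(\rho)=\min\{\lambda_2(C):C\in\mathfrak{m}_{PDT},\ z(C)\in\mathbf{W}_\rho\}$, where $z(C)$ is the circumcenter of the triangle $C$ and $\mathbf{W}_\rho=\rho^{1/2}[0,1]^2$. Then for all $t\ge0$, $$\mathbb{P}\left(\alpha_3^{3/5}\rho^{3/5}A_{\min,PDT}(\rho)\ge t\right)\longrightarrow e^{-t^{5/3}}\qquad\text{as }\rho\to\infty,$$ where $\alpha_3=2^{-2/3}\cdot3^{-1/2}\cdot5^{-1}\cdot\pi^{2/3}\cdot\Gamma(1/6)^2$.
   Context: $\lambda_2$ is area. Let $\mathbf{X}$ be a homogeneous Poisson point process in $\mathbf{R}^2$. If three points of $\mathbf{X}$ lie on a circle containing no point of $\mathbf{X}$ in its interior, their convex hull (a triangle) is called a cell; the collection of all such cells is the Poisson-Delaunay tessellation $\mathfrak{m}_{PDT}$. The nucleus $z(C)$ of a cell $C$ is its circumcenter. The intensity of the tessellation is $\gamma=\lambda_2(B)^{-1}\mathbb{E}[\#\{C\in\mathfrak{m}_{PDT}:z(C)\in B\}]$ for any Borel $B$ with $0<\lambda_2(B)<\infty$; intensity $\gamma=1$ corresponds to $\mathbf{X}$ having intensity $\beta_2=1/2$. *)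

theory Defs
  imports "HOL-Probability.Probability"
begin

text \<open>
  A point process is represented by its random locally finite support; this loses nothing for
  homogeneous Poisson processes, which are simple. The counting law is written out instead of using
  \<^const>\<open>poisson_pmf\<close>, which is only specified for positive rates, while null sets \<open>B\<close> have rate 0.
\<close>

locale homogeneous_poisson_process = prob_space M
  for M :: "'w measure" +
  fixes X :: "'w \<Rightarrow> 'b::euclidean_space set" and \<beta> :: real
  assumes intensity_pos: "\<beta> > 0"
    and locally_finite: "\<And>\<omega> B. \<omega> \<in> space M \<Longrightarrow> bounded B \<Longrightarrow> finite (X \<omega> \<inter> B)"
    and count_measurable:
      "\<And>B. B \<in> sets borel \<Longrightarrow> bounded B \<Longrightarrow>
         random_variable (count_space UNIV) (\<lambda>\<omega>. card (X \<omega> \<inter> B))"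
    and count_poisson:
      "\<And>B k. B \<in> sets borel \<Longrightarrow> bounded B \<Longrightarrow>
         prob {\<omega> \<in> space M. card (X \<omega> \<inter> B) = k} =
           (\<beta> * measure lborel B) ^ k / fact k * exp (- (\<beta> * measure lborel B))"
    and count_indep:
      "\<And>(B :: nat \<Rightarrow> 'b set) n.
         (\<And>i. i < n \<Longrightarrow> B i \<in> sets borel \<and> bounded (B i)) \<Longrightarrow>
         disjoint_family_on B {..<n} \<Longrightarrow>
         indep_vars (\<lambda>_. count_space UNIV) (\<lambda>i \<omega>. card (X \<omega> \<inter> B i)) {..<n}"

definition delaunay_cells :: "(real^2) set \<Rightarrow> (real^2) set set" where
  "delaunay_cells P =
     {convex hull {x, y, z} | x y z.
        x \<in> P \<and> y \<in> P \<and> z \<in> P \<and> x \<noteq> y \<and> y \<noteq> z \<and> x \<noteq> z \<and>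
        (\<exists>c r. {x, y, z} \<subseteq> sphere c r \<and> P \<inter> ball c r = {})}"

text \<open>
  The vertices of a triangle, given as a set, are its extreme points; the circumcenter is the point
  equidistant from them.
\<close>

definition circumcenter :: "(real^2) set \<Rightarrow> real^2" where
  "circumcenter C = (THE c. \<exists>r. \<forall>p. p extreme_point_of C \<longrightarrow> dist c p = r)"

text \<open>Here \<open>emeasure (count_space UNIV)\<close> is the number of elements of a possibly infinite set.\<close>

definition tessellation_intensity ::
    "'w measure \<Rightarrow> ('w \<Rightarrow> (real^2) set set) \<Rightarrow> real \<Rightarrow> bool" where
  "tessellation_intensity M m \<gamma> \<longleftrightarrow>
     (\<forall>B\<in>sets borel. 0 < emeasure lborel B \<and> emeasure lborel B < \<infinity> \<longrightarrow>
        (\<integral>\<^sup>+\<omega>. emeasure (count_space UNIV) {C \<in> m \<omega>. circumcenter C \<in> B} \<partial>M)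
          / emeasure lborel B = ennreal \<gamma>)"

definition window :: "real \<Rightarrow> (real^2) set" where
  "window \<rho> = (\<lambda>x. sqrt \<rho> *\<^sub>R x) ` cbox 0 1"

text \<open>If no nucleus lies in the window, the value is \<open>\<infinity>\<close>.\<close>

definition min_area :: "(real^2) set set \<Rightarrow> real \<Rightarrow> ennreal" where
  "min_area m \<rho> = (INF C\<in>{C \<in> m. circumcenter C \<in> window \<rho>}. emeasure lborel C)"

definition alpha3 :: real where
  "alpha3 = 2 powr (-2/3) * 3 powr (-1/2) * 5 powr (-1) * pi powr (2/3) * (Gamma (1/6))\<^sup>2"

end

theory Submission
  imports Defs "HOL-Real_Asymp.Real_Asymp"
begin

text \<open>
  The minimal area is at least a given bound iff no empty triple with circumcenter in the window has
  area below \<open>v = t (\<alpha>\<^sub>3 \<rho>) powr (-3/5)\<close>. By the Mecke formula the expected number of such ordered triples is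
  an integral over triangles; writing a triangle as \<open>x, x + y, x + y w\<close> with complex multiplication
  separates position, circumradius and shape \<open>w\<close>. The shapes with normalised area below \<open>s\<close> concentrate along the
  line \<open>w \<in> \<real>\<close> and have mass asymptotic to a constant times \<open>s powr (5/3)\<close>, the constant being a Beta integral; this
  fixes \<open>\<alpha>\<^sub>3\<close>.

  For the Poisson limit, the window is cut into blocks of fixed side \<open>L\<close>, each shrunk by a margin \<open>K\<close>, and only
  cells of circumradius at most \<open>K\<close> are kept. The blocks are then independent. In one block the probability of a
  small cell differs from a sixth of the expected number of ordered triples by the expected number of pairs of small
  triangles, which is \<open>o(v powr (5/3))\<close>. Outside the blocks the first moment suffices, and its contribution
  vanishes when first \<open>\<rho>\<close>, then \<open>K\<close> and \<open>L / K\<close> tend to infinity.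
\<close>

section \<open>Configurations\<close>

text \<open>A typical cell of small area \<open>v\<close> has circumradius of order 1, sides of
  order \<open>v powr (1/3)\<close> and height of order \<open>v powr (2/3)\<close>: its vertices
  crowd on a short arc of an empty circle. Placing the second vertex costs
  \<open>v powr (2/3)\<close> and the third \<open>v\<close>, hence the exponent 5/3. A triangle of
  diameter \<open>sqrt v\<close>, or one with two vertices at distance \<open>v\<close>, costs
  \<open>v ^ 2\<close>, which is negligible. The obstacle to a Poisson limit is clumping, two small
  triangles arising together. If they share a side longer than \<delta>, the remaining vertex of the
  second is confined to a strip of area of order \<open>v / \<delta>\<close>; a side shorter than
  \<delta> costs \<open>\<delta> ^ 2\<close>. Both are harmless if \<delta> is a power of
  \<open>v\<close> with exponent strictly between 5/6 and 1. The cut-off \<open>K\<close> that makes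
  blocks independent also bounds these strips. The hypotheses speak of counts in finitely many
  disjoint bounded sets. Independence of whole restrictions and the Mecke formula are derived from
  them; the intensity 1 fixes the rate 1/2 because the process has \<open>2 * \<beta>\<close> cells
  per unit area.\<close>

definition lfin :: "'b::euclidean_space set set" where
  "lfin = {\<xi>. \<forall>B. bounded B \<longrightarrow> finite (\<xi> \<inter> B)}"

definition cyl :: "('b::euclidean_space set \<times> nat) set \<Rightarrow> 'b set set" where
  "cyl S = {\<xi>\<in>lfin. \<forall>s\<in>S. card (\<xi> \<inter> fst s) = snd s}"

text \<open>Test sets are bounded: there a locally finite configuration has finitely many points,
  whereas \<open>card\<close> would report 0 for an infinite intersection. Finitely many conditions
  at once make the family stable under intersection.\<close>

definition cyls :: "'b::euclidean_space set set set" where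
  "cyls = {cyl S | S. finite S \<and> (\<forall>s\<in>S. fst s \<in> sets borel \<and> bounded (fst s))}"

definition cfg :: "'b::euclidean_space set measure" where
  "cfg = sigma lfin cyls"

lemma cyls_Pow: "cyls \<subseteq> Pow lfin"
  by (auto simp: cyls_def cyl_def)

lemma space_cfg [simp]: "space cfg = lfin"
  unfolding cfg_def by (rule space_measure_of[OF cyls_Pow])

lemma sets_cfg: "sets cfg = sigma_sets lfin cyls"
  unfolding cfg_def by (rule sets_measure_of[OF cyls_Pow])

lemma Int_stable_cyls: "Int_stable cyls"
proof (rule Int_stableI)
  fix a b :: "'a set set" assume "a \<in> cyls" "b \<in> cyls"
  then obtain S T where "a = cyl S" "b = cyl T" "finite S" "finite T"
    "\<forall>s\<in>S. fst s \<in> sets borel \<and> bounded (fst s)" "\<forall>s\<in>T. fst s \<in> sets borel \<and> bounded (fst s)"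
    unfolding cyls_def by blast
  then show "a \<inter> b \<in> cyls"
    unfolding cyls_def by (intro CollectI exI[of _ "S \<union> T"]) (auto simp: cyl_def)
qed

lemma lfin_in_cyls: "lfin \<in> cyls"
  unfolding cyls_def by (intro CollectI exI[of _ "{}"]) (auto simp: cyl_def)

lemma measurable_card_Int:
  assumes "B \<in> sets borel" "bounded B"
  shows "(\<lambda>\<xi>. card (\<xi> \<inter> B)) \<in> measurable cfg (count_space UNIV)"
proof (rule measurable_count_space_eq2_countable[THEN iffD2], intro conjI ballI)
  fix k
  have "(\<lambda>\<xi>. card (\<xi> \<inter> B)) -` {k} \<inter> space cfg = cyl {(B,k)}"
    by (auto simp: cyl_def)
  also have "\<dots> \<in> cyls" unfolding cyls_def using assms by (intro CollectI exI[of _ "{(B,k)}"]) auto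
  finally show "(\<lambda>\<xi>. card (\<xi> \<inter> B)) -` {k} \<inter> space cfg \<in> sets cfg"
    unfolding sets_cfg by (rule sigma_sets.Basic)
qed auto

lemma measurable_into_cfg:
  assumes "\<And>x. x \<in> space N \<Longrightarrow> f x \<in> lfin"
    and "\<And>B. B \<in> sets borel \<Longrightarrow> bounded B \<Longrightarrow> (\<lambda>x. card (f x \<inter> B)) \<in> measurable N (count_space UNIV)"
  shows "f \<in> measurable N cfg"
  unfolding cfg_def
proof (rule measurable_measure_of[OF cyls_Pow])
  show "f \<in> space N \<rightarrow> lfin" using assms by auto
  fix A :: "'b set set" assume "A \<in> cyls"
  then obtain S where S: "A = cyl S" "finite S" "\<forall>s\<in>S. fst s \<in> sets borel \<and> bounded (fst s)"
    unfolding cyls_def by blast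
  have "{x\<in>space N. \<forall>s\<in>S. card (f x \<inter> fst s) = snd s} \<in> sets N"
  proof (rule sets.sets_Collect_finite_All[OF _ \<open>finite S\<close>])
    fix s assume "s \<in> S"
    then have [measurable]: "(\<lambda>x. card (f x \<inter> fst s)) \<in> measurable N (count_space UNIV)"
      using S assms by (cases s) auto
    show "{x \<in> space N. card (f x \<inter> fst s) = snd s} \<in> sets N" by measurable
  qed
  also have "{x\<in>space N. \<forall>s\<in>S. card (f x \<inter> fst s) = snd s} = f -` A \<inter> space N"
    using assms(1) by (auto simp: S cyl_def)
  finally show "f -` A \<inter> space N \<in> sets N" .
qed

lemma lfin_subset: "\<xi> \<in> lfin \<Longrightarrow> \<eta> \<subseteq> \<xi> \<Longrightarrow> \<eta> \<in> lfin"
  unfolding lfin_def by (blast intro: finite_subset[OF Int_mono])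

lemma measurable_restrict_cfg:
  assumes "U \<in> sets borel"
  shows "(\<lambda>\<xi>. \<xi> \<inter> U) \<in> measurable cfg cfg"
proof (rule measurable_into_cfg)
  fix B :: "'a set" assume "B \<in> sets borel" "bounded B"
  then show "(\<lambda>x. card (x \<inter> U \<inter> B)) \<in> measurable cfg (count_space UNIV)"
    using measurable_card_Int[of "U \<inter> B"] assms by (auto simp: Int_assoc bounded_Int)
qed (auto intro: lfin_subset)

text \<open>Bridges from the index sets \<open>{..<n}\<close> of the locale to arbitrary finite
  index sets; below, the indices are pairs of a region and a subset of its test sets.\<close>

lemma (in prob_space) indep_vars_reindex_bij:
  assumes f: "bij_betw f I L" and ind: "indep_vars (\<lambda>i. M' (f i)) (\<lambda>i. X (f i)) I"
  shows "indep_vars M' X L"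
  unfolding indep_vars_def2
proof (intro conjI ballI)
  fix i assume "i \<in> L"
  then show "random_variable (M' i) (X i)"
    using ind f unfolding indep_vars_def2 bij_betw_def by auto
next
  have ind': "indep_sets (\<lambda>i. {X (f i) -` A \<inter> space M |A. A \<in> sets (M' (f i))}) I"
    using ind unfolding indep_vars_def2 by auto
  show "indep_sets (\<lambda>i. {X i -` A \<inter> space M |A. A \<in> sets (M' i)}) L"
  proof (rule indep_setsI)
    fix i assume "i \<in> L"
    then show "{X i -` A \<inter> space M |A. A \<in> sets (M' i)} \<subseteq> events"
      using ind' f unfolding indep_sets_def bij_betw_def by blast
  next
    fix A J assume J: "J \<noteq> {}" "J \<subseteq> L" "finite J"
      and A: "\<forall>j\<in>J. A j \<in> {X j -` A \<inter> space M |A. A \<in> sets (M' j)}"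
    define J' where "J' = {i\<in>I. f i \<in> J}"
    have b: "f ` J' = J" "inj_on f J'"
      using f J(2) unfolding J'_def bij_betw_def inj_on_def by auto
    have fin: "finite J'" using b J by (metis finite_imageD)
    have "prob (\<Inter>j\<in>J'. A (f j)) = (\<Prod>j\<in>J'. prob (A (f j)))"
    proof (rule indep_setsD[OF ind'])
      show "J' \<subseteq> I" "J' \<noteq> {}" "finite J'" using b J fin by (auto simp: J'_def)
      show "\<forall>j\<in>J'. A (f j) \<in> {X (f j) -` A \<inter> space M |A. A \<in> sets (M' (f j))}"
        using A J'_def by auto
    qed
    then show "prob (\<Inter>j\<in>J. A j) = (\<Prod>j\<in>J. prob (A j))"
      using prod.reindex[OF b(2), of "\<lambda>j. prob (A j)"] unfolding b(1)[symmetric] by (simp add: o_def image_image)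
  qed
qed

section \<open>Independence of restrictions to disjoint sets\<close>

context homogeneous_poisson_process
begin

lemma X_lfin: "\<omega> \<in> space M \<Longrightarrow> X \<omega> \<in> lfin"
  unfolding lfin_def using locally_finite by auto

lemma X_measurable: "X \<in> measurable M cfg"
  by (rule measurable_into_cfg) (auto intro: X_lfin count_measurable)

lemma indep_counts:
  assumes "finite L" "disjoint_family_on E L" "\<And>i. i \<in> L \<Longrightarrow> E i \<in> sets borel \<and> bounded (E i)"
  shows "indep_vars (\<lambda>_. count_space UNIV) (\<lambda>i \<omega>. card (X \<omega> \<inter> E i)) L"
proof -
  obtain f where f: "bij_betw f {0..<card L} L" using ex_bij_betw_nat_finite[OF assms(1)] by blast
  then have f: "bij_betw f {..<card L} L" by (simp add: atLeast0LessThan)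
  have "indep_vars (\<lambda>_. count_space UNIV) (\<lambda>i \<omega>. card (X \<omega> \<inter> E (f i))) {..<card L}"
  proof (rule count_indep)
    show "\<And>i. i < card L \<Longrightarrow> E (f i) \<in> sets borel \<and> bounded (E (f i))"
      using assms f by (auto simp: bij_betw_def)
    show "disjoint_family_on (\<lambda>i. E (f i)) {..<card L}"
      unfolding disjoint_family_on_def
    proof (intro ballI impI)
      fix m n assume "m \<in> {..<card L}" "n \<in> {..<card L}" "m \<noteq> n"
      then have "f m \<in> L" "f n \<in> L" "f m \<noteq> f n" using f by (auto simp: bij_betw_def inj_on_def)
      then show "E (f m) \<inter> E (f n) = {}" using assms(2) by (auto simp: disjoint_family_on_def)
    qed
  qed
  then show ?thesis by (rule indep_vars_reindex_bij[OF f])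
qed

text \<open>It is enough to treat cylinder events, a generator stable under intersection. The
  finitely many test sets of a cylinder cut \<open>U j\<close> into disjoint bounded atoms, whose
  counts are independent by \<open>indep_counts\<close>; grouping the atoms by \<open>j\<close>
  gives independence of the cylinder events. The sets \<open>U j\<close> themselves may be
  unbounded.\<close>

lemma indep_restrictions:
  assumes fin: "finite I" and disj: "disjoint_family_on U I" and U: "\<And>i. i \<in> I \<Longrightarrow> U i \<in> sets borel"
  shows "indep_vars (\<lambda>_. cfg) (\<lambda>i \<omega>. X \<omega> \<inter> U i) I"
proof -
  let ?Y = "\<lambda>i \<omega>. X \<omega> \<inter> U i"
  let ?F = "\<lambda>i. {?Y i -` A \<inter> space M |A. A \<in> cyls}"
  have Ym: "?Y i \<in> measurable M cfg" if "i \<in> I" for i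
    using measurable_compose[OF X_measurable measurable_restrict_cfg[OF U[OF that]]] .
  have Ysp: "?Y i \<in> space M \<rightarrow> lfin" for i
    using X_lfin by (auto intro: lfin_subset)
  have "indep_sets ?F I"
  proof (rule indep_setsI)
    fix i assume "i \<in> I"
    have "cyls \<subseteq> sets cfg" unfolding sets_cfg by (auto intro: sigma_sets.Basic)
    then show "?F i \<subseteq> events"
      using measurable_sets[OF Ym[OF \<open>i \<in> I\<close>]] by auto
  next
    fix A J assume J: "J \<noteq> {}" "J \<subseteq> I" "finite J" and A: "\<forall>j\<in>J. A j \<in> ?F j"
    have "\<exists>S. finite S \<and> (\<forall>s\<in>S. fst s \<in> sets borel \<and> bounded (fst s)) \<and> A j = ?Y j -` cyl S \<inter> space M" if "j \<in> J" for j
    proof -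
      have "A j \<in> ?F j" using bspec[OF A that] .
      then obtain C where C: "C \<in> cyls" "A j = ?Y j -` C \<inter> space M"
        unfolding mem_Collect_eq by (elim exE conjE) (rule that)
      from C(1) obtain S where "C = cyl S" "finite S" "\<forall>s\<in>S. fst s \<in> sets borel \<and> bounded (fst s)"
        unfolding cyls_def mem_Collect_eq by (elim exE conjE) (rule that)
      with C(2) show ?thesis by (intro exI[of _ S]) simp
    qed
    then have "\<forall>j\<in>J. \<exists>S. finite S \<and> (\<forall>s\<in>S. fst s \<in> sets borel \<and> bounded (fst s)) \<and> A j = ?Y j -` cyl S \<inter> space M"
      by (intro ballI)
    from bchoice[OF this] obtain S where S0: "\<forall>j\<in>J. finite (S j) \<and> (\<forall>s\<in>S j. fst s \<in> sets borel \<and> bounded (fst s)) \<and> A j = ?Y j -` cyl (S j) \<inter> space M"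
      by (rule exE)
    have S: "\<And>j. j \<in> J \<Longrightarrow> finite (S j)"
      "\<And>j s. j \<in> J \<Longrightarrow> s \<in> S j \<Longrightarrow> fst s \<in> sets borel \<and> bounded (fst s)"
      "\<And>j. j \<in> J \<Longrightarrow> A j = ?Y j -` cyl (S j) \<inter> space M"
      using S0 by simp_all
    \<comment> \<open>\<open>E (j, T)\<close> is the atom of \<open>U j\<close> consisting of the
      points that, among the test sets of \<open>S j\<close>, lie in exactly those of
      \<open>T\<close>.\<close>
    define E where "E = (\<lambda>(j,T). U j \<inter> (\<Inter>s\<in>T. fst s) \<inter> (\<Inter>s\<in>S j - T. - fst s))"
    \<comment> \<open>\<open>T = {}\<close> is left out: that atom can be unbounded, and no count in
      a test set involves it.\<close>
    define K where "K j = {j} \<times> (Pow (S j) - {{}})" for j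
    define L where "L = (\<Union>j\<in>J. K j)"
    have finK: "finite (K j)" if "j \<in> J" for j using S that by (auto simp: K_def)
    have finL: "finite L" using finK J by (auto simp: L_def)
    have Ebb: "E i \<in> sets borel \<and> bounded (E i)" if iL: "i \<in> L" for i
    proof -
      obtain j T where i: "i = (j,T)" "j \<in> J" "T \<subseteq> S j" "T \<noteq> {}" using iL by (auto simp: L_def K_def)
      then obtain s where s: "s \<in> T" by auto
      have "finite T" using i S finite_subset by blast
      have *: "fst s \<in> sets borel" if "s \<in> S j" for s using S(2)[of j s] that i by auto
      then have "E i \<in> sets borel"
        unfolding E_def i(1) prod.case
      proof (intro sets.Int)
        show "(\<Inter>s\<in>T. fst s) \<in> sets borel"
          using i \<open>finite T\<close> * by (intro sets.finite_INT) blast+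
        show "(\<Inter>s\<in>S j - T. - fst s) \<in> sets borel"
        proof (cases "S j - T = {}")
          case False
          then show ?thesis using * S(1)[of j] i by (intro sets.finite_INT borel_comp) blast+
        next
          case True
          then show ?thesis unfolding True by simp
        qed
        show "U j \<in> sets borel" using U i J by auto
      qed
      moreover have "bounded (fst s)" using S(2)[of j s] s i by auto
      then have "bounded (E i)" by (rule bounded_subset) (use s in \<open>auto simp: E_def i\<close>)
      ultimately show ?thesis by auto
    qed
    have Edisj: "disjoint_family_on E L"
      unfolding disjoint_family_on_def
    proof (intro ballI impI)
      fix a b assume ab: "a \<in> L" "b \<in> L" "a \<noteq> b"
      then obtain j T j' T' where *: "a = (j,T)" "b = (j',T')" "j \<in> J" "T \<subseteq> S j" "j' \<in> J" "T' \<subseteq> S j'"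
        by (auto simp: L_def K_def)
      show "E a \<inter> E b = {}"
      proof (cases "j = j'")
        case False
        have "j \<in> I" "j' \<in> I" using * J by auto
        then have "U j \<inter> U j' = {}" using disj False unfolding disjoint_family_on_def by blast
        then show ?thesis by (auto simp: * E_def)
      next
        case True
        then have "T \<noteq> T'" using ab * by auto
        then obtain s where "s \<in> T - T' \<or> s \<in> T' - T" by auto
        then show ?thesis using * True by (auto simp: E_def)
      qed
    qed
    have iv: "indep_vars (\<lambda>_. count_space UNIV) (\<lambda>i \<omega>. card (X \<omega> \<inter> E i)) L"
      by (rule indep_counts[OF finL Edisj Ebb])
    have iv': "indep_vars (\<lambda>j. PiM (K j) (\<lambda>_. count_space UNIV)) (\<lambda>j \<omega>. restrict (\<lambda>i. card (X \<omega> \<inter> E i)) (K j)) J"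
      by (rule indep_vars_restrict[OF iv]) (auto simp: L_def K_def disjoint_family_on_def)
    \<comment> \<open>The cylinder condition in terms of atom counts: the part of a test set
      \<open>s\<close> inside \<open>U j\<close> is the disjoint union of the atoms with
      \<open>s \<in> T\<close>.\<close>
    define Z where "Z j = {c\<in>space (PiM (K j) (\<lambda>_. count_space (UNIV::nat set))).
       \<forall>s\<in>S j. (\<Sum>T\<in>{T. T \<subseteq> S j \<and> s \<in> T}. c (j,T)) = snd s}" for j
    have Zm: "Z j \<in> sets (PiM (K j) (\<lambda>_. count_space UNIV))" if "j \<in> J" for j
      unfolding Z_def
    proof (rule sets.sets_Collect_finite_All[OF _ S(1)[OF that]])
      fix s assume "s \<in> S j"
      have "(\<lambda>c. \<Sum>T\<in>{T. T \<subseteq> S j \<and> s \<in> T}. c (j,T)) \<in> measurable (PiM (K j) (\<lambda>_. count_space (UNIV::nat set))) (count_space UNIV)"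
        by (intro measurable_sum_nat measurable_component_singleton) (auto simp: K_def)
      then show "{c \<in> space (PiM (K j) (\<lambda>_. count_space (UNIV::nat set))). (\<Sum>T\<in>{T. T \<subseteq> S j \<and> s \<in> T}. c (j,T)) = snd s} \<in> sets (PiM (K j) (\<lambda>_. count_space UNIV))"
        by measurable
    qed
    have AZ: "A j = (\<lambda>\<omega>. restrict (\<lambda>i. card (X \<omega> \<inter> E i)) (K j)) -` Z j \<inter> space M" if j: "j \<in> J" for j
    proof -
      have "card (X \<omega> \<inter> U j \<inter> fst s) = (\<Sum>T\<in>{T. T \<subseteq> S j \<and> s \<in> T}. restrict (\<lambda>i. card (X \<omega> \<inter> E i)) (K j) (j,T))"
        if w: "\<omega> \<in> space M" and s: "s \<in> S j" for s \<omega>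
      proof -
        have "X \<omega> \<inter> U j \<inter> fst s = (\<Union>T\<in>{T. T \<subseteq> S j \<and> s \<in> T}. X \<omega> \<inter> E (j,T))"
        proof (intro equalityI subsetI)
          fix x assume x: "x \<in> X \<omega> \<inter> U j \<inter> fst s"
          then show "x \<in> (\<Union>T\<in>{T. T \<subseteq> S j \<and> s \<in> T}. X \<omega> \<inter> E (j,T))"
            using s by (intro UN_I[of "{s\<in>S j. x \<in> fst s}"]) (auto simp: E_def)
        qed (auto simp: E_def)
        also have "card \<dots> = (\<Sum>T\<in>{T. T \<subseteq> S j \<and> s \<in> T}. card (X \<omega> \<inter> E (j,T)))"
        proof (rule card_UN_disjoint)
          show "finite {T. T \<subseteq> S j \<and> s \<in> T}" using S(1)[OF j] by auto
          show "\<forall>i\<in>{T. T \<subseteq> S j \<and> s \<in> T}. finite (X \<omega> \<inter> E (j, i))"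
            using locally_finite[OF w] Ebb j by (auto simp: L_def K_def)
          show "\<forall>i\<in>{T. T \<subseteq> S j \<and> s \<in> T}. \<forall>i'\<in>{T. T \<subseteq> S j \<and> s \<in> T}. i \<noteq> i' \<longrightarrow> X \<omega> \<inter> E (j, i) \<inter> (X \<omega> \<inter> E (j, i')) = {}"
            using Edisj j unfolding disjoint_family_on_def L_def K_def by blast
        qed
        also have "\<dots> = (\<Sum>T\<in>{T. T \<subseteq> S j \<and> s \<in> T}. restrict (\<lambda>i. card (X \<omega> \<inter> E i)) (K j) (j,T))"
          by (intro sum.cong) (auto simp: K_def)
        finally show ?thesis .
      qed
      then show ?thesis unfolding S(3)[OF j] using Ysp[of j]
        by (auto simp: cyl_def Z_def space_PiM Pi_iff)
    qed
    have "prob (\<Inter>j\<in>J. (\<lambda>\<omega>. restrict (\<lambda>i. card (X \<omega> \<inter> E i)) (K j)) -` Z j \<inter> space M) =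
       (\<Prod>j\<in>J. prob ((\<lambda>\<omega>. restrict (\<lambda>i. card (X \<omega> \<inter> E i)) (K j)) -` Z j \<inter> space M))"
      by (rule indep_varsD[OF iv']) (use J Zm in auto)
    then show "prob (\<Inter>j\<in>J. A j) = (\<Prod>j\<in>J. prob (A j))" using AZ by simp
  qed
  then have "indep_sets (\<lambda>i. sigma_sets (space M) (?F i)) I"
  proof (rule indep_sets_sigma)
    fix i show "Int_stable (?F i)"
    proof (rule Int_stableI)
      fix a b assume "a \<in> ?F i" "b \<in> ?F i"
      then obtain A B where "a = ?Y i -` A \<inter> space M" "b = ?Y i -` B \<inter> space M" "A \<in> cyls" "B \<in> cyls"
        unfolding mem_Collect_eq by (elim exE conjE) (rule that)
      then show "a \<inter> b \<in> ?F i" using Int_stable_cyls unfolding Int_stable_def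
        by (intro CollectI exI[of _ "A \<inter> B"]) auto
    qed
  qed
  moreover have "sigma_sets (space M) (?F i) = {?Y i -` A \<inter> space M |A. A \<in> sets cfg}" for i
    using sigma_sets_vimage_commute[OF Ysp[of i], of cyls] by (simp add: sets_cfg)
  ultimately show ?thesis
    unfolding indep_vars_def2 using Ym by auto
qed

end

section \<open>The Mecke formula\<close>

definition point_sum :: "'a set \<Rightarrow> ('a \<Rightarrow> ennreal) \<Rightarrow> ennreal" where
  "point_sum \<xi> f = (\<integral>\<^sup>+x. f x \<partial>count_space \<xi>)"

section \<open>Measurability of sums over the points of a configuration\<close>

lemma Times_UN_distrib: "A \<times> (\<Union>i\<in>I. B i) = (\<Union>i\<in>I. A \<times> B i)"
  by auto

text \<open>These rectangles are the generator on which kernels and measures on pairs (point,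
  remaining configuration) are compared. A general measurable second factor is reached by induction
  on \<open>sigma_sets\<close> with the Borel factor fixed.\<close>

lemma borel_cfg_generator:
  "sets (borel \<Otimes>\<^sub>M cfg) = sigma_sets (UNIV \<times> lfin) {B \<times> C |B C. B \<in> sets borel \<and> C \<in> cyls}"
  (is "_ = sigma_sets ?\<Omega> ?G")
proof
  have cyl: "cyls \<subseteq> sets cfg" unfolding sets_cfg by (auto intro: sigma_sets.Basic)
  have "?G \<subseteq> sets (borel \<Otimes>\<^sub>M cfg)" using cyl by auto
  then have "sigma_sets (space (borel \<Otimes>\<^sub>M cfg)) ?G \<subseteq> sets (borel \<Otimes>\<^sub>M cfg)"
    by (rule sets.sigma_sets_subset)
  then show "sigma_sets ?\<Omega> ?G \<subseteq> sets (borel \<Otimes>\<^sub>M cfg)" by (simp add: space_pair_measure)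
  have Gp: "?G \<subseteq> Pow ?\<Omega>" using cyls_Pow by fastforce
  interpret sigma_algebra ?\<Omega> "sigma_sets ?\<Omega> ?G" by (rule sigma_algebra_sigma_sets[OF Gp])
  have "B \<times> C \<in> sigma_sets ?\<Omega> ?G" if B: "B \<in> sets borel" and C: "C \<in> sigma_sets lfin cyls" for B C
    using C
  proof induction
    case (Basic a) then show ?case using B by (intro sigma_sets.Basic) auto
  next
    case Empty then show ?case by (simp add: sigma_sets.Empty)
  next
    case (Compl a)
    have "B \<times> lfin \<in> sigma_sets ?\<Omega> ?G" using B lfin_in_cyls by (intro sigma_sets.Basic) auto
    then have "B \<times> lfin - B \<times> a \<in> sigma_sets ?\<Omega> ?G" using Compl.IH by (rule Diff)
    moreover have "B \<times> lfin - B \<times> a = B \<times> (lfin - a)" by auto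
    ultimately show ?case by simp
  next
    case (Union a)
    have "(\<Union>i. B \<times> a i) \<in> sigma_sets ?\<Omega> ?G" using Union.IH by (intro countable_UN) auto
    then show ?case by (simp add: Times_UN_distrib)
  qed
  then show "sets (borel \<Otimes>\<^sub>M cfg) \<subseteq> sigma_sets ?\<Omega> ?G"
    unfolding sets_pair_measure space_borel space_cfg
    by (intro sigma_sets_mono) (auto simp: sets_cfg)
qed

lemma Int_stable_rect: "Int_stable {B \<times> C |B C. B \<in> sets borel \<and> C \<in> cyls}"
proof (rule Int_stableI)
  fix a b :: "('a \<times> 'b set) set"
  assume "a \<in> {B \<times> C |B C. B \<in> sets borel \<and> C \<in> cyls}" "b \<in> {B \<times> C |B C. B \<in> sets borel \<and> C \<in> cyls}"
  then obtain B C B' C' where "a = B \<times> C" "b = B' \<times> C'" "B \<in> sets borel" "B' \<in> sets borel" "C \<in> cyls" "C' \<in> cyls"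
    by auto
  then show "a \<inter> b \<in> {B \<times> C |B C. B \<in> sets borel \<and> C \<in> cyls}"
    using Int_stable_cyls unfolding Int_stable_def
    by (intro CollectI exI[of _ "B \<inter> B'"] exI[of _ "C \<inter> C'"]) auto
qed

lemma space_borel_cfg [simp]: "space (borel \<Otimes>\<^sub>M cfg) = UNIV \<times> lfin"
  by (simp add: space_pair_measure)

lemma lfin_Diff [simp]: "\<xi> \<in> lfin \<Longrightarrow> \<xi> - A \<in> lfin"
  by (auto intro: lfin_subset)

lemma lfin_finite: "\<xi> \<in> lfin \<Longrightarrow> bounded B \<Longrightarrow> finite (\<xi> \<inter> B)"
  by (auto simp: lfin_def)

text \<open>The reduced Campbell measure of a single configuration. Averaging it over the law gives
  the left-hand side of the Mecke formula; a bounded window \<open>D\<close> keeps it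
  finite.\<close>

definition reduced :: "'b::euclidean_space set \<Rightarrow> 'b set \<Rightarrow> ('b \<times> 'b set) measure" where
  "reduced D \<xi> = distr (count_space (\<xi> \<inter> D)) (borel \<Otimes>\<^sub>M cfg) (\<lambda>x. (x, \<xi> - {x}))"

text \<open>The normalisation makes the kernel substochastic, so that integrals against it depend measurably on the configuration.\<close>

definition reduced1 :: "'b::euclidean_space set \<Rightarrow> 'b set \<Rightarrow> ('b \<times> 'b set) measure" where
  "reduced1 D \<xi> = scale_measure (ennreal (1 / (1 + real (card (\<xi> \<inter> D))))) (reduced D \<xi>)"

lemma reduced_measurable [simp]:
  "\<xi> \<in> lfin \<Longrightarrow> (\<lambda>x. (x, \<xi> - {x})) \<in> measurable (count_space (\<xi> \<inter> D)) (borel \<Otimes>\<^sub>M cfg)"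
  by (auto simp: space_pair_measure lfin_Diff)

lemma nn_integral_reduced:
  assumes "\<xi> \<in> lfin" "f \<in> borel_measurable (borel \<Otimes>\<^sub>M cfg)"
  shows "nn_integral (reduced D \<xi>) f = point_sum (\<xi> \<inter> D) (\<lambda>x. f (x, \<xi> - {x}))"
  unfolding reduced_def point_sum_def using assms by (intro nn_integral_distr) auto

lemma emeasure_reduced:
  assumes "\<xi> \<in> lfin" "bounded D" "E \<in> sets (borel \<Otimes>\<^sub>M cfg)"
  shows "emeasure (reduced D \<xi>) E = of_nat (card {x\<in>\<xi> \<inter> D. (x, \<xi> - {x}) \<in> E})"
proof -
  have fin: "finite (\<xi> \<inter> D)" by (rule lfin_finite[OF assms(1,2)])
  have eq: "(\<lambda>x. (x, \<xi> - {x})) -` E \<inter> (\<xi> \<inter> D) = {x\<in>\<xi> \<inter> D. (x, \<xi> - {x}) \<in> E}" by auto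
  have "emeasure (reduced D \<xi>) E = emeasure (count_space (\<xi> \<inter> D)) ((\<lambda>x. (x, \<xi> - {x})) -` E \<inter> (\<xi> \<inter> D))"
    unfolding reduced_def using assms by (subst emeasure_distr[OF reduced_measurable]) auto
  also have "\<dots> = of_nat (card {x\<in>\<xi> \<inter> D. (x, \<xi> - {x}) \<in> E})"
    unfolding eq using fin by (subst emeasure_count_space_finite) (auto intro: finite_subset[OF _ fin])
  finally show ?thesis .
qed

lemma point_sum_reduced1:
  assumes "\<xi> \<in> lfin" "f \<in> borel_measurable (borel \<Otimes>\<^sub>M cfg)"
  shows "point_sum (\<xi> \<inter> D) (\<lambda>x. f (x, \<xi> - {x})) = ennreal (1 + real (card (\<xi> \<inter> D))) * nn_integral (reduced1 D \<xi>) f"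
proof -
  have "nn_integral (reduced1 D \<xi>) f = ennreal (1 / (1 + real (card (\<xi> \<inter> D)))) * nn_integral (reduced D \<xi>) f"
    unfolding reduced1_def by (rule nn_integral_scale_measure) (use assms in \<open>simp add: reduced_def\<close>)
  then show ?thesis
    unfolding nn_integral_reduced[OF assms]
    by (simp add: mult.assoc[symmetric] ennreal_mult[symmetric] del: ennreal_plus)
qed

text \<open>Here an atom of the partition by the test sets of \<open>S\<close>, not a cell of the
  tessellation.\<close>

definition cell :: "('b::euclidean_space set \<times> nat) set \<Rightarrow> ('b set \<times> nat) set \<Rightarrow> 'b set" where
  "cell S T = {x. \<forall>s\<in>S. x \<in> fst s \<longleftrightarrow> s \<in> T}"

lemma cell_sets: "finite S \<Longrightarrow> \<forall>s\<in>S. fst s \<in> sets borel \<Longrightarrow> cell S T \<in> sets borel"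
proof -
  assume S: "finite S" "\<forall>s\<in>S. fst s \<in> sets borel"
  have "{x\<in>space borel. \<forall>s\<in>S. x \<in> fst s \<longleftrightarrow> s \<in> T} \<in> sets borel"
  proof (rule sets.sets_Collect_finite_All[OF _ S(1)])
    fix s assume "s \<in> S"
    then have [measurable]: "fst s \<in> sets borel" using S by auto
    show "{x \<in> space borel. (x \<in> fst s) = (s \<in> T)} \<in> sets borel" by measurable
  qed
  then show ?thesis by (simp add: cell_def)
qed

text \<open>If \<open>x\<close> is a point of \<xi> in \<open>cell S T\<close>, removing it lowers
  exactly the counts in the test sets of \<open>T\<close>. So \<xi> belongs here iff
  \<open>\<xi> - {x}\<close> lies in \<open>cyl S\<close>.\<close>

definition cyl1 :: "('b::euclidean_space set \<times> nat) set \<Rightarrow> ('b set \<times> nat) set \<Rightarrow> 'b set set" where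
  "cyl1 S T = {\<xi>\<in>lfin. \<forall>s\<in>S. card (\<xi> \<inter> fst s) = snd s + (if s \<in> T then 1 else 0)}"

lemma cyl1_sets:
  assumes "finite S" "\<forall>s\<in>S. fst s \<in> sets borel \<and> bounded (fst s)"
  shows "cyl1 S T \<in> sets cfg"
proof -
  have "{\<xi>\<in>space cfg. \<forall>s\<in>S. card (\<xi> \<inter> fst s) = snd s + (if s \<in> T then 1 else 0)} \<in> sets cfg"
  proof (rule sets.sets_Collect_finite_All[OF _ assms(1)])
    fix s assume "s \<in> S"
    then have [measurable]: "(\<lambda>\<xi>. card (\<xi> \<inter> fst s)) \<in> measurable cfg (count_space UNIV)"
      using assms measurable_card_Int by auto
    show "{\<xi> \<in> space cfg. card (\<xi> \<inter> fst s) = snd s + (if s \<in> T then 1 else 0)} \<in> sets cfg" by measurable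
  qed
  then show ?thesis by (simp add: cyl1_def)
qed

text \<open>Points are sorted by the atom containing them. Within an atom, whether
  \<open>\<xi> - {x}\<close> lies in the cylinder is the same for all \<open>x\<close>, so each atom
  contributes a count times an indicator, which is measurable in \<xi>.\<close>

lemma emeasure_reduced_rect:
  assumes \<xi>: "\<xi> \<in> lfin" and D: "bounded D" "D \<in> sets borel" and B: "B \<in> sets borel" and S: "finite S" "\<forall>s\<in>S. fst s \<in> sets borel \<and> bounded (fst s)"
  shows "emeasure (reduced D \<xi>) (B \<times> cyl S) =
    (\<Sum>T\<in>Pow S. of_nat (card (\<xi> \<inter> (D \<inter> B \<inter> cell S T))) * indicator (cyl1 S T) \<xi>)"
proof -
  have fin: "finite (\<xi> \<inter> D)" by (rule lfin_finite[OF \<xi> D(1)])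
  have CS: "cyl S \<in> sets cfg" unfolding sets_cfg using S by (intro sigma_sets.Basic) (auto simp: cyls_def)
  have eq: "x \<in> \<xi> \<Longrightarrow> x \<in> cell S T \<Longrightarrow> \<xi> - {x} \<in> cyl S \<longleftrightarrow> \<xi> \<in> cyl1 S T" if "T \<subseteq> S" for x T
  proof -
    assume x: "x \<in> \<xi>" "x \<in> cell S T"
    have "card ((\<xi> - {x}) \<inter> fst s) = snd s \<longleftrightarrow> card (\<xi> \<inter> fst s) = snd s + (if s \<in> T then 1 else 0)" if s: "s \<in> S" for s
    proof (cases "s \<in> T")
      case True
      then have "x \<in> \<xi> \<inter> fst s" using x s by (auto simp: cell_def)
      moreover have "finite (\<xi> \<inter> fst s)" using lfin_finite \<xi> S s by auto
      ultimately have "card (\<xi> \<inter> fst s) = Suc (card (\<xi> \<inter> fst s - {x}))" by (metis card_Suc_Diff1)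
      moreover have "(\<xi> - {x}) \<inter> fst s = \<xi> \<inter> fst s - {x}" by auto
      ultimately show ?thesis using True by simp
    next
      case False
      then have "x \<notin> fst s" using x s by (auto simp: cell_def)
      then have "(\<xi> - {x}) \<inter> fst s = \<xi> \<inter> fst s" by auto
      then show ?thesis using False by simp
    qed
    then show ?thesis using \<xi> lfin_Diff[OF \<xi>] by (auto simp: cyl_def cyl1_def)
  qed
  have "{x\<in>\<xi> \<inter> D. (x, \<xi> - {x}) \<in> B \<times> cyl S} = (\<Union>T\<in>Pow S. {x\<in>\<xi> \<inter> (D \<inter> B \<inter> cell S T). \<xi> \<in> cyl1 S T})"
  proof (intro equalityI subsetI)
    fix x assume x: "x \<in> {x\<in>\<xi> \<inter> D. (x, \<xi> - {x}) \<in> B \<times> cyl S}"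
    define T where "T = {s\<in>S. x \<in> fst s}"
    have "T \<subseteq> S" "x \<in> cell S T" by (auto simp: T_def cell_def)
    then show "x \<in> (\<Union>T\<in>Pow S. {x\<in>\<xi> \<inter> (D \<inter> B \<inter> cell S T). \<xi> \<in> cyl1 S T})"
      using x eq by auto
  qed (use eq in auto)
  also have "card \<dots> = (\<Sum>T\<in>Pow S. card {x\<in>\<xi> \<inter> (D \<inter> B \<inter> cell S T). \<xi> \<in> cyl1 S T})"
  proof (rule card_UN_disjoint)
    show "\<forall>i\<in>Pow S. \<forall>j\<in>Pow S. i \<noteq> j \<longrightarrow>
       {x \<in> \<xi> \<inter> (D \<inter> B \<inter> cell S i). \<xi> \<in> cyl1 S i} \<inter> {x \<in> \<xi> \<inter> (D \<inter> B \<inter> cell S j). \<xi> \<in> cyl1 S j} = {}"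
      by (auto simp: cell_def)
  qed (use S fin in \<open>auto intro: finite_subset[of _ "\<xi> \<inter> D"]\<close>)
  also have "\<dots> = (\<Sum>T\<in>Pow S. card (\<xi> \<inter> (D \<inter> B \<inter> cell S T)) * of_bool (\<xi> \<in> cyl1 S T))"
  proof (intro sum.cong refl)
    fix T
    show "card {x \<in> \<xi> \<inter> (D \<inter> B \<inter> cell S T). \<xi> \<in> cyl1 S T} = card (\<xi> \<inter> (D \<inter> B \<inter> cell S T)) * of_bool (\<xi> \<in> cyl1 S T)"
      by (cases "\<xi> \<in> cyl1 S T") (auto intro: arg_cong[where f=card])
  qed
  finally show ?thesis
    using emeasure_reduced[OF \<xi> D(1) pair_measureI[OF B CS]]
    by (simp add: indicator_def)
qed

text \<open>On generating rectangles, measurability is that of counts and cylinder indicators by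
  \<open>emeasure_reduced_rect\<close>; the generator then carries it to all measurable
  sets.\<close>

lemma reduced1_kernel:
  assumes D: "bounded D" "D \<in> sets borel"
  shows "reduced1 D \<in> measurable cfg (subprob_algebra (borel \<Otimes>\<^sub>M cfg))"
proof (rule measurable_subprob_algebra_generated[OF borel_cfg_generator Int_stable_rect])
  have m1: "(\<lambda>\<xi>. ennreal (1 / (1 + real (card (\<xi> \<inter> D))))) \<in> borel_measurable cfg"
    using measurable_card_Int[OF D(2,1)] by measurable
  show "{B \<times> C |B C. B \<in> sets borel \<and> C \<in> cyls} \<subseteq> Pow (UNIV \<times> lfin)"
    using cyls_Pow by fastforce
  fix \<xi> :: "'a set" assume \<xi>: "\<xi> \<in> space cfg"
  show "sets (reduced1 D \<xi>) = sets (borel \<Otimes>\<^sub>M cfg)" by (simp add: reduced1_def reduced_def)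
  show "subprob_space (reduced1 D \<xi>)"
  proof
    have "emeasure (reduced1 D \<xi>) (space (reduced1 D \<xi>)) \<le> ennreal (1 / (1 + real (card (\<xi> \<inter> D)))) * of_nat (card (\<xi> \<inter> D))"
    proof -
      have "UNIV \<times> lfin \<in> sets (borel \<Otimes>\<^sub>M cfg)" by (metis sets.top space_borel_cfg)
      then have "emeasure (reduced D \<xi>) (UNIV \<times> lfin) \<le> of_nat (card (\<xi> \<inter> D))"
        using \<xi> D lfin_finite by (subst emeasure_reduced) (auto intro!: card_mono)
      moreover have "space (reduced D \<xi>) = UNIV \<times> lfin" by (simp add: reduced_def)
      ultimately show ?thesis unfolding reduced1_def emeasure_scale_measure space_scale_measure
        by (intro mult_left_mono) auto
    qed
    also have "\<dots> \<le> 1"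
      by (simp add: ennreal_of_nat_eq_real_of_nat ennreal_mult[symmetric] divide_simps)
    finally show "emeasure (reduced1 D \<xi>) (space (reduced1 D \<xi>)) \<le> 1" .
    have "(0, \<xi>) \<in> space (reduced1 D \<xi>)" using \<xi> by (simp add: reduced1_def reduced_def space_scale_measure space_pair_measure)
    then show "space (reduced1 D \<xi>) \<noteq> {}" by auto
  qed
next
  have m1: "(\<lambda>\<xi>. ennreal (1 / (1 + real (card (\<xi> \<inter> D))))) \<in> borel_measurable cfg"
    using measurable_card_Int[OF D(2,1)] by measurable
  have *: "(\<lambda>\<xi>. emeasure (reduced1 D \<xi>) A) \<in> borel_measurable cfg" if A: "A \<in> {B \<times> C |B C. B \<in> sets borel \<and> C \<in> cyls}" for A
  proof -
    obtain B S where A: "A = B \<times> cyl S" "B \<in> sets borel" "finite S" "\<forall>s\<in>S. fst s \<in> sets borel \<and> bounded (fst s)"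
      using A by (auto simp: cyls_def)
    have "(\<lambda>\<xi>. \<Sum>T\<in>Pow S. of_nat (card (\<xi> \<inter> (D \<inter> B \<inter> cell S T))) * indicator (cyl1 S T) \<xi> :: ennreal) \<in> borel_measurable cfg"
    proof (intro borel_measurable_sum)
      fix T assume "T \<in> Pow S"
      have [measurable]: "(\<lambda>\<xi>. card (\<xi> \<inter> (D \<inter> B \<inter> cell S T))) \<in> measurable cfg (count_space UNIV)"
        using D A cell_sets[of S T] by (intro measurable_card_Int) (auto simp: bounded_Int)
      have [measurable]: "cyl1 S T \<in> sets cfg" using A cyl1_sets by blast
      show "(\<lambda>\<xi>. of_nat (card (\<xi> \<inter> (D \<inter> B \<inter> cell S T))) * indicator (cyl1 S T) \<xi> :: ennreal) \<in> borel_measurable cfg"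
        by measurable
    qed
    with m1 have "(\<lambda>\<xi>. ennreal (1 / (1 + real (card (\<xi> \<inter> D)))) * (\<Sum>T\<in>Pow S. of_nat (card (\<xi> \<inter> (D \<inter> B \<inter> cell S T))) * indicator (cyl1 S T) \<xi>)) \<in> borel_measurable cfg"
      by (rule borel_measurable_times_ennreal)
    then show ?thesis unfolding reduced1_def emeasure_scale_measure A(1)
      by (subst measurable_cong, subst emeasure_reduced_rect[OF _ D A(2-4)]) (auto simp only: space_cfg)
  qed
  then show "\<And>A. A \<in> {B \<times> C |B C. B \<in> sets borel \<and> C \<in> cyls} \<Longrightarrow> (\<lambda>\<xi>. emeasure (reduced1 D \<xi>) A) \<in> borel_measurable cfg" .
  show "(\<lambda>\<xi>. emeasure (reduced1 D \<xi>) (UNIV \<times> lfin)) \<in> borel_measurable cfg"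
    by (intro * CollectI exI[of _ UNIV] exI[of _ lfin]) (use lfin_in_cyls in auto)
qed

lemma point_sum_indicator: "point_sum \<xi> f = (\<integral>\<^sup>+x. f x * indicator \<xi> x \<partial>count_space UNIV)"
  unfolding point_sum_def by (simp add: nn_integral_count_space_indicator)

lemma point_sum_mono_set: "\<xi> \<subseteq> \<eta> \<Longrightarrow> point_sum \<xi> f \<le> point_sum \<eta> f"
  unfolding point_sum_indicator by (intro nn_integral_mono mult_left_mono) (auto simp: indicator_def)

lemma point_sum_mono_SUP:
  fixes D :: "nat \<Rightarrow> 'a set"
  assumes "incseq D" "(\<Union>n. D n) = UNIV"
  shows "point_sum \<xi> f = (SUP n. point_sum (\<xi> \<inter> D n) f)"
proof -
  have "point_sum (\<xi> \<inter> D n) f = (\<integral>\<^sup>+x. f x * indicator (D n) x \<partial>count_space \<xi>)" for n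
    unfolding point_sum_def by (simp add: nn_integral_count_space_indicator indicator_inter_arith mult_ac
        nn_integral_count_space_indicator[of "\<xi> \<inter> D n"] nn_integral_count_space_indicator[of \<xi>])
  then have "(SUP n. point_sum (\<xi> \<inter> D n) f) = (SUP n. (\<integral>\<^sup>+x. f x * indicator (D n) x \<partial>count_space \<xi>))" by simp
  also have "\<dots> = (\<integral>\<^sup>+x. (SUP n. f x * indicator (D n) x) \<partial>count_space \<xi>)"
    using assms(1) by (intro nn_integral_monotone_convergence_SUP[symmetric])
      (auto simp: incseq_def le_fun_def indicator_def intro!: mult_left_mono)
  also have "\<dots> = point_sum \<xi> f"
    unfolding point_sum_def
  proof (intro nn_integral_cong)
    fix x
    obtain n where "x \<in> D n" using assms by auto
    then have "f x \<le> f x * indicator (D n) x" by simp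
    then show "(SUP n. f x * indicator (D n) x) = f x"
      by (intro antisym SUP_least) (auto simp: indicator_def intro: SUP_upper2)
  qed
  finally show ?thesis by simp
qed

text \<open>The extra parameter \<open>p\<close> makes the statement iterable: in double and triple
  sums the points already chosen are parameters. Kernels serve bounded windows, and a supremum over
  growing balls gives the full sum.\<close>

lemma point_sum_measurable:
  fixes f :: "'p \<times> 'b::euclidean_space \<times> 'b set \<Rightarrow> ennreal"
  assumes [measurable]: "f \<in> borel_measurable (N \<Otimes>\<^sub>M (borel \<Otimes>\<^sub>M cfg))"
  shows "(\<lambda>(p,\<xi>). point_sum \<xi> (\<lambda>x. f (p, x, \<xi> - {x}))) \<in> borel_measurable (N \<Otimes>\<^sub>M cfg)"
proof -
  define D :: "nat \<Rightarrow> 'b set" where "D n = ball 0 (real n)" for n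
  have D: "bounded (D n)" "D n \<in> sets borel" for n by (auto simp: D_def)
  have "(\<lambda>q. point_sum (snd q \<inter> D n) (\<lambda>x. f (fst q, x, snd q - {x}))) \<in> borel_measurable (N \<Otimes>\<^sub>M cfg)" for n
  proof -
    have [measurable]: "(\<lambda>q. reduced1 (D n) (snd q)) \<in> measurable (N \<Otimes>\<^sub>M cfg) (subprob_algebra (borel \<Otimes>\<^sub>M cfg))"
      by (rule measurable_compose[OF measurable_snd reduced1_kernel[OF D]])
    have m: "(\<lambda>q. card (snd q \<inter> D n)) \<in> measurable (N \<Otimes>\<^sub>M cfg) (count_space UNIV)"
      by (rule measurable_compose[OF measurable_snd measurable_card_Int]) (use D in auto)
    have "(\<lambda>q. \<integral>\<^sup>+y. f (fst q, y) \<partial>reduced1 (D n) (snd q)) \<in> borel_measurable (N \<Otimes>\<^sub>M cfg)"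
      by (rule nn_integral_measurable_subprob_algebra2[where N="borel \<Otimes>\<^sub>M cfg"]) measurable
    then have "(\<lambda>q. ennreal (1 + real (card (snd q \<inter> D n))) * (\<integral>\<^sup>+y. f (fst q, y) \<partial>reduced1 (D n) (snd q))) \<in> borel_measurable (N \<Otimes>\<^sub>M cfg)"
      using m by measurable
    also have "?this \<longleftrightarrow> ?thesis"
    proof (rule measurable_cong)
      fix q :: "'p \<times> 'b set" assume q: "q \<in> space (N \<Otimes>\<^sub>M cfg)"
      then have "(\<lambda>y. f (fst q, y)) \<in> borel_measurable (borel \<Otimes>\<^sub>M cfg)" by (auto simp: space_pair_measure)
      then show "ennreal (1 + real (card (snd q \<inter> D n))) * (\<integral>\<^sup>+y. f (fst q, y) \<partial>reduced1 (D n) (snd q)) = point_sum (snd q \<inter> D n) (\<lambda>x. f (fst q, x, snd q - {x}))"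
        using point_sum_reduced1[of "snd q" "\<lambda>y. f (fst q, y)" "D n"] q by (auto simp: space_pair_measure)
    qed
    finally show ?thesis .
  qed
  then have "(\<lambda>q. SUP n. point_sum (snd q \<inter> D n) (\<lambda>x. f (fst q, x, snd q - {x}))) \<in> borel_measurable (N \<Otimes>\<^sub>M cfg)"
    by (intro borel_measurable_SUP) auto
  moreover have "incseq D" "(\<Union>n. D n) = UNIV"
    by (auto simp: D_def incseq_def dist_norm intro: reals_Archimedean2)
  ultimately show ?thesis
    by (subst (asm) point_sum_mono_SUP[symmetric]) (auto simp: case_prod_beta')
qed

section \<open>The Mecke formula for the law of the process\<close>

context homogeneous_poisson_process
begin

definition "law = distr M cfg X"

lemma sets_law [measurable_cong, simp]: "sets law = sets cfg" and space_law [simp]: "space law = lfin"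
  by (simp_all add: law_def)

lemma prob_space_law: "prob_space law"
  unfolding law_def by (rule prob_space_distr[OF X_measurable])

lemma indep_complement:
  assumes Q: "Q \<in> sets borel" and C: "C1 \<in> sets cfg" "C2 \<in> sets cfg"
  shows "prob {\<omega>\<in>space M. X \<omega> \<inter> Q \<in> C1 \<and> X \<omega> \<inter> - Q \<in> C2} =
    prob {\<omega>\<in>space M. X \<omega> \<inter> Q \<in> C1} * prob {\<omega>\<in>space M. X \<omega> \<inter> - Q \<in> C2}"
proof -
  define U where "U b = (if b then Q else - Q)" for b
  define C where "C b = (if b then C1 else C2)" for b
  have "indep_vars (\<lambda>_. cfg) (\<lambda>i \<omega>. X \<omega> \<inter> U i) (UNIV::bool set)"
    using Q by (intro indep_restrictions) (auto simp: disjoint_family_on_def U_def)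
  then have "prob (\<Inter>b\<in>UNIV. (\<lambda>\<omega>. X \<omega> \<inter> U b) -` C b \<inter> space M) = (\<Prod>b\<in>UNIV. prob ((\<lambda>\<omega>. X \<omega> \<inter> U b) -` C b \<inter> space M))"
    by (rule indep_varsD) (use C in \<open>auto simp: C_def\<close>)
  moreover have "(\<Inter>b\<in>UNIV. (\<lambda>\<omega>. X \<omega> \<inter> U b) -` C b \<inter> space M) = {\<omega>\<in>space M. X \<omega> \<inter> Q \<in> C1 \<and> X \<omega> \<inter> - Q \<in> C2}"
    unfolding UNIV_bool U_def C_def by auto
  moreover have "(\<lambda>\<omega>. X \<omega> \<inter> U True) -` C True \<inter> space M = {\<omega>\<in>space M. X \<omega> \<inter> Q \<in> C1}"
    "(\<lambda>\<omega>. X \<omega> \<inter> U False) -` C False \<inter> space M = {\<omega>\<in>space M. X \<omega> \<inter> - Q \<in> C2}"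
    by (auto simp: U_def C_def)
  ultimately show ?thesis by (simp add: UNIV_bool mult.commute)
qed

text \<open>The Mecke formula on a product of a set with a cylinder reduces, on the cells generated by the test sets of the cylinder, to \<open>k * P (N = k) = \<lambda> * P (N = k - 1)\<close> for a Poisson variable \<open>N\<close> of mean \<open>\<lambda>\<close>.\<close>

lemma mecke_cell:
  assumes Q: "Q \<in> sets borel" "bounded Q" and S: "finite S" "\<forall>s\<in>S. fst s \<in> sets borel \<and> bounded (fst s)"
    and in_T: "\<And>s. s \<in> S \<Longrightarrow> s \<in> T \<Longrightarrow> Q \<subseteq> fst s" and nin_T: "\<And>s. s \<in> S \<Longrightarrow> s \<notin> T \<Longrightarrow> Q \<inter> fst s = {}"
  shows "(\<integral>\<^sup>+\<xi>. of_nat (card (\<xi> \<inter> Q)) * indicator (cyl1 S T) \<xi> \<partial>law) = ennreal (\<beta> * measure lborel Q) * emeasure law (cyl S)"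
proof -
  let ?m = "\<beta> * measure lborel Q"
  have Am: "{\<xi>\<in>lfin. card (\<xi> \<inter> Q) = n} \<in> sets cfg" for n
    using measurable_sets[OF measurable_card_Int[OF Q], of "{n}"] by (simp add: vimage_def Int_def conj_commute)
  \<comment> \<open>\<open>V m\<close> is the cylinder condition on the part outside
    \<open>Q\<close>, given \<open>m\<close> points inside; it is independent of the count in
    \<open>Q\<close>.\<close>
  define V where "V m = {\<xi>\<in>lfin. \<forall>s\<in>S. card (\<xi> \<inter> (fst s - Q)) + (if s \<in> T then m else 0) = snd s}" for m
  have Vm: "V m \<in> sets cfg" for m
  proof -
    have "{\<xi>\<in>space cfg. \<forall>s\<in>S. card (\<xi> \<inter> (fst s - Q)) + (if s \<in> T then m else 0) = snd s} \<in> sets cfg"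
    proof (rule sets.sets_Collect_finite_All[OF _ S(1)])
      fix s assume "s \<in> S"
      then have [measurable]: "(\<lambda>\<xi>. card (\<xi> \<inter> (fst s - Q))) \<in> measurable cfg (count_space UNIV)"
        using S Q by (intro measurable_card_Int) (auto intro: bounded_subset)
      show "{\<xi> \<in> space cfg. card (\<xi> \<inter> (fst s - Q)) + (if s \<in> T then m else 0) = snd s} \<in> sets cfg" by measurable
    qed
    then show ?thesis by (simp add: V_def)
  qed
  define A where "A n k = {\<xi>\<in>lfin. card (\<xi> \<inter> Q) = n} \<inter> V k" for n k
  have Asets: "A n k \<in> sets cfg" for n k unfolding A_def using Am Vm by auto
  have split: "card (\<xi> \<inter> fst s) = card (\<xi> \<inter> (fst s - Q)) + (if s \<in> T then card (\<xi> \<inter> Q) else 0)"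
    if "\<xi> \<in> lfin" "s \<in> S" for \<xi> s
  proof (cases "s \<in> T")
    case True
    then have "\<xi> \<inter> fst s = \<xi> \<inter> (fst s - Q) \<union> \<xi> \<inter> Q" using in_T[OF that(2) True] by auto
    moreover have "finite (\<xi> \<inter> (fst s - Q))" "finite (\<xi> \<inter> Q)"
      using that S Q by (auto intro!: lfin_finite intro: bounded_subset)
    moreover have "\<xi> \<inter> (fst s - Q) \<inter> (\<xi> \<inter> Q) = {}" by auto
    ultimately show ?thesis using True card_Un_disjoint by metis
  next
    case False
    then have "\<xi> \<inter> fst s = \<xi> \<inter> (fst s - Q)" using nin_T[OF that(2) False] by auto
    then show ?thesis using False by simp
  qed
  have prA: "emeasure law (A n k) = ennreal (?m ^ n / fact n * exp (- ?m)) * ennreal (prob {\<omega>\<in>space M. X \<omega> \<inter> - Q \<in> V k})" for n k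
  proof -
    have "emeasure law (A n k) = emeasure M {\<omega>\<in>space M. X \<omega> \<in> A n k}"
      unfolding law_def using Asets by (subst emeasure_distr[OF X_measurable]) (auto simp: vimage_def Int_def conj_commute intro!: arg_cong[where f="emeasure M"])
    also have "{\<omega>\<in>space M. X \<omega> \<in> A n k} = {\<omega>\<in>space M. X \<omega> \<inter> Q \<in> {\<xi>\<in>lfin. card (\<xi> \<inter> Q) = n} \<and> X \<omega> \<inter> - Q \<in> V k}"
    proof -
      have "\<xi> \<inter> - Q \<inter> (fst s - Q) = \<xi> \<inter> (fst s - Q)" for \<xi> s by auto
      then show ?thesis using X_lfin by (auto simp: A_def V_def intro: lfin_subset)
    qed
    also have "emeasure M \<dots> = ennreal (prob \<dots>)" by (simp add: emeasure_eq_measure)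
    also have "prob {\<omega>\<in>space M. X \<omega> \<inter> Q \<in> {\<xi>\<in>lfin. card (\<xi> \<inter> Q) = n} \<and> X \<omega> \<inter> - Q \<in> V k} =
      prob {\<omega>\<in>space M. X \<omega> \<inter> Q \<in> {\<xi>\<in>lfin. card (\<xi> \<inter> Q) = n}} * prob {\<omega>\<in>space M. X \<omega> \<inter> - Q \<in> V k}"
      by (rule indep_complement[OF Q(1) Am Vm])
    also have "{\<omega>\<in>space M. X \<omega> \<inter> Q \<in> {\<xi>\<in>lfin. card (\<xi> \<inter> Q) = n}} = {\<omega>\<in>space M. card (X \<omega> \<inter> Q) = n}"
      using X_lfin by (auto intro: lfin_subset)
    also have "prob \<dots> = ?m ^ n / fact n * exp (- ?m)" by (rule count_poisson[OF Q])
    finally show ?thesis using intensity_pos by (subst ennreal_mult[symmetric]) auto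
  qed
  have "(\<integral>\<^sup>+\<xi>. of_nat (card (\<xi> \<inter> Q)) * indicator (cyl1 S T) \<xi> \<partial>law) =
     (\<integral>\<^sup>+\<xi>. (\<Sum>m. of_nat (Suc m) * indicator (A (Suc m) m) \<xi>) \<partial>law)"
  proof (rule nn_integral_cong)
    fix \<xi> assume "\<xi> \<in> space law"
    then have x: "\<xi> \<in> lfin" by simp
    show "of_nat (card (\<xi> \<inter> Q)) * indicator (cyl1 S T) \<xi> = (\<Sum>m. of_nat (Suc m) * indicator (A (Suc m) m) \<xi> :: ennreal)"
    proof (cases "card (\<xi> \<inter> Q)")
      case 0
      then have "indicator (A (Suc m) m) \<xi> = (0::ennreal)" for m by (auto simp: A_def)
      then show ?thesis using 0 by simp
    next
      \<comment> \<open>With \<open>Suc m\<close> points in \<open>Q\<close> and one of them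
        removed, the outer condition is \<open>V m\<close>; hence the shifted pair of indices in
        \<open>A (Suc m) m\<close>.\<close>
      case (Suc m)
      have "(\<Sum>m. of_nat (Suc m) * indicator (A (Suc m) m) \<xi> :: ennreal) = (\<Sum>k\<in>{m}. of_nat (Suc k) * indicator (A (Suc k) k) \<xi>)"
        by (rule suminf_finite) (auto simp: A_def Suc)
      moreover have "\<xi> \<in> A (Suc m) m \<longleftrightarrow> \<xi> \<in> cyl1 S T"
        using x split[OF x] Suc by (auto simp: A_def V_def cyl1_def)
      ultimately show ?thesis using Suc by (simp add: indicator_def)
    qed
  qed
  also have "\<dots> = (\<Sum>m. \<integral>\<^sup>+\<xi>. of_nat (Suc m) * indicator (A (Suc m) m) \<xi> \<partial>law)"
    using Asets by (intro nn_integral_suminf) auto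
  also have "\<dots> = (\<Sum>m. of_nat (Suc m) * emeasure law (A (Suc m) m))"
    using Asets by (intro suminf_cong nn_integral_cmult_indicator) auto
  also have "\<dots> = (\<Sum>m. ennreal ?m * emeasure law (A m m))"
  proof (rule suminf_cong)
    fix m
    have "of_nat (Suc m) * ennreal (?m ^ Suc m / fact (Suc m) * exp (- ?m)) = ennreal ?m * ennreal (?m ^ m / fact m * exp (- ?m))"
    proof -
      have "real (Suc m) * (?m ^ Suc m / fact (Suc m) * exp (- ?m)) = ?m * (?m ^ m / fact m * exp (- ?m))"
        by (simp del: of_nat_Suc add: fact_Suc)
      then show ?thesis using intensity_pos unfolding ennreal_of_nat_eq_real_of_nat
        by (subst (1 2) ennreal_mult[symmetric]) (auto simp del: of_nat_Suc)
    qed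
    then show "of_nat (Suc m) * emeasure law (A (Suc m) m) = ennreal ?m * emeasure law (A m m)"
      unfolding prA by (simp add: mult.assoc[symmetric])
  qed
  also have "\<dots> = ennreal ?m * (\<Sum>m. emeasure law (A m m))" by (rule ennreal_suminf_cmult)
  also have "(\<Sum>m. emeasure law (A m m)) = emeasure law (\<Union>m. A m m)"
    using Asets by (intro suminf_emeasure) (auto simp: disjoint_family_on_def A_def)
  also have "(\<Union>m. A m m) = cyl S"
  proof (rule set_eqI)
    fix \<xi>
    have "(\<forall>s\<in>S. card (\<xi> \<inter> (fst s - Q)) + (if s \<in> T then card (\<xi> \<inter> Q) else 0) = snd s) \<longleftrightarrow> (\<forall>s\<in>S. card (\<xi> \<inter> fst s) = snd s)"
      if "\<xi> \<in> lfin"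
      by (intro ball_cong refl) (simp only: split[OF that])
    then show "\<xi> \<in> (\<Union>m. A m m) \<longleftrightarrow> \<xi> \<in> cyl S"
      unfolding A_def V_def cyl_def by (simp split del: if_split cong: conj_cong)
  qed
  finally show ?thesis .
qed

text \<open>By \<open>emeasure_reduced_rect\<close> the left side splits over the atoms,
  \<open>mecke_cell\<close> evaluates each of them, and the atoms reassemble to
  \<open>B \<inter> D\<close>.\<close>

lemma mecke_rect:
  assumes D: "bounded D" "D \<in> sets borel" and B: "B \<in> sets borel" and C: "C \<in> cyls"
  shows "(\<integral>\<^sup>+\<xi>. emeasure (reduced D \<xi>) (B \<times> C) \<partial>law) = ennreal \<beta> * emeasure lborel (B \<inter> D) * emeasure law C"
proof -
  obtain S where S: "C = cyl S" "finite S" "\<forall>s\<in>S. fst s \<in> sets borel \<and> bounded (fst s)"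
    using C by (auto simp: cyls_def)
  have cs: "cell S T \<in> sets borel" for T using cell_sets S by auto
  have Qb: "bounded (D \<inter> B \<inter> cell S T)" for T using D by (auto simp: bounded_Int)
  have [measurable]: "(\<lambda>\<xi>. card (\<xi> \<inter> (D \<inter> B \<inter> cell S T))) \<in> measurable cfg (count_space UNIV)" for T
    using D B cs Qb by (intro measurable_card_Int) auto
  have [measurable]: "cyl1 S T \<in> sets cfg" for T by (rule cyl1_sets[OF S(2,3)])
  have "(\<integral>\<^sup>+\<xi>. emeasure (reduced D \<xi>) (B \<times> C) \<partial>law) =
     (\<integral>\<^sup>+\<xi>. (\<Sum>T\<in>Pow S. of_nat (card (\<xi> \<inter> (D \<inter> B \<inter> cell S T))) * indicator (cyl1 S T) \<xi>) \<partial>law)"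
    unfolding S(1) by (intro nn_integral_cong emeasure_reduced_rect) (use D B S in auto)
  also have "\<dots> = (\<Sum>T\<in>Pow S. \<integral>\<^sup>+\<xi>. of_nat (card (\<xi> \<inter> (D \<inter> B \<inter> cell S T))) * indicator (cyl1 S T) \<xi> \<partial>law)"
    by (intro nn_integral_sum) measurable
  also have "\<dots> = (\<Sum>T\<in>Pow S. ennreal (\<beta> * measure lborel (D \<inter> B \<inter> cell S T)) * emeasure law (cyl S))"
    using D B cs Qb S by (intro sum.cong refl mecke_cell) (auto simp: cell_def)
  also have "\<dots> = ennreal \<beta> * (\<Sum>T\<in>Pow S. emeasure lborel (D \<inter> B \<inter> cell S T)) * emeasure law (cyl S)"
  proof -
    have "ennreal (\<beta> * measure lborel (D \<inter> B \<inter> cell S T)) = ennreal \<beta> * emeasure lborel (D \<inter> B \<inter> cell S T)" for T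
    proof -
      have "emeasure lborel (D \<inter> B \<inter> cell S T) = ennreal (measure lborel (D \<inter> B \<inter> cell S T))"
        using emeasure_bounded_finite[OF Qb[of T]] by (intro emeasure_eq_ennreal_measure) auto
      then show ?thesis using intensity_pos by (simp add: ennreal_mult)
    qed
    then show ?thesis by (simp add: sum_distrib_left sum_distrib_right)
  qed
  also have "(\<Sum>T\<in>Pow S. emeasure lborel (D \<inter> B \<inter> cell S T)) = emeasure lborel (\<Union>T\<in>Pow S. D \<inter> B \<inter> cell S T)"
  proof (rule sum_emeasure)
    show "(\<lambda>T. D \<inter> B \<inter> cell S T) ` Pow S \<subseteq> sets lborel" using D B cs by auto
    show "disjoint_family_on (\<lambda>T. D \<inter> B \<inter> cell S T) (Pow S)"
      unfolding disjoint_family_on_def by (auto simp: cell_def)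
    show "finite (Pow S)" using S by auto
  qed
  also have "(\<Union>T\<in>Pow S. D \<inter> B \<inter> cell S T) = B \<inter> D"
  proof (intro equalityI subsetI)
    fix x assume "x \<in> B \<inter> D"
    then show "x \<in> (\<Union>T\<in>Pow S. D \<inter> B \<inter> cell S T)"
      by (intro UN_I[of "{s\<in>S. x \<in> fst s}"]) (auto simp: cell_def)
  qed auto
  finally show ?thesis using S by simp
qed

lemma law_integral_measurable [measurable]:
  assumes "f \<in> borel_measurable (N \<Otimes>\<^sub>M cfg)"
  shows "(\<lambda>x. \<integral>\<^sup>+\<xi>. f (x,\<xi>) \<partial>law) \<in> borel_measurable N"
proof -
  interpret L: prob_space law by (rule prob_space_law)
  have "f \<in> borel_measurable (N \<Otimes>\<^sub>M law)"
    using assms unfolding measurable_cong_sets[OF sets_pair_measure_cong[OF refl sets_law] refl] .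
  then show ?thesis by (rule L.borel_measurable_nn_integral_fst)
qed

text \<open>Both sides are integrals against finite measures on pairs (point, configuration) that
  agree on rectangles by \<open>mecke_rect\<close>, hence everywhere by uniqueness on an
  intersection-stable generator.\<close>

lemma mecke_bounded:
  assumes D: "bounded D" "D \<in> sets borel" and f: "f \<in> borel_measurable (borel \<Otimes>\<^sub>M cfg)"
  shows "(\<integral>\<^sup>+\<xi>. point_sum (\<xi> \<inter> D) (\<lambda>x. f (x, \<xi> - {x})) \<partial>law) = ennreal \<beta> * (\<integral>\<^sup>+x. indicator D x * (\<integral>\<^sup>+\<xi>. f (x,\<xi>) \<partial>law) \<partial>lborel)"
proof -
  interpret L: prob_space law by (rule prob_space_law)
  let ?c = "\<lambda>\<xi>. ennreal (1 + real (card (\<xi> \<inter> D)))"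
  have cm [measurable]: "?c \<in> borel_measurable cfg"
    by (intro measurable_compose[OF measurable_card_Int[OF D(2,1)]]) simp
  note K = reduced1_kernel[OF D]
  \<comment> \<open>The density \<open>1 + card\<close> cancels the normalisation of
    \<open>reduced1\<close>; \<open>\<mu>1\<close> is thus the averaged reduced Campbell
    measure.\<close>
  define \<mu>1 where "\<mu>1 = density law ?c \<bind> reduced1 D"
  define \<mu>2 where "\<mu>2 = density lborel (\<lambda>x. ennreal \<beta> * indicator D x) \<Otimes>\<^sub>M law"
  have K': "reduced1 D \<in> measurable (density law ?c) (subprob_algebra (borel \<Otimes>\<^sub>M cfg))"
    using K by (simp add: measurable_def)
  have ne: "space (density law ?c) \<noteq> {}" using L.not_empty by simp
  have nn1: "integral\<^sup>N \<mu>1 g = (\<integral>\<^sup>+\<xi>. point_sum (\<xi> \<inter> D) (\<lambda>x. g (x, \<xi> - {x})) \<partial>law)"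
    if g: "g \<in> borel_measurable (borel \<Otimes>\<^sub>M cfg)" for g
  proof -
    have m: "(\<lambda>\<xi>. integral\<^sup>N (reduced1 D \<xi>) g) \<in> borel_measurable cfg"
      by (rule measurable_compose[OF K nn_integral_measurable_subprob_algebra[OF g]])
    have "integral\<^sup>N \<mu>1 g = (\<integral>\<^sup>+\<xi>. integral\<^sup>N (reduced1 D \<xi>) g \<partial>density law ?c)"
      unfolding \<mu>1_def by (rule nn_integral_bind[OF g K'])
    also have "\<dots> = (\<integral>\<^sup>+\<xi>. ?c \<xi> * integral\<^sup>N (reduced1 D \<xi>) g \<partial>law)"
      using m cm by (intro nn_integral_density) (simp_all only: measurable_cong_sets[OF sets_law refl])
    also have "\<dots> = (\<integral>\<^sup>+\<xi>. point_sum (\<xi> \<inter> D) (\<lambda>x. g (x, \<xi> - {x})) \<partial>law)"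
      using g by (intro nn_integral_cong) (auto simp: point_sum_reduced1)
    finally show ?thesis .
  qed
  have dens: "emeasure (density lborel (\<lambda>x. ennreal \<beta> * indicator D x)) B = ennreal \<beta> * emeasure lborel (B \<inter> D)"
    if "B \<in> sets borel" for B
    using that D by (subst emeasure_density) (auto simp: nn_integral_cmult mult.assoc nn_integral_indicator[symmetric] simp del: nn_integral_indicator
       intro!: arg_cong2[where f="(*)"] nn_integral_cong split: split_indicator)
  have eqr: "emeasure \<mu>1 E = emeasure \<mu>2 E" if E: "E \<in> {B \<times> C |B C. B \<in> sets borel \<and> C \<in> cyls}" for E
  proof -
    obtain B C where E: "E = B \<times> C" "B \<in> sets borel" "C \<in> cyls" using E by auto
    then have C: "C \<in> sets cfg" by (auto simp: sets_cfg intro: sigma_sets.Basic)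
    have ind: "indicator (B \<times> C) \<in> borel_measurable (borel \<Otimes>\<^sub>M cfg)" using E C by auto
    have s1: "sets \<mu>1 = sets (borel \<Otimes>\<^sub>M cfg)" unfolding \<mu>1_def by (rule sets_bind[OF sets_kernel[OF K'] ne])
    have "emeasure \<mu>1 E = integral\<^sup>N \<mu>1 (indicator (B \<times> C))"
      unfolding E(1) by (rule nn_integral_indicator[symmetric]) (simp only: s1 pair_measureI[OF E(2) C])
    also have "\<dots> = (\<integral>\<^sup>+\<xi>. point_sum (\<xi> \<inter> D) (\<lambda>x. indicator (B \<times> C) (x, \<xi> - {x})) \<partial>law)"
      by (rule nn1[OF ind])
    also have "\<dots> = (\<integral>\<^sup>+\<xi>. emeasure (reduced D \<xi>) (B \<times> C) \<partial>law)"
    proof (rule nn_integral_cong)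
      fix \<xi> assume "\<xi> \<in> space law"
      then show "point_sum (\<xi> \<inter> D) (\<lambda>x. indicator (B \<times> C) (x, \<xi> - {x})) = emeasure (reduced D \<xi>) (B \<times> C)"
        using nn_integral_reduced[OF _ ind, of \<xi> D] pair_measureI[OF E(2) C] by (simp add: reduced_def)
    qed
    also have "\<dots> = ennreal \<beta> * emeasure lborel (B \<inter> D) * emeasure law C"
      by (rule mecke_rect[OF D E(2,3)])
    also have "\<dots> = emeasure \<mu>2 E"
      unfolding \<mu>2_def E(1) using E C by (subst L.emeasure_pair_measure_Times) (auto simp: dens)
    finally show ?thesis .
  qed
  have s1: "sets \<mu>1 = sets (borel \<Otimes>\<^sub>M cfg)" unfolding \<mu>1_def by (rule sets_bind[OF sets_kernel[OF K'] ne])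
  have s2: "sets \<mu>2 = sets (borel \<Otimes>\<^sub>M cfg)" unfolding \<mu>2_def by (intro sets_pair_measure_cong) auto
  have "\<mu>1 = \<mu>2"
  proof (rule measure_eqI_generator_eq[where A="\<lambda>_. UNIV \<times> lfin"])
    show "Int_stable {B \<times> C |(B::'b set) C. B \<in> sets borel \<and> C \<in> cyls}" by (rule Int_stable_rect)
    show "{B \<times> C |(B::'b set) C. B \<in> sets borel \<and> C \<in> cyls} \<subseteq> Pow (UNIV \<times> lfin)" using cyls_Pow by fastforce
    show "sets \<mu>1 = sigma_sets (UNIV \<times> lfin) {B \<times> C |B C. B \<in> sets borel \<and> C \<in> cyls}"
      "sets \<mu>2 = sigma_sets (UNIV \<times> lfin) {B \<times> C |B C. B \<in> sets borel \<and> C \<in> cyls}"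
      using s1 s2 borel_cfg_generator by auto
    have rr: "UNIV \<times> lfin \<in> {B \<times> C |(B::'b set) C. B \<in> sets borel \<and> C \<in> cyls}"
      by (intro CollectI exI[of _ UNIV] exI[of _ lfin]) (use lfin_in_cyls in auto)
    then show r: "range (\<lambda>_::nat. UNIV \<times> lfin) \<subseteq> {B \<times> C |(B::'b set) C. B \<in> sets borel \<and> C \<in> cyls}" by blast
    fix i :: nat
    have "emeasure \<mu>2 (UNIV \<times> lfin) = ennreal \<beta> * emeasure lborel D * emeasure law lfin"
      unfolding \<mu>2_def by (subst L.emeasure_pair_measure_Times) (auto simp: dens intro: sets.top[of cfg, simplified])
    also have "\<dots> < \<infinity>" using emeasure_bounded_finite[OF D(1)] by (simp add: ennreal_mult_less_top L.emeasure_space_1[simplified])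
    finally show "emeasure \<mu>1 (UNIV \<times> lfin) \<noteq> \<infinity>" using eqr[OF rr] by auto
  qed (auto intro: eqr)
  have "(\<integral>\<^sup>+\<xi>. point_sum (\<xi> \<inter> D) (\<lambda>x. f (x, \<xi> - {x})) \<partial>law) = integral\<^sup>N \<mu>2 f"
    using nn1[OF f] \<open>\<mu>1 = \<mu>2\<close> by simp
  also have "\<dots> = (\<integral>\<^sup>+x. (\<integral>\<^sup>+\<xi>. f (x,\<xi>) \<partial>law) \<partial>density lborel (\<lambda>x. ennreal \<beta> * indicator D x))"
    unfolding \<mu>2_def using f by (intro L.nn_integral_fst[symmetric]) (auto simp: measurable_def space_pair_measure s2[unfolded \<mu>2_def])
  also have "\<dots> = (\<integral>\<^sup>+x. ennreal \<beta> * indicator D x * (\<integral>\<^sup>+\<xi>. f (x,\<xi>) \<partial>law) \<partial>lborel)"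
    using law_integral_measurable[OF f] D by (intro nn_integral_density) auto
  also have "\<dots> = ennreal \<beta> * (\<integral>\<^sup>+x. indicator D x * (\<integral>\<^sup>+\<xi>. f (x,\<xi>) \<partial>law) \<partial>lborel)"
    using law_integral_measurable[OF f] D by (subst nn_integral_cmult[symmetric]) (auto simp: mult.assoc)
  finally show ?thesis .
qed

text \<open>Balls around the origin exhaust the space, and both sides are monotone limits of their
  versions on these windows.\<close>

theorem mecke:
  assumes f [measurable]: "f \<in> borel_measurable (borel \<Otimes>\<^sub>M cfg)"
  shows "(\<integral>\<^sup>+\<xi>. point_sum \<xi> (\<lambda>x. f (x, \<xi> - {x})) \<partial>law) = ennreal \<beta> * (\<integral>\<^sup>+x. (\<integral>\<^sup>+\<xi>. f (x,\<xi>) \<partial>law) \<partial>lborel)"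
proof -
  interpret L: prob_space law by (rule prob_space_law)
  define D :: "nat \<Rightarrow> 'b set" where "D n = ball 0 (real n)" for n
  have D: "bounded (D n)" "D n \<in> sets borel" for n by (auto simp: D_def)
  have D2: "incseq D" "(\<Union>n. D n) = UNIV"
    by (auto simp: D_def incseq_def dist_norm intro: reals_Archimedean2)
  have m: "(\<lambda>\<xi>. point_sum (\<xi> \<inter> D n) (\<lambda>x. f (x, \<xi> - {x}))) \<in> borel_measurable law" for n
  proof -
    have "(\<lambda>\<xi>. ennreal (1 + real (card (\<xi> \<inter> D n))) * integral\<^sup>N (reduced1 (D n) \<xi>) f) \<in> borel_measurable cfg"
      by (intro borel_measurable_times_ennreal measurable_compose[OF measurable_card_Int[OF D(2,1)]]
         measurable_compose[OF reduced1_kernel[OF D] nn_integral_measurable_subprob_algebra[OF f]]) simp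
    then have "(\<lambda>\<xi>. ennreal (1 + real (card (\<xi> \<inter> D n))) * integral\<^sup>N (reduced1 (D n) \<xi>) f) \<in> borel_measurable law"
      unfolding measurable_cong_sets[OF sets_law refl] .
    then show ?thesis
      by (rule measurable_cong[THEN iffD1, rotated]) (simp only: space_law point_sum_reduced1[OF _ f])
  qed
  have "(\<integral>\<^sup>+\<xi>. point_sum \<xi> (\<lambda>x. f (x, \<xi> - {x})) \<partial>law) = (\<integral>\<^sup>+\<xi>. (SUP n. point_sum (\<xi> \<inter> D n) (\<lambda>x. f (x, \<xi> - {x}))) \<partial>law)"
    by (intro nn_integral_cong point_sum_mono_SUP[OF D2])
  also have "\<dots> = (SUP n. \<integral>\<^sup>+\<xi>. point_sum (\<xi> \<inter> D n) (\<lambda>x. f (x, \<xi> - {x})) \<partial>law)"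
  proof (rule nn_integral_monotone_convergence_SUP[OF _ m])
    show "incseq (\<lambda>n \<xi>. point_sum (\<xi> \<inter> D n) (\<lambda>x. f (x, \<xi> - {x})))"
      using D2(1) by (auto simp: incseq_def le_fun_def intro!: point_sum_mono_set)
  qed
  also have "\<dots> = (SUP n. ennreal \<beta> * (\<integral>\<^sup>+x. indicator (D n) x * (\<integral>\<^sup>+\<xi>. f (x,\<xi>) \<partial>law) \<partial>lborel))"
    by (simp add: mecke_bounded[OF D f])
  also have "\<dots> = ennreal \<beta> * (SUP n. \<integral>\<^sup>+x. indicator (D n) x * (\<integral>\<^sup>+\<xi>. f (x,\<xi>) \<partial>law) \<partial>lborel)"
    by (rule SUP_mult_left_ennreal[symmetric])
  also have "(SUP n. \<integral>\<^sup>+x. indicator (D n) x * (\<integral>\<^sup>+\<xi>. f (x,\<xi>) \<partial>law) \<partial>lborel) = (\<integral>\<^sup>+x. (SUP n. indicator (D n) x * (\<integral>\<^sup>+\<xi>. f (x,\<xi>) \<partial>law)) \<partial>lborel)"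
    using D D2(1) law_integral_measurable[OF f] by (intro nn_integral_monotone_convergence_SUP[symmetric])
      (auto simp: incseq_def le_fun_def indicator_def intro!: mult_right_mono, blast)
  also have "\<dots> = (\<integral>\<^sup>+x. (\<integral>\<^sup>+\<xi>. f (x,\<xi>) \<partial>law) \<partial>lborel)"
  proof (intro nn_integral_cong)
    fix x
    obtain n where "x \<in> D n" using D2 by auto
    then have "(\<integral>\<^sup>+\<xi>. f (x,\<xi>) \<partial>law) \<le> indicator (D n) x * (\<integral>\<^sup>+\<xi>. f (x,\<xi>) \<partial>law)" by simp
    then show "(SUP n. indicator (D n) x * (\<integral>\<^sup>+\<xi>. f (x,\<xi>) \<partial>law)) = (\<integral>\<^sup>+\<xi>. f (x,\<xi>) \<partial>law)"
      by (intro antisym SUP_least) (auto simp: indicator_def intro: SUP_upper2)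
  qed
  finally show ?thesis .
qed

end

section \<open>Shapes of triangles\<close>

definition mk2 :: "real \<Rightarrow> real \<Rightarrow> real^2" where
  "mk2 x y = x *\<^sub>R axis 1 1 + y *\<^sub>R axis 2 1"

lemma mk2_nth [simp]: "mk2 x y $ 1 = x" "mk2 x y $ 2 = y"
  by (simp_all add: mk2_def axis_def)

lemma measurable_mk2 [measurable]:
  assumes [measurable]: "f \<in> borel_measurable M" "g \<in> borel_measurable M"
  shows "(\<lambda>x. mk2 (f x) (g x)) \<in> borel_measurable M"
  unfolding mk2_def by (intro borel_measurable_add borel_measurable_scaleR borel_measurable_const) auto

lemma measurable_nth2 [measurable]: "f \<in> borel_measurable M \<Longrightarrow> (\<lambda>x. (f x :: real^2) $ i) \<in> borel_measurable M"
proof -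
  have "(\<lambda>x. f x $ i) = (\<lambda>x. f x \<bullet> axis i 1)" by (simp add: inner_axis)
  then show "f \<in> borel_measurable M \<Longrightarrow> ?thesis" by simp
qed

lemma norm2_sq: "(norm (v::real^2))\<^sup>2 = (v$1)\<^sup>2 + (v$2)\<^sup>2"
  by (simp add: norm_vec_def L2_set_def sum_2)

lemma Basis_2: "(Basis :: (real^2) set) = {axis 1 1, axis 2 1}"
  unfolding Basis_vec_def by (auto simp: UNIV_2)

lemma prod_Basis_2: "(\<Prod>b\<in>(Basis :: (real^2) set). f b) = f (axis 1 1) * f (axis 2 1)"
  unfolding Basis_2 by (subst prod.insert) (auto simp: axis_eq_axis)

lemma lborel_real2: "distr (lborel \<Otimes>\<^sub>M lborel) borel (\<lambda>(x,y). mk2 x y) = (lborel :: (real^2) measure)"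
proof (rule lborel_eqI[symmetric])
  fix l u :: "real^2" assume b: "\<And>b. b \<in> Basis \<Longrightarrow> l \<bullet> b \<le> u \<bullet> b"
  have le: "l$1 \<le> u$1" "l$2 \<le> u$2"
    using b[of "axis 1 1"] b[of "axis 2 1"] by (auto simp: Basis_2 inner_axis)
  have "(\<lambda>(x,y). mk2 x y) -` box l u = {l$1<..<u$1} \<times> {l$2<..<u$2}"
    by (auto simp: mem_box_cart forall_2)
  then have "emeasure (distr (lborel \<Otimes>\<^sub>M lborel) borel (\<lambda>(x,y). mk2 x y)) (box l u) = emeasure (lborel \<Otimes>\<^sub>M lborel) ({l$1<..<u$1} \<times> {l$2<..<u$2})"
    by (subst emeasure_distr) (auto simp: space_pair_measure)
  also have "\<dots> = ennreal (u$1 - l$1) * ennreal (u$2 - l$2)"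
    using le by (subst lborel.emeasure_pair_measure_Times) auto
  also have "\<dots> = (\<Prod>b\<in>Basis. (u - l) \<bullet> b)"
    using le by (simp add: prod_Basis_2 inner_axis ennreal_mult)
  finally show "emeasure (distr (lborel \<Otimes>\<^sub>M lborel) borel (\<lambda>(x,y). mk2 x y)) (box l u) = (\<Prod>b\<in>Basis. (u - l) \<bullet> b)" .
qed simp

lemma nn_integral_real2:
  fixes g :: "real^2 \<Rightarrow> ennreal"
  assumes [measurable]: "g \<in> borel_measurable borel"
  shows "(\<integral>\<^sup>+w. g w \<partial>lborel) = (\<integral>\<^sup>+x. \<integral>\<^sup>+y. g (mk2 x y) \<partial>lborel \<partial>lborel)"
proof -
  have "(\<integral>\<^sup>+w. g w \<partial>lborel) = (\<integral>\<^sup>+p. g (case p of (x,y) \<Rightarrow> mk2 x y) \<partial>(lborel \<Otimes>\<^sub>M lborel))"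
    by (subst lborel_real2[symmetric]) (subst nn_integral_distr, auto)
  also have "\<dots> = (\<integral>\<^sup>+x. \<integral>\<^sup>+y. g (mk2 x y) \<partial>lborel \<partial>lborel)"
    by (subst lborel.nn_integral_fst[symmetric]) (auto simp: case_prod_beta')
  finally show ?thesis .
qed

text \<open>Complex multiplication in coordinates: for \<open>y \<noteq> 0\<close> a rotation and
  dilation that carries (1, 0) to \<open>y\<close>.\<close>

definition cmul :: "real^2 \<Rightarrow> real^2 \<Rightarrow> real^2" where
  "cmul y w = mk2 (y$1 * w$1 - y$2 * w$2) (y$1 * w$2 + y$2 * w$1)"

lemma norm_cmul: "norm (cmul y w) = norm y * norm w"
proof (rule power2_eq_imp_eq)
  show "(norm (cmul y w))\<^sup>2 = (norm y * norm w)\<^sup>2"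
    unfolding power_mult_distrib norm2_sq cmul_def mk2_nth by algebra
qed auto

lemma linear_cmul: "linear (cmul y)"
  by (rule linearI) (auto simp: cmul_def vec_eq_iff forall_2 algebra_simps)

lemma measurable_cmul [measurable]:
  assumes [measurable]: "f \<in> borel_measurable M" "g \<in> borel_measurable M"
  shows "(\<lambda>x. cmul (f x) (g x)) \<in> borel_measurable M"
  unfolding cmul_def by measurable

lemma nn_integral_cmul:
  assumes [measurable]: "g \<in> borel_measurable borel" and y: "y \<noteq> 0"
  shows "(\<integral>\<^sup>+w. g w \<partial>lborel) = ennreal ((norm y)\<^sup>2) * (\<integral>\<^sup>+w. g (cmul y w) \<partial>lborel)"
proof -
  define N where "N = (norm y)\<^sup>2"
  have N: "N > 0" "N = (y$1)\<^sup>2 + (y$2)\<^sup>2" using y by (auto simp: N_def norm2_sq[symmetric])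
  \<comment> \<open>The complex inverse of \<open>y\<close>, its conjugate divided by the squared
    modulus; multiplication by it has determinant \<open>1 / N\<close>.\<close>
  define z where "z = mk2 (y$1 / N) (- y$2 / N)"
  have zy: "cmul z (cmul y w) = w" "cmul y (cmul z w) = w" for w
    using N(1) unfolding z_def cmul_def vec_eq_iff forall_2 mk2_nth 
    by (simp_all add: field_simps, simp_all add: N(2) power2_eq_square algebra_simps)
  have detz: "det (matrix (cmul z)) = 1 / N"
  proof -
    have "det (matrix (cmul z)) = (z$1)\<^sup>2 + (z$2)\<^sup>2"
      by (simp add: det_2 matrix_def cmul_def axis_def power2_eq_square)
    also have "\<dots> = 1 / N"
      using N(1) by (simp add: z_def power_divide add_divide_distrib[symmetric] N(2)[symmetric])
         (simp add: power2_eq_square)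
    finally show ?thesis .
  qed
  have "lborel = density (distr lborel borel (cmul y)) (\<lambda>_. ennreal N)"
  proof (rule lborel_eqI)
    fix l u :: "real^2" assume le: "\<And>b. b \<in> Basis \<Longrightarrow> l \<bullet> b \<le> u \<bullet> b"
    have img: "cmul y -` box l u = cmul z ` box l u"
      using zy by (auto simp: image_iff) metis
    have lm: "cmul z ` box l u \<in> lmeasurable" by (rule measurable_linear_image[OF linear_cmul]) auto
    have vs: "cmul y -` box l u \<in> sets borel" using measurable_sets[of "cmul y" borel borel "box l u"] by simp
    have "emeasure (density (distr lborel borel (cmul y)) (\<lambda>_. ennreal N)) (box l u) = ennreal N * emeasure lborel (cmul y -` box l u)"
      by (subst emeasure_density) (auto simp: nn_integral_cmult emeasure_distr)
    also have "emeasure lborel (cmul y -` box l u) = emeasure lebesgue (cmul z ` box l u)"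
      using vs unfolding img by simp
    also have "\<dots> = ennreal (measure lebesgue (cmul z ` box l u))" using lm by (simp add: emeasure_eq_measure2)
    also have "measure lebesgue (cmul z ` box l u) = 1 / N * measure lebesgue (box l u)"
      using N(1) by (subst measure_linear_image[OF linear_cmul]) (auto simp: detz)
    also have "ennreal N * ennreal (1 / N * measure lebesgue (box l u)) = ennreal (measure lebesgue (box l u))"
      using N(1) by (subst ennreal_mult[symmetric]) auto
    also have "\<dots> = (\<Prod>b\<in>Basis. (u - l) \<bullet> b)" using le by (simp add: measure_lborel_box_eq)
    finally show "emeasure (density (distr lborel borel (cmul y)) (\<lambda>_. ennreal N)) (box l u) = (\<Prod>b\<in>Basis. (u - l) \<bullet> b)" .
  qed simp
  then have "(\<integral>\<^sup>+w. g w \<partial>lborel) = (\<integral>\<^sup>+w. g w \<partial>density (distr lborel borel (cmul y)) (\<lambda>_. ennreal N))" by simp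
  also have "\<dots> = ennreal N * (\<integral>\<^sup>+w. g (cmul y w) \<partial>lborel)"
    by (simp add: nn_integral_density nn_integral_cmult nn_integral_distr)
  finally show ?thesis by (simp add: N_def)
qed

text \<open>Polar coordinates for radial functions. The two measures on the line agree on
  \<open>{..a}\<close> because the disc of radius \<open>a\<close> has area \<open>pi * a^2\<close>,
  and these half-lines form a generator.\<close>

lemma nn_integral_norm2:
  assumes [measurable]: "g \<in> borel_measurable borel"
  shows "(\<integral>\<^sup>+y. g (norm (y::real^2)) \<partial>lborel) = (\<integral>\<^sup>+r. ennreal (2 * pi * r) * indicator {0..} r * g r \<partial>lborel)"
proof -
  let ?d = "\<lambda>r::real. ennreal (2 * pi * r) * indicator {0..} r"
  have eq1: "emeasure (distr lborel borel (norm :: real^2 \<Rightarrow> real)) {..a} = emeasure (density lborel ?d) {..a}" for a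
  proof (cases "a \<ge> 0")
    case True
    have "emeasure (distr lborel borel (norm :: real^2 \<Rightarrow> real)) {..a} = emeasure lborel (cball (0::real^2) a)"
      by (subst emeasure_distr) (auto intro!: arg_cong[where f="emeasure lborel"])
    also have "\<dots> = ennreal (pi * a\<^sup>2)"
      using True by (simp add: emeasure_cball unit_ball_vol_2 power2_eq_square)
    also have "\<dots> = (\<integral>\<^sup>+r. ennreal (2 * pi * r) * indicator {0..a} r \<partial>lborel)"
    proof -
      have "(\<integral>\<^sup>+r. ennreal (2 * pi * r) * indicator {0..a} r \<partial>lborel) = ennreal (pi * a\<^sup>2 - pi * 0\<^sup>2)"
        by (rule nn_integral_FTC_Icc) (use True in \<open>auto intro!: derivative_eq_intros\<close>)
      then show ?thesis by simp
    qed
    also have "\<dots> = emeasure (density lborel ?d) {..a}"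
      by (subst emeasure_density) (auto intro!: nn_integral_cong simp: indicator_def)
    finally show ?thesis .
  next
    case False
    have "(norm :: real^2 \<Rightarrow> real) -` {..a} = {}" using False by (auto simp: not_le) (smt (verit) norm_ge_zero)
    then have "emeasure (distr lborel borel (norm :: real^2 \<Rightarrow> real)) {..a} = 0"
      by (subst emeasure_distr) auto
    moreover have "(\<lambda>r. ?d r * indicator {..a} r) = (\<lambda>_. 0)"
      using False by (auto simp: fun_eq_iff split: split_indicator)
    then have "emeasure (density lborel ?d) {..a} = (\<integral>\<^sup>+r. 0 \<partial>lborel)"
      by (subst emeasure_density) auto
    ultimately show ?thesis by simp
  qed
  have "distr lborel borel (norm :: real^2 \<Rightarrow> real) = density lborel ?d"
  proof (rule measure_eqI_generator_eq[where E="range atMost" and \<Omega>=UNIV and A="\<lambda>n. {..real n}"])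
    show "Int_stable (range atMost :: real set set)" by (auto simp: Int_stable_def)
    show "sets (distr lborel borel (norm :: real^2 \<Rightarrow> real)) = sigma_sets UNIV (range atMost)"
      "sets (density lborel ?d) = sigma_sets UNIV (range atMost)"
      by (simp_all add: borel_eq_atMost)
    show "(\<Union>n. {..real n}) = UNIV" by (auto intro: real_arch_simple)
    fix n
    have "emeasure (distr lborel borel (norm :: real^2 \<Rightarrow> real)) {..real n} = emeasure lborel (cball (0::real^2) (real n))"
      by (subst emeasure_distr) (auto intro!: arg_cong[where f="emeasure lborel"])
    then show "emeasure (distr lborel borel (norm :: real^2 \<Rightarrow> real)) {..real n} \<noteq> \<infinity>"
      by (simp add: emeasure_cball)
  qed (auto simp: eq1)
  then have "(\<integral>\<^sup>+y. g y \<partial>distr lborel borel (norm :: real^2 \<Rightarrow> real)) = (\<integral>\<^sup>+y. g y \<partial>density lborel ?d)" by simp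
  then show ?thesis by (simp add: nn_integral_distr nn_integral_density)
qed

definition det2 :: "real^2 \<Rightarrow> real^2 \<Rightarrow> real" where
  "det2 y z = y$1 * z$2 - y$2 * z$1"

text \<open>The product of the three sides over four times the area, for the triangle 0,
  \<open>y\<close>, \<open>z\<close>. In the degenerate case division by zero makes it 0;
  nondegeneracy is demanded separately where it matters.\<close>

definition circrad :: "real^2 \<Rightarrow> real^2 \<Rightarrow> real" where
  "circrad y z = norm y * norm z * norm (z - y) / (2 * \<bar>det2 y z\<bar>)"

text \<open>The squared product of the distances from the point \<open>(x, y)\<close> to 0 and to
  1.\<close>

definition quart :: "real \<Rightarrow> real \<Rightarrow> real" where
  "quart x y = (x\<^sup>2 + y\<^sup>2) * ((x - 1)\<^sup>2 + y\<^sup>2)"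

lemma measurable_det2 [measurable]:
  assumes [measurable]: "f \<in> borel_measurable M" "g \<in> borel_measurable M"
  shows "(\<lambda>x. det2 (f x) (g x)) \<in> borel_measurable M"
  unfolding det2_def by measurable

lemma measurable_circrad [measurable]:
  assumes [measurable]: "f \<in> borel_measurable M" "g \<in> borel_measurable M"
  shows "(\<lambda>x. circrad (f x) (g x)) \<in> borel_measurable M"
  unfolding circrad_def by measurable

lemma measurable_quart [measurable]:
  assumes [measurable]: "f \<in> borel_measurable M" "g \<in> borel_measurable M"
  shows "(\<lambda>x. quart (f x) (g x)) \<in> borel_measurable M"
  unfolding quart_def by measurable

lemma quart_pos: "y \<noteq> 0 \<Longrightarrow> quart x y > 0"
  unfolding quart_def by (intro mult_pos_pos add_nonneg_pos) auto

lemma det2_cmul: "det2 y (cmul y w) = (norm y)\<^sup>2 * w$2"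
  unfolding norm2_sq by (simp add: det2_def cmul_def power2_eq_square algebra_simps)

lemma circrad_cmul:
  assumes "y \<noteq> 0"
  shows "circrad y (cmul y w) = norm y * (sqrt (quart (w$1) (w$2)) / (2 * \<bar>w$2\<bar>))"
proof -
  have c: "cmul y w - y = cmul y (w - mk2 1 0)"
    by (simp add: cmul_def vec_eq_iff forall_2 algebra_simps)
  have n: "norm v = sqrt ((v$1)\<^sup>2 + (v$2)\<^sup>2)" for v :: "real^2"
    by (metis norm2_sq norm_ge_zero real_sqrt_unique)
  have "norm w * norm (w - mk2 1 0) = sqrt (quart (w$1) (w$2))"
    unfolding n[of w] n[of "w - mk2 1 0"] quart_def by (simp add: real_sqrt_mult)
  then show ?thesis
    using assms unfolding circrad_def c norm_cmul det2_cmul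
    by (simp add: abs_mult power2_eq_square)
qed

text \<open>The triangle \<open>0, y, cmul y w\<close> is similar to \<open>0, 1, w\<close>, which has circumradius \<open>sqrt (quart w) / (2 * \<bar>w$2\<bar>)\<close> and area \<open>\<bar>w$2\<bar> / 2\<close>. The remaining size parameter \<open>norm y\<close> is exchanged for the circumradius.\<close>

lemma triangle_shape_integral:
  fixes F :: "real \<Rightarrow> real \<Rightarrow> ennreal"
  assumes [measurable]: "(\<lambda>(a,b). F a b) \<in> borel_measurable (borel \<Otimes>\<^sub>M borel)"
  shows "(\<integral>\<^sup>+y. \<integral>\<^sup>+z. (if det2 y z \<noteq> 0 then F (circrad y z) (\<bar>det2 y z\<bar> / 2) else 0) \<partial>lborel \<partial>lborel) =
    (\<integral>\<^sup>+R. ennreal (2 * pi * R ^ 3) * indicator {0<..} R *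
      (\<integral>\<^sup>+x. \<integral>\<^sup>+y. ennreal (16 * y ^ 4 / (quart x y)\<^sup>2) * F R (R\<^sup>2 * (2 * \<bar>y\<bar> ^ 3 / quart x y)) \<partial>lborel \<partial>lborel) \<partial>lborel)"
proof -
  have Fm [measurable]: "(\<lambda>x. F (f x) (g x)) \<in> borel_measurable M"
    if "f \<in> borel_measurable M" "g \<in> borel_measurable M" for f g and M :: "'z measure"
    using measurable_compose[OF measurable_Pair[OF that] assms] by simp
  \<comment> \<open>The circumradius of the normalised triangle 0, 1, \<open>w\<close>, so that a
    triangle of this shape with first side \<open>r\<close> has circumradius
    \<open>r * \<rho> w\<close>.\<close>
  define \<rho> where "\<rho> = (\<lambda>w::real^2. sqrt (quart (w$1) (w$2)) / (2 * \<bar>w$2\<bar>))"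
  have [measurable]: "\<rho> \<in> borel_measurable borel" unfolding \<rho>_def by measurable
  \<comment> \<open>The factor \<open>r^2\<close> is the Jacobian of multiplication by a vector of
    length \<open>r\<close>.\<close>
  define G where "G = (\<lambda>r w. ennreal (r\<^sup>2) * (if w$2 \<noteq> 0 then F (r * \<rho> w) (r\<^sup>2 * (\<bar>w$2\<bar> / 2)) else 0))"
  have Gm [measurable]: "(\<lambda>x. G (f x) (g x)) \<in> borel_measurable M"
    if [measurable]: "f \<in> borel_measurable M" "g \<in> borel_measurable M" for f g and M :: "'z measure"
    unfolding G_def by measurable
  have "(\<integral>\<^sup>+y. \<integral>\<^sup>+z. (if det2 y z \<noteq> 0 then F (circrad y z) (\<bar>det2 y z\<bar> / 2) else 0) \<partial>lborel \<partial>lborel) =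
      (\<integral>\<^sup>+y. \<integral>\<^sup>+w. G (norm (y::real^2)) w \<partial>lborel \<partial>lborel)"
  proof -
    have *: "(\<integral>\<^sup>+z. (if det2 y z \<noteq> 0 then F (circrad y z) (\<bar>det2 y z\<bar> / 2) else 0) \<partial>lborel) = (\<integral>\<^sup>+w. G (norm y) w \<partial>lborel)"
      if y: "y \<noteq> 0" for y
    proof -
    have "(\<integral>\<^sup>+z. (if det2 y z \<noteq> 0 then F (circrad y z) (\<bar>det2 y z\<bar> / 2) else 0) \<partial>lborel) =
      ennreal ((norm y)\<^sup>2) * (\<integral>\<^sup>+w. (if det2 y (cmul y w) \<noteq> 0 then F (circrad y (cmul y w)) (\<bar>det2 y (cmul y w)\<bar> / 2) else 0) \<partial>lborel)"
      by (rule nn_integral_cmul[OF _ y]) measurable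
    also have "\<dots> = (\<integral>\<^sup>+w. ennreal ((norm y)\<^sup>2) * (if det2 y (cmul y w) \<noteq> 0 then F (circrad y (cmul y w)) (\<bar>det2 y (cmul y w)\<bar> / 2) else 0) \<partial>lborel)"
      by (rule nn_integral_cmult[symmetric]) measurable
    also have "\<dots> = (\<integral>\<^sup>+w. G (norm y) w \<partial>lborel)"
      unfolding G_def \<rho>_def using y by (intro nn_integral_cong) (simp add: circrad_cmul det2_cmul abs_mult)
    finally show "(\<integral>\<^sup>+z. (if det2 y z \<noteq> 0 then F (circrad y z) (\<bar>det2 y z\<bar> / 2) else 0) \<partial>lborel) = (\<integral>\<^sup>+w. G (norm y) w \<partial>lborel)" .
    qed
    have "AE y in lborel. (y::real^2) \<noteq> 0" by (rule AE_lborel_singleton)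
    then have "AE y in lborel. (\<integral>\<^sup>+z. (if det2 y z \<noteq> 0 then F (circrad y z) (\<bar>det2 y z\<bar> / 2) else 0) \<partial>lborel) = (\<integral>\<^sup>+w. G (norm y) w \<partial>lborel)"
      by eventually_elim (rule *)
    then show ?thesis by (rule nn_integral_cong_AE)
  qed
  also have "\<dots> = (\<integral>\<^sup>+w. \<integral>\<^sup>+y. G (norm (y::real^2)) w \<partial>lborel \<partial>lborel)"
    by (rule lborel_pair.Fubini') measurable
  also have "\<dots> = (\<integral>\<^sup>+w. \<integral>\<^sup>+R. ennreal (2 * pi * R ^ 3) * indicator {0<..} R * (ennreal (16 * ((w::real^2)$2) ^ 4 / (quart (w$1) (w$2))\<^sup>2) * F R (R\<^sup>2 * (2 * \<bar>w$2\<bar> ^ 3 / quart (w$1) (w$2)))) \<partial>lborel \<partial>lborel)"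
  proof (rule nn_integral_cong)
    fix w :: "real^2"
    let ?q = "quart (w$1) (w$2)"
    have "(\<integral>\<^sup>+y. G (norm (y::real^2)) w \<partial>lborel) = (\<integral>\<^sup>+r. ennreal (2 * pi * r) * indicator {0..} r * G r w \<partial>lborel)"
      by (rule nn_integral_norm2) measurable
    also have "\<dots> = (\<integral>\<^sup>+R. ennreal (2 * pi * R ^ 3) * indicator {0<..} R * (ennreal (16 * ((w::real^2)$2) ^ 4 / ?q\<^sup>2) * F R (R\<^sup>2 * (2 * \<bar>w$2\<bar> ^ 3 / ?q))) \<partial>lborel)"
    proof (cases "w$2 = 0")
      case True
      then show ?thesis by (simp add: G_def)
    next
      case False
      then have q: "?q > 0" by (rule quart_pos)
      then have p: "\<rho> w > 0" using False by (simp add: \<rho>_def)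
      have p2: "(\<rho> w)\<^sup>2 = ?q / (4 * (w$2)\<^sup>2)" using q by (simp add: \<rho>_def power_divide power_mult_distrib)
      have "(\<integral>\<^sup>+r. ennreal (2 * pi * r) * indicator {0..} r * G r w \<partial>lborel) =
         ennreal \<bar>1 / \<rho> w\<bar> * (\<integral>\<^sup>+R. ennreal (2 * pi * (0 + 1 / \<rho> w * R)) * indicator {0..} (0 + 1 / \<rho> w * R) * G (0 + 1 / \<rho> w * R) w \<partial>lborel)"
        using p by (intro nn_integral_real_affine) auto
      also have "\<dots> = (\<integral>\<^sup>+R. ennreal \<bar>1 / \<rho> w\<bar> * (ennreal (2 * pi * (0 + 1 / \<rho> w * R)) * indicator {0..} (0 + 1 / \<rho> w * R) * G (0 + 1 / \<rho> w * R) w) \<partial>lborel)"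
        by (rule nn_integral_cmult[symmetric]) measurable
      also have "\<dots> = (\<integral>\<^sup>+R. ennreal (2 * pi * R ^ 3) * indicator {0<..} R * (ennreal (16 * ((w::real^2)$2) ^ 4 / ?q\<^sup>2) * F R (R\<^sup>2 * (2 * \<bar>w$2\<bar> ^ 3 / ?q))) \<partial>lborel)"
      proof (rule nn_integral_cong)
        fix R :: real
        show "ennreal \<bar>1 / \<rho> w\<bar> * (ennreal (2 * pi * (0 + 1 / \<rho> w * R)) * indicator {0..} (0 + 1 / \<rho> w * R) * G (0 + 1 / \<rho> w * R) w) =
           ennreal (2 * pi * R ^ 3) * indicator {0<..} R * (ennreal (16 * ((w::real^2)$2) ^ 4 / ?q\<^sup>2) * F R (R\<^sup>2 * (2 * \<bar>w$2\<bar> ^ 3 / ?q)))"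
        proof (cases "R > 0")
          case False
          then show ?thesis using p by (cases "R = 0") (auto simp: zero_le_divide_iff G_def)
        next
          case True
          have a: "(R / \<rho> w)\<^sup>2 * (\<bar>w$2\<bar> / 2) = R\<^sup>2 * (2 * \<bar>w$2\<bar> ^ 3 / ?q)"
          proof -
            have "\<bar>w$2\<bar> ^ 3 = \<bar>w$2\<bar> * (w$2)\<^sup>2" by (simp add: power3_eq_cube power2_eq_square)
            then show ?thesis unfolding power_divide p2 using q False by (simp add: field_simps)
          qed
          \<comment> \<open>Substituting \<open>r = R / \<rho> w\<close> collects four factors
            \<open>1 / \<rho> w\<close>: one from \<open>dr\<close>, one from the polar density, two
            from the Jacobian. They produce \<open>16 * y^4 / quart^2\<close>.\<close>
          have b: "1 / \<rho> w * (2 * pi * (R / \<rho> w)) * (R / \<rho> w)\<^sup>2 = 2 * pi * R ^ 3 * (16 * ((w::real^2)$2) ^ 4 / ?q\<^sup>2)"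
          proof -
            have "1 / \<rho> w * (2 * pi * (R / \<rho> w)) * (R / \<rho> w)\<^sup>2 = 2 * pi * R ^ 3 / ((\<rho> w)\<^sup>2)\<^sup>2"
              by (simp add: field_simps power2_eq_square power3_eq_cube)
            also have "\<dots> = 2 * pi * R ^ 3 * (16 * ((w::real^2)$2) ^ 4 / ?q\<^sup>2)"
              unfolding p2 by (simp add: power_divide power_mult_distrib)
            finally show ?thesis .
          qed
          have "ennreal \<bar>1 / \<rho> w\<bar> * (ennreal (2 * pi * (0 + 1 / \<rho> w * R)) * indicator {0..} (0 + 1 / \<rho> w * R) * G (0 + 1 / \<rho> w * R) w) =
            ennreal (1 / \<rho> w) * ennreal (2 * pi * (R / \<rho> w)) * ennreal ((R / \<rho> w)\<^sup>2) * F R (R\<^sup>2 * (2 * \<bar>w$2\<bar> ^ 3 / ?q))"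
          proof -
            have e: "0 + 1 / \<rho> w * R = R / \<rho> w" "R / \<rho> w * \<rho> w = R" using p by auto
            have Gv: "G (0 + 1 / \<rho> w * R) w = ennreal ((R / \<rho> w)\<^sup>2) * F R (R\<^sup>2 * (2 * \<bar>w$2\<bar> ^ 3 / ?q))"
              unfolding e(1) G_def using False by (simp only: e(2) a if_True not_False_eq_True)
            show ?thesis unfolding Gv using True p by (simp add: mult.assoc)
          qed
          also have "\<dots> = ennreal (2 * pi * R ^ 3 * (16 * ((w::real^2)$2) ^ 4 / ?q\<^sup>2)) * F R (R\<^sup>2 * (2 * \<bar>w$2\<bar> ^ 3 / ?q))"
          proof -
            have "ennreal (1 / \<rho> w) * ennreal (2 * pi * (R / \<rho> w)) * ennreal ((R / \<rho> w)\<^sup>2) = ennreal (1 / \<rho> w * (2 * pi * (R / \<rho> w)) * (R / \<rho> w)\<^sup>2)"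
              using True p by (subst ennreal_mult, simp, simp, subst ennreal_mult) auto
            then show ?thesis unfolding b by simp
          qed
          finally have eq: "ennreal \<bar>1 / \<rho> w\<bar> * (ennreal (2 * pi * (0 + 1 / \<rho> w * R)) * indicator {0..} (0 + 1 / \<rho> w * R) * G (0 + 1 / \<rho> w * R) w) =
            ennreal (2 * pi * R ^ 3 * (16 * (w$2) ^ 4 / ?q\<^sup>2)) * F R (R\<^sup>2 * (2 * \<bar>w$2\<bar> ^ 3 / ?q))" .
          have m: "ennreal (2 * pi * R ^ 3 * (16 * (w$2) ^ 4 / ?q\<^sup>2)) = ennreal (2 * pi * R ^ 3) * ennreal (16 * (w$2) ^ 4 / ?q\<^sup>2)"
            using True by (intro ennreal_mult) auto
          have i: "indicator {0<..} R = (1::ennreal)" using True by simp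
          show ?thesis unfolding eq m i by (simp only: mult_1_right mult.assoc)
        qed
      qed
      finally show ?thesis .
    qed
    finally show "(\<integral>\<^sup>+y. G (norm (y::real^2)) w \<partial>lborel) = (\<integral>\<^sup>+R. ennreal (2 * pi * R ^ 3) * indicator {0<..} R * (ennreal (16 * ((w::real^2)$2) ^ 4 / ?q\<^sup>2) * F R (R\<^sup>2 * (2 * \<bar>w$2\<bar> ^ 3 / ?q))) \<partial>lborel)" .
  qed
  also have "\<dots> = (\<integral>\<^sup>+R. \<integral>\<^sup>+w. ennreal (2 * pi * R ^ 3) * indicator {0<..} R * (ennreal (16 * ((w::real^2)$2) ^ 4 / (quart (w$1) (w$2))\<^sup>2) * F R (R\<^sup>2 * (2 * \<bar>w$2\<bar> ^ 3 / quart (w$1) (w$2)))) \<partial>lborel \<partial>lborel)"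
    by (rule lborel_pair.Fubini') measurable
  also have "\<dots> = (\<integral>\<^sup>+R. ennreal (2 * pi * R ^ 3) * indicator {0<..} R * (\<integral>\<^sup>+w. ennreal (16 * ((w::real^2)$2) ^ 4 / (quart (w$1) (w$2))\<^sup>2) * F R (R\<^sup>2 * (2 * \<bar>w$2\<bar> ^ 3 / quart (w$1) (w$2))) \<partial>lborel) \<partial>lborel)"
  proof (rule nn_integral_cong)
    fix R :: real
    have "(\<lambda>w. ennreal (16 * ((w::real^2)$2) ^ 4 / (quart (w$1) (w$2))\<^sup>2) * F R (R\<^sup>2 * (2 * \<bar>w$2\<bar> ^ 3 / quart (w$1) (w$2)))) \<in> borel_measurable lborel"
      unfolding quart_def by (intro borel_measurable_times_ennreal Fm borel_measurable_const measurable_compose[OF _ measurable_ennreal]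
          borel_measurable_divide borel_measurable_times borel_measurable_power borel_measurable_add borel_measurable_diff
          borel_measurable_abs measurable_nth2 measurable_ident_sets refl) simp_all
    then show "(\<integral>\<^sup>+w. ennreal (2 * pi * R ^ 3) * indicator {0<..} R * (ennreal (16 * ((w::real^2)$2) ^ 4 / (quart (w$1) (w$2))\<^sup>2) * F R (R\<^sup>2 * (2 * \<bar>w$2\<bar> ^ 3 / quart (w$1) (w$2)))) \<partial>lborel) =
      ennreal (2 * pi * R ^ 3) * indicator {0<..} R * (\<integral>\<^sup>+w. ennreal (16 * ((w::real^2)$2) ^ 4 / (quart (w$1) (w$2))\<^sup>2) * F R (R\<^sup>2 * (2 * \<bar>w$2\<bar> ^ 3 / quart (w$1) (w$2))) \<partial>lborel)"
      by (rule nn_integral_cmult)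
  qed
  also have "\<dots> = (\<integral>\<^sup>+R. ennreal (2 * pi * R ^ 3) * indicator {0<..} R *
      (\<integral>\<^sup>+x. \<integral>\<^sup>+y. ennreal (16 * y ^ 4 / (quart x y)\<^sup>2) * F R (R\<^sup>2 * (2 * \<bar>y\<bar> ^ 3 / quart x y)) \<partial>lborel \<partial>lborel) \<partial>lborel)"
  proof (rule nn_integral_cong)
    fix R :: real
    have mm: "(\<lambda>w. ennreal (16 * ((w::real^2)$2) ^ 4 / (quart (w$1) (w$2))\<^sup>2) * F R (R\<^sup>2 * (2 * \<bar>w$2\<bar> ^ 3 / quart (w$1) (w$2)))) \<in> borel_measurable borel"
      unfolding quart_def by (intro borel_measurable_times_ennreal Fm borel_measurable_const measurable_compose[OF _ measurable_ennreal]
          borel_measurable_divide borel_measurable_times borel_measurable_power borel_measurable_add borel_measurable_diff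
          borel_measurable_abs measurable_nth2 measurable_ident_sets refl)
    have "(\<integral>\<^sup>+w. ennreal (16 * ((w::real^2)$2) ^ 4 / (quart (w$1) (w$2))\<^sup>2) * F R (R\<^sup>2 * (2 * \<bar>w$2\<bar> ^ 3 / quart (w$1) (w$2))) \<partial>lborel) =
      (\<integral>\<^sup>+x. \<integral>\<^sup>+y. ennreal (16 * y ^ 4 / (quart x y)\<^sup>2) * F R (R\<^sup>2 * (2 * \<bar>y\<bar> ^ 3 / quart x y)) \<partial>lborel \<partial>lborel)"
      by (subst nn_integral_real2[OF mm]) (simp only: mk2_nth)
    then show "ennreal (2 * pi * R ^ 3) * indicator {0<..} R * (\<integral>\<^sup>+w. ennreal (16 * ((w::real^2)$2) ^ 4 / (quart (w$1) (w$2))\<^sup>2) * F R (R\<^sup>2 * (2 * \<bar>w$2\<bar> ^ 3 / quart (w$1) (w$2))) \<partial>lborel) =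
      ennreal (2 * pi * R ^ 3) * indicator {0<..} R * (\<integral>\<^sup>+x. \<integral>\<^sup>+y. ennreal (16 * y ^ 4 / (quart x y)\<^sup>2) * F R (R\<^sup>2 * (2 * \<bar>y\<bar> ^ 3 / quart x y)) \<partial>lborel \<partial>lborel)"
      by (rule arg_cong)
  qed
  finally show ?thesis .
qed

section \<open>Total mass of all shapes\<close>

lemma shape_ray_integral:
  fixes u e :: real
  assumes u: "u > 0" and e: "e = 1 \<or> e = -1"
  shows "(\<integral>\<^sup>+x. ennreal (x / ((1 + u\<^sup>2) * x\<^sup>2 - 2 * e * x + 1)\<^sup>2) * indicator {0..} x \<partial>lborel) =
    ennreal (1 / (2 * u\<^sup>2) + e / (2 * u ^ 3) * (pi / 2 + arctan (e / u)))"
proof -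
  let ?d = "\<lambda>x. (1 + u\<^sup>2) * x\<^sup>2 - 2 * e * x + 1"
  \<comment> \<open>On a line \<open>y = x * u\<close> through the vertex 0, \<open>quart\<close>
    factors into \<open>x^2 * (1 + u^2)\<close> times a quadratic; \<open>?d\<close> is this
    quadratic on the half-line where \<open>x\<close> has sign \<open>e\<close>. Completing the
    square as in \<open>dd\<close> yields the arctangent, and the rational part accounts for the
    squared denominator.\<close>
  define F where "F x = (e * x - 1) / (2 * u\<^sup>2) / ?d x + e / (2 * u ^ 3) * arctan (((1 + u\<^sup>2) * x - e) / u)" for x
  have e2: "e\<^sup>2 = 1" "e * e = 1" using e by auto
  have dd: "(1 + u\<^sup>2) * ?d x = ((1 + u\<^sup>2) * x - e)\<^sup>2 + u\<^sup>2" for x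
    using e2(1) by (simp add: power2_eq_square algebra_simps)
  have d0: "?d x > 0" for x
  proof -
    have "(1 + u\<^sup>2) * ?d x > 0" unfolding dd using u by (intro add_nonneg_pos) auto
    then show ?thesis by (simp add: zero_less_mult_iff add_pos_nonneg) (smt (verit) zero_le_power2)
  qed
  have der: "(F has_real_derivative x / (?d x)\<^sup>2) (at x)" for x
  proof -
    have "?d x \<noteq> 0" using d0[of x] by simp
    have "(F has_real_derivative
       ((e / (2 * u\<^sup>2)) * ?d x - (e * x - 1) / (2 * u\<^sup>2) * ((1 + u\<^sup>2) * (2 * x) - 2 * e)) / (?d x * ?d x)
        + e / (2 * u ^ 3) * (inverse (1 + (((1 + u\<^sup>2) * x - e) / u)\<^sup>2) * ((1 + u\<^sup>2) / u))) (at x)"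
    proof -
      have A: "((\<lambda>x. (e * x - 1) / (2 * u\<^sup>2)) has_real_derivative e / (2 * u\<^sup>2)) (at x)"
        by (rule DERIV_cdivide) (auto intro!: derivative_eq_intros)
      have B: "(?d has_real_derivative (1 + u\<^sup>2) * (2 * x) - 2 * e) (at x)"
        by (auto intro!: derivative_eq_intros)
      have C: "((\<lambda>x. ((1 + u\<^sup>2) * x - e) / u) has_real_derivative (1 + u\<^sup>2) / u) (at x)"
        by (rule DERIV_cdivide) (auto intro!: derivative_eq_intros)
      show ?thesis unfolding F_def
        by (rule DERIV_cong[OF DERIV_add[OF DERIV_divide[OF A B \<open>?d x \<noteq> 0\<close>] DERIV_cmult[OF DERIV_chain2[OF DERIV_arctan C]]]]) simp
    qed
    also have "1 + (((1 + u\<^sup>2) * x - e) / u)\<^sup>2 = (1 + u\<^sup>2) * ?d x / u\<^sup>2"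
      unfolding dd using u by (simp add: power_divide field_simps)
    also have "inverse ((1 + u\<^sup>2) * ?d x / u\<^sup>2) * ((1 + u\<^sup>2) / u) = u / ?d x"
    proof -
      have "1 + u\<^sup>2 > 0" by (simp add: add_pos_nonneg)
      then show ?thesis using u \<open>?d x \<noteq> 0\<close> by (simp add: power2_eq_square)
    qed
    also have "((e / (2 * u\<^sup>2)) * ?d x - (e * x - 1) / (2 * u\<^sup>2) * ((1 + u\<^sup>2) * (2 * x) - 2 * e)) / (?d x * ?d x)
        + e / (2 * u ^ 3) * (u / ?d x) = x / (?d x)\<^sup>2"
    proof -
      define D where "D = ?d x"
      have D: "D \<noteq> 0" using \<open>?d x \<noteq> 0\<close> by (simp add: D_def)
      have m1: "e / (2 * u ^ 3) * (u / D) = (e / (2 * u\<^sup>2) * D) / (D * D)"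
        using u D by (simp add: power2_eq_square power3_eq_cube)
      have m2: "(e / (2 * u\<^sup>2)) * D - (e * x - 1) / (2 * u\<^sup>2) * ((1 + u\<^sup>2) * (2 * x) - 2 * e) + e / (2 * u\<^sup>2) * D = x"
      proof -
        have "e * D - (e * x - 1) * ((1 + u\<^sup>2) * x - e) = x * u\<^sup>2"
          unfolding D_def using e2(1) by (simp add: power2_eq_square algebra_simps)
        then show ?thesis using u by (simp add: field_simps) 
      qed
      show ?thesis unfolding D_def[symmetric] m1 add_divide_distrib[symmetric] m2
        by (simp add: power2_eq_square)
    qed
    finally show ?thesis .
  qed
  have lim: "(F \<longlongrightarrow> e / (2 * u ^ 3) * (pi / 2)) at_top"
  proof -
    have m: "1 + u\<^sup>2 > 0" by (simp add: add_pos_nonneg)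
    have "((\<lambda>x. (e * x - 1) / (2 * u\<^sup>2) / ?d x) \<longlongrightarrow> 0) at_top"
      using e u m by (elim disjE; simp only:; real_asymp)
    moreover have "filterlim (\<lambda>x. ((1 + u\<^sup>2) * x - e) / u) at_top at_top"
      using u m by real_asymp
    then have "((\<lambda>x. arctan (((1 + u\<^sup>2) * x - e) / u)) \<longlongrightarrow> pi / 2) at_top"
      by (rule filterlim_compose[OF tendsto_arctan_at_top])
    ultimately have "(F \<longlongrightarrow> 0 + e / (2 * u ^ 3) * (pi / 2)) at_top"
      unfolding F_def by (intro tendsto_intros)
    then show ?thesis by simp
  qed
  have "(\<integral>\<^sup>+x. ennreal (x / (?d x)\<^sup>2) * indicator {0..} x \<partial>lborel) = ennreal (e / (2 * u ^ 3) * (pi / 2) - F 0)"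
    by (rule nn_integral_FTC_atLeast[OF _ der _ lim]) (auto)
  also have "e / (2 * u ^ 3) * (pi / 2) - F 0 = 1 / (2 * u\<^sup>2) + e / (2 * u ^ 3) * (pi / 2 + arctan (e / u))"
  proof -
    have alg: "k * p - (- a - k * b) = a + k * (p + b)" for k p a b :: real by (simp add: algebra_simps)
    have "F 0 = - (1 / (2 * u\<^sup>2)) - e / (2 * u ^ 3) * arctan (e / u)"
      by (simp add: F_def arctan_minus)
    then show ?thesis by (simp only: alg)
  qed
  finally show ?thesis by simp
qed

lemma nn_integral_even:
  fixes g :: "real \<Rightarrow> ennreal"
  assumes [measurable]: "g \<in> borel_measurable borel"
  shows "(\<integral>\<^sup>+x. g x \<partial>lborel) = (\<integral>\<^sup>+x. g x * indicator {0..} x \<partial>lborel) + (\<integral>\<^sup>+x. g (- x) * indicator {0..} x \<partial>lborel)"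
proof -
  have "(\<integral>\<^sup>+x. g x \<partial>lborel) = (\<integral>\<^sup>+x. g x * indicator {0..} x + g x * indicator {..<0} x \<partial>lborel)"
    by (intro nn_integral_cong) (auto simp: indicator_def)
  also have "\<dots> = (\<integral>\<^sup>+x. g x * indicator {0..} x \<partial>lborel) + (\<integral>\<^sup>+x. g x * indicator {..<0} x \<partial>lborel)"
    by (rule nn_integral_add) auto
  also have "(\<integral>\<^sup>+x. g x * indicator {..<0} x \<partial>lborel) = ennreal \<bar>-1\<bar> * (\<integral>\<^sup>+x. g (0 + -1 * x) * indicator {..<0} (0 + -1 * x) \<partial>lborel)"
    by (rule nn_integral_real_affine) auto
  also have "\<dots> = (\<integral>\<^sup>+x. g (- x) * indicator {0<..} x \<partial>lborel)"
    by (simp add: indicator_def of_bool_def)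
  also have "\<dots> = (\<integral>\<^sup>+x. g (- x) * indicator {0..} x \<partial>lborel)"
  proof -
    have "AE x in lborel. x \<noteq> (0::real)" by (rule AE_lborel_singleton)
    then have "AE x in lborel. g (- x) * indicator {0<..} x = g (- x) * indicator {0..} x"
      by eventually_elim (auto simp: indicator_def)
    then show ?thesis by (rule nn_integral_cong_AE)
  qed
  finally show ?thesis .
qed

text \<open>The two halves of the line are the cases \<open>e = 1\<close> and \<open>e = -1\<close>;
  their arctangents combine through \<open>arctan (1 / u) = pi / 2 - arctan u\<close>.\<close>

lemma shape_line_integral:
  fixes u :: real
  assumes u: "u > 0"
  shows "(\<integral>\<^sup>+x. ennreal (\<bar>x\<bar> / ((1 + u\<^sup>2) * x\<^sup>2 - 2 * x + 1)\<^sup>2) \<partial>lborel) = ennreal (1 / u\<^sup>2 + (pi / 2 - arctan u) / u ^ 3)"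
proof -
  have "(\<integral>\<^sup>+x. ennreal (\<bar>x\<bar> / ((1 + u\<^sup>2) * x\<^sup>2 - 2 * x + 1)\<^sup>2) \<partial>lborel) =
    (\<integral>\<^sup>+x. ennreal (\<bar>x\<bar> / ((1 + u\<^sup>2) * x\<^sup>2 - 2 * x + 1)\<^sup>2) * indicator {0..} x \<partial>lborel) +
    (\<integral>\<^sup>+x. ennreal (\<bar>- x\<bar> / ((1 + u\<^sup>2) * (- x)\<^sup>2 - 2 * (- x) + 1)\<^sup>2) * indicator {0..} x \<partial>lborel)"
    by (rule nn_integral_even) measurable
  also have "(\<integral>\<^sup>+x. ennreal (\<bar>x\<bar> / ((1 + u\<^sup>2) * x\<^sup>2 - 2 * x + 1)\<^sup>2) * indicator {0..} x \<partial>lborel) =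
     (\<integral>\<^sup>+x. ennreal (x / ((1 + u\<^sup>2) * x\<^sup>2 - 2 * 1 * x + 1)\<^sup>2) * indicator {0..} x \<partial>lborel)"
    by (intro nn_integral_cong) (auto simp: indicator_def)
  also have "(\<integral>\<^sup>+x. ennreal (\<bar>- x\<bar> / ((1 + u\<^sup>2) * (- x)\<^sup>2 - 2 * (- x) + 1)\<^sup>2) * indicator {0..} x \<partial>lborel) =
     (\<integral>\<^sup>+x. ennreal (x / ((1 + u\<^sup>2) * x\<^sup>2 - 2 * (-1) * x + 1)\<^sup>2) * indicator {0..} x \<partial>lborel)"
    by (intro nn_integral_cong) (auto simp: indicator_def)
  also have "(\<integral>\<^sup>+x. ennreal (x / ((1 + u\<^sup>2) * x\<^sup>2 - 2 * 1 * x + 1)\<^sup>2) * indicator {0..} x \<partial>lborel) +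
      (\<integral>\<^sup>+x. ennreal (x / ((1 + u\<^sup>2) * x\<^sup>2 - 2 * (-1) * x + 1)\<^sup>2) * indicator {0..} x \<partial>lborel) =
    ennreal (1 / (2 * u\<^sup>2) + 1 / (2 * u ^ 3) * (pi / 2 + arctan (1 / u))) + ennreal (1 / (2 * u\<^sup>2) + - 1 / (2 * u ^ 3) * (pi / 2 + arctan (- 1 / u)))"
    by (subst (1 2) shape_ray_integral[OF u]) auto
  also have "\<dots> = ennreal ((1 / (2 * u\<^sup>2) + 1 / (2 * u ^ 3) * (pi / 2 + arctan (1 / u))) + (1 / (2 * u\<^sup>2) + - 1 / (2 * u ^ 3) * (pi / 2 + arctan (- 1 / u))))"
  proof (rule ennreal_plus[symmetric])
    have "0 \<le> pi / 2 + arctan (1 / u)" using arctan_lbound[of "1 / u"] by linarith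
    then show "0 \<le> 1 / (2 * u\<^sup>2) + 1 / (2 * u ^ 3) * (pi / 2 + arctan (1 / u))"
      using u by (intro add_nonneg_nonneg mult_nonneg_nonneg) auto
    have "u - (pi / 2 - arctan (1 / u)) \<ge> 0"
    proof -
      have "arctan (1 / u) = sgn u * pi / 2 - arctan u" by (rule Transcendental.arctan_inverse) (use u in simp)
      then have "pi / 2 - arctan (1 / u) = arctan u" unfolding sgn_pos[OF u] by linarith
      then show ?thesis using arctan_le_self[of u] u by simp
    qed
    then show "0 \<le> 1 / (2 * u\<^sup>2) + - 1 / (2 * u ^ 3) * (pi / 2 + arctan (- 1 / u))"
      using u by (simp add: arctan_minus power2_eq_square power3_eq_cube field_simps)
  qed
  also have "(1 / (2 * u\<^sup>2) + 1 / (2 * u ^ 3) * (pi / 2 + arctan (1 / u))) + (1 / (2 * u\<^sup>2) + - 1 / (2 * u ^ 3) * (pi / 2 + arctan (- 1 / u))) = 1 / u\<^sup>2 + (pi / 2 - arctan u) / u ^ 3"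
    using u by (simp add: arctan_minus Transcendental.arctan_inverse field_simps)
  finally show ?thesis .
qed

lemma shape_total_aux:
  "(\<integral>\<^sup>+u. ennreal (16 * u ^ 4 / (1 + u\<^sup>2)\<^sup>2) * ennreal (1 / u\<^sup>2 + (pi / 2 - arctan \<bar>u\<bar>) / \<bar>u\<bar> ^ 3) \<partial>lborel) = ennreal (12 * pi)"
proof -
  define f where "f u = 16 * (u\<^sup>2 / (1 + u\<^sup>2)\<^sup>2 + u * (pi / 2 - arctan u) / (1 + u\<^sup>2)\<^sup>2)" for u :: real
  \<comment> \<open>Integration by parts on the arctangent term, with
    \<open>-1 / (2 * (1 + u^2))\<close> as primitive of \<open>u / (1 + u^2)^2\<close>. The values
    \<open>-4 * pi\<close> at 0 and \<open>2 * pi\<close> at infinity give \<open>6 * pi\<close> for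
    each half-line.\<close>
  define F where "F u = 16 * (arctan u / 4 - 3 / 4 * (u / (1 + u\<^sup>2)) - (pi / 2 - arctan u) / (2 * (1 + u\<^sup>2)))" for u :: real
  have p: "1 + u\<^sup>2 > 0" for u :: real by (simp add: add_pos_nonneg)
  have der: "(F has_real_derivative f u) (at u)" for u
  proof -
    define m where "m = 1 + u\<^sup>2"
    have m: "m > 0" "m \<noteq> 0" "u\<^sup>2 = m - 1" using p[of u] by (auto simp: m_def)
    have "(F has_real_derivative 16 * (inverse (1 + u\<^sup>2) / 4 - 3 / 4 * ((1 + u\<^sup>2 - u * (2 * u)) / ((1 + u\<^sup>2) * (1 + u\<^sup>2)))
        - ((- inverse (1 + u\<^sup>2)) * (2 * (1 + u\<^sup>2)) - (pi / 2 - arctan u) * (2 * (2 * u))) / ((2 * (1 + u\<^sup>2)) * (2 * (1 + u\<^sup>2))))) (at u)"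
    proof -
      have A: "((\<lambda>u. pi / 2 - arctan u) has_real_derivative - inverse (1 + u\<^sup>2)) (at u)"
        by (auto intro!: derivative_eq_intros)
      have B: "((\<lambda>u::real. 2 * (1 + u\<^sup>2)) has_real_derivative 2 * (2 * u)) (at u)"
        by (auto intro!: derivative_eq_intros)
      have D: "((\<lambda>u::real. 1 + u\<^sup>2) has_real_derivative 2 * u) (at u)"
        by (auto intro!: derivative_eq_intros)
      have n: "1 + u\<^sup>2 \<noteq> 0" "2 * (1 + u\<^sup>2) \<noteq> 0" using p[of u] by auto
      show ?thesis unfolding F_def
        by (rule DERIV_cong[OF DERIV_cmult[OF DERIV_diff[OF DERIV_diff[OF DERIV_cdivide[OF DERIV_arctan] DERIV_cmult[OF DERIV_divide[OF DERIV_ident D n(1)]]]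
            DERIV_divide[OF A B n(2)]]]]) simp
    qed
    also have "16 * (inverse (1 + u\<^sup>2) / 4 - 3 / 4 * ((1 + u\<^sup>2 - u * (2 * u)) / ((1 + u\<^sup>2) * (1 + u\<^sup>2)))
        - ((- inverse (1 + u\<^sup>2)) * (2 * (1 + u\<^sup>2)) - (pi / 2 - arctan u) * (2 * (2 * u))) / ((2 * (1 + u\<^sup>2)) * (2 * (1 + u\<^sup>2)))) = f u"
    proof -
      have "u * (2 * u) = 2 * u\<^sup>2" by (simp add: power2_eq_square)
      also have "\<dots> = 2 * (m - 1)" by (rule arg_cong[OF m(3)])
      finally have e1: "u * (2 * u) = 2 * (m - 1)" .
      have a1: "inverse m / 4 = (m / 4) / (m * m)" using m(2) by (simp add: field_simps)
      have a3: "(- inverse m * (2 * m) - (pi / 2 - arctan u) * (2 * (2 * u))) / (2 * m * (2 * m)) = (- (1 / 2) - u * (pi / 2 - arctan u)) / (m * m)"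
      proof -
        have "- inverse m * (2 * m) = - 2" using m(2) by simp
        then have e2: "- inverse m * (2 * m) - A * (2 * (2 * u)) = 4 * (- (1 / 2) - u * A)" for A by simp
        have e3: "2 * m * (2 * m) = 4 * (m * m)" by simp
        show ?thesis unfolding e2 e3 by (rule mult_divide_mult_cancel_left) simp
      qed
      have e4: "16 * (m / 4 / k - 3 / 4 * ((m - 2 * (m - 1)) / k) - (- (1 / 2) - u * A) / k) = 16 * ((m - 1) / k + u * A / k)" for A k :: real
        by (simp add: diff_divide_distrib add_divide_distrib)
      show ?thesis unfolding f_def m_def[symmetric] unfolding m(3) e1 a1 a3 power2_eq_square[of m] e4 ..
    qed
    finally show ?thesis .
  qed
  have f0: "f u \<ge> 0" if "u \<ge> 0" for u
  proof -
    have "pi / 2 - arctan u > 0" using arctan_ubound[of u] by simp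
    then show ?thesis using that p[of u] unfolding f_def by (intro mult_nonneg_nonneg add_nonneg_nonneg divide_nonneg_nonneg) auto
  qed
  have lim: "(F \<longlongrightarrow> 2 * pi) at_top" unfolding F_def by real_asymp
  have fm [measurable]: "f \<in> borel_measurable borel" unfolding f_def by measurable
  have I: "(\<integral>\<^sup>+u. ennreal (f u) * indicator {0..} u \<partial>lborel) = ennreal (2 * pi - F 0)"
    by (rule nn_integral_FTC_atLeast[OF fm der f0 lim])
  let ?g = "\<lambda>u::real. ennreal (16 * u ^ 4 / (1 + u\<^sup>2)\<^sup>2) * ennreal (1 / u\<^sup>2 + (pi / 2 - arctan \<bar>u\<bar>) / \<bar>u\<bar> ^ 3)"
  have gf: "?g u * indicator {0..} u = ennreal (f u) * indicator {0..} u" for u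
  proof (cases "u > 0")
    case True
    then have "pi / 2 - arctan u > 0" using arctan_ubound[of u] by simp
    then have "?g u = ennreal (16 * u ^ 4 / (1 + u\<^sup>2)\<^sup>2 * (1 / u\<^sup>2 + (pi / 2 - arctan \<bar>u\<bar>) / \<bar>u\<bar> ^ 3))"
      using True by (subst ennreal_mult) (auto intro!: add_nonneg_nonneg divide_nonneg_nonneg)
    also have "16 * u ^ 4 / (1 + u\<^sup>2)\<^sup>2 * (1 / u\<^sup>2 + (pi / 2 - arctan \<bar>u\<bar>) / \<bar>u\<bar> ^ 3) = f u"
    proof -
      have "u ^ 4 * (1 / u\<^sup>2) = u\<^sup>2" "u ^ 4 * ((pi / 2 - arctan u) / u ^ 3) = u * (pi / 2 - arctan u)"
        using True by (simp_all add: eval_nat_numeral)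
      then have "u ^ 4 * (1 / u\<^sup>2 + (pi / 2 - arctan u) / u ^ 3) = u\<^sup>2 + u * (pi / 2 - arctan u)"
        by (simp only: distrib_left)
      then have "16 * u ^ 4 / (1 + u\<^sup>2)\<^sup>2 * (1 / u\<^sup>2 + (pi / 2 - arctan u) / u ^ 3) = 16 * (u\<^sup>2 + u * (pi / 2 - arctan u)) / (1 + u\<^sup>2)\<^sup>2"
        by (metis (no_types, opaque_lifting) mult.assoc times_divide_eq_left)
      then show ?thesis using True by (simp add: f_def add_divide_distrib distrib_left)
    qed
    finally show ?thesis by simp
  next
    case False
    then show ?thesis by (cases "u = 0") (auto simp: f_def)
  qed
  have "(\<integral>\<^sup>+u. ?g u \<partial>lborel) = (\<integral>\<^sup>+u. ?g u * indicator {0..} u \<partial>lborel) + (\<integral>\<^sup>+u. ?g (- u) * indicator {0..} u \<partial>lborel)"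
    by (rule nn_integral_even) measurable
  also have "(\<lambda>u. ?g (- u) * indicator {0..} u) = (\<lambda>u. ?g u * indicator {0..} u)" by simp
  also have "(\<integral>\<^sup>+u. ?g u * indicator {0..} u \<partial>lborel) = ennreal (6 * pi)"
    unfolding gf I by (simp add: F_def)
  finally show ?thesis by (simp add: ennreal_plus[symmetric] del: ennreal_plus)
qed

text \<open>Substituting \<open>y = x * u\<close> and integrating over \<open>x\<close> first
  reduces the double integral to the elementary integrals above. The value \<open>12 * pi\<close>
  determines the mean number of cells per unit area.\<close>

lemma shape_total:
  "(\<integral>\<^sup>+x. \<integral>\<^sup>+y. ennreal (16 * y ^ 4 / (quart x y)\<^sup>2) \<partial>lborel \<partial>lborel) = ennreal (12 * pi)"
proof -
  have "(\<integral>\<^sup>+x. \<integral>\<^sup>+y. ennreal (16 * y ^ 4 / (quart x y)\<^sup>2) \<partial>lborel \<partial>lborel) =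
    (\<integral>\<^sup>+x. \<integral>\<^sup>+u. ennreal (16 * u ^ 4 / (1 + u\<^sup>2)\<^sup>2) * ennreal (\<bar>x\<bar> / ((1 + u\<^sup>2) * x\<^sup>2 - 2 * x + 1)\<^sup>2) \<partial>lborel \<partial>lborel)"
  proof -
    have *: "(\<integral>\<^sup>+y. ennreal (16 * y ^ 4 / (quart x y)\<^sup>2) \<partial>lborel) =
       (\<integral>\<^sup>+u. ennreal (16 * u ^ 4 / (1 + u\<^sup>2)\<^sup>2) * ennreal (\<bar>x\<bar> / ((1 + u\<^sup>2) * x\<^sup>2 - 2 * x + 1)\<^sup>2) \<partial>lborel)" if x: "x \<noteq> 0" for x :: real
    proof -
      have "(\<integral>\<^sup>+y. ennreal (16 * y ^ 4 / (quart x y)\<^sup>2) \<partial>lborel) = ennreal \<bar>x\<bar> * (\<integral>\<^sup>+u. ennreal (16 * (0 + x * u) ^ 4 / (quart x (0 + x * u))\<^sup>2) \<partial>lborel)"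
        using x by (intro nn_integral_real_affine) measurable
      also have "\<dots> = (\<integral>\<^sup>+u. ennreal \<bar>x\<bar> * ennreal (16 * (0 + x * u) ^ 4 / (quart x (0 + x * u))\<^sup>2) \<partial>lborel)"
        by (rule nn_integral_cmult[symmetric]) measurable
      also have "\<dots> = (\<integral>\<^sup>+u. ennreal (16 * u ^ 4 / (1 + u\<^sup>2)\<^sup>2) * ennreal (\<bar>x\<bar> / ((1 + u\<^sup>2) * x\<^sup>2 - 2 * x + 1)\<^sup>2) \<partial>lborel)"
      proof (rule nn_integral_cong)
        fix u :: real
        have q: "quart x (0 + x * u) = x\<^sup>2 * ((1 + u\<^sup>2) * ((1 + u\<^sup>2) * x\<^sup>2 - 2 * x + 1))"
          unfolding quart_def by (simp add: power2_eq_square algebra_simps)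
        have "\<bar>x\<bar> * (16 * (0 + x * u) ^ 4 / (quart x (0 + x * u))\<^sup>2) = 16 * u ^ 4 / (1 + u\<^sup>2)\<^sup>2 * (\<bar>x\<bar> / ((1 + u\<^sup>2) * x\<^sup>2 - 2 * x + 1)\<^sup>2)"
          unfolding q power_mult_distrib using x by (simp add: power_mult_distrib)
        then show "ennreal \<bar>x\<bar> * ennreal (16 * (0 + x * u) ^ 4 / (quart x (0 + x * u))\<^sup>2) = ennreal (16 * u ^ 4 / (1 + u\<^sup>2)\<^sup>2) * ennreal (\<bar>x\<bar> / ((1 + u\<^sup>2) * x\<^sup>2 - 2 * x + 1)\<^sup>2)"
          by (subst (1 2) ennreal_mult[symmetric]) auto
      qed
      finally show ?thesis .
    qed
    have "AE x in lborel. x \<noteq> (0::real)" by (rule AE_lborel_singleton)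
    then have "AE x in lborel. (\<integral>\<^sup>+y. ennreal (16 * y ^ 4 / (quart x y)\<^sup>2) \<partial>lborel) =
       (\<integral>\<^sup>+u. ennreal (16 * u ^ 4 / (1 + u\<^sup>2)\<^sup>2) * ennreal (\<bar>x\<bar> / ((1 + u\<^sup>2) * x\<^sup>2 - 2 * x + 1)\<^sup>2) \<partial>lborel)"
      by eventually_elim (rule *)
    then show ?thesis by (rule nn_integral_cong_AE)
  qed
  also have "\<dots> = (\<integral>\<^sup>+u. \<integral>\<^sup>+x. ennreal (16 * u ^ 4 / (1 + u\<^sup>2)\<^sup>2) * ennreal (\<bar>x\<bar> / ((1 + u\<^sup>2) * x\<^sup>2 - 2 * x + 1)\<^sup>2) \<partial>lborel \<partial>lborel)"
    by (rule lborel_pair.Fubini') measurable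
  also have "\<dots> = (\<integral>\<^sup>+u. ennreal (16 * u ^ 4 / (1 + u\<^sup>2)\<^sup>2) * ennreal (1 / u\<^sup>2 + (pi / 2 - arctan \<bar>u\<bar>) / \<bar>u\<bar> ^ 3) \<partial>lborel)"
  proof (rule nn_integral_cong)
    fix u :: real
    show "(\<integral>\<^sup>+x. ennreal (16 * u ^ 4 / (1 + u\<^sup>2)\<^sup>2) * ennreal (\<bar>x\<bar> / ((1 + u\<^sup>2) * x\<^sup>2 - 2 * x + 1)\<^sup>2) \<partial>lborel) =
      ennreal (16 * u ^ 4 / (1 + u\<^sup>2)\<^sup>2) * ennreal (1 / u\<^sup>2 + (pi / 2 - arctan \<bar>u\<bar>) / \<bar>u\<bar> ^ 3)"
    proof (cases "u = 0")
      case False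
      then have "\<bar>u\<bar> > 0" by simp
      from shape_line_integral[OF this] show ?thesis by (subst nn_integral_cmult) auto
    qed simp
  qed
  also note shape_total_aux
  finally show ?thesis .
qed

section \<open>One-dimensional Gamma and Beta integrals\<close>

lemma gaussian_cubic_integral:
  fixes c :: real assumes c: "c > 0"
  shows "(\<integral>\<^sup>+R. ennreal (R ^ 3 * exp (- (c * R\<^sup>2))) * indicator {0..} R \<partial>lborel) = ennreal (1 / (2 * c\<^sup>2))"
proof -
  define F where "F R = - (R\<^sup>2 / (2 * c) + 1 / (2 * c\<^sup>2)) * exp (- (c * R\<^sup>2))" for R :: real
  have "(F has_real_derivative R ^ 3 * exp (- (c * R\<^sup>2))) (at R)" for R
    unfolding F_def using c
    by (auto intro!: derivative_eq_intros simp: field_simps power2_eq_square power3_eq_cube)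
  moreover have "(F \<longlongrightarrow> 0) at_top" unfolding F_def using c by real_asymp
  ultimately have "(\<integral>\<^sup>+R. ennreal (R ^ 3 * exp (- (c * R\<^sup>2))) * indicator {0..} R \<partial>lborel) = ennreal (0 - F 0)"
    by (intro nn_integral_FTC_atLeast) auto
  then show ?thesis by (simp add: F_def)
qed

lemma has_integral_of_absolutely_integrable:
  fixes f :: "real \<Rightarrow> real"
  assumes "f absolutely_integrable_on S \<and> integral S f = b"
  shows "(f has_integral b) S"
  using integrable_integral[OF set_lebesgue_integral_eq_integral(1)[OF conjunct1[OF assms]]] conjunct2[OF assms] by simp

lemma nn_integral_of_has_integral:
  fixes f :: "real \<Rightarrow> real"
  assumes "(f has_integral I) A" "\<And>x. x \<in> A \<Longrightarrow> 0 \<le> f x"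
  shows "(\<integral>\<^sup>+x. ennreal (f x) * indicator A x \<partial>lborel) = ennreal I"
proof -
  have "(\<integral>\<^sup>+x. ennreal (f x) * indicator A x \<partial>lborel) = (\<integral>\<^sup>+x. ennreal (indicator A x * f x) \<partial>lborel)"
    by (intro nn_integral_cong) (auto simp: indicator_def)
  then show ?thesis using nn_integral_has_integral_lebesgue[OF assms(2,1)] by simp
qed

text \<open>The substitution \<open>t = c * R^2\<close> in the integral for
  \<open>Gamma (1/3)\<close>. The power -1/3 is what remains of \<open>R^3\<close> against
  \<open>(v / R^2) powr (5/3)\<close>.\<close>

lemma gaussian_powr_integral:
  fixes c :: real assumes c: "c > 0"
  shows "(\<integral>\<^sup>+R. ennreal (R powr (-1/3) * exp (- (c * R\<^sup>2))) * indicator {0<..} R \<partial>lborel) = ennreal (Gamma (1/3) * c powr (-1/3) / 2)"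
proof -
  let ?f = "\<lambda>t::real. t powr (1/3 - 1) / exp t"
  let ?g = "\<lambda>R::real. c * R\<^sup>2"
  have "(?f has_integral Gamma (1/3)) {0..}" by (rule Gamma_integral_real) simp
  then have I: "(?f has_integral Gamma (1/3)) {0<..}"
  proof (rule has_integral_spike_set_eq[THEN iffD1, rotated 2])
    show "negligible {x \<in> {0..} - {0<..}. ?f x \<noteq> 0}"
      by (rule negligible_subset[of "{0}"]) auto
    show "negligible {x \<in> {0<..} - {0..}. ?f x \<noteq> 0}"
      by (rule negligible_subset[of "{}"]) auto
  qed
  have A: "?f absolutely_integrable_on {0<..}"
    using I by (intro nonnegative_absolutely_integrable_1) (auto simp: has_integral_integrable)
  have img: "?g ` {0<..} = {0<..}"
  proof (intro equalityI subsetI)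
    fix t :: real assume "t \<in> {0<..}"
    then show "t \<in> ?g ` {0<..}" using c by (intro image_eqI[of _ _ "sqrt (t / c)"]) auto
  qed (use c in auto)
  have inj: "inj_on ?g {0<..}" using c by (auto simp: inj_on_def power2_eq_iff)
  have der: "(?g has_field_derivative 2 * c * R) (at R within {0<..})" for R
    by (auto intro!: derivative_eq_intros)
  have "(\<lambda>R. \<bar>2 * c * R\<bar> * ?f (?g R)) absolutely_integrable_on {0<..} \<and> integral {0<..} (\<lambda>R. \<bar>2 * c * R\<bar> * ?f (?g R)) = Gamma (1/3)"
    using has_absolute_integral_change_of_variables_1'[OF _ der inj, of ?f "Gamma (1/3)"] A I unfolding img
    by (auto simp: integral_unique)
  then have "((\<lambda>R. \<bar>2 * c * R\<bar> * ?f (?g R)) has_integral Gamma (1/3)) {0<..}"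
    by (rule has_integral_of_absolutely_integrable)
  then have "(\<integral>\<^sup>+R. ennreal (\<bar>2 * c * R\<bar> * ?f (?g R)) * indicator {0<..} R \<partial>lborel) = ennreal (Gamma (1/3))"
    by (rule nn_integral_of_has_integral) auto
  also have "(\<lambda>R. ennreal (\<bar>2 * c * R\<bar> * ?f (?g R)) * indicator {0<..} R) =
     (\<lambda>R. ennreal (2 * c powr (1/3)) * (ennreal (R powr (-1/3) * exp (- (c * R\<^sup>2))) * indicator {0<..} R))"
  proof
    fix R :: real
    show "ennreal (\<bar>2 * c * R\<bar> * ?f (?g R)) * indicator {0<..} R = ennreal (2 * c powr (1/3)) * (ennreal (R powr (-1/3) * exp (- (c * R\<^sup>2))) * indicator {0<..} R)"
    proof (cases "R > 0")
      case True
      have "\<bar>2 * c * R\<bar> * ?f (?g R) = 2 * (c powr 1 * c powr (-2/3)) * (R powr 1 * (R powr 2) powr (-2/3)) * exp (- (c * R\<^sup>2))"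
        using True c by (simp add: powr_mult exp_minus field_simps)
      also have "c powr 1 * c powr (-2/3) = c powr (1/3)" by (simp only: powr_add[symmetric]) simp
      also have "R powr 1 * (R powr 2) powr (-2/3) = R powr (-1/3)" by (simp only: powr_powr powr_add[symmetric]) simp
      finally show ?thesis using True by (simp add: ennreal_mult[symmetric] mult.assoc)
    qed simp
  qed
  also have "(\<integral>\<^sup>+R. ennreal (2 * c powr (1/3)) * (ennreal (R powr (-1/3) * exp (- (c * R\<^sup>2))) * indicator {0<..} R) \<partial>lborel) =
     ennreal (2 * c powr (1/3)) * (\<integral>\<^sup>+R. ennreal (R powr (-1/3) * exp (- (c * R\<^sup>2))) * indicator {0<..} R \<partial>lborel)"
    by (rule nn_integral_cmult) measurable
  finally have eq: "ennreal (2 * c powr (1/3)) * (\<integral>\<^sup>+R. ennreal (R powr (-1/3) * exp (- (c * R\<^sup>2))) * indicator {0<..} R \<partial>lborel) = ennreal (Gamma (1/3))" .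
  have "(\<integral>\<^sup>+R. ennreal (R powr (-1/3) * exp (- (c * R\<^sup>2))) * indicator {0<..} R \<partial>lborel) =
    ennreal (c powr (-1/3) / 2) * (ennreal (2 * c powr (1/3)) * (\<integral>\<^sup>+R. ennreal (R powr (-1/3) * exp (- (c * R\<^sup>2))) * indicator {0<..} R \<partial>lborel))"
  proof -
    have "ennreal (c powr (-1/3) / 2) * ennreal (2 * c powr (1/3)) = ennreal (c powr (-1/3) / 2 * (2 * c powr (1/3)))"
      by (rule ennreal_mult[symmetric]) auto
    also have "c powr (-1/3) / 2 * (2 * c powr (1/3)) = c powr (-1/3) * c powr (1/3)" by simp
    also have "\<dots> = 1" using c by (simp add: powr_add[symmetric])
    finally show ?thesis by (simp add: mult.assoc[symmetric])
  qed
  also have "\<dots> = ennreal (c powr (-1/3) / 2 * Gamma (1/3))" unfolding eq by (rule ennreal_mult[symmetric]) (auto simp: Gamma_real_nonneg)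
  finally show ?thesis by (simp add: mult.commute)
qed

text \<open>The Beta integral gives the part over (0, 1). The map \<open>1 / t\<close> carries it to
  \<open>{1<..}\<close>, and \<open>1 - x\<close> carries that to \<open>{..<0}\<close>; the weight
  with its Jacobian is invariant under both, since they exchange the roles of three collinear
  vertices.\<close>

lemma beta_line_integral:
  "(\<integral>\<^sup>+x. ennreal (\<bar>x * (x - 1)\<bar> powr (-2/3)) \<partial>lborel) = ennreal (3 * Beta (1/3) (1/3 :: real))"
proof -
  let ?B = "Beta (1/3) (1/3 :: real)"
  let ?h = "\<lambda>x::real. \<bar>x * (x - 1)\<bar> powr (-2/3)"
  let ?f = "\<lambda>t::real. t powr (1/3 - 1) * (1 - t) powr (1/3 - 1)"
  have "(?f has_integral ?B) {0..1}" by (rule has_integral_Beta_real) auto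
  then have I: "(?f has_integral ?B) {0<..<1}" by (simp add: has_integral_Icc_iff_Ioo)
  have fh: "?f t = ?h t" if "t \<in> {0<..<1}" for t
  proof -
    have "\<bar>t * (t - 1)\<bar> = t * (1 - t)" using that by (simp add: abs_mult)
    then show ?thesis using that by (simp add: powr_mult)
  qed
  have B1: "(?h has_integral ?B) {0<..<1}"
    by (rule has_integral_eq[OF _ I]) (rule fh)
  have nA: "?h absolutely_integrable_on {0<..<1}"
    using B1 by (intro nonnegative_absolutely_integrable_1) (auto simp: has_integral_integrable)
  have "1 / t \<in> {1<..}" if "t \<in> {0<..<1}" for t :: real using that by auto
  moreover have "x \<in> (\<lambda>t. 1 / t) ` {0<..<1}" if "x \<in> {1<..}" for x :: real
    using that by (intro image_eqI[of _ _ "1 / x"]) auto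
  ultimately have img: "(\<lambda>t. 1 / t) ` {0<..<1::real} = {1<..}" by blast
  have inj: "inj_on (\<lambda>t. 1 / t :: real) {0<..<1}" by (auto simp: inj_on_def)
  have der: "((\<lambda>t. 1 / t) has_field_derivative - (1 / t\<^sup>2)) (at t within {0<..<1})" if "t \<in> {0<..<1}" for t :: real
    using that by (auto intro!: derivative_eq_intros simp: power2_eq_square field_simps)
  have tr: "\<bar>- (1 / t\<^sup>2)\<bar> * ?h (1 / t) = ?h t" if t: "t \<in> {0<..<1}" for t
  proof -
    have "\<bar>1 / t * (1 / t - 1)\<bar> = (t * (1 - t)) / t powr 3" 
      using t by (simp add: abs_mult field_simps power3_eq_cube power2_eq_square)
    moreover have "\<bar>t * (t - 1)\<bar> = t * (1 - t)" using t by (simp add: abs_mult)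
    moreover have "\<bar>- (1 / t\<^sup>2)\<bar> = t powr (-2)" using t by (simp add: powr_minus_divide)
    moreover have "((t * (1 - t)) / t powr 3) powr (-2/3) = (t * (1 - t)) powr (-2/3) * t powr 2"
    proof -
      have "(t powr 3) powr (-2/3) = t powr (-2)" using powr_powr[of t 3 "-2/3"] by simp
      moreover have "((t * (1 - t)) / t powr 3) powr (-2/3) = (t * (1 - t)) powr (-2/3) / (t powr 3) powr (-2/3)"
        by (rule powr_divide)
      ultimately show ?thesis by (simp only: powr_minus divide_inverse inverse_inverse_eq)
    qed
    moreover have "t powr (-2) * ((t * (1 - t)) powr (-2/3) * t powr 2) = (t * (1 - t)) powr (-2/3)"
    proof -
      have 1: "t powr (-2) * t powr 2 = 1" using t by (simp add: powr_minus)
      show ?thesis unfolding mult.left_commute[of "t powr (-2)"] 1 by simp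
    qed
    ultimately show ?thesis by (simp only:)
  qed
  have H: "((\<lambda>t. \<bar>- (1 / t\<^sup>2)\<bar> * ?h (1 / t)) has_integral ?B) {0<..<1}"
    by (rule has_integral_eq[OF _ B1]) (rule tr[symmetric])
  then have "(\<lambda>t. \<bar>- (1 / t\<^sup>2)\<bar> * ?h (1 / t)) absolutely_integrable_on {0<..<1}"
    by (intro nonnegative_absolutely_integrable_1) (auto simp: has_integral_integrable)
  moreover have "integral {0<..<1} (\<lambda>t. \<bar>- (1 / t\<^sup>2)\<bar> * ?h (1 / t)) = ?B"
    by (rule integral_unique[OF H])
  ultimately have "?h absolutely_integrable_on {1<..} \<and> integral {1<..} ?h = ?B"
    using has_absolute_integral_change_of_variables_1'[OF _ der inj, of ?h ?B] unfolding img by auto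
  then have B2: "(?h has_integral ?B) {1<..}"
    by (rule has_integral_of_absolutely_integrable)
  have i1: "(\<integral>\<^sup>+x. ennreal (?h x) * indicator {0<..<1} x \<partial>lborel) = ennreal ?B"
    by (rule nn_integral_of_has_integral[OF B1]) auto
  have i2: "(\<integral>\<^sup>+x. ennreal (?h x) * indicator {1<..} x \<partial>lborel) = ennreal ?B"
    by (rule nn_integral_of_has_integral[OF B2]) auto
  have i3: "(\<integral>\<^sup>+x. ennreal (?h x) * indicator {..<0} x \<partial>lborel) = ennreal ?B"
  proof -
    have "(\<integral>\<^sup>+x. ennreal (?h x) * indicator {..<0} x \<partial>lborel) = ennreal \<bar>-1\<bar> * (\<integral>\<^sup>+x. ennreal (?h (1 + -1 * x)) * indicator {..<0} (1 + -1 * x) \<partial>lborel)"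
      by (rule nn_integral_real_affine) auto
    also have "\<dots> = (\<integral>\<^sup>+x. ennreal (?h x) * indicator {1<..} x \<partial>lborel)"
    proof -
      have "(1 - x) * - x = x * (x - 1)" for x :: real by (simp add: algebra_simps)
      then show ?thesis by (simp add: indicator_def of_bool_def) 
    qed
    finally show ?thesis using i2 by simp
  qed
  have "(\<integral>\<^sup>+x. ennreal (?h x) \<partial>lborel) = (\<integral>\<^sup>+x. (ennreal (?h x) * indicator {0<..<1} x + ennreal (?h x) * indicator {1<..} x) + ennreal (?h x) * indicator {..<0} x \<partial>lborel)"
  proof (rule nn_integral_cong)
    fix x :: real
    consider "x < 0" | "x = 0" | "0 < x" "x < 1" | "x = 1" | "x > 1" by linarith
    then show "ennreal (?h x) = (ennreal (?h x) * indicator {0<..<1} x + ennreal (?h x) * indicator {1<..} x) + ennreal (?h x) * indicator {..<0} x"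
      by cases auto
  qed
  also have "\<dots> = (ennreal ?B + ennreal ?B) + ennreal ?B"
  proof -
    have "(\<integral>\<^sup>+x. (ennreal (?h x) * indicator {0<..<1} x + ennreal (?h x) * indicator {1<..} x) + ennreal (?h x) * indicator {..<0} x \<partial>lborel) =
      (\<integral>\<^sup>+x. ennreal (?h x) * indicator {0<..<1} x + ennreal (?h x) * indicator {1<..} x \<partial>lborel) + (\<integral>\<^sup>+x. ennreal (?h x) * indicator {..<0} x \<partial>lborel)"
      by (rule nn_integral_add) auto
    also have "(\<integral>\<^sup>+x. ennreal (?h x) * indicator {0<..<1} x + ennreal (?h x) * indicator {1<..} x \<partial>lborel) = 
      (\<integral>\<^sup>+x. ennreal (?h x) * indicator {0<..<1} x \<partial>lborel) + (\<integral>\<^sup>+x. ennreal (?h x) * indicator {1<..} x \<partial>lborel)"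
      by (rule nn_integral_add) auto
    finally show ?thesis unfolding i1 i2 i3 .
  qed
  also have "\<dots> = ennreal (3 * ?B)"
    by (simp add: ennreal_plus[symmetric] Beta_def Gamma_real_nonneg del: ennreal_plus)
  finally show ?thesis .
qed

section \<open>Flat shapes\<close>

text \<open>\<open>2 * \<bar>y\<bar> ^ 3 / quart x y\<close> is the area of the triangle of
  circumradius 1 similar to 0, 1, \<open>(x, y)\<close>: the area \<open>\<bar>y\<bar> / 2\<close>
  over the squared circumradius \<open>quart x y / (4 * y^2)\<close>.\<close>

definition shape_tail :: "real \<Rightarrow> ennreal" where
  "shape_tail s = (\<integral>\<^sup>+x. \<integral>\<^sup>+y. ennreal (16 * y ^ 4 / (quart x y)\<^sup>2) * indicator {..<s} (2 * \<bar>y\<bar> ^ 3 / quart x y) \<partial>lborel \<partial>lborel)"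

text \<open>On this region \<open>quart x y\<close> is comparable to its value on the line \<open>y = 0\<close>; the complement, where two vertices nearly coincide, contributes \<open>o(s powr (5/3))\<close>.\<close>

definition near_line :: "real \<Rightarrow> real \<Rightarrow> bool" where
  "near_line x y \<longleftrightarrow> \<bar>y\<bar> \<le> \<bar>x\<bar> \<and> \<bar>y\<bar> \<le> \<bar>x - 1\<bar>"

definition near_tail :: "real \<Rightarrow> real \<Rightarrow> real \<Rightarrow> ennreal" where
  "near_tail s x y = (if 2 * \<bar>y\<bar> ^ 3 / quart x y < s \<and> near_line x y then ennreal (16 * y ^ 4 / (quart x y)\<^sup>2) else 0)"

definition far_tail :: "real \<Rightarrow> real \<Rightarrow> real \<Rightarrow> ennreal" where
  "far_tail s x y = (if 2 * \<bar>y\<bar> ^ 3 / quart x y < s \<and> \<not> near_line x y then ennreal (16 * y ^ 4 / (quart x y)\<^sup>2) else 0)"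

text \<open>The substitution \<open>y = \<sigma> * e\<close> with \<open>\<sigma> ^ 3 = s\<close>.\<close>

definition near_scaled :: "real \<Rightarrow> real \<Rightarrow> real \<Rightarrow> ennreal" where
  "near_scaled \<sigma> x e = (if 2 * \<bar>e\<bar> ^ 3 / quart x (\<sigma> * e) < 1 \<and> near_line x (\<sigma> * e) then ennreal (16 * e ^ 4 / (quart x (\<sigma> * e))\<^sup>2) else 0)"

text \<open>Cut-off \<open>P\<close> and denominator \<open>Q\<close> are kept apart: in the limit
  both equal \<open>quart\<close> on the line, while the dominating function has a cut-off four
  times larger.\<close>

definition near_limit :: "real \<Rightarrow> real \<Rightarrow> real \<Rightarrow> ennreal" where
  "near_limit P Q e = (if 2 * \<bar>e\<bar> ^ 3 < P then ennreal (16 * e ^ 4 / Q\<^sup>2) else 0)"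

lemma near_line_measurable [measurable]:
  assumes [measurable]: "f \<in> borel_measurable M" "g \<in> borel_measurable M"
  shows "Measurable.pred M (\<lambda>x. near_line (f x) (g x))"
  unfolding near_line_def by measurable

lemma tail_measurable [measurable]:
  assumes [measurable]: "f \<in> borel_measurable M" "g \<in> borel_measurable M" "h \<in> borel_measurable M"
  shows "(\<lambda>x. near_tail (f x) (g x) (h x)) \<in> borel_measurable M" "(\<lambda>x. far_tail (f x) (g x) (h x)) \<in> borel_measurable M"
    "(\<lambda>x. near_scaled (f x) (g x) (h x)) \<in> borel_measurable M" "(\<lambda>x. near_limit (f x) (g x) (h x)) \<in> borel_measurable M"
  unfolding near_tail_def far_tail_def near_scaled_def near_limit_def by measurable

lemma shape_tail_split:
  "shape_tail s = (\<integral>\<^sup>+x. \<integral>\<^sup>+y. near_tail s x y \<partial>lborel \<partial>lborel) + (\<integral>\<^sup>+x. \<integral>\<^sup>+y. far_tail s x y \<partial>lborel \<partial>lborel)"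
proof -
  have eq: "ennreal (16 * y ^ 4 / (quart x y)\<^sup>2) * indicator {..<s} (2 * \<bar>y\<bar> ^ 3 / quart x y) = near_tail s x y + far_tail s x y" for x y
    by (auto simp: near_tail_def far_tail_def indicator_def)
  have "shape_tail s = (\<integral>\<^sup>+x. (\<integral>\<^sup>+y. near_tail s x y \<partial>lborel) + (\<integral>\<^sup>+y. far_tail s x y \<partial>lborel) \<partial>lborel)"
    unfolding shape_tail_def eq by (rule nn_integral_cong, rule nn_integral_add) measurable
  also have "\<dots> = (\<integral>\<^sup>+x. \<integral>\<^sup>+y. near_tail s x y \<partial>lborel \<partial>lborel) + (\<integral>\<^sup>+x. \<integral>\<^sup>+y. far_tail s x y \<partial>lborel \<partial>lborel)"
    by (rule nn_integral_add) measurable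
  finally show ?thesis .
qed

text \<open>The origin of the exponent 5/3: the weight \<open>y ^ 4\<close> contributes four factors
  \<open>s powr (1/3)\<close> and \<open>dy\<close> a fifth.\<close>

lemma near_tail_scale:
  assumes s: "s > 0"
  shows "(\<integral>\<^sup>+y. near_tail s x y \<partial>lborel) = ennreal (s powr (5/3)) * (\<integral>\<^sup>+e. near_scaled (s powr (1/3)) x e \<partial>lborel)"
proof -
  define \<sigma> where "\<sigma> = s powr (1/3)"
  have \<sigma>: "\<sigma> > 0" using s by (simp add: \<sigma>_def)
  have \<sigma>3: "\<sigma> ^ 3 = s" 
  proof -
    have "\<sigma> ^ 3 = \<sigma> powr 3" using \<sigma> by simp
    also have "\<dots> = s powr 1" unfolding \<sigma>_def by (simp only: powr_powr; simp)
    finally show ?thesis using s by simp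
  qed
  have \<sigma>5: "\<sigma> * \<sigma> ^ 4 = s powr (5/3)"
  proof -
    have "\<sigma> * \<sigma> ^ 4 = \<sigma> ^ 5" by (simp add: eval_nat_numeral)
    also have "\<sigma> ^ 5 = \<sigma> powr 5" using \<sigma> by simp
    also have "\<dots> = s powr (5/3)" unfolding \<sigma>_def by (simp only: powr_powr; simp)
    finally show ?thesis .
  qed
  have eq: "near_tail s x (0 + \<sigma> * e) = ennreal (\<sigma> ^ 4) * near_scaled \<sigma> x e" for e
  proof (cases "quart x (\<sigma> * e) = 0")
    case True
    then have "\<sigma> * e = 0" using quart_pos[of "\<sigma> * e" x] by fastforce
    then have "e = 0" using \<sigma> by simp
    then show ?thesis by (simp add: near_tail_def near_scaled_def)
  next
    case False
    then have q: "quart x (\<sigma> * e) > 0" by (simp add: quart_def zero_less_mult_iff sum_power2_gt_zero_iff add_nonneg_nonneg order_less_le)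
    have "2 * \<bar>\<sigma> * e\<bar> ^ 3 = s * (2 * \<bar>e\<bar> ^ 3)" using \<sigma> by (simp add: abs_mult power_mult_distrib \<sigma>3)
    then have "2 * \<bar>\<sigma> * e\<bar> ^ 3 / quart x (\<sigma> * e) < s \<longleftrightarrow> 2 * \<bar>e\<bar> ^ 3 / quart x (\<sigma> * e) < 1"
      using q s by (simp add: divide_less_eq)
    moreover have "ennreal (16 * (\<sigma> * e) ^ 4 / (quart x (\<sigma> * e))\<^sup>2) = ennreal (\<sigma> ^ 4) * ennreal (16 * e ^ 4 / (quart x (\<sigma> * e))\<^sup>2)"
      using \<sigma> by (subst ennreal_mult[symmetric]) (auto simp: power_mult_distrib mult_ac)
    ultimately show ?thesis by (simp add: near_tail_def near_scaled_def)
  qed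
  have "(\<integral>\<^sup>+y. near_tail s x y \<partial>lborel) = ennreal \<bar>\<sigma>\<bar> * (\<integral>\<^sup>+e. near_tail s x (0 + \<sigma> * e) \<partial>lborel)"
    using \<sigma> by (intro nn_integral_real_affine) auto
  also have "\<dots> = ennreal \<sigma> * (ennreal (\<sigma> ^ 4) * (\<integral>\<^sup>+e. near_scaled \<sigma> x e \<partial>lborel))"
    unfolding eq using \<sigma> by (subst nn_integral_cmult) auto
  also have "\<dots> = ennreal (s powr (5/3)) * (\<integral>\<^sup>+e. near_scaled \<sigma> x e \<partial>lborel)"
    using \<sigma> by (simp only: mult.assoc[symmetric] \<sigma>5[symmetric]) (simp add: ennreal_mult)
  finally show ?thesis by (simp only: \<sigma>_def)
qed

lemma near_limit_integral:
  assumes P: "P > 0"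
  shows "(\<integral>\<^sup>+e. near_limit P Q e \<partial>lborel) = ennreal (32 / 5 * (P / 2) powr (5/3) / Q\<^sup>2)"
proof -
  define r where "r = (P / 2) powr (1/3)"
  have r: "r > 0" using P by (simp add: r_def)
  have r3: "r ^ 3 = P / 2"
  proof -
    have "r ^ 3 = r powr 3" using r by simp
    also have "\<dots> = (P / 2) powr 1" unfolding r_def by (simp only: powr_powr; simp)
    finally show ?thesis using P by simp
  qed
  have r5: "r ^ 5 = (P / 2) powr (5/3)"
  proof -
    have "r ^ 5 = r powr 5" using r by simp
    also have "\<dots> = (P / 2) powr (5/3)" unfolding r_def by (simp only: powr_powr; simp)
    finally show ?thesis .
  qed
  have iff: "2 * \<bar>e\<bar> ^ 3 < P \<longleftrightarrow> \<bar>e\<bar> < r" for e :: real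
  proof -
    have "2 * \<bar>e\<bar> ^ 3 < P \<longleftrightarrow> \<bar>e\<bar> ^ 3 < r ^ 3" unfolding r3 by auto
    also have "\<dots> \<longleftrightarrow> \<bar>e\<bar> < r"
    proof -
      have "r ^ 3 \<le> \<bar>e\<bar> ^ 3 \<longleftrightarrow> r \<le> \<bar>e\<bar>" using r by (intro power_mono_iff) auto
      then show ?thesis by (meson not_le)
    qed
    finally show ?thesis .
  qed
  have "AE e in lborel. e \<noteq> r" "AE e in lborel. e \<noteq> - r" by (rule AE_lborel_singleton)+
  then have "AE e in lborel. near_limit P Q e = ennreal (16 * e ^ 4 / Q\<^sup>2) * indicator {-r..r} e"
    by eventually_elim (auto simp: near_limit_def iff indicator_def abs_less_iff)
  then have "(\<integral>\<^sup>+e. near_limit P Q e \<partial>lborel) = (\<integral>\<^sup>+e. ennreal (16 * e ^ 4 / Q\<^sup>2) * indicator {-r..r} e \<partial>lborel)"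
    by (rule nn_integral_cong_AE)
  also have "\<dots> = ennreal (16 / 5 * r ^ 5 / Q\<^sup>2 - 16 / 5 * (- r) ^ 5 / Q\<^sup>2)"
  proof (rule nn_integral_FTC_Icc)
    show "((\<lambda>e. 16 / 5 * e ^ 5 / Q\<^sup>2) has_real_derivative 16 * e ^ 4 / Q\<^sup>2) (at e)" for e
      by (rule DERIV_cdivide) (auto intro!: derivative_eq_intros)
  qed (use r in auto)
  also have "16 / 5 * r ^ 5 / Q\<^sup>2 - 16 / 5 * (- r) ^ 5 / Q\<^sup>2 = 32 / 5 * r ^ 5 / Q\<^sup>2" by simp
  finally show ?thesis unfolding r5 .
qed

text \<open>The value of \<open>quart\<close> on the line \<open>y = 0\<close>.\<close>

definition lineQ :: "real \<Rightarrow> real" where "lineQ x = (x * (x - 1))\<^sup>2"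

lemma lineQ_pos: "x \<noteq> 0 \<Longrightarrow> x \<noteq> 1 \<Longrightarrow> lineQ x > 0"
  by (simp add: lineQ_def)

lemma lineQ_measurable [measurable]: "lineQ \<in> borel_measurable borel"
  unfolding lineQ_def by measurable

text \<open>The cut-off lies at \<open>\<bar>e\<bar> = (c * lineQ x / 2) powr (1/3)\<close>, whose
  fifth power gives \<open>lineQ x powr (5/3)\<close>; divided by \<open>(lineQ x)^2\<close> this
  leaves \<open>lineQ x powr (-1/3)\<close>, the Beta weight.\<close>

lemma near_limit_lineQ:
  assumes x: "x \<noteq> 0" "x \<noteq> 1" and c: "c > 0"
  shows "(\<integral>\<^sup>+e. near_limit (c * lineQ x) (lineQ x) e \<partial>lborel) = ennreal (32 / 5 * (c / 2) powr (5/3)) * ennreal (\<bar>x * (x - 1)\<bar> powr (-2/3))"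
proof -
  have Q: "lineQ x > 0" using lineQ_pos x by simp
  have a: "\<bar>x * (x - 1)\<bar> > 0" using x by simp
  have "(c * lineQ x / 2) powr (5/3) = (c / 2) powr (5/3) * lineQ x powr (5/3)"
    using c Q by (subst powr_mult[symmetric]) auto
  moreover have "lineQ x powr (5/3) / (lineQ x)\<^sup>2 = \<bar>x * (x - 1)\<bar> powr (-2/3)"
  proof -
    have "(lineQ x)\<^sup>2 = lineQ x powr 2" using Q by simp
    then have "lineQ x powr (5/3) / (lineQ x)\<^sup>2 = lineQ x powr (5/3 - 2)" by (simp only: powr_diff)
    also have "\<dots> = \<bar>x * (x - 1)\<bar> powr (-2/3)"
    proof -
      have "lineQ x = \<bar>x * (x - 1)\<bar> powr 2" using a by (simp add: lineQ_def)
      then have "lineQ x powr (5/3 - 2) = (\<bar>x * (x - 1)\<bar> powr 2) powr (5/3 - 2)" by (rule arg_cong)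
      then show ?thesis by (simp only: powr_powr; simp)
    qed
    finally show ?thesis .
  qed
  ultimately have "32 / 5 * (c * lineQ x / 2) powr (5/3) / (lineQ x)\<^sup>2 = 32 / 5 * (c / 2) powr (5/3) * \<bar>x * (x - 1)\<bar> powr (-2/3)"
    by (metis (no_types, opaque_lifting) mult.assoc times_divide_eq_right)
  then show ?thesis
    using near_limit_integral[of "c * lineQ x" "lineQ x"] c Q by (simp only: mult_pos_pos) (rule ennreal_mult, auto)
qed

lemma quart_ge_lineQ: "lineQ x \<le> quart x y"
proof -
  have "x\<^sup>2 * (x - 1)\<^sup>2 \<le> (x\<^sup>2 + y\<^sup>2) * ((x - 1)\<^sup>2 + y\<^sup>2)" by (intro mult_mono) auto
  then show ?thesis by (simp add: lineQ_def quart_def power_mult_distrib)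
qed

lemma quart_le_lineQ:
  assumes "near_line x y" shows "quart x y \<le> 4 * lineQ x"
proof -
  have "y\<^sup>2 \<le> x\<^sup>2" "y\<^sup>2 \<le> (x - 1)\<^sup>2" using assms by (auto simp: near_line_def abs_le_square_iff)
  then have "(x\<^sup>2 + y\<^sup>2) * ((x - 1)\<^sup>2 + y\<^sup>2) \<le> (2 * x\<^sup>2) * (2 * (x - 1)\<^sup>2)" by (intro mult_mono) auto
  then show ?thesis by (simp add: lineQ_def quart_def power_mult_distrib)
qed

text \<open>On \<open>near_line\<close>, \<open>quart\<close> lies between \<open>lineQ\<close> and
  four times \<open>lineQ\<close>. The lower bound serves the denominator and the upper one the
  cut-off, so the majorant does not depend on \<sigma>.\<close>

lemma near_scaled_le:
  assumes x: "x \<noteq> 0" "x \<noteq> 1"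
  shows "near_scaled \<sigma> x e \<le> near_limit (4 * lineQ x) (lineQ x) e"
proof (cases "2 * \<bar>e\<bar> ^ 3 / quart x (\<sigma> * e) < 1 \<and> near_line x (\<sigma> * e)")
  case True
  have Q: "lineQ x > 0" using lineQ_pos x by simp
  have q: "lineQ x \<le> quart x (\<sigma> * e)" by (rule quart_ge_lineQ)
  have "2 * \<bar>e\<bar> ^ 3 < quart x (\<sigma> * e)" using True Q q by (simp add: divide_less_eq)
  also have "\<dots> \<le> 4 * lineQ x" using True by (intro quart_le_lineQ) auto
  finally have c: "2 * \<bar>e\<bar> ^ 3 < 4 * lineQ x" .
  have "(lineQ x)\<^sup>2 \<le> (quart x (\<sigma> * e))\<^sup>2" using q Q by (intro power_mono) auto
  then have "16 * e ^ 4 / (quart x (\<sigma> * e))\<^sup>2 \<le> 16 * e ^ 4 / (lineQ x)\<^sup>2"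
    using Q by (intro divide_left_mono) (auto intro!: mult_pos_pos simp: order_less_le_trans[OF Q q])
  then show ?thesis using True c by (simp add: near_scaled_def near_limit_def ennreal_leI)
next
  case False
  then have "near_scaled \<sigma> x e = 0" unfolding near_scaled_def by (rule if_not_P)
  then show ?thesis by simp
qed

text \<open>The excluded \<open>e\<close> are those where the cut-off jumps, a null set. The
  condition \<open>near_line\<close> holds eventually because \<open>x\<close> is fixed and
  different from 0 and 1.\<close>

lemma near_scaled_pointwise:
  assumes x: "x \<noteq> 0" "x \<noteq> 1" and \<sigma>: "\<sigma> \<longlonglongrightarrow> 0" and e: "2 * \<bar>e\<bar> ^ 3 \<noteq> lineQ x"
  shows "(\<lambda>n. near_scaled (\<sigma> n) x e) \<longlonglongrightarrow> near_limit (lineQ x) (lineQ x) e"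
proof -
  have Q: "lineQ x > 0" using lineQ_pos x by simp
  have q: "(\<lambda>n. quart x (\<sigma> n * e)) \<longlonglongrightarrow> lineQ x"
  proof -
    have "(\<lambda>n. (x\<^sup>2 + (\<sigma> n * e)\<^sup>2) * ((x - 1)\<^sup>2 + (\<sigma> n * e)\<^sup>2)) \<longlonglongrightarrow> (x\<^sup>2 + (0 * e)\<^sup>2) * ((x - 1)\<^sup>2 + (0 * e)\<^sup>2)"
      by (intro tendsto_intros \<sigma>)
    then show ?thesis by (simp add: quart_def lineQ_def power_mult_distrib)
  qed
  have r: "(\<lambda>n. 2 * \<bar>e\<bar> ^ 3 / quart x (\<sigma> n * e)) \<longlonglongrightarrow> 2 * \<bar>e\<bar> ^ 3 / lineQ x"
    using Q by (intro tendsto_intros q) auto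
  have v: "(\<lambda>n. ennreal (16 * e ^ 4 / (quart x (\<sigma> n * e))\<^sup>2)) \<longlonglongrightarrow> ennreal (16 * e ^ 4 / (lineQ x)\<^sup>2)"
    using Q by (intro tendsto_ennrealI tendsto_intros q) auto
  have z: "(\<lambda>n. \<bar>\<sigma> n * e\<bar>) \<longlonglongrightarrow> 0" 
    using tendsto_rabs[OF tendsto_mult[OF \<sigma> tendsto_const[of e]]] by simp
  have nl: "eventually (\<lambda>n. near_line x (\<sigma> n * e)) sequentially"
    using order_tendstoD(2)[OF z, of "\<bar>x\<bar>"] order_tendstoD(2)[OF z, of "\<bar>x - 1\<bar>"] x
    by (auto simp: near_line_def elim: eventually_elim2)
  show ?thesis
  proof (cases "2 * \<bar>e\<bar> ^ 3 < lineQ x")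
    case True
    then have "2 * \<bar>e\<bar> ^ 3 / lineQ x < 1" using Q by simp
    from order_tendstoD(2)[OF r this] nl
    have "eventually (\<lambda>n. ennreal (16 * e ^ 4 / (quart x (\<sigma> n * e))\<^sup>2) = near_scaled (\<sigma> n) x e) sequentially"
      by eventually_elim (simp add: near_scaled_def)
    from Lim_transform_eventually[OF v this] show ?thesis using True by (simp add: near_limit_def)
  next
    case False
    then have "2 * \<bar>e\<bar> ^ 3 / lineQ x > 1" using Q e by simp
    from order_tendstoD(1)[OF r this]
    have "eventually (\<lambda>n. 0 = near_scaled (\<sigma> n) x e) sequentially"
      by eventually_elim (simp add: near_scaled_def)
    from Lim_transform_eventually[OF tendsto_const this] show ?thesis using False by (simp add: near_limit_def)
  qed
qed

lemma near_scaled_inner_limit: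
  assumes x: "x \<noteq> 0" "x \<noteq> 1" and \<sigma>: "\<sigma> \<longlonglongrightarrow> 0"
  shows "(\<lambda>n. \<integral>\<^sup>+e. near_scaled (\<sigma> n) x e \<partial>lborel) \<longlonglongrightarrow> (\<integral>\<^sup>+e. near_limit (lineQ x) (lineQ x) e \<partial>lborel)"
proof (rule nn_integral_dominated_convergence[where w="near_limit (4 * lineQ x) (lineQ x)"])
  have Q: "lineQ x > 0" using lineQ_pos x by simp
  show "(\<integral>\<^sup>+e. near_limit (4 * lineQ x) (lineQ x) e \<partial>lborel) < \<infinity>"
    using Q by (subst near_limit_integral) auto
  define r where "r = root 3 (lineQ x / 2)"
  have "2 * \<bar>e\<bar> ^ 3 = lineQ x \<Longrightarrow> e = r \<or> e = - r" for e
  proof -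
    assume "2 * \<bar>e\<bar> ^ 3 = lineQ x"
    then have "\<bar>e\<bar> ^ 3 = lineQ x / 2" by simp
    then have "\<bar>e\<bar> = r" unfolding r_def by (metis abs_ge_zero real_root_power_cancel zero_less_numeral)
    then show ?thesis by linarith
  qed
  moreover have "AE e in lborel. e \<noteq> r" "AE e in lborel. e \<noteq> - r" by (rule AE_lborel_singleton)+
  ultimately show "AE e in lborel. (\<lambda>n. near_scaled (\<sigma> n) x e) \<longlonglongrightarrow> near_limit (lineQ x) (lineQ x) e"
    by (auto intro!: near_scaled_pointwise x \<sigma> elim!: AE_mp)
qed (auto simp: near_scaled_le x)

text \<open>The integral of \<open>\<bar>x * (x - 1)\<bar> powr (-2/3)\<close> over the line; its three pieces are equal by symmetry.\<close>

definition beta_const :: real where "beta_const = 3 * Beta (1/3) (1/3)"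

lemma near_limit_line_integral:
  assumes c: "c > 0"
  shows "(\<integral>\<^sup>+x. \<integral>\<^sup>+e. near_limit (c * lineQ x) (lineQ x) e \<partial>lborel \<partial>lborel) = ennreal (32 / 5 * (c / 2) powr (5/3)) * ennreal beta_const"
proof -
  have "AE x in lborel. x \<noteq> (0::real)" "AE x in lborel. x \<noteq> (1::real)" by (rule AE_lborel_singleton)+
  then have "AE x in lborel. (\<integral>\<^sup>+e. near_limit (c * lineQ x) (lineQ x) e \<partial>lborel) = ennreal (32 / 5 * (c / 2) powr (5/3)) * ennreal (\<bar>x * (x - 1)\<bar> powr (-2/3))"
    by eventually_elim (rule near_limit_lineQ, auto simp: c)
  then have "(\<integral>\<^sup>+x. \<integral>\<^sup>+e. near_limit (c * lineQ x) (lineQ x) e \<partial>lborel \<partial>lborel) = (\<integral>\<^sup>+x. ennreal (32 / 5 * (c / 2) powr (5/3)) * ennreal (\<bar>x * (x - 1)\<bar> powr (-2/3)) \<partial>lborel)"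
    by (rule nn_integral_cong_AE)
  also have "\<dots> = ennreal (32 / 5 * (c / 2) powr (5/3)) * (\<integral>\<^sup>+x. ennreal (\<bar>x * (x - 1)\<bar> powr (-2/3)) \<partial>lborel)"
    by (rule nn_integral_cmult) measurable
  finally show ?thesis unfolding beta_line_integral beta_const_def .
qed

lemma near_scaled_bound:
  "(\<integral>\<^sup>+x. \<integral>\<^sup>+e. near_scaled \<sigma> x e \<partial>lborel \<partial>lborel) \<le> ennreal (32 / 5 * (4 / 2) powr (5/3)) * ennreal beta_const"
proof -
  have "AE x in lborel. x \<noteq> (0::real)" "AE x in lborel. x \<noteq> (1::real)" by (rule AE_lborel_singleton)+
  then have "AE x in lborel. (\<integral>\<^sup>+e. near_scaled \<sigma> x e \<partial>lborel) \<le> (\<integral>\<^sup>+e. near_limit (4 * lineQ x) (lineQ x) e \<partial>lborel)"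
    by eventually_elim (auto intro!: nn_integral_mono near_scaled_le)
  then show ?thesis unfolding near_limit_line_integral[of 4, symmetric, simplified]
    by (subst near_limit_line_integral[symmetric]) (auto intro: nn_integral_mono_AE)
qed

lemma near_scaled_limit:
  assumes \<sigma>: "\<sigma> \<longlonglongrightarrow> 0"
  shows "(\<lambda>n. \<integral>\<^sup>+x. \<integral>\<^sup>+e. near_scaled (\<sigma> n) x e \<partial>lborel \<partial>lborel) \<longlonglongrightarrow> ennreal (32 / 5 * (1 / 2) powr (5/3)) * ennreal beta_const"
proof -
  have "(\<lambda>n. \<integral>\<^sup>+x. \<integral>\<^sup>+e. near_scaled (\<sigma> n) x e \<partial>lborel \<partial>lborel) \<longlonglongrightarrow> (\<integral>\<^sup>+x. \<integral>\<^sup>+e. near_limit (lineQ x) (lineQ x) e \<partial>lborel \<partial>lborel)"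
  proof (rule nn_integral_dominated_convergence[where w="\<lambda>x. \<integral>\<^sup>+e. near_limit (4 * lineQ x) (lineQ x) e \<partial>lborel"])
    have ae: "AE x in lborel. x \<noteq> (0::real)" "AE x in lborel. x \<noteq> (1::real)" by (rule AE_lborel_singleton)+
    show "AE x in lborel. (\<integral>\<^sup>+e. near_scaled (\<sigma> j) x e \<partial>lborel) \<le> (\<integral>\<^sup>+e. near_limit (4 * lineQ x) (lineQ x) e \<partial>lborel)" for j
      using ae by eventually_elim (auto intro!: nn_integral_mono near_scaled_le)
    show "AE x in lborel. (\<lambda>n. \<integral>\<^sup>+e. near_scaled (\<sigma> n) x e \<partial>lborel) \<longlonglongrightarrow> (\<integral>\<^sup>+e. near_limit (lineQ x) (lineQ x) e \<partial>lborel)"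
      using ae by eventually_elim (rule near_scaled_inner_limit[OF _ _ \<sigma>])
    show "(\<integral>\<^sup>+x. \<integral>\<^sup>+e. near_limit (4 * lineQ x) (lineQ x) e \<partial>lborel \<partial>lborel) < \<infinity>"
      by (subst near_limit_line_integral) (auto simp: ennreal_mult_less_top)
  qed measurable
  then show ?thesis using near_limit_line_integral[of 1] by simp
qed

section \<open>The region away from the line\<close>

definition far_majorant :: "real \<Rightarrow> real" where
  "far_majorant y = (if \<bar>y\<bar> \<le> 1 then 32 * \<bar>y\<bar> powr (-5/3) else 16 * \<bar>y\<bar> powr (-7/3))"

lemma far_majorant_measurable [measurable]: "far_majorant \<in> borel_measurable borel"
  unfolding far_majorant_def by measurable

text \<open>Off \<open>near_line\<close> one of the horizontal distances to 0 and 1, say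
  \<open>\<bar>a\<bar>\<close>, is below \<open>\<bar>y\<bar>\<close>. For the other,
  \<open>\<bar>b\<bar> + \<bar>y\<bar> \<ge> 1\<close>, whence \<open>b^2 + y^2 \<ge> 1/2\<close>.
  The second bound multiplies \<open>y^2\<close> from both factors.\<close>

lemma quart_far:
  assumes n: "\<not> near_line x y" shows "quart x y \<ge> y\<^sup>2 / 2" "quart x y \<ge> y ^ 4"
proof -
  have gen: "(a\<^sup>2 + y\<^sup>2) * (b\<^sup>2 + y\<^sup>2) \<ge> y\<^sup>2 / 2 \<and> (a\<^sup>2 + y\<^sup>2) * (b\<^sup>2 + y\<^sup>2) \<ge> y ^ 4" if ab: "\<bar>a\<bar> < \<bar>y\<bar>" "\<bar>a - b\<bar> = 1" for a b :: real
  proof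
    have "b\<^sup>2 + y\<^sup>2 \<ge> 1 / 2"
    proof -
      have "\<bar>b\<bar> + \<bar>y\<bar> \<ge> 1" using ab by linarith
      then have "(\<bar>b\<bar> + \<bar>y\<bar>)\<^sup>2 \<ge> 1\<^sup>2" by (intro power_mono) auto
      then have "1 \<le> (\<bar>b\<bar> + \<bar>y\<bar>)\<^sup>2" by (simp only: one_power2)
      moreover have "(\<bar>b\<bar> + \<bar>y\<bar>)\<^sup>2 + (\<bar>b\<bar> - \<bar>y\<bar>)\<^sup>2 = 2 * (b\<^sup>2 + y\<^sup>2)" by (simp add: power2_sum power2_diff)
      moreover have "(\<bar>b\<bar> - \<bar>y\<bar>)\<^sup>2 \<ge> 0" by simp
      moreover have "1 / 2 \<le> C" if "1 \<le> A" "A + B = 2 * C" "0 \<le> B" for A B C :: real using that by linarith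
      ultimately show ?thesis by blast
    qed
    then have "y\<^sup>2 * (1 / 2) \<le> (a\<^sup>2 + y\<^sup>2) * (b\<^sup>2 + y\<^sup>2)" by (intro mult_mono) auto
    then show "(a\<^sup>2 + y\<^sup>2) * (b\<^sup>2 + y\<^sup>2) \<ge> y\<^sup>2 / 2" by simp
    have "y\<^sup>2 * y\<^sup>2 \<le> (a\<^sup>2 + y\<^sup>2) * (b\<^sup>2 + y\<^sup>2)" by (intro mult_mono) auto
    then show "(a\<^sup>2 + y\<^sup>2) * (b\<^sup>2 + y\<^sup>2) \<ge> y ^ 4" by (simp add: power_add[symmetric])
  qed
  have "\<bar>x\<bar> < \<bar>y\<bar> \<or> \<bar>x - 1\<bar> < \<bar>y\<bar>" using n by (auto simp: near_line_def)
  then show "quart x y \<ge> y\<^sup>2 / 2" "quart x y \<ge> y ^ 4"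
    using gen[of x "x - 1"] gen[of "x - 1" x] by (auto simp: quart_def mult.commute)
qed

text \<open>From \<open>\<bar>y\<bar>^3 \<le> s * q\<close> with \<open>q = quart x y\<close> one
  gets \<open>y^4 / q^2 \<le> s powr (5/3) * \<bar>y\<bar> powr (-1) * q powr (-1/3)\<close>. The
  bounds \<open>q \<ge> y^2 / 2\<close> and \<open>q \<ge> y^4\<close> then give the two branches of
  \<open>far_majorant\<close>, for small and for large \<open>y\<close>.\<close>

lemma far_tail_le:
  assumes s: "s > 0"
  shows "far_tail s x y \<le> ennreal (s powr (5/3)) * (ennreal (far_majorant y) * indicator {x. \<not> near_line x y} x)"
proof (cases "2 * \<bar>y\<bar> ^ 3 / quart x y < s \<and> \<not> near_line x y")
  case True
  show ?thesis
  proof (cases "y = 0")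
    case True then show ?thesis by (simp add: far_tail_def)
  next
    case False
    define a where "a = \<bar>y\<bar>"
    define q where "q = quart x y"
    have a: "a > 0" using False by (simp add: a_def)
    have q: "q > 0" using quart_pos[OF False] by (simp add: q_def)
    have ya: "y ^ 4 = a powr 4" "y\<^sup>2 = a powr 2" using a by (simp_all add: a_def)
    have "2 * a ^ 3 < s * q" using True q by (simp add: a_def q_def divide_less_eq)
    then have "a ^ 3 \<le> s * q" using a by (smt (verit) zero_less_power)
    then have "a powr 3 \<le> s * q" using a by simp
    then have "(a powr 3) powr (5/3) \<le> (s * q) powr (5/3)" using a by (intro powr_mono2) auto
    then have a5: "a powr 5 \<le> s powr (5/3) * q powr (5/3)" using s q by (simp add: powr_powr powr_mult)
    have q2: "q\<^sup>2 = q powr (5/3) * q powr (1/3)"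
    proof -
      have "q powr (5/3) * q powr (1/3) = q powr 2" by (simp only: powr_add[symmetric]; simp)
      then show ?thesis using q by simp
    qed
    have "a powr 4 / q\<^sup>2 = a powr 5 * a powr (-1) / (q powr (5/3) * q powr (1/3))"
      unfolding q2 by (simp only: powr_add[symmetric]; simp)
    also have "\<dots> \<le> (s powr (5/3) * q powr (5/3)) * a powr (-1) / (q powr (5/3) * q powr (1/3))"
      using a5 by (intro divide_right_mono mult_right_mono) auto
    also have "\<dots> = s powr (5/3) * (a powr (-1) * q powr (-1/3))"
      using q by (simp add: powr_minus_divide)
    finally have main: "a powr 4 / q\<^sup>2 \<le> s powr (5/3) * (a powr (-1) * q powr (-1/3))" .
    have d: "16 * (a powr (-1) * q powr (-1/3)) \<le> far_majorant y"
    proof (cases "a \<le> 1")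
      case le: True
      have "q \<ge> a powr 2 / 2" using quart_far(1)[of x y] True by (simp add: q_def ya)
      then have "q powr (-1/3) \<le> (a powr 2 / 2) powr (-1/3)" using a by (intro powr_mono2') auto
      also have "\<dots> = (a powr 2) powr (-1/3) / 2 powr (-1/3)" by (rule powr_divide)
      also have "\<dots> = a powr (-2/3) * 2 powr (1/3)" by (simp only: powr_powr; simp add: powr_minus_divide)
      also have "\<dots> \<le> a powr (-2/3) * 2 powr 1" by (intro mult_left_mono powr_mono) auto
      finally have "a powr (-1) * q powr (-1/3) \<le> a powr (-1) * (a powr (-2/3) * 2)" by (intro mult_left_mono) auto
      also have "\<dots> = 2 * a powr (-5/3)"
      proof -
        have "a powr (-1) * a powr (-2/3) = a powr (-5/3)" by (simp only: powr_add[symmetric]; simp)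
        then show ?thesis by (simp only: mult.assoc[symmetric]; simp)
      qed
      finally show ?thesis using le by (simp add: far_majorant_def a_def)
    next
      case gt: False
      have "q \<ge> a powr 4" using quart_far(2)[of x y] True by (simp add: q_def ya)
      then have "q powr (-1/3) \<le> (a powr 4) powr (-1/3)" using a by (intro powr_mono2') auto
      also have "\<dots> = a powr (-4/3)" by (simp only: powr_powr; simp)
      finally have "a powr (-1) * q powr (-1/3) \<le> a powr (-1) * a powr (-4/3)" by (intro mult_left_mono) auto
      also have "\<dots> = a powr (-7/3)" by (simp only: powr_add[symmetric]; simp)
      finally show ?thesis using gt by (simp add: far_majorant_def a_def)
    qed
    have "16 * (a powr 4 / q\<^sup>2) \<le> 16 * (s powr (5/3) * (a powr (-1) * q powr (-1/3)))"
      by (rule mult_left_mono[OF main]) simp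
    also have "\<dots> = s powr (5/3) * (16 * (a powr (-1) * q powr (-1/3)))" by (rule mult.left_commute)
    also have "\<dots> \<le> s powr (5/3) * far_majorant y" by (rule mult_left_mono[OF d]) simp
    finally have "ennreal (16 * y ^ 4 / (quart x y)\<^sup>2) \<le> ennreal (s powr (5/3) * far_majorant y)"
      by (intro ennreal_leI) (simp add: ya q_def)
    also have "\<dots> = ennreal (s powr (5/3)) * ennreal (far_majorant y)"
      by (rule ennreal_mult) (auto simp: far_majorant_def)
    finally show ?thesis using True by (simp add: far_tail_def)
  qed
next
  case False
  then have "far_tail s x y = 0" unfolding far_tail_def by (rule if_not_P)
  then show ?thesis by simp
qed

text \<open>For fixed \<open>y\<close> the far \<open>x\<close> fill two intervals of total length
  at most \<open>4 * \<bar>y\<bar>\<close>. This extra factor turns the exponents -5/3 and -7/3 into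
  -2/3 and -4/3, integrable at 0 and at infinity respectively.\<close>

lemma far_majorant_finite:
  "(\<integral>\<^sup>+y. \<integral>\<^sup>+x. ennreal (far_majorant y) * indicator {x. \<not> near_line x y} x \<partial>lborel \<partial>lborel) < \<infinity>"
proof -
  have "(\<integral>\<^sup>+x. ennreal (far_majorant y) * indicator {x. \<not> near_line x y} x \<partial>lborel) \<le> ennreal (far_majorant y * (4 * \<bar>y\<bar>))" for y
  proof -
    have "(\<integral>\<^sup>+x. ennreal (far_majorant y) * indicator {x. \<not> near_line x y} x \<partial>lborel) = ennreal (far_majorant y) * emeasure lborel {x. \<not> near_line x y}"
      by (rule nn_integral_cmult_indicator) measurable
    also have "emeasure lborel {x. \<not> near_line x y} \<le> emeasure lborel ({- \<bar>y\<bar>..\<bar>y\<bar>} \<union> {1 - \<bar>y\<bar>..1 + \<bar>y\<bar>})"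
      by (intro emeasure_mono) (auto simp: near_line_def)
    also have "\<dots> \<le> emeasure lborel {- \<bar>y\<bar>..\<bar>y\<bar>} + emeasure lborel {1 - \<bar>y\<bar>..1 + \<bar>y\<bar>}"
      by (rule emeasure_subadditive) auto
    also have "\<dots> = ennreal (4 * \<bar>y\<bar>)" by (simp add: ennreal_plus[symmetric] del: ennreal_plus)
    finally show ?thesis by (simp add: ennreal_mult far_majorant_def mult_left_mono)
  qed
  then have "(\<integral>\<^sup>+y. \<integral>\<^sup>+x. ennreal (far_majorant y) * indicator {x. \<not> near_line x y} x \<partial>lborel \<partial>lborel) \<le> (\<integral>\<^sup>+y. ennreal (far_majorant y * (4 * \<bar>y\<bar>)) \<partial>lborel)"
    by (rule nn_integral_mono)
  also have "\<dots> = (\<integral>\<^sup>+y. ennreal (far_majorant y * (4 * \<bar>y\<bar>)) * indicator {0..} y \<partial>lborel) + (\<integral>\<^sup>+y. ennreal (far_majorant (- y) * (4 * \<bar>- y\<bar>)) * indicator {0..} y \<partial>lborel)"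
    by (rule nn_integral_even) measurable
  also have "(\<lambda>y. ennreal (far_majorant (- y) * (4 * \<bar>- y\<bar>)) * indicator {0..} y) = (\<lambda>y. ennreal (far_majorant y * (4 * \<bar>y\<bar>)) * indicator {0..} y)"
  proof -
    have "far_majorant (- y) = far_majorant y" for y by (auto simp: far_majorant_def)
    then show ?thesis by simp
  qed
  also have "(\<integral>\<^sup>+y. ennreal (far_majorant y * (4 * \<bar>y\<bar>)) * indicator {0..} y \<partial>lborel) \<le>
     (\<integral>\<^sup>+y. ennreal 128 * (ennreal (y powr (-2/3)) * indicator {0..1} y) + ennreal 64 * (ennreal (y powr (-4/3)) * indicator {1..} y) \<partial>lborel)"
  proof (rule nn_integral_mono)
    fix y :: real
    have m: "y powr (-5/3) * y = y powr (-2/3)" "y powr (-7/3) * y = y powr (-4/3)" if "y > 0"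
    proof -
      have "y powr (-5/3) * y powr 1 = y powr (-2/3)" by (simp only: powr_add[symmetric]; simp)
      moreover have "y powr (-7/3) * y powr 1 = y powr (-4/3)" by (simp only: powr_add[symmetric]; simp)
      ultimately show "y powr (-5/3) * y = y powr (-2/3)" "y powr (-7/3) * y = y powr (-4/3)" using that by simp_all
    qed
    consider "y \<le> 0" | "0 < y" "y \<le> 1" | "y > 1" by linarith
    then show "ennreal (far_majorant y * (4 * \<bar>y\<bar>)) * indicator {0..} y \<le> ennreal 128 * (ennreal (y powr (-2/3)) * indicator {0..1} y) + ennreal 64 * (ennreal (y powr (-4/3)) * indicator {1..} y)"
    proof cases
      case 1 then show ?thesis by (cases "y = 0") (auto simp: far_majorant_def)
    next
      case 2
      have "far_majorant y * (4 * \<bar>y\<bar>) = 128 * (y powr (-5/3) * y)" using 2 by (simp add: far_majorant_def)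
      then have "ennreal (far_majorant y * (4 * \<bar>y\<bar>)) = ennreal 128 * ennreal (y powr (-2/3))"
        using m(1) 2 by (simp only: ennreal_mult[symmetric])  (simp add: ennreal_mult)
      then show ?thesis using 2 by simp
    next
      case 3
      have "far_majorant y * (4 * \<bar>y\<bar>) = 64 * (y powr (-7/3) * y)" using 3 by (simp add: far_majorant_def)
      then have "ennreal (far_majorant y * (4 * \<bar>y\<bar>)) = ennreal 64 * ennreal (y powr (-4/3))"
        using m(2) 3 by (simp only: ennreal_mult[symmetric])  (simp add: ennreal_mult)
      then show ?thesis using 3 by simp
    qed
  qed
  also have "\<dots> = ennreal 128 * (\<integral>\<^sup>+y. ennreal (y powr (-2/3)) * indicator {0..1} y \<partial>lborel) + ennreal 64 * (\<integral>\<^sup>+y. ennreal (y powr (-4/3)) * indicator {1..} y \<partial>lborel)"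
    by (subst nn_integral_add, measurable, subst (1 2) nn_integral_cmult, measurable)
  also have "(\<integral>\<^sup>+y. ennreal (y powr (-2/3)) * indicator {0..1} y \<partial>lborel) = ennreal (1 powr (-2/3 + 1) / (-2/3 + 1))"
    by (rule nn_integral_of_has_integral[OF has_integral_powr_from_0]) auto
  also have "(\<integral>\<^sup>+y. ennreal (y powr (-4/3)) * indicator {1..} y \<partial>lborel) = ennreal (- (1 powr (-4/3 + 1)) / (-4/3 + 1))"
    by (rule nn_integral_of_has_integral[OF has_integral_powr_to_inf]) auto
  finally show ?thesis
    by (rule order_le_less_trans) (auto simp: ennreal_mult[symmetric] ennreal_plus[symmetric] intro: add_mono simp del: ennreal_plus)
qed

lemma powr_53_cancel: "x powr (-5/3) * x powr (5/3) = 1" if "x > 0" for x :: real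
  using that by (simp add: powr_add[symmetric])

text \<open>The majorant alone gives order \<open>s powr (5/3)\<close>. The limit is 0 by dominated
  convergence, because a fixed shape with \<open>y \<noteq> 0\<close> has positive normalised area
  and drops out once \<open>s\<close> is below it.\<close>

lemma far_tail_limit:
  assumes s: "\<And>n. s n > 0" "s \<longlonglongrightarrow> 0"
  shows "(\<lambda>n. ennreal (s n powr (-5/3)) * (\<integral>\<^sup>+x. \<integral>\<^sup>+y. far_tail (s n) x y \<partial>lborel \<partial>lborel)) \<longlonglongrightarrow> 0"
proof -
  let ?k = "\<lambda>n p. ennreal (s n powr (-5/3)) * far_tail (s n) (fst p) (snd p)"
  let ?w = "\<lambda>p. ennreal (far_majorant (snd p)) * indicator {x. \<not> near_line x (snd p)} (fst p)"
  have wm: "?w \<in> borel_measurable (lborel \<Otimes>\<^sub>M lborel)"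
    unfolding indicator_def by measurable
  have e: "ennreal (s n powr (-5/3)) * (\<integral>\<^sup>+x. \<integral>\<^sup>+y. far_tail (s n) x y \<partial>lborel \<partial>lborel) = (\<integral>\<^sup>+p. ?k n p \<partial>(lborel \<Otimes>\<^sub>M lborel))" for n
  proof -
    have "(\<integral>\<^sup>+x. \<integral>\<^sup>+y. far_tail (s n) x y \<partial>lborel \<partial>lborel) = (\<integral>\<^sup>+p. far_tail (s n) (fst p) (snd p) \<partial>(lborel \<Otimes>\<^sub>M lborel))"
    proof -
      have m: "(\<lambda>p. far_tail (s n) (fst p) (snd p)) \<in> borel_measurable (lborel \<Otimes>\<^sub>M lborel)" by measurable
      show ?thesis using lborel.nn_integral_fst[OF m] by simp
    qed
    then show ?thesis by (simp add: nn_integral_cmult)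
  qed
  have b: "?k n p \<le> ?w p" for n p
  proof -
    have "?k n p \<le> ennreal (s n powr (-5/3)) * (ennreal (s n powr (5/3)) * ?w p)"
      by (intro mult_left_mono far_tail_le s) auto
    also have "\<dots> = ennreal (s n powr (-5/3) * s n powr (5/3)) * ?w p"
      by (simp add: ennreal_mult mult.assoc)
    also have "s n powr (-5/3) * s n powr (5/3) = 1" by (rule powr_53_cancel[OF s(1)])
    finally show ?thesis by simp
  qed
  have "(\<lambda>n. \<integral>\<^sup>+p. ?k n p \<partial>(lborel \<Otimes>\<^sub>M lborel)) \<longlonglongrightarrow> (\<integral>\<^sup>+p. 0 \<partial>((lborel \<Otimes>\<^sub>M lborel) :: (real \<times> real) measure))"
  proof (rule nn_integral_dominated_convergence[where w="?w"])
    have "(\<integral>\<^sup>+p. ?w p \<partial>(lborel \<Otimes>\<^sub>M lborel)) = (\<integral>\<^sup>+y. \<integral>\<^sup>+x. ?w (x,y) \<partial>lborel \<partial>lborel)"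
      using lborel_pair.nn_integral_snd[OF wm] by (rule sym)
    then show "(\<integral>\<^sup>+p. ?w p \<partial>(lborel \<Otimes>\<^sub>M lborel)) < \<infinity>" using far_majorant_finite by simp
    show "AE p in lborel \<Otimes>\<^sub>M lborel. (\<lambda>n. ?k n p) \<longlonglongrightarrow> 0"
    proof (rule AE_I2)
      fix p :: "real \<times> real"
      obtain x y where p: "p = (x,y)" by (cases p)
      have "eventually (\<lambda>n. 0 = ?k n p) sequentially"
      proof (cases "y = 0")
        case True then show ?thesis by (simp add: p far_tail_def)
      next
        case False
        then have "2 * \<bar>y\<bar> ^ 3 / quart x y > 0" using quart_pos[OF False, of x] by (intro divide_pos_pos) auto
        from order_tendstoD(2)[OF s(2) this] show ?thesis
          by eventually_elim (simp add: p far_tail_def)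
      qed
      from Lim_transform_eventually[OF tendsto_const this] show "(\<lambda>n. ?k n p) \<longlonglongrightarrow> 0" .
    qed
  qed (use wm b in auto)
  then show ?thesis unfolding e by simp
qed

lemma far_tail_bound:
  obtains C where "C \<ge> 0" "\<And>s. s > 0 \<Longrightarrow> (\<integral>\<^sup>+x. \<integral>\<^sup>+y. far_tail s x y \<partial>lborel \<partial>lborel) \<le> ennreal (s powr (5/3)) * ennreal C"
proof
  let ?C = "\<integral>\<^sup>+y. \<integral>\<^sup>+x. ennreal (far_majorant y) * indicator {x. \<not> near_line x y} x \<partial>lborel \<partial>lborel"
  fix s :: real assume s: "s > 0"
  have wm: "(\<lambda>(x,y). ennreal (far_majorant y) * indicator {x. \<not> near_line x y} x) \<in> borel_measurable (lborel \<Otimes>\<^sub>M lborel)"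
    unfolding indicator_def by measurable
  have "(\<integral>\<^sup>+x. \<integral>\<^sup>+y. far_tail s x y \<partial>lborel \<partial>lborel) \<le> (\<integral>\<^sup>+x. \<integral>\<^sup>+y. ennreal (s powr (5/3)) * (ennreal (far_majorant y) * indicator {x. \<not> near_line x y} x) \<partial>lborel \<partial>lborel)"
    by (intro nn_integral_mono far_tail_le s)
  also have "\<dots> = (\<integral>\<^sup>+y. \<integral>\<^sup>+x. ennreal (s powr (5/3)) * (ennreal (far_majorant y) * indicator {x. \<not> near_line x y} x) \<partial>lborel \<partial>lborel)"
    by (rule lborel_pair.Fubini') (unfold indicator_def, measurable)
  also have "\<dots> = (\<integral>\<^sup>+y. ennreal (s powr (5/3)) * (\<integral>\<^sup>+x. ennreal (far_majorant y) * indicator {x. \<not> near_line x y} x \<partial>lborel) \<partial>lborel)"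
    by (rule nn_integral_cong, rule nn_integral_cmult) measurable
  also have "\<dots> = ennreal (s powr (5/3)) * ?C"
    by (rule nn_integral_cmult) (unfold indicator_def, measurable)
  also have "?C = ennreal (enn2real ?C)" using far_majorant_finite by simp
  finally show "(\<integral>\<^sup>+x. \<integral>\<^sup>+y. far_tail s x y \<partial>lborel \<partial>lborel) \<le> ennreal (s powr (5/3)) * ennreal (enn2real ?C)" .
qed simp

text \<open>The coefficient of \<open>s powr (5/3)\<close> in \<open>shape_tail s\<close> as
  \<open>s\<close> tends to 0; it is the value of \<open>near_limit_line_integral\<close> at
  \<open>c = 1\<close>.\<close>

definition tail_const :: real where "tail_const = 32 / 5 * (1 / 2) powr (5/3) * beta_const"

lemma beta_const_nonneg: "beta_const \<ge> 0"
  by (simp add: beta_const_def Beta_def Gamma_real_nonneg)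

lemma shape_tail_limit:
  assumes s: "\<And>n. s n > 0" "s \<longlonglongrightarrow> 0"
  shows "(\<lambda>n. ennreal (s n powr (-5/3)) * shape_tail (s n)) \<longlonglongrightarrow> ennreal tail_const"
proof -
  have "(\<lambda>n. s n powr (1/3)) \<longlonglongrightarrow> 0 powr (1/3)"
    by (rule tendsto_powr'[OF s(2) tendsto_const]) (use s(1) in \<open>auto simp: less_imp_le\<close>)
  then have \<sigma>: "(\<lambda>n. s n powr (1/3)) \<longlonglongrightarrow> 0" by simp
  have A: "ennreal (s n powr (-5/3)) * (\<integral>\<^sup>+x. \<integral>\<^sup>+y. near_tail (s n) x y \<partial>lborel \<partial>lborel) = (\<integral>\<^sup>+x. \<integral>\<^sup>+e. near_scaled (s n powr (1/3)) x e \<partial>lborel \<partial>lborel)" for n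
  proof -
    have "ennreal (s n powr (-5/3)) * (\<integral>\<^sup>+x. \<integral>\<^sup>+y. near_tail (s n) x y \<partial>lborel \<partial>lborel) =
      ennreal (s n powr (-5/3)) * (ennreal (s n powr (5/3)) * (\<integral>\<^sup>+x. \<integral>\<^sup>+e. near_scaled (s n powr (1/3)) x e \<partial>lborel \<partial>lborel))"
      unfolding near_tail_scale[OF s(1)] by (subst nn_integral_cmult) auto
    also have "\<dots> = ennreal (s n powr (-5/3) * s n powr (5/3)) * (\<integral>\<^sup>+x. \<integral>\<^sup>+e. near_scaled (s n powr (1/3)) x e \<partial>lborel \<partial>lborel)"
      by (simp add: ennreal_mult mult.assoc)
    also have "s n powr (-5/3) * s n powr (5/3) = 1" by (rule powr_53_cancel[OF s(1)])
    finally show ?thesis by simp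
  qed
  have "(\<lambda>n. ennreal (s n powr (-5/3)) * (\<integral>\<^sup>+x. \<integral>\<^sup>+y. near_tail (s n) x y \<partial>lborel \<partial>lborel) + ennreal (s n powr (-5/3)) * (\<integral>\<^sup>+x. \<integral>\<^sup>+y. far_tail (s n) x y \<partial>lborel \<partial>lborel))
     \<longlonglongrightarrow> ennreal (32 / 5 * (1 / 2) powr (5/3)) * ennreal beta_const + 0"
    unfolding A by (intro tendsto_add near_scaled_limit \<sigma> far_tail_limit s)
  note lim = this
  show ?thesis
  proof -
    have tc: "ennreal tail_const = ennreal (32 / 5 * (1 / 2) powr (5/3)) * ennreal beta_const"
      unfolding tail_const_def by (rule ennreal_mult) (auto simp: beta_const_nonneg)
    from lim show ?thesis unfolding shape_tail_split tc by (simp only: distrib_left add_0_right)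
  qed
qed

text \<open>Valid for all \<open>s > 0\<close>, not just small ones: it is applied with
  \<open>s = v / R^2\<close>, which is unbounded as \<open>R\<close> tends to 0.\<close>

lemma shape_tail_bound:
  obtains C where "C \<ge> 0" "\<And>s. s > 0 \<Longrightarrow> shape_tail s \<le> ennreal (C * s powr (5/3))"
proof -
  obtain C where C: "C \<ge> 0" "\<And>s. s > 0 \<Longrightarrow> (\<integral>\<^sup>+x. \<integral>\<^sup>+y. far_tail s x y \<partial>lborel \<partial>lborel) \<le> ennreal (s powr (5/3)) * ennreal C"
    by (rule far_tail_bound) blast
  define A where "A = 32 / 5 * (4 / 2) powr (5/3) * beta_const"
  have A0: "A \<ge> 0" by (simp add: A_def beta_const_nonneg)
  show ?thesis
  proof
    show "A + C \<ge> 0" using A0 C by simp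
    fix s :: real assume s: "s > 0"
    have "(\<integral>\<^sup>+x. \<integral>\<^sup>+y. near_tail s x y \<partial>lborel \<partial>lborel) = ennreal (s powr (5/3)) * (\<integral>\<^sup>+x. \<integral>\<^sup>+e. near_scaled (s powr (1/3)) x e \<partial>lborel \<partial>lborel)"
      unfolding near_tail_scale[OF s] by (rule nn_integral_cmult) measurable
    also have "\<dots> \<le> ennreal (s powr (5/3)) * (ennreal (32 / 5 * (4 / 2) powr (5/3)) * ennreal beta_const)"
      by (intro mult_left_mono near_scaled_bound) auto
    also have "\<dots> = ennreal (s powr (5/3)) * ennreal A"
      unfolding A_def by (subst ennreal_mult[symmetric]) (auto simp: beta_const_nonneg)
    finally have "shape_tail s \<le> ennreal (s powr (5/3)) * ennreal A + ennreal (s powr (5/3)) * ennreal C"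
      unfolding shape_tail_split using C(2)[OF s] by (intro add_mono)
    also have "\<dots> = ennreal ((A + C) * s powr (5/3))"
    proof -
      have "ennreal ((A + C) * s powr (5/3)) = (ennreal A + ennreal C) * ennreal (s powr (5/3))"
        using A0 C(1) by (simp add: ennreal_mult)
      then show ?thesis by (simp only: distrib_right mult.commute)
    qed
    finally show "shape_tail s \<le> ennreal ((A + C) * s powr (5/3))" .
  qed
qed

section \<open>Integration over the circumradius\<close>

lemma shape_tail_measurable [measurable]: "shape_tail \<in> borel_measurable borel"
proof -
  have "(\<lambda>s. \<integral>\<^sup>+x. \<integral>\<^sup>+y. (if 2 * \<bar>y\<bar> ^ 3 / quart x y < s then ennreal (16 * y ^ 4 / (quart x y)\<^sup>2) else 0) \<partial>lborel \<partial>lborel) \<in> borel_measurable borel"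
    by measurable
  also have "(\<lambda>s. \<integral>\<^sup>+x. \<integral>\<^sup>+y. (if 2 * \<bar>y\<bar> ^ 3 / quart x y < s then ennreal (16 * y ^ 4 / (quart x y)\<^sup>2) else 0) \<partial>lborel \<partial>lborel) = shape_tail"
    unfolding shape_tail_def by (intro ext nn_integral_cong) (auto simp: indicator_def)
  finally show ?thesis .
qed

definition radius_tail :: "real \<Rightarrow> real set \<Rightarrow> real \<Rightarrow> ennreal" where
  "radius_tail c S v = (\<integral>\<^sup>+R. ennreal (2 * pi * R ^ 3) * indicator {0<..} R * (ennreal (exp (- (c * R\<^sup>2))) * indicator S R * shape_tail (v / R\<^sup>2)) \<partial>lborel)"

definition radius_mass :: "real \<Rightarrow> real set \<Rightarrow> ennreal" where
  "radius_mass c S = (\<integral>\<^sup>+R. ennreal (2 * pi * (R powr (-1/3) * exp (- (c * R\<^sup>2)))) * indicator {0<..} R * indicator S R \<partial>lborel)"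

lemma radius_tail_factor:
  fixes v R :: real
  assumes v: "v > 0" and R: "R > 0"
  shows "R ^ 3 * (v / R\<^sup>2) powr (5/3) = v powr (5/3) * R powr (-1/3)"
proof -
  have "(v / R\<^sup>2) powr (5/3) = v powr (5/3) / (R powr 2) powr (5/3)" using R by (simp add: powr_divide)
  also have "(R powr 2) powr (5/3) = R powr (10/3)" by (simp only: powr_powr; simp)
  finally have "R ^ 3 * (v / R\<^sup>2) powr (5/3) = v powr (5/3) * (R powr 3 / R powr (10/3))" using R by simp
  also have "R powr 3 / R powr (10/3) = R powr (-1/3)" by (simp only: powr_diff[symmetric]; simp)
  finally show ?thesis .
qed

lemma radius_mass_UNIV:
  assumes "c > 0"
  shows "radius_mass c UNIV = ennreal (pi * Gamma (1/3) * c powr (-1/3))"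
proof -
  have "radius_mass c UNIV = (\<integral>\<^sup>+R. ennreal (2 * pi) * (ennreal (R powr (-1/3) * exp (- (c * R\<^sup>2))) * indicator {0<..} R) \<partial>lborel)"
    unfolding radius_mass_def by (intro nn_integral_cong) (simp add: ennreal_mult mult.assoc)
  also have "\<dots> = ennreal (2 * pi) * ennreal (Gamma (1/3) * c powr (-1/3) / 2)"
    unfolding gaussian_powr_integral[OF assms, symmetric] by (rule nn_integral_cmult) measurable
  also have "\<dots> = ennreal (2 * pi * (Gamma (1/3) * c powr (-1/3) / 2))"
    by (rule ennreal_mult[symmetric]) (auto simp: Gamma_real_nonneg)
  finally show ?thesis by (simp add: mult_ac)
qed

text \<open>For fixed \<open>R\<close>, \<open>shape_tail (v / R^2)\<close> is asymptotic to
  \<open>tail_const * (v / R^2) powr (5/3)\<close>, and \<open>shape_tail_bound\<close> is uniform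
  in \<open>R\<close>. Dominated convergence applies with a multiple of the density of
  \<open>radius_mass\<close> as majorant.\<close>

lemma radius_tail_limit:
  assumes c: "c > 0" and S [measurable]: "S \<in> sets borel" and v: "\<And>n. v n > 0" "v \<longlonglongrightarrow> 0"
  shows "(\<lambda>n. ennreal (v n powr (-5/3)) * radius_tail c S (v n)) \<longlonglongrightarrow> ennreal tail_const * radius_mass c S"
proof -
  obtain C where C: "C \<ge> 0" "\<And>s. s > 0 \<Longrightarrow> shape_tail s \<le> ennreal (C * s powr (5/3))"
    by (rule shape_tail_bound) blast
  let ?g = "\<lambda>R. ennreal (2 * pi * (R powr (-1/3) * exp (- (c * R\<^sup>2)))) * indicator {0<..} R * indicator S R"
  let ?u = "\<lambda>n R. ?g R * (ennreal ((v n / R\<^sup>2) powr (-5/3)) * shape_tail (v n / R\<^sup>2))"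
  have e: "ennreal (v n powr (-5/3)) * radius_tail c S (v n) = (\<integral>\<^sup>+R. ?u n R \<partial>lborel)" for n
  proof -
    have "ennreal (v n powr (-5/3)) * radius_tail c S (v n) =
      (\<integral>\<^sup>+R. ennreal (v n powr (-5/3)) * (ennreal (2 * pi * R ^ 3) * indicator {0<..} R * (ennreal (exp (- (c * R\<^sup>2))) * indicator S R * shape_tail (v n / R\<^sup>2))) \<partial>lborel)"
      unfolding radius_tail_def by (rule nn_integral_cmult[symmetric]) measurable
    also have "\<dots> = (\<integral>\<^sup>+R. ?u n R \<partial>lborel)"
    proof (rule nn_integral_cong)
      fix R :: real
      show "ennreal (v n powr (-5/3)) * (ennreal (2 * pi * R ^ 3) * indicator {0<..} R * (ennreal (exp (- (c * R\<^sup>2))) * indicator S R * shape_tail (v n / R\<^sup>2))) = ?u n R"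
      proof (cases "R > 0")
        case True
        let ?h = "v n / R\<^sup>2"
        have h: "?h > 0" using v(1)[of n] True by simp
        have "v n powr (-5/3) * (2 * pi * R ^ 3) = 2 * pi * R powr (-1/3) * ?h powr (-5/3)"
        proof -
          have a: "v n powr (-5/3) * v n powr (5/3) = 1" "?h powr (-5/3) * ?h powr (5/3) = 1"
          proof -
            show "v n powr (-5/3) * v n powr (5/3) = 1" "?h powr (-5/3) * ?h powr (5/3) = 1"
              by (rule powr_53_cancel[OF v(1)], rule powr_53_cancel[OF h])
          qed
          have "v n powr (-5/3) * (2 * pi * R ^ 3) = v n powr (-5/3) * (2 * pi * (R ^ 3 * ?h powr (5/3))) * ?h powr (-5/3)"
            using a(2) by (simp add: mult.assoc mult.commute)
          also have "\<dots> = (v n powr (-5/3) * v n powr (5/3)) * (2 * pi * R powr (-1/3)) * ?h powr (-5/3)"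
            unfolding radius_tail_factor[OF v(1) True] by (simp only: mult_ac)
          finally show ?thesis unfolding a by simp
        qed
        then have "ennreal (v n powr (-5/3)) * ennreal (2 * pi * R ^ 3) * ennreal (exp (- (c * R\<^sup>2))) = ennreal (2 * pi * (R powr (-1/3) * exp (- (c * R\<^sup>2)))) * ennreal (?h powr (-5/3))"
          using True by (simp only: ennreal_mult[symmetric] powr_ge_zero exp_ge_zero mult_nonneg_nonneg pi_ge_zero zero_le_power less_imp_le zero_le_numeral)
             (simp add: mult_ac)
        then show ?thesis using True by (simp add: mult_ac)
      qed simp
    qed
    finally show ?thesis .
  qed
  have "(\<lambda>n. \<integral>\<^sup>+R. ?u n R \<partial>lborel) \<longlonglongrightarrow> (\<integral>\<^sup>+R. ?g R * ennreal tail_const \<partial>lborel)"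
  proof (rule nn_integral_dominated_convergence[where w="\<lambda>R. ?g R * ennreal C"])
    have "(\<integral>\<^sup>+R. ?g R * ennreal C \<partial>lborel) = radius_mass c S * ennreal C"
      unfolding radius_mass_def by (rule nn_integral_multc) measurable
    also have "radius_mass c S \<le> radius_mass c UNIV"
      unfolding radius_mass_def by (intro nn_integral_mono) (auto simp: indicator_def)
    finally show "(\<integral>\<^sup>+R. ?g R * ennreal C \<partial>lborel) < \<infinity>"
      unfolding radius_mass_UNIV[OF c] by (rule order_le_less_trans) (auto intro: mult_right_mono simp: ennreal_mult_less_top)
    show "AE R in lborel. ?u n R \<le> ?g R * ennreal C" for n
    proof (rule AE_I2)
      fix R :: real
      show "?u n R \<le> ?g R * ennreal C"
      proof (cases "R > 0")
        case True
        let ?h = "v n / R\<^sup>2"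
        have h: "?h > 0" using v(1)[of n] True by simp
        have "ennreal (?h powr (-5/3)) * shape_tail ?h \<le> ennreal (?h powr (-5/3)) * ennreal (C * ?h powr (5/3))"
          by (intro mult_left_mono C h) auto
        also have "\<dots> = ennreal (?h powr (-5/3) * (C * ?h powr (5/3)))"
          using C by (intro ennreal_mult[symmetric]) auto
        also have "?h powr (-5/3) * (C * ?h powr (5/3)) = C * (?h powr (-5/3) * ?h powr (5/3))" by (simp only: mult_ac)
        also have "?h powr (-5/3) * ?h powr (5/3) = 1" by (rule powr_53_cancel[OF h])
        finally show ?thesis by (intro mult_left_mono) auto
      qed simp
    qed
    show "AE R in lborel. (\<lambda>n. ?u n R) \<longlonglongrightarrow> ?g R * ennreal tail_const"
    proof (rule AE_I2)
      fix R :: real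
      show "(\<lambda>n. ?u n R) \<longlonglongrightarrow> ?g R * ennreal tail_const"
      proof (cases "R > 0")
        case True
        have "(\<lambda>n. v n / R\<^sup>2) \<longlonglongrightarrow> 0 / R\<^sup>2" using True by (intro tendsto_intros v) auto
        then have "(\<lambda>n. ennreal ((v n / R\<^sup>2) powr (-5/3)) * shape_tail (v n / R\<^sup>2)) \<longlonglongrightarrow> ennreal tail_const"
          using True v(1) by (intro shape_tail_limit) auto
        then show ?thesis by (intro ennreal_tendsto_cmult) (auto simp: ennreal_mult_less_top indicator_def)
      qed simp
    qed
  qed measurable
  then show ?thesis unfolding e radius_mass_def
    by (subst (asm) nn_integral_multc) (measurable, simp add: mult.commute)
qed

section \<open>Empty circumscribed discs\<close>

text \<open>Cramer's rule for the equations \<open>2 * (c \<bullet> y) = norm y ^ 2\<close> and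
  \<open>2 * (c \<bullet> z) = norm z ^ 2\<close>, which express equal distance to 0,
  \<open>y\<close> and \<open>z\<close>.\<close>

definition center0 :: "real^2 \<Rightarrow> real^2 \<Rightarrow> real^2" where
  "center0 y z = mk2 (((norm y)\<^sup>2 * z$2 - (norm z)\<^sup>2 * y$2) / (2 * det2 y z)) (((norm z)\<^sup>2 * y$1 - (norm y)\<^sup>2 * z$1) / (2 * det2 y z))"

lemma measurable_center0 [measurable]:
  assumes [measurable]: "f \<in> borel_measurable M" "g \<in> borel_measurable M"
  shows "(\<lambda>x. center0 (f x) (g x)) \<in> borel_measurable M"
  unfolding center0_def by measurable

lemma equidistant_iff:
  fixes c y :: "real^2"
  shows "norm (c - y) = norm c \<longleftrightarrow> 2 * (c$1 * y$1 + c$2 * y$2) = (norm y)\<^sup>2"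
proof -
  have "norm (c - y) = norm c \<longleftrightarrow> (norm (c - y))\<^sup>2 = (norm c)\<^sup>2" by (simp add: power2_eq_iff_nonneg)
  also have "\<dots> \<longleftrightarrow> 2 * (c$1 * y$1 + c$2 * y$2) = (norm y)\<^sup>2"
    unfolding norm2_sq by (auto simp add: power2_eq_square algebra_simps)
  finally show ?thesis .
qed

lemma center0_equidistant:
  assumes "det2 y z \<noteq> 0"
  shows "norm (center0 y z - y) = norm (center0 y z)" "norm (center0 y z - z) = norm (center0 y z)"
proof -
  define d where "d = det2 y z"
  have d: "d \<noteq> 0" using assms by (simp add: d_def)
  define P where "P = (norm y)\<^sup>2 * z$2 - (norm z)\<^sup>2 * y$2"
  define Q where "Q = (norm z)\<^sup>2 * y$1 - (norm y)\<^sup>2 * z$1"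
  have c: "center0 y z $ 1 = P / (2 * d)" "center0 y z $ 2 = Q / (2 * d)" by (simp_all add: center0_def P_def Q_def d_def)
  have "P * y$1 + Q * y$2 = (norm y)\<^sup>2 * d" "P * z$1 + Q * z$2 = (norm z)\<^sup>2 * d"
    by (simp_all add: P_def Q_def d_def det2_def algebra_simps)
  moreover have "2 * (P / (2 * d) * a + Q / (2 * d) * b) = (P * a + Q * b) / d" for a b
    using d by (simp add: field_simps)
  ultimately show "norm (center0 y z - y) = norm (center0 y z)" "norm (center0 y z - z) = norm (center0 y z)"
    unfolding equidistant_iff c using d by simp_all
qed

lemma center0_unique:
  assumes "det2 y z \<noteq> 0" "norm (c - y) = norm c" "norm (c - z) = norm c"
  shows "c = center0 y z"
proof -
  have a: "2 * (c$1 * y$1 + c$2 * y$2) = (norm y)\<^sup>2" "2 * (c$1 * z$1 + c$2 * z$2) = (norm z)\<^sup>2"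
    using assms(2,3) by (simp_all only: equidistant_iff)
  have "c$1 * (2 * det2 y z) = (norm y)\<^sup>2 * z$2 - (norm z)\<^sup>2 * y$2" "c$2 * (2 * det2 y z) = (norm z)\<^sup>2 * y$1 - (norm y)\<^sup>2 * z$1"
    unfolding a[symmetric] det2_def by (simp_all add: algebra_simps)
  then show ?thesis using assms(1) by (simp add: vec_eq_iff forall_2 center0_def eq_divide_eq)
qed

text \<open>After squaring, both sides have the denominator \<open>(2 * det2 y z)^2\<close>, and the
  numerators agree as polynomials in the coordinates.\<close>

lemma norm_center0:
  assumes "det2 y z \<noteq> 0"
  shows "norm (center0 y z) = circrad y z"
proof (rule power2_eq_imp_eq)
  have "(norm (center0 y z))\<^sup>2 = (((norm y)\<^sup>2 * z$2 - (norm z)\<^sup>2 * y$2)\<^sup>2 + ((norm z)\<^sup>2 * y$1 - (norm y)\<^sup>2 * z$1)\<^sup>2) / (2 * det2 y z)\<^sup>2"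
    unfolding norm2_sq[of "center0 y z"] by (simp add: center0_def power_divide add_divide_distrib)
  also have "((norm y)\<^sup>2 * z$2 - (norm z)\<^sup>2 * y$2)\<^sup>2 + ((norm z)\<^sup>2 * y$1 - (norm y)\<^sup>2 * z$1)\<^sup>2 = (norm y)\<^sup>2 * (norm z)\<^sup>2 * (norm (z - y))\<^sup>2"
    unfolding norm2_sq vector_minus_component by algebra
  finally show "(norm (center0 y z))\<^sup>2 = (circrad y z)\<^sup>2"
    by (simp add: circrad_def power_divide power_mult_distrib)
qed (auto simp: circrad_def)

lemma det2_zero_collinear:
  "det2 (y - x) (z - x) = 0 \<longleftrightarrow> collinear {x, y, z}"
proof -
  have "det2 a b = 0 \<longleftrightarrow> (a = 0 \<or> b = 0 \<or> (\<exists>c. b = c *\<^sub>R a))" for a b :: "real^2"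
  proof
    assume d: "det2 a b = 0"
    show "a = 0 \<or> b = 0 \<or> (\<exists>c. b = c *\<^sub>R a)"
    proof (cases "a = 0")
      case False
      then have "a$1 \<noteq> 0 \<or> a$2 \<noteq> 0" by (auto simp: vec_eq_iff forall_2)
      then show ?thesis
      proof
        assume "a$1 \<noteq> 0"
        then have "b = (b$1 / a$1) *\<^sub>R a" using d by (auto simp: vec_eq_iff forall_2 det2_def field_simps)
        then show ?thesis by blast
      next
        assume "a$2 \<noteq> 0"
        then have "b = (b$2 / a$2) *\<^sub>R a" using d by (auto simp: vec_eq_iff forall_2 det2_def field_simps)
        then show ?thesis by blast
      qed
    qed simp
  qed (auto simp: det2_def)
  then have "det2 (y - x) (z - x) = 0 \<longleftrightarrow> collinear {0, y - x, z - x}"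
    unfolding collinear_lemma by simp
  also have "\<dots> \<longleftrightarrow> collinear {y, x, z}" using collinear_3[of y x z] by simp
  also have "{y, x, z} = {x, y, z}" by auto
  finally show ?thesis .
qed

definition ccenter :: "real^2 \<Rightarrow> real^2 \<Rightarrow> real^2 \<Rightarrow> real^2" where "ccenter x y z = x + center0 (y - x) (z - x)"
definition crad :: "real^2 \<Rightarrow> real^2 \<Rightarrow> real^2 \<Rightarrow> real" where "crad x y z = circrad (y - x) (z - x)"
definition tarea :: "real^2 \<Rightarrow> real^2 \<Rightarrow> real^2 \<Rightarrow> real" where "tarea x y z = \<bar>det2 (y - x) (z - x)\<bar> / 2"

lemma measurable_triangle [measurable]:
  assumes [measurable]: "f \<in> borel_measurable M" "g \<in> borel_measurable M" "h \<in> borel_measurable M"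
  shows "(\<lambda>x. ccenter (f x) (g x) (h x)) \<in> borel_measurable M"
    "(\<lambda>x. crad (f x) (g x) (h x)) \<in> borel_measurable M"
    "(\<lambda>x. tarea (f x) (g x) (h x)) \<in> borel_measurable M"
  unfolding ccenter_def crad_def tarea_def by measurable

lemma sphere_ccenter:
  assumes "\<not> collinear {x, y, z}"
  shows "{x, y, z} \<subseteq> sphere (ccenter x y z) (crad x y z)"
proof -
  have d: "det2 (y - x) (z - x) \<noteq> 0" using assms det2_zero_collinear by simp
  have e: "ccenter x y z - x = center0 (y - x) (z - x)" "ccenter x y z - y = center0 (y - x) (z - x) - (y - x)"
    "ccenter x y z - z = center0 (y - x) (z - x) - (z - x)"
    by (simp_all add: ccenter_def)
  have "norm (ccenter x y z - x) = crad x y z" "norm (ccenter x y z - y) = crad x y z" "norm (ccenter x y z - z) = crad x y z"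
    unfolding e by (simp_all only: center0_equidistant[OF d] norm_center0[OF d] crad_def)
  then show ?thesis by (simp add: dist_norm)
qed

lemma sphere_unique:
  assumes nc: "\<not> collinear {x, y, z}" and s: "{x, y, z} \<subseteq> sphere c r"
  shows "c = ccenter x y z" "r = crad x y z"
proof -
  have d: "det2 (y - x) (z - x) \<noteq> 0" using nc det2_zero_collinear by simp
  have n: "norm (c - x) = r" "norm (c - y) = r" "norm (c - z) = r" using s by (auto simp: dist_norm)
  have "c - x = center0 (y - x) (z - x)"
    by (rule center0_unique[OF d]) (use n in simp_all)
  then show c: "c = ccenter x y z" by (simp add: ccenter_def algebra_simps)
  have "dist (ccenter x y z) x = crad x y z" using sphere_ccenter[OF nc] by auto
  then show "r = crad x y z" using n(1) c by (simp add: dist_norm)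
qed

text \<open>A line meets a circle at most twice: if \<open>z - x\<close> is \<open>t\<close> times
  \<open>y - x\<close>, equal distances force \<open>t = t^2\<close>, so \<open>z\<close> would be
  \<open>x\<close> or \<open>y\<close>.\<close>

lemma sphere_not_collinear:
  fixes x y z c :: "real^2"
  assumes s: "{x, y, z} \<subseteq> sphere c r" and d: "x \<noteq> y" "y \<noteq> z" "x \<noteq> z"
  shows "\<not> collinear {x, y, z}"
proof
  assume "collinear {x, y, z}"
  then have "collinear {y, x, z}" by (simp add: insert_commute)
  then have "collinear {0, y - x, z - x}" using collinear_3[of y x z] by simp
  then obtain t where t: "z - x = t *\<^sub>R (y - x)" using d unfolding collinear_lemma by auto
  define a where "a = c - x"
  define u where "u = y - x"
  have n: "norm a = r" "norm (a - u) = r" "norm (a - t *\<^sub>R u) = r"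
    using s t unfolding a_def u_def t[symmetric] by (auto simp: dist_norm)
  have e1: "2 * (a$1 * u$1 + a$2 * u$2) = (norm u)\<^sup>2" using n equidistant_iff[of a u] by simp
  have "2 * (a$1 * (t * u$1) + a$2 * (t * u$2)) = (norm (t *\<^sub>R u))\<^sup>2" using n equidistant_iff[of a "t *\<^sub>R u"] by simp
  then have "t * (2 * (a$1 * u$1 + a$2 * u$2)) = t\<^sup>2 * (norm u)\<^sup>2" by (simp add: power_mult_distrib algebra_simps)
  then have "t * (norm u)\<^sup>2 = t\<^sup>2 * (norm u)\<^sup>2" unfolding e1 .
  moreover have "norm u \<noteq> 0" using d by (simp add: u_def)
  ultimately have "t = 0 \<or> t = 1" by (auto simp: power2_eq_square)
  then show False using t d by auto
qed

lemma extreme_points_triangle: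
  assumes "\<not> collinear {x, y, z :: real^2}"
  shows "p extreme_point_of convex hull {x, y, z} \<longleftrightarrow> p \<in> {x, y, z}"
proof -
  have "\<not> affine_dependent {x, y, z}" using assms collinear_3_eq_affine_dependent[of x y z] by auto
  then show ?thesis by (rule extreme_point_of_convex_hull_affine_independent)
qed

lemma circumcenter_triangle:
  assumes nc: "\<not> collinear {x, y, z}"
  shows "circumcenter (convex hull {x, y, z}) = ccenter x y z"
  unfolding circumcenter_def extreme_points_triangle[OF nc]
proof (rule the_equality)
  show "\<exists>r. \<forall>p. p \<in> {x, y, z} \<longrightarrow> dist (ccenter x y z) p = r"
    using sphere_ccenter[OF nc] by auto
  fix c assume "\<exists>r. \<forall>p. p \<in> {x, y, z} \<longrightarrow> dist c p = r"
  then obtain r where "{x, y, z} \<subseteq> sphere c r" by auto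
  then show "c = ccenter x y z" by (rule sphere_unique[OF nc])
qed

lemma emeasure_triangle: "emeasure lborel (convex hull {x, y, z}) = ennreal (tarea x y z)"
proof -
  have b: "bounded (convex hull {x, y, z})" by (simp add: bounded_convex_hull finite_imp_bounded)
  then have "emeasure lborel (convex hull {x, y, z}) = ennreal (measure lborel (convex hull {x, y, z}))"
    using emeasure_bounded_finite[OF b] by (intro emeasure_eq_ennreal_measure) auto
  then show ?thesis unfolding content_triangle tarea_def det2_def
    by (simp add: abs_minus_commute mult.commute) 
qed

text \<open>Explicit centre and radius, in place of an existential quantifier over circles, make the
  condition visibly measurable.\<close>

definition empty_triple :: "(real^2) set \<Rightarrow> real^2 \<Rightarrow> real^2 \<Rightarrow> real^2 \<Rightarrow> bool" where
  "empty_triple \<xi> x y z \<longleftrightarrow> \<not> collinear {x, y, z} \<and> \<xi> \<inter> ball (ccenter x y z) (crad x y z) = {}"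

text \<open>The right-hand side depends on the set \<open>{x, y, z}\<close> alone, which gives
  invariance under reordering of the vertices.\<close>

lemma empty_triple_sphere:
  "empty_triple \<xi> x y z \<and> ccenter x y z \<in> B \<longleftrightarrow>
    \<not> collinear {x, y, z} \<and> (\<exists>c r. {x, y, z} \<subseteq> sphere c r \<and> c \<in> B \<and> \<xi> \<inter> ball c r = {})"
  using sphere_ccenter[of x y z] sphere_unique[of x y z] unfolding empty_triple_def by metis

lemma delaunay_cells_triples:
  "delaunay_cells \<xi> = {convex hull {x, y, z} | x y z. x \<in> \<xi> \<and> y \<in> \<xi> \<and> z \<in> \<xi> \<and> empty_triple \<xi> x y z}" (is "_ = ?R")
proof (intro equalityI subsetI)
  fix C assume "C \<in> delaunay_cells \<xi>"
  then obtain x y z c r where *: "C = convex hull {x, y, z}" "x \<in> \<xi>" "y \<in> \<xi>" "z \<in> \<xi>" "x \<noteq> y" "y \<noteq> z" "x \<noteq> z"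
    "{x, y, z} \<subseteq> sphere c r" "\<xi> \<inter> ball c r = {}"
    unfolding delaunay_cells_def mem_Collect_eq by (elim exE conjE) (rule that)
  have nc: "\<not> collinear {x, y, z}" using sphere_not_collinear * by blast
  have "empty_triple \<xi> x y z" using nc sphere_unique[OF nc *(8)] *(9) by (simp add: empty_triple_def)
  then show "C \<in> ?R" using * by blast
next
  fix C assume "C \<in> ?R"
  then obtain x y z where *: "C = convex hull {x, y, z}" "x \<in> \<xi>" "y \<in> \<xi>" "z \<in> \<xi>" "empty_triple \<xi> x y z" by auto
  then have nc: "\<not> collinear {x, y, z}" by (simp add: empty_triple_def)
  then have "x \<noteq> y" "y \<noteq> z" "x \<noteq> z" by (auto simp: insert_commute)
  moreover have "{x, y, z} \<subseteq> sphere (ccenter x y z) (crad x y z)" by (rule sphere_ccenter[OF nc])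
  moreover have "\<xi> \<inter> ball (ccenter x y z) (crad x y z) = {}" using * by (simp add: empty_triple_def)
  ultimately show "C \<in> delaunay_cells \<xi>" unfolding delaunay_cells_def mem_Collect_eq using *(1-4) by blast
qed

section \<open>Cells and ordered triples\<close>

definition triples :: "(real^2) set \<Rightarrow> (real^2) set \<Rightarrow> ((real^2) \<times> (real^2) \<times> (real^2)) set" where
  "triples \<xi> B = {(x, y, z). x \<in> \<xi> \<and> y \<in> \<xi> \<and> z \<in> \<xi> \<and> empty_triple \<xi> x y z \<and> ccenter x y z \<in> B}"

lemma emeasure_count_fibres:
  assumes im: "h ` A = B" and fib: "\<And>b. b \<in> B \<Longrightarrow> card {a\<in>A. h a = b} = k" and k: "k > 0"
  shows "emeasure (count_space UNIV) A = of_nat k * emeasure (count_space UNIV) B"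
proof (cases "finite B")
  case True
  have fin: "finite {a\<in>A. h a = b}" if "b \<in> B" for b using fib[OF that] k by (intro card_ge_0_finite) simp
  have A: "A = (\<Union>b\<in>B. {a\<in>A. h a = b})" using im by auto
  have "finite A" by (subst A) (use True fin in auto)
  have "card A = (\<Sum>b\<in>B. card {a\<in>A. h a = b})"
    by (subst A, subst card_UN_disjoint) (use True fin in auto)
  then have "card A = k * card B" using fib by simp
  then show ?thesis using True \<open>finite A\<close> by (simp add: emeasure_count_space)
next
  case False
  then have "infinite A" using im by auto
  then show ?thesis using False k by (simp add: emeasure_count_space ennreal_mult_eq_top_iff)
qed

lemma card_orderings:
  assumes "x \<noteq> y" "y \<noteq> z" "x \<noteq> (z::'a)"
  shows "card {(a, b, c). {a, b, c} = {x, y, z}} = 6"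
proof -
  have "{(a, b, c). {a, b, c} = {x, y, z}} = {(x,y,z), (x,z,y), (y,x,z), (y,z,x), (z,x,y), (z,y,x)}"
  proof (intro equalityI subsetI)
    fix t assume "t \<in> {(a, b, c). {a, b, c} = {x, y, z}}"
    then obtain a b c where t: "t = (a, b, c)" "{a, b, c} = {x, y, z}" by auto
    have "card {x, y, z} = 3" using assms by simp
    then have "card {a, b, c} = 3" by (simp only: t(2))
    then have d: "a \<noteq> b" "b \<noteq> c" "a \<noteq> c" by (auto simp: card_insert_if split: if_splits)
    have "a \<in> {x, y, z}" "b \<in> {x, y, z}" "c \<in> {x, y, z}" unfolding t(2)[symmetric] by simp_all
    then have "a = x \<or> a = y \<or> a = z" "b = x \<or> b = y \<or> b = z" "c = x \<or> c = y \<or> c = z" by simp_all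
    then show "t \<in> {(x,y,z), (x,z,y), (y,x,z), (y,z,x), (z,x,y), (z,y,x)}"
      unfolding t(1) by (elim disjE; use d in simp)
  next
    fix t assume "t \<in> {(x,y,z), (x,z,y), (y,x,z), (y,z,x), (z,x,y), (z,y,x)}"
    then have "t = (x,y,z) \<or> t = (x,z,y) \<or> t = (y,x,z) \<or> t = (y,z,x) \<or> t = (z,x,y) \<or> t = (z,y,x)" by simp
    then show "t \<in> {(a, b, c). {a, b, c} = {x, y, z}}" by (elim disjE; simp; blast)
  qed
  then show ?thesis using assms by auto
qed

text \<open>A hull determines its vertices as extreme points, so the triples over one cell are
  exactly the six orderings of its vertex set.\<close>

lemma triples_cells:
  "emeasure (count_space UNIV) (triples \<xi> B) = 6 * emeasure (count_space UNIV) {C \<in> delaunay_cells \<xi>. circumcenter C \<in> B}"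
proof -
  let ?h = "\<lambda>(x, y, z). convex hull {x, y, z :: real^2}"
  let ?C = "{C \<in> delaunay_cells \<xi>. circumcenter C \<in> B}"
  have cc: "circumcenter (convex hull {x, y, z}) = ccenter x y z" if "empty_triple \<xi> x y z" for x y z
    using that circumcenter_triangle by (simp add: empty_triple_def)
  have im: "?h ` triples \<xi> B = ?C"
  proof (intro equalityI subsetI)
    fix C assume "C \<in> ?h ` triples \<xi> B"
    then obtain x y z where "C = convex hull {x, y, z}" "x \<in> \<xi>" "y \<in> \<xi>" "z \<in> \<xi>" "empty_triple \<xi> x y z" "ccenter x y z \<in> B"
      by (auto simp: triples_def)
    then show "C \<in> ?C" using cc unfolding delaunay_cells_triples by auto
  next
    fix C assume "C \<in> ?C"
    then obtain x y z where "C = convex hull {x, y, z}" "x \<in> \<xi>" "y \<in> \<xi>" "z \<in> \<xi>" "empty_triple \<xi> x y z" "circumcenter C \<in> B"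
      unfolding delaunay_cells_triples by auto
    then show "C \<in> ?h ` triples \<xi> B" using cc by (intro image_eqI[of _ _ "(x, y, z)"]) (auto simp: triples_def)
  qed
  have "card {t \<in> triples \<xi> B. ?h t = C} = 6" if "C \<in> ?C" for C
  proof -
    from that have "C \<in> ?h ` triples \<xi> B" unfolding im .
    then obtain t where t: "C = ?h t" "t \<in> triples \<xi> B" by (rule imageE)
    obtain x y z where "t = (x, y, z)" by (cases t)
    with t have xyz: "(x, y, z) \<in> triples \<xi> B" "C = convex hull {x, y, z}" by auto
    then have nc: "\<not> collinear {x, y, z}" by (auto simp: triples_def empty_triple_def)
    then have d: "x \<noteq> y" "y \<noteq> z" "x \<noteq> z" by (auto simp: insert_commute)
    have "{t \<in> triples \<xi> B. ?h t = C} = {(a, b, c). {a, b, c} = {x, y, z}}"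
    proof (intro equalityI subsetI)
      fix t assume t: "t \<in> {t \<in> triples \<xi> B. ?h t = C}"
      obtain a b c where abc: "t = (a, b, c)" by (cases t)
      have nc': "\<not> collinear {a, b, c}" and h: "convex hull {a, b, c} = C" using t by (auto simp: abc triples_def empty_triple_def)
      have "p \<in> {a, b, c} \<longleftrightarrow> p \<in> {x, y, z}" for p
        using extreme_points_triangle[OF nc, of p] extreme_points_triangle[OF nc', of p] h xyz(2) by simp
      then show "t \<in> {(a, b, c). {a, b, c} = {x, y, z}}" unfolding abc by blast
    next
      fix t assume "t \<in> {(a, b, c). {a, b, c} = {x, y, z}}"
      then obtain a b c where abc: "t = (a, b, c)" "{a, b, c} = {x, y, z}" by auto
      have "{x, y, z} \<subseteq> \<xi>" "empty_triple \<xi> x y z \<and> ccenter x y z \<in> B" using xyz(1) by (auto simp: triples_def)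
      then have "{a, b, c} \<subseteq> \<xi>" "empty_triple \<xi> a b c \<and> ccenter a b c \<in> B"
        unfolding empty_triple_sphere abc(2) by auto
      then show "t \<in> {t \<in> triples \<xi> B. ?h t = C}" using abc xyz(2) by (auto simp: triples_def)
    qed
    then show ?thesis using card_orderings[OF d] by simp
  qed
  then have "emeasure (count_space UNIV) (triples \<xi> B) = of_nat 6 * emeasure (count_space UNIV) ?C"
    by (intro emeasure_count_fibres[OF im]) auto
  then show ?thesis by simp
qed

text \<open>The nested removal of points matches three applications of the Mecke formula and builds
  in that the points are distinct.\<close>

definition triple_sum :: "'a set \<Rightarrow> ('a \<Rightarrow> 'a \<Rightarrow> 'a \<Rightarrow> ennreal) \<Rightarrow> ennreal" where
  "triple_sum \<xi> f = point_sum \<xi> (\<lambda>x. point_sum (\<xi> - {x}) (\<lambda>y. point_sum (\<xi> - {x} - {y}) (\<lambda>z. f x y z)))"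

lemma triple_sum_count:
  "triple_sum \<xi> f = (\<integral>\<^sup>+(x, y, z). f x y z * indicator {(x, y, z). x \<in> \<xi> \<and> y \<in> \<xi> \<and> z \<in> \<xi> \<and> x \<noteq> y \<and> y \<noteq> z \<and> x \<noteq> z} (x, y, z) \<partial>count_space UNIV)"
proof -
  let ?I = "\<lambda>x y z. indicator {(x, y, z). x \<in> \<xi> \<and> y \<in> \<xi> \<and> z \<in> \<xi> \<and> x \<noteq> y \<and> y \<noteq> z \<and> x \<noteq> z} (x, y, z) :: ennreal"
  have "triple_sum \<xi> f = (\<integral>\<^sup>+x. \<integral>\<^sup>+y. \<integral>\<^sup>+z. f x y z * ?I x y z \<partial>count_space UNIV \<partial>count_space UNIV \<partial>count_space UNIV)"
    unfolding triple_sum_def point_sum_indicator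
  proof (rule nn_integral_cong)
    fix x
    have "(\<integral>\<^sup>+y. (\<integral>\<^sup>+z. f x y z * indicator (\<xi> - {x} - {y}) z \<partial>count_space UNIV) * indicator (\<xi> - {x}) y \<partial>count_space UNIV) * indicator \<xi> x =
      (\<integral>\<^sup>+y. (\<integral>\<^sup>+z. f x y z * indicator (\<xi> - {x} - {y}) z \<partial>count_space UNIV) * indicator (\<xi> - {x}) y * indicator \<xi> x \<partial>count_space UNIV)"
      by (rule nn_integral_multc[symmetric]) simp
    also have "\<dots> = (\<integral>\<^sup>+y. (\<integral>\<^sup>+z. f x y z * indicator (\<xi> - {x} - {y}) z * (indicator (\<xi> - {x}) y * indicator \<xi> x) \<partial>count_space UNIV) \<partial>count_space UNIV)"
      unfolding mult.assoc[of _ "indicator (\<xi> - {x}) _"] by (rule nn_integral_cong, rule nn_integral_multc[symmetric]) simp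
    also have "\<dots> = (\<integral>\<^sup>+y. \<integral>\<^sup>+z. f x y z * ?I x y z \<partial>count_space UNIV \<partial>count_space UNIV)"
      by (rule nn_integral_cong, rule nn_integral_cong) (auto simp: indicator_def)
    finally show "(\<integral>\<^sup>+y. (\<integral>\<^sup>+z. f x y z * indicator (\<xi> - {x} - {y}) z \<partial>count_space UNIV) * indicator (\<xi> - {x}) y \<partial>count_space UNIV) * indicator \<xi> x = (\<integral>\<^sup>+y. \<integral>\<^sup>+z. f x y z * ?I x y z \<partial>count_space UNIV \<partial>count_space UNIV)" .
  qed
  also have "\<dots> = (\<integral>\<^sup>+x. \<integral>\<^sup>+q. (case q of (y, z) \<Rightarrow> f x y z * ?I x y z) \<partial>count_space UNIV \<partial>count_space UNIV)"
    by (subst nn_integral_fst_count_space[symmetric]) simp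
  also have "\<dots> = (\<integral>\<^sup>+(x, y, z). f x y z * ?I x y z \<partial>count_space UNIV)"
    by (subst nn_integral_fst_count_space[symmetric]) simp
  finally show ?thesis .
qed

lemma triple_sum_empty_triples:
  "triple_sum \<xi> (\<lambda>x y z. if empty_triple \<xi> x y z \<and> ccenter x y z \<in> B then 1 else 0) = emeasure (count_space UNIV) (triples \<xi> B)"
proof -
  have d: "x \<noteq> y \<and> y \<noteq> z \<and> x \<noteq> z" if "empty_triple \<xi> x y z" for x y z
    using that by (auto simp: empty_triple_def insert_commute)
  have "triple_sum \<xi> (\<lambda>x y z. if empty_triple \<xi> x y z \<and> ccenter x y z \<in> B then 1 else 0) = (\<integral>\<^sup>+t. indicator (triples \<xi> B) t \<partial>count_space UNIV)"
    unfolding triple_sum_count by (rule nn_integral_cong) (auto simp: triples_def indicator_def split: if_splits dest: d)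
  then show ?thesis by simp
qed

text \<open>An infimum is at least a bound iff every member is; this also covers a window without
  nuclei, where the value is infinity.\<close>

lemma min_area_iff:
  assumes c: "c > 0" and t: "t \<ge> 0"
  shows "ennreal c * min_area (delaunay_cells \<xi>) \<rho> \<ge> ennreal t \<longleftrightarrow>
    \<not> (\<exists>x\<in>\<xi>. \<exists>y\<in>\<xi>. \<exists>z\<in>\<xi>. empty_triple \<xi> x y z \<and> ccenter x y z \<in> window \<rho> \<and> tarea x y z < t / c)"
proof -
  have e: "ennreal t \<le> ennreal c * a \<longleftrightarrow> ennreal (t / c) \<le> a" for a
  proof (cases a)
    case (real r)
    have "ennreal t \<le> ennreal c * a \<longleftrightarrow> t \<le> c * r" using real c by (simp add: ennreal_mult[symmetric])
    also have "\<dots> \<longleftrightarrow> t / c \<le> r" using c by (simp add: divide_le_eq mult.commute)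
    finally show ?thesis using real by simp
  next
    case top
    then show ?thesis using c by (simp add: ennreal_mult_top)
  qed
  have "ennreal c * min_area (delaunay_cells \<xi>) \<rho> \<ge> ennreal t \<longleftrightarrow> (\<forall>C\<in>delaunay_cells \<xi>. circumcenter C \<in> window \<rho> \<longrightarrow> ennreal (t / c) \<le> emeasure lborel C)"
    unfolding e min_area_def le_INF_iff by auto
  also have "\<dots> \<longleftrightarrow> (\<forall>x\<in>\<xi>. \<forall>y\<in>\<xi>. \<forall>z\<in>\<xi>. empty_triple \<xi> x y z \<longrightarrow> ccenter x y z \<in> window \<rho> \<longrightarrow> t / c \<le> tarea x y z)"
  proof -
    have "circumcenter (convex hull {x, y, z}) = ccenter x y z" if "empty_triple \<xi> x y z" for x y z
      using that circumcenter_triangle by (simp add: empty_triple_def)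
    moreover have "0 \<le> tarea x y z" for x y z by (simp add: tarea_def)
    ultimately have E: "(circumcenter (convex hull {x, y, z}) \<in> window \<rho> \<longrightarrow> ennreal (t / c) \<le> emeasure lborel (convex hull {x, y, z})) \<longleftrightarrow>
      (ccenter x y z \<in> window \<rho> \<longrightarrow> t / c \<le> tarea x y z)" if "empty_triple \<xi> x y z" for x y z
      using that by (simp add: emeasure_triangle)
    show ?thesis unfolding delaunay_cells_triples
    proof (intro iffI ballI impI)
      fix x y z assume H: "\<forall>C\<in>{convex hull {x, y, z} |x y z. x \<in> \<xi> \<and> y \<in> \<xi> \<and> z \<in> \<xi> \<and> empty_triple \<xi> x y z}.
          circumcenter C \<in> window \<rho> \<longrightarrow> ennreal (t / c) \<le> emeasure lborel C"
        and m: "x \<in> \<xi>" "y \<in> \<xi>" "z \<in> \<xi>" "empty_triple \<xi> x y z" "ccenter x y z \<in> window \<rho>"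
      have "convex hull {x, y, z} \<in> {convex hull {x, y, z} |x y z. x \<in> \<xi> \<and> y \<in> \<xi> \<and> z \<in> \<xi> \<and> empty_triple \<xi> x y z}"
        using m by blast
      from bspec[OF H this] show "t / c \<le> tarea x y z" using E[OF m(4)] m(5) by blast
    next
      fix C assume H: "\<forall>x\<in>\<xi>. \<forall>y\<in>\<xi>. \<forall>z\<in>\<xi>. empty_triple \<xi> x y z \<longrightarrow> ccenter x y z \<in> window \<rho> \<longrightarrow> t / c \<le> tarea x y z"
        and C: "C \<in> {convex hull {x, y, z} |x y z. x \<in> \<xi> \<and> y \<in> \<xi> \<and> z \<in> \<xi> \<and> empty_triple \<xi> x y z}" "circumcenter C \<in> window \<rho>"
      from C(1) obtain x y z where m: "C = convex hull {x, y, z}" "x \<in> \<xi>" "y \<in> \<xi>" "z \<in> \<xi>" "empty_triple \<xi> x y z"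
        unfolding mem_Collect_eq by (elim exE conjE) (rule that)
      show "ennreal (t / c) \<le> emeasure lborel C" using E[OF m(5)] H m C(2) by blast
    qed
  qed
  finally show ?thesis by (auto simp: not_less)
qed

section \<open>Expected numbers of cells\<close>

lemma nn_integral_translate:
  fixes g :: "'a::euclidean_space \<Rightarrow> ennreal"
  assumes [measurable]: "g \<in> borel_measurable borel"
  shows "(\<integral>\<^sup>+y. g (y - x) \<partial>lborel) = (\<integral>\<^sup>+y. g y \<partial>lborel)"
proof -
  have "(\<integral>\<^sup>+y. g y \<partial>lborel) = (\<integral>\<^sup>+y. g y \<partial>distr lborel borel ((+) (- x)))"
    unfolding lborel_distr_plus ..
  also have "\<dots> = (\<integral>\<^sup>+y. g (y - x) \<partial>lborel)"
    by (subst nn_integral_distr) auto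
  finally show ?thesis ..
qed

lemma emeasure_translate:
  assumes [measurable]: "B \<in> sets borel"
  shows "(\<integral>\<^sup>+x. indicator B (x + c) \<partial>lborel) = emeasure lborel (B :: 'a::euclidean_space set)"
  using nn_integral_translate[of "indicator B" "- c"] by simp

text \<open>An open ball is the union of the balls of radius \<open>1 / Suc n\<close> around those
  points \<open>q\<close> of a countable dense set with \<open>dist c q + 1 / Suc n \<le> R\<close>.
  Emptiness thus becomes a countable conjunction of conditions on counts.\<close>

lemma ball_disjoint_measurable [measurable]:
  fixes f :: "'p \<Rightarrow> 'b::euclidean_space"
  assumes [measurable]: "f \<in> borel_measurable N" "g \<in> borel_measurable N" and h [measurable]: "h \<in> measurable N cfg"
  shows "Measurable.pred N (\<lambda>x. h x \<inter> ball (f x) (g x) = {})"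
proof -
  obtain D :: "'b set" where D: "countable D" "\<And>X. open X \<Longrightarrow> X \<noteq> {} \<Longrightarrow> \<exists>d\<in>D. d \<in> X"
    by (rule countable_dense_setE) blast
  have m: "(\<lambda>x. card (h x \<inter> ball q r)) \<in> measurable N (count_space UNIV)" for q r
    by (rule measurable_compose[OF h measurable_card_Int]) auto
  have eq: "\<xi> \<inter> ball c R = {} \<longleftrightarrow> (\<forall>q\<in>D. \<forall>n::nat. dist c q + 1 / Suc n \<le> R \<longrightarrow> card (\<xi> \<inter> ball q (1 / Suc n)) = 0)"
    if \<xi>: "\<xi> \<in> lfin" for \<xi> c R
  proof
    assume e: "\<xi> \<inter> ball c R = {}"
    show "\<forall>q\<in>D. \<forall>n::nat. dist c q + 1 / Suc n \<le> R \<longrightarrow> card (\<xi> \<inter> ball q (1 / Suc n)) = 0"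
    proof (intro ballI allI impI)
      fix q n assume le: "dist c q + 1 / Suc n \<le> R"
      have "ball q (1 / Suc n) \<subseteq> ball c R"
      proof
        fix y assume "y \<in> ball q (1 / Suc n)"
        then show "y \<in> ball c R" using dist_triangle[of c y q] le by (simp add: dist_commute)
      qed
      then have "\<xi> \<inter> ball q (1 / Suc n) = {}" using e by blast
      then show "card (\<xi> \<inter> ball q (1 / Suc n)) = 0" by simp
    qed
  next
    assume a: "\<forall>q\<in>D. \<forall>n::nat. dist c q + 1 / Suc n \<le> R \<longrightarrow> card (\<xi> \<inter> ball q (1 / Suc n)) = 0"
    show "\<xi> \<inter> ball c R = {}"
    proof (rule ccontr)
      assume "\<xi> \<inter> ball c R \<noteq> {}"
      then obtain y where y: "y \<in> \<xi>" "dist c y < R" by auto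
      obtain n where n: "1 / Suc n < (R - dist c y) / 2" using y nat_approx_posE[of "(R - dist c y) / 2"] by auto
      obtain q where q: "q \<in> D" "dist y q < 1 / Suc n" using D(2)[of "ball y (1 / Suc n)"] by auto
      have "dist c q + 1 / Suc n \<le> R" 
      proof -
        have "2 * (1 / Suc n) < R - dist c y" using n by simp
        moreover have "A + e \<le> R'" if "A \<le> B + C" "2 * e < R' - B" "C < e" for A B C e R' :: real
          using that by simp
        ultimately show ?thesis using dist_triangle[of c q y] q(2) by blast
      qed
      then have "card (\<xi> \<inter> ball q (1 / Suc n)) = 0" using a q(1) by blast
      then have "\<xi> \<inter> ball q (1 / Suc n) = {}" using lfin_finite[OF \<xi>, of "ball q (1 / Suc n)"] by auto
      then show False using y(1) q(2) by (auto simp: dist_commute)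
    qed
  qed
  have "Measurable.pred N (\<lambda>x. \<forall>q\<in>D. \<forall>n::nat. dist (f x) q + 1 / Suc n \<le> g x \<longrightarrow> card (h x \<inter> ball q (1 / Suc n)) = 0)"
  proof -
    have mm: "Measurable.pred N (\<lambda>x. dist (f x) q + 1 / Suc n \<le> g x \<longrightarrow> card (h x \<inter> ball q (1 / Suc n)) = 0)" for q n
    proof -
      note [measurable] = m[of q "1 / Suc n"]
      show ?thesis by measurable
    qed
    show ?thesis
      unfolding pred_def using D(1)
      by (intro sets.sets_Collect_countable_All' sets.sets_Collect_countable_All mm[unfolded pred_def])
  qed
  also have "?this \<longleftrightarrow> ?thesis"
    by (rule measurable_cong) (use eq measurable_space[OF h] in auto)
  finally show ?thesis .
qed

lemma empty_triple_det2:
  "empty_triple \<xi> x y z \<longleftrightarrow> det2 (y - x) (z - x) \<noteq> 0 \<and> \<xi> \<inter> ball (ccenter x y z) (crad x y z) = {}"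
  unfolding empty_triple_def det2_zero_collinear ..

lemma empty_triple_measurable [measurable]:
  assumes [measurable]: "f \<in> borel_measurable N" "g \<in> borel_measurable N" "h \<in> borel_measurable N" "k \<in> measurable N cfg"
  shows "Measurable.pred N (\<lambda>p. empty_triple (k p) (f p) (g p) (h p))"
  unfolding empty_triple_det2 by measurable

text \<open>The vertices lie on the boundary circle, outside the open disc. So the condition can be
  read off the configuration without the three points, as the Mecke formula requires.\<close>

lemma empty_triple_diff:
  "empty_triple (\<xi> - {x} - {y} - {z}) x y z \<longleftrightarrow> empty_triple \<xi> x y z"
  using sphere_ccenter[of x y z] unfolding empty_triple_def by auto

lemma point_sum_param_measurable:
  assumes "f \<in> borel_measurable (borel \<Otimes>\<^sub>M cfg)"
  shows "(\<lambda>\<xi>. point_sum \<xi> (\<lambda>x. f (x, \<xi> - {x}))) \<in> borel_measurable cfg"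
proof -
  have "(\<lambda>(p::unit, q). f q) \<in> borel_measurable (count_space UNIV \<Otimes>\<^sub>M (borel \<Otimes>\<^sub>M cfg))"
    using assms by measurable
  from point_sum_measurable[OF this]
  have "(\<lambda>(p::unit, \<xi>). point_sum \<xi> (\<lambda>x. f (x, \<xi> - {x}))) \<in> borel_measurable (count_space UNIV \<Otimes>\<^sub>M cfg)" by simp
  from measurable_compose[OF measurable_Pair1'[of "()" "count_space UNIV" cfg] this] show ?thesis by simp
qed

text \<open>Packaged as an operator on measurable functions, summation over one further point can be
  iterated by the measurability prover.\<close>

definition point_sum_last :: "('p \<times> 'b \<times> 'b::euclidean_space set \<Rightarrow> ennreal) \<Rightarrow> 'p \<times> 'b set \<Rightarrow> ennreal" where
  "point_sum_last f = (\<lambda>(p, \<xi>). point_sum \<xi> (\<lambda>x. f (p, x, \<xi> - {x})))"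

lemma point_sum_last_measurable [measurable]:
  "f \<in> borel_measurable (N \<Otimes>\<^sub>M (borel \<Otimes>\<^sub>M cfg)) \<Longrightarrow> point_sum_last f \<in> borel_measurable (N \<Otimes>\<^sub>M cfg)"
  unfolding point_sum_last_def by (rule point_sum_measurable)

lemma radius_tail_shape:
  "(\<integral>\<^sup>+R. ennreal (2 * pi * R ^ 3) * indicator {0<..} R *
      (\<integral>\<^sup>+x. \<integral>\<^sup>+y. ennreal (16 * y ^ 4 / (quart x y)\<^sup>2) * (ennreal (exp (- (c * R\<^sup>2))) * (if R \<in> S \<and> R\<^sup>2 * (2 * \<bar>y\<bar> ^ 3 / quart x y) < v then 1 else 0)) \<partial>lborel \<partial>lborel) \<partial>lborel)
    = radius_tail c S v"
    unfolding radius_tail_def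
  proof (rule nn_integral_cong)
    fix R :: real
    show "ennreal (2 * pi * R ^ 3) * indicator {0<..} R *
      (\<integral>\<^sup>+x. \<integral>\<^sup>+y. ennreal (16 * y ^ 4 / (quart x y)\<^sup>2) * (ennreal (exp (- (c * R\<^sup>2))) * (if R \<in> S \<and> R\<^sup>2 * (2 * \<bar>y\<bar> ^ 3 / quart x y) < v then 1 else 0)) \<partial>lborel \<partial>lborel) =
      ennreal (2 * pi * R ^ 3) * indicator {0<..} R * (ennreal (exp (- (c * R\<^sup>2))) * indicator S R * shape_tail (v / R\<^sup>2))"
    proof (cases "R > 0")
      case True
      have w: "R\<^sup>2 * a < v \<longleftrightarrow> a < v / R\<^sup>2" for a using True by (simp add: less_divide_eq mult.commute)
      have e: "ennreal (16 * y ^ 4 / (quart x y)\<^sup>2) * (ennreal (exp (- (c * R\<^sup>2))) * (if R \<in> S \<and> R\<^sup>2 * (2 * \<bar>y\<bar> ^ 3 / quart x y) < v then 1 else 0)) =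
        (ennreal (exp (- (c * R\<^sup>2))) * indicator S R) * (ennreal (16 * y ^ 4 / (quart x y)\<^sup>2) * indicator {..<v / R\<^sup>2} (2 * \<bar>y\<bar> ^ 3 / quart x y))" for x y
        unfolding w
        by (cases "R \<in> S"; cases "2 * \<bar>y\<bar> ^ 3 / quart x y < v / R\<^sup>2"; simp add: mult.commute)
      have im: "(\<lambda>y. ennreal (16 * y ^ 4 / (quart x y)\<^sup>2) * indicator {..<v / R\<^sup>2} (2 * \<bar>y\<bar> ^ 3 / quart x y)) \<in> borel_measurable lborel" for x
        by measurable
      have im2: "(\<lambda>x. \<integral>\<^sup>+y. ennreal (16 * y ^ 4 / (quart x y)\<^sup>2) * indicator {..<v / R\<^sup>2} (2 * \<bar>y\<bar> ^ 3 / quart x y) \<partial>lborel) \<in> borel_measurable lborel"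
        by measurable
      show ?thesis unfolding e nn_integral_cmult[OF im] nn_integral_cmult[OF im2] shape_tail_def ..
    qed simp
  qed

text \<open>An exceedance in the sense of extreme values for minima: the area falls below the level
  \<open>v\<close>.\<close>

definition exceed :: "real \<Rightarrow> real set \<Rightarrow> (real^2) set \<Rightarrow> (real^2) set \<Rightarrow> real^2 \<Rightarrow> real^2 \<Rightarrow> real^2 \<Rightarrow> bool" where
  "exceed v S B \<xi> x y z \<longleftrightarrow> empty_triple \<xi> x y z \<and> ccenter x y z \<in> B \<and> crad x y z \<in> S \<and> tarea x y z < v"

text \<open>Ordered triples are counted, so every cell contributes 6.\<close>

definition num_exceed :: "real \<Rightarrow> real set \<Rightarrow> (real^2) set \<Rightarrow> (real^2) set \<Rightarrow> ennreal" where
  "num_exceed v S B \<xi> = triple_sum \<xi> (\<lambda>x y z. if exceed v S B \<xi> x y z then 1 else 0)"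

section \<open>Moments for the planar process\<close>

locale planar_poisson = homogeneous_poisson_process M X \<beta>
  for M :: "'w measure" and X :: "'w \<Rightarrow> (real^2) set" and \<beta> :: real
begin

text \<open>\<open>mecke\<close> is applied three times, each time with the points already chosen as
  parameters.\<close>

lemma mecke3:
  assumes f [measurable]: "f \<in> borel_measurable (borel \<Otimes>\<^sub>M (borel \<Otimes>\<^sub>M (borel \<Otimes>\<^sub>M cfg)))"
  shows "(\<lambda>\<xi>. triple_sum \<xi> (\<lambda>x y z. f (x, y, z, \<xi> - {x} - {y} - {z}))) \<in> borel_measurable cfg" (is ?meas)
    and "(\<integral>\<^sup>+\<xi>. triple_sum \<xi> (\<lambda>x y z. f (x, y, z, \<xi> - {x} - {y} - {z})) \<partial>law) =
      ennreal (\<beta> ^ 3) * (\<integral>\<^sup>+x. \<integral>\<^sup>+y. \<integral>\<^sup>+z. \<integral>\<^sup>+\<xi>. f (x, y, z, \<xi>) \<partial>law \<partial>lborel \<partial>lborel \<partial>lborel)" (is ?eq)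
proof -
  define f2 where "f2 = (\<lambda>(p, z, \<xi>). f (fst p, snd p, z, \<xi>))"
  have f2 [measurable]: "f2 \<in> borel_measurable ((borel \<Otimes>\<^sub>M borel) \<Otimes>\<^sub>M (borel \<Otimes>\<^sub>M cfg))"
    unfolding f2_def by measurable
  define F2 where "F2 = (\<lambda>(x, y, \<xi>). point_sum_last f2 ((x, y), \<xi>))"
  have F2 [measurable]: "F2 \<in> borel_measurable (borel \<Otimes>\<^sub>M (borel \<Otimes>\<^sub>M cfg))"
    unfolding F2_def by measurable
  define F1 where "F1 = point_sum_last F2"
  have F1 [measurable]: "F1 \<in> borel_measurable (borel \<Otimes>\<^sub>M cfg)"
    unfolding F1_def by measurable
  have eq0: "triple_sum \<xi> (\<lambda>x y z. f (x, y, z, \<xi> - {x} - {y} - {z})) = point_sum \<xi> (\<lambda>x. F1 (x, \<xi> - {x}))" for \<xi>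
    by (simp add: triple_sum_def F1_def F2_def f2_def point_sum_last_def)
  show ?meas unfolding eq0 by (rule point_sum_param_measurable[OF F1])
  have s1: "(\<integral>\<^sup>+\<xi>. point_sum \<xi> (\<lambda>x. F1 (x, \<xi> - {x})) \<partial>law) = ennreal \<beta> * (\<integral>\<^sup>+x. \<integral>\<^sup>+\<xi>. F1 (x, \<xi>) \<partial>law \<partial>lborel)"
    by (rule mecke[OF F1])
  have s2: "(\<integral>\<^sup>+\<xi>. F1 (x, \<xi>) \<partial>law) = ennreal \<beta> * (\<integral>\<^sup>+y. \<integral>\<^sup>+\<xi>. F2 (x, y, \<xi>) \<partial>law \<partial>lborel)" for x
  proof -
    have "(\<lambda>q. F2 (x, q)) \<in> borel_measurable (borel \<Otimes>\<^sub>M cfg)" by measurable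
    from mecke[OF this] show ?thesis by (simp add: F1_def point_sum_last_def)
  qed
  have s3: "(\<integral>\<^sup>+\<xi>. F2 (x, y, \<xi>) \<partial>law) = ennreal \<beta> * (\<integral>\<^sup>+z. \<integral>\<^sup>+\<xi>. f (x, y, z, \<xi>) \<partial>law \<partial>lborel)" for x y
  proof -
    have "(\<lambda>q. f (x, y, q)) \<in> borel_measurable (borel \<Otimes>\<^sub>M cfg)" by measurable
    from mecke[OF this] show ?thesis by (simp add: F2_def f2_def point_sum_last_def)
  qed
  have f' [measurable]: "(\<lambda>q. f (fst (fst q), snd (fst q), snd q)) \<in> borel_measurable ((borel \<Otimes>\<^sub>M borel) \<Otimes>\<^sub>M (borel \<Otimes>\<^sub>M cfg))"
    by measurable
  have I [measurable]: "(\<lambda>q. \<integral>\<^sup>+\<xi>. f (fst (fst q), snd (fst q), snd q, \<xi>) \<partial>law) \<in> borel_measurable ((borel \<Otimes>\<^sub>M borel) \<Otimes>\<^sub>M borel)"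
  proof -
    have "(\<lambda>r. f (fst (fst (fst r)), snd (fst (fst r)), snd (fst r), snd r)) \<in> borel_measurable (((borel \<Otimes>\<^sub>M borel) \<Otimes>\<^sub>M borel) \<Otimes>\<^sub>M cfg)"
      by measurable
    from law_integral_measurable[OF this] show ?thesis by simp
  qed
  have I1: "(\<lambda>y. \<integral>\<^sup>+z. \<integral>\<^sup>+\<xi>. f (x, y, z, \<xi>) \<partial>law \<partial>lborel) \<in> borel_measurable borel" for x
  proof -
    have "(\<lambda>q. \<integral>\<^sup>+\<xi>. f (x, fst q, snd q, \<xi>) \<partial>law) \<in> borel_measurable (borel \<Otimes>\<^sub>M borel)"
      using measurable_compose[OF _ I, of "\<lambda>q. ((x, fst q), snd q)"] by simp
    then show ?thesis by measurable
  qed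
  have I2: "(\<lambda>x. \<integral>\<^sup>+y. \<integral>\<^sup>+z. \<integral>\<^sup>+\<xi>. f (x, y, z, \<xi>) \<partial>law \<partial>lborel \<partial>lborel) \<in> borel_measurable borel"
    using I by measurable
  have "(\<integral>\<^sup>+\<xi>. point_sum \<xi> (\<lambda>x. F1 (x, \<xi> - {x})) \<partial>law) = ennreal \<beta> * (ennreal \<beta> * (ennreal \<beta> * (\<integral>\<^sup>+x. \<integral>\<^sup>+y. \<integral>\<^sup>+z. \<integral>\<^sup>+\<xi>. f (x, y, z, \<xi>) \<partial>law \<partial>lborel \<partial>lborel \<partial>lborel)))"
    unfolding s1 s2 s3 using I1 I2
    by (simp add: nn_integral_cmult)
  then show ?eq unfolding eq0 using intensity_pos
    by (simp add: power3_eq_cube ennreal_mult mult.assoc)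
qed

lemma law_void:
  assumes "R \<ge> 0"
  shows "(\<integral>\<^sup>+\<xi>. (if \<xi> \<inter> ball c R = {} then 1 else 0) \<partial>law) = ennreal (exp (- (\<beta> * pi * R\<^sup>2)))"
proof -
  let ?E = "{\<xi>\<in>lfin. \<xi> \<inter> ball c R = {}}"
  have "Measurable.pred cfg (\<lambda>\<xi>. \<xi> \<inter> ball c R = {})" by measurable
  then have E: "?E \<in> sets cfg" by (simp add: pred_def)
  have "(\<integral>\<^sup>+\<xi>. (if \<xi> \<inter> ball c R = {} then 1 else 0) \<partial>law) = (\<integral>\<^sup>+\<xi>. indicator ?E \<xi> \<partial>law)"
    by (rule nn_integral_cong) (auto simp: indicator_def)
  also have "\<dots> = emeasure law ?E" using E by simp
  also have "\<dots> = emeasure M (X -` ?E \<inter> space M)"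
    unfolding law_def by (rule emeasure_distr[OF X_measurable E])
  also have "X -` ?E \<inter> space M = {\<omega>\<in>space M. card (X \<omega> \<inter> ball c R) = 0}"
  proof -
    have "X \<omega> \<in> ?E \<longleftrightarrow> card (X \<omega> \<inter> ball c R) = 0" if "\<omega> \<in> space M" for \<omega>
      using X_lfin[OF that] locally_finite[OF that, of "ball c R"] by simp
    then show ?thesis by (auto simp: vimage_def)
  qed
  also have "emeasure M \<dots> = ennreal (exp (- (\<beta> * measure lborel (ball c R))))"
    using count_poisson[of "ball c R" 0] by (simp add: emeasure_eq_measure)
  finally show ?thesis using circle_area[OF assms, of c] by (simp add: mult_ac)
qed

text \<open>After \<open>mecke3\<close> and the void probability, translation by \<open>x\<close>
  leaves an integrand that depends on \<open>x\<close> through the centre alone. Integrating over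
  \<open>x\<close> turns the condition on the centre into the area of \<open>B\<close>; the rest is
  \<open>triangle_shape_integral\<close>.\<close>

lemma triple_expectation:
  assumes [measurable]: "(\<lambda>(a, b). \<phi> a b) \<in> borel_measurable (borel \<Otimes>\<^sub>M borel)" and B [measurable]: "B \<in> sets borel"
  shows "(\<lambda>\<xi>. triple_sum \<xi> (\<lambda>x y z. if empty_triple \<xi> x y z \<and> ccenter x y z \<in> B then \<phi> (crad x y z) (tarea x y z) else 0)) \<in> borel_measurable cfg"
    and "(\<integral>\<^sup>+\<xi>. triple_sum \<xi> (\<lambda>x y z. if empty_triple \<xi> x y z \<and> ccenter x y z \<in> B then \<phi> (crad x y z) (tarea x y z) else 0) \<partial>law) =
    ennreal (\<beta> ^ 3) * emeasure lborel B *
     (\<integral>\<^sup>+R. ennreal (2 * pi * R ^ 3) * indicator {0<..} R *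
      (\<integral>\<^sup>+x. \<integral>\<^sup>+y. ennreal (16 * y ^ 4 / (quart x y)\<^sup>2) * (ennreal (exp (- (\<beta> * pi * R\<^sup>2))) * \<phi> R (R\<^sup>2 * (2 * \<bar>y\<bar> ^ 3 / quart x y))) \<partial>lborel \<partial>lborel) \<partial>lborel)"
proof -
  have \<phi>m [measurable]: "(\<lambda>x. \<phi> (f x) (g x)) \<in> borel_measurable N"
    if "f \<in> borel_measurable N" "g \<in> borel_measurable N" for f g and N :: "'z measure"
    using measurable_compose[OF measurable_Pair[OF that] assms(1)] by simp
  define f where "f = (\<lambda>(x, y, z, \<xi>). if empty_triple \<xi> x y z \<and> ccenter x y z \<in> B then \<phi> (crad x y z) (tarea x y z) else 0)"
  have fm: "f \<in> borel_measurable (borel \<Otimes>\<^sub>M (borel \<Otimes>\<^sub>M (borel \<Otimes>\<^sub>M cfg)))"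
    unfolding f_def by measurable
  have c: "triple_sum \<xi> (\<lambda>x y z. if empty_triple \<xi> x y z \<and> ccenter x y z \<in> B then \<phi> (crad x y z) (tarea x y z) else 0) =
     triple_sum \<xi> (\<lambda>x y z. f (x, y, z, \<xi> - {x} - {y} - {z}))" for \<xi>
    by (simp add: f_def empty_triple_diff)
  show "(\<lambda>\<xi>. triple_sum \<xi> (\<lambda>x y z. if empty_triple \<xi> x y z \<and> ccenter x y z \<in> B then \<phi> (crad x y z) (tarea x y z) else 0)) \<in> borel_measurable cfg"
    unfolding c by (rule mecke3(1)[OF fm])
  define \<Psi> where "\<Psi> u w = (if det2 u w \<noteq> 0 then ennreal (exp (- (\<beta> * pi * (circrad u w)\<^sup>2))) * \<phi> (circrad u w) (\<bar>det2 u w\<bar> / 2) else 0)" for u w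
  have \<Psi>m [measurable]: "(\<lambda>x. \<Psi> (f x) (g x)) \<in> borel_measurable N"
    if [measurable]: "f \<in> borel_measurable N" "g \<in> borel_measurable N" for f g and N :: "'z measure"
    unfolding \<Psi>_def by measurable
  have inner: "(\<integral>\<^sup>+\<xi>. f (x, y, z, \<xi>) \<partial>law) = \<Psi> (y - x) (z - x) * indicator B (x + center0 (y - x) (z - x))" for x y z
  proof (cases "det2 (y - x) (z - x) \<noteq> 0 \<and> ccenter x y z \<in> B")
    case True
    have R: "crad x y z \<ge> 0" by (simp add: crad_def circrad_def)
    have "(\<integral>\<^sup>+\<xi>. f (x, y, z, \<xi>) \<partial>law) = (\<integral>\<^sup>+\<xi>. (if \<xi> \<inter> ball (ccenter x y z) (crad x y z) = {} then 1 else 0) * \<phi> (crad x y z) (tarea x y z) \<partial>law)"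
      using True by (intro nn_integral_cong) (simp add: f_def empty_triple_det2)
    also have "\<dots> = (\<integral>\<^sup>+\<xi>. (if \<xi> \<inter> ball (ccenter x y z) (crad x y z) = {} then 1 else 0) \<partial>law) * \<phi> (crad x y z) (tarea x y z)"
      by (rule nn_integral_multc) measurable
    finally show ?thesis using True unfolding law_void[OF R]
      by (simp add: \<Psi>_def crad_def tarea_def ccenter_def)
  next
    case False
    then have "(\<integral>\<^sup>+\<xi>. f (x, y, z, \<xi>) \<partial>law) = (\<integral>\<^sup>+\<xi>. 0 \<partial>law)"
      by (intro nn_integral_cong) (auto simp: f_def empty_triple_det2)
    then show ?thesis using False by (auto simp: \<Psi>_def ccenter_def indicator_def)
  qed
  have g1: "(\<integral>\<^sup>+z. \<Psi> u (z - x) * indicator B (x + center0 u (z - x)) \<partial>lborel) = (\<integral>\<^sup>+z. \<Psi> u z * indicator B (x + center0 u z) \<partial>lborel)" for u x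
    by (rule nn_integral_translate[of "\<lambda>z. \<Psi> u z * indicator B (x + center0 u z)"]) measurable
  have g2: "(\<integral>\<^sup>+y. \<integral>\<^sup>+z. \<Psi> (y - x) z * indicator B (x + center0 (y - x) z) \<partial>lborel \<partial>lborel) = (\<integral>\<^sup>+y. \<integral>\<^sup>+z. \<Psi> y z * indicator B (x + center0 y z) \<partial>lborel \<partial>lborel)" for x
    by (rule nn_integral_translate[of "\<lambda>y. \<integral>\<^sup>+z. \<Psi> y z * indicator B (x + center0 y z) \<partial>lborel"]) measurable
  have "(\<integral>\<^sup>+x. \<integral>\<^sup>+y. \<integral>\<^sup>+z. \<integral>\<^sup>+\<xi>. f (x, y, z, \<xi>) \<partial>law \<partial>lborel \<partial>lborel \<partial>lborel) = (\<integral>\<^sup>+x. \<integral>\<^sup>+y. \<integral>\<^sup>+z. \<Psi> y z * indicator B (x + center0 y z) \<partial>lborel \<partial>lborel \<partial>lborel)"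
    unfolding inner g1 g2 ..
  also have "\<dots> = (\<integral>\<^sup>+y. \<integral>\<^sup>+x. \<integral>\<^sup>+z. \<Psi> y z * indicator B (x + center0 y z) \<partial>lborel \<partial>lborel \<partial>lborel)"
    by (rule lborel_pair.Fubini') measurable
  also have "\<dots> = (\<integral>\<^sup>+y. \<integral>\<^sup>+z. \<integral>\<^sup>+x. \<Psi> y z * indicator B (x + center0 y z) \<partial>lborel \<partial>lborel \<partial>lborel)"
    by (rule nn_integral_cong, rule lborel_pair.Fubini') measurable
  also have "\<dots> = (\<integral>\<^sup>+y. \<integral>\<^sup>+z. \<Psi> y z * emeasure lborel B \<partial>lborel \<partial>lborel)"
  proof (rule nn_integral_cong, rule nn_integral_cong)
    fix y z :: "real^2"
    have "(\<integral>\<^sup>+x. \<Psi> y z * indicator B (x + center0 y z) \<partial>lborel) = \<Psi> y z * (\<integral>\<^sup>+x. indicator B (x + center0 y z) \<partial>lborel)"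
      by (rule nn_integral_cmult) measurable
    then show "(\<integral>\<^sup>+x. \<Psi> y z * indicator B (x + center0 y z) \<partial>lborel) = \<Psi> y z * emeasure lborel B"
      by (simp only: emeasure_translate[OF B])
  qed
  also have "\<dots> = (\<integral>\<^sup>+y. (\<integral>\<^sup>+z. \<Psi> y z \<partial>lborel) * emeasure lborel B \<partial>lborel)"
    by (rule nn_integral_cong, rule nn_integral_multc) measurable
  also have "\<dots> = (\<integral>\<^sup>+y. \<integral>\<^sup>+z. \<Psi> y z \<partial>lborel \<partial>lborel) * emeasure lborel B"
    by (rule nn_integral_multc) measurable
  also have "(\<integral>\<^sup>+y. \<integral>\<^sup>+z. \<Psi> y z \<partial>lborel \<partial>lborel) = 
     (\<integral>\<^sup>+R. ennreal (2 * pi * R ^ 3) * indicator {0<..} R *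
      (\<integral>\<^sup>+x. \<integral>\<^sup>+y. ennreal (16 * y ^ 4 / (quart x y)\<^sup>2) * (ennreal (exp (- (\<beta> * pi * R\<^sup>2))) * \<phi> R (R\<^sup>2 * (2 * \<bar>y\<bar> ^ 3 / quart x y))) \<partial>lborel \<partial>lborel) \<partial>lborel)"
    unfolding \<Psi>_def by (rule triangle_shape_integral[of "\<lambda>R a. ennreal (exp (- (\<beta> * pi * R\<^sup>2))) * \<phi> R a"]) measurable
  finally show "(\<integral>\<^sup>+\<xi>. triple_sum \<xi> (\<lambda>x y z. if empty_triple \<xi> x y z \<and> ccenter x y z \<in> B then \<phi> (crad x y z) (tarea x y z) else 0) \<partial>law) =
    ennreal (\<beta> ^ 3) * emeasure lborel B *
     (\<integral>\<^sup>+R. ennreal (2 * pi * R ^ 3) * indicator {0<..} R *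
      (\<integral>\<^sup>+x. \<integral>\<^sup>+y. ennreal (16 * y ^ 4 / (quart x y)\<^sup>2) * (ennreal (exp (- (\<beta> * pi * R\<^sup>2))) * \<phi> R (R\<^sup>2 * (2 * \<bar>y\<bar> ^ 3 / quart x y))) \<partial>lborel \<partial>lborel) \<partial>lborel)"
    unfolding c mecke3(2)[OF fm] by (simp only: mult_ac)
qed

lemma integral_law:
  assumes "g \<in> borel_measurable cfg"
  shows "(\<integral>\<^sup>+\<xi>. g \<xi> \<partial>law) = (\<integral>\<^sup>+\<omega>. g (X \<omega>) \<partial>M)"
  unfolding law_def by (rule nn_integral_distr[OF X_measurable]) (use assms in \<open>simp add: measurable_def\<close>)

text \<open>The mean number of ordered triples per unit area is \<open>\<beta>^3 * 24 * pi^2 / (2 *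
  (\<beta> * pi)^2) = 12 * \<beta>\<close>. With six orderings per cell this means two cells per
  point; the factor 6 stays on the left to avoid division in \<open>ennreal\<close>.\<close>

lemma cell_intensity:
  assumes B [measurable]: "B \<in> sets borel"
  shows "(\<integral>\<^sup>+\<omega>. emeasure (count_space UNIV) {C \<in> delaunay_cells (X \<omega>). circumcenter C \<in> B} \<partial>M) * 6 = ennreal (12 * \<beta>) * emeasure lborel B"
proof -
  let ?N = "\<lambda>\<xi>. triple_sum \<xi> (\<lambda>x y z. if empty_triple \<xi> x y z \<and> ccenter x y z \<in> B then 1 else 0)"
  have Nm: "?N \<in> borel_measurable cfg"
    using triple_expectation(1)[of "\<lambda>_ _. 1" B] by simp
  have N6: "?N \<xi> = 6 * emeasure (count_space UNIV) {C \<in> delaunay_cells \<xi>. circumcenter C \<in> B}" for \<xi>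
    unfolding triple_sum_empty_triples triples_cells ..
  have c: "\<beta> * pi > 0" using intensity_pos by simp
  have "(\<integral>\<^sup>+\<xi>. ?N \<xi> \<partial>law) = ennreal (\<beta> ^ 3) * emeasure lborel B *
     (\<integral>\<^sup>+R. ennreal (2 * pi * R ^ 3) * indicator {0<..} R *
      (\<integral>\<^sup>+x. \<integral>\<^sup>+y. ennreal (16 * y ^ 4 / (quart x y)\<^sup>2) * (ennreal (exp (- (\<beta> * pi * R\<^sup>2))) * 1) \<partial>lborel \<partial>lborel) \<partial>lborel)"
    using triple_expectation(2)[of "\<lambda>_ _. 1" B] by simp
  also have "(\<integral>\<^sup>+R. ennreal (2 * pi * R ^ 3) * indicator {0<..} R *
      (\<integral>\<^sup>+x. \<integral>\<^sup>+y. ennreal (16 * y ^ 4 / (quart x y)\<^sup>2) * (ennreal (exp (- (\<beta> * pi * R\<^sup>2))) * 1) \<partial>lborel \<partial>lborel) \<partial>lborel) =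
     (\<integral>\<^sup>+R. ennreal (24 * pi\<^sup>2) * (ennreal (R ^ 3 * exp (- (\<beta> * pi * R\<^sup>2))) * indicator {0..} R) \<partial>lborel)"
  proof (rule nn_integral_cong)
    fix R :: real
    have "(\<integral>\<^sup>+x. \<integral>\<^sup>+y. ennreal (16 * y ^ 4 / (quart x y)\<^sup>2) * (ennreal (exp (- (\<beta> * pi * R\<^sup>2))) * 1) \<partial>lborel \<partial>lborel) =
      (\<integral>\<^sup>+x. \<integral>\<^sup>+y. ennreal (16 * y ^ 4 / (quart x y)\<^sup>2) \<partial>lborel \<partial>lborel) * ennreal (exp (- (\<beta> * pi * R\<^sup>2)))"
      by (simp add: nn_integral_multc)
    then have i: "(\<integral>\<^sup>+x. \<integral>\<^sup>+y. ennreal (16 * y ^ 4 / (quart x y)\<^sup>2) * (ennreal (exp (- (\<beta> * pi * R\<^sup>2))) * 1) \<partial>lborel \<partial>lborel) = ennreal (12 * pi) * ennreal (exp (- (\<beta> * pi * R\<^sup>2)))"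
      by (simp only: shape_total)
    show "ennreal (2 * pi * R ^ 3) * indicator {0<..} R *
      (\<integral>\<^sup>+x. \<integral>\<^sup>+y. ennreal (16 * y ^ 4 / (quart x y)\<^sup>2) * (ennreal (exp (- (\<beta> * pi * R\<^sup>2))) * 1) \<partial>lborel \<partial>lborel) =
      ennreal (24 * pi\<^sup>2) * (ennreal (R ^ 3 * exp (- (\<beta> * pi * R\<^sup>2))) * indicator {0..} R)"
    proof (cases "R > 0")
      case True
      have "ennreal (2 * pi * R ^ 3) * (ennreal (12 * pi) * ennreal (exp (- (\<beta> * pi * R\<^sup>2)))) = ennreal ((2 * pi * R ^ 3) * ((12 * pi) * exp (- (\<beta> * pi * R\<^sup>2))))"
        using True by (subst ennreal_mult[of "12 * pi", symmetric], simp, simp, subst ennreal_mult[symmetric]) auto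
      also have "(2 * pi * R ^ 3) * ((12 * pi) * exp (- (\<beta> * pi * R\<^sup>2))) = 24 * pi\<^sup>2 * (R ^ 3 * exp (- (\<beta> * pi * R\<^sup>2)))"
        by (simp add: power2_eq_square)
      also have "ennreal \<dots> = ennreal (24 * pi\<^sup>2) * ennreal (R ^ 3 * exp (- (\<beta> * pi * R\<^sup>2)))"
        using True by (intro ennreal_mult) auto
      finally show ?thesis unfolding i using True by (simp only: indicator_simps greaterThan_iff atLeast_iff less_imp_le mult_1_right)
    next
      case False
      then show ?thesis by (cases "R = 0") auto
    qed
  qed
  also have "\<dots> = ennreal (24 * pi\<^sup>2) * ennreal (1 / (2 * (\<beta> * pi)\<^sup>2))"
    unfolding gaussian_cubic_integral[OF c, symmetric] by (rule nn_integral_cmult) measurable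
  also have "\<dots> = ennreal (12 / \<beta>\<^sup>2)"
    by (subst ennreal_mult[symmetric]) (auto simp: power_mult_distrib)
  also have "ennreal (\<beta> ^ 3) * emeasure lborel B * ennreal (12 / \<beta>\<^sup>2) = ennreal (\<beta> ^ 3) * ennreal (12 / \<beta>\<^sup>2) * emeasure lborel B"
    by (simp only: mult_ac)
  also have "ennreal (\<beta> ^ 3) * ennreal (12 / \<beta>\<^sup>2) = ennreal (12 * \<beta>)"
    using intensity_pos by (subst ennreal_mult[symmetric]) (auto simp: power2_eq_square power3_eq_cube)
  finally have "(\<integral>\<^sup>+\<omega>. ?N (X \<omega>) \<partial>M) = ennreal (12 * \<beta>) * emeasure lborel B"
    unfolding integral_law[OF Nm] .
  moreover have "(\<integral>\<^sup>+\<omega>. ?N (X \<omega>) \<partial>M) = (\<integral>\<^sup>+\<omega>. emeasure (count_space UNIV) {C \<in> delaunay_cells (X \<omega>). circumcenter C \<in> B} \<partial>M) * 6"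
  proof -
    let ?e = "\<lambda>\<xi>. emeasure (count_space UNIV) {C \<in> delaunay_cells \<xi>. circumcenter C \<in> B}"
    have e: "?e \<xi> = ?N \<xi> / 6" for \<xi> unfolding N6 mult.commute[of 6] by (rule ennreal_mult_divide_eq[symmetric]) auto
    have m: "(\<lambda>\<omega>. ?e (X \<omega>)) \<in> borel_measurable M"
      unfolding e using measurable_compose[OF X_measurable Nm] by (intro borel_measurable_divide_ennreal) auto
    have "(\<integral>\<^sup>+\<omega>. ?N (X \<omega>) \<partial>M) = (\<integral>\<^sup>+\<omega>. ?e (X \<omega>) * 6 \<partial>M)" unfolding N6 by (simp only: mult.commute)
    also have "\<dots> = (\<integral>\<^sup>+\<omega>. ?e (X \<omega>) \<partial>M) * 6" by (rule nn_integral_multc[OF m])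
    finally show ?thesis .
  qed
  ultimately show ?thesis by simp
qed

text \<open>At the unit square the hypothesis and \<open>cell_intensity\<close> together read
  \<open>6 = 12 * \<beta>\<close>.\<close>

lemma intensity_half:
  assumes "tessellation_intensity M (\<lambda>\<omega>. delaunay_cells (X \<omega>)) 1"
  shows "\<beta> = 1 / 2"
proof -
  let ?B = "cbox 0 1 :: (real^2) set"
  let ?I = "\<integral>\<^sup>+\<omega>. emeasure (count_space UNIV) {C \<in> delaunay_cells (X \<omega>). circumcenter C \<in> ?B} \<partial>M"
  have "emeasure lborel ?B = 1"
  proof -
    have "\<forall>b\<in>Basis. (0 :: real^2) \<bullet> b \<le> 1 \<bullet> b" by (simp add: Basis_2 inner_axis)
    then show ?thesis unfolding emeasure_lborel_cbox_eq by (simp add: prod_Basis_2 inner_axis)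
  qed
  then have "?I / 1 = ennreal 1" "?I * 6 = ennreal (12 * \<beta>)"
    using assms[unfolded tessellation_intensity_def, rule_format, of ?B] cell_intensity[of ?B] by auto
  then have "ennreal 6 = ennreal (12 * \<beta>)" by (simp add: divide_ennreal_def)
  then show ?thesis using intensity_pos by (subst (asm) ennreal_inj) auto
qed

lemma num_exceed:
  assumes S [measurable]: "S \<in> sets borel" and B [measurable]: "B \<in> sets borel"
  shows "num_exceed v S B \<in> borel_measurable cfg"
    and "(\<integral>\<^sup>+\<xi>. num_exceed v S B \<xi> \<partial>law) = ennreal (\<beta> ^ 3) * emeasure lborel B * radius_tail (\<beta> * pi) S v"
proof -
  define \<phi> where "\<phi> = (\<lambda>R a. if R \<in> S \<and> a < v then 1 else 0 :: ennreal)"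
  have \<phi>: "(\<lambda>(R, a). \<phi> R a) \<in> borel_measurable (borel \<Otimes>\<^sub>M borel)"
    unfolding \<phi>_def by measurable
  have eq: "num_exceed v S B = (\<lambda>\<xi>. triple_sum \<xi> (\<lambda>x y z. if empty_triple \<xi> x y z \<and> ccenter x y z \<in> B then \<phi> (crad x y z) (tarea x y z) else 0))"
    unfolding num_exceed_def exceed_def \<phi>_def by (intro ext arg_cong2[where f=triple_sum] refl) auto
  show "num_exceed v S B \<in> borel_measurable cfg" unfolding eq by (rule triple_expectation(1)[OF \<phi> B])
  have "(\<integral>\<^sup>+R. ennreal (2 * pi * R ^ 3) * indicator {0<..} R *
      (\<integral>\<^sup>+x. \<integral>\<^sup>+y. ennreal (16 * y ^ 4 / (quart x y)\<^sup>2) * (ennreal (exp (- (\<beta> * pi * R\<^sup>2))) * \<phi> R (R\<^sup>2 * (2 * \<bar>y\<bar> ^ 3 / quart x y))) \<partial>lborel \<partial>lborel) \<partial>lborel)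
    = radius_tail (\<beta> * pi) S v"
    unfolding \<phi>_def by (rule radius_tail_shape)
  then show "(\<integral>\<^sup>+\<xi>. num_exceed v S B \<xi> \<partial>law) = ennreal (\<beta> ^ 3) * emeasure lborel B * radius_tail (\<beta> * pi) S v"
    unfolding eq triple_expectation(2)[OF \<phi> B] by simp
qed

end

section \<open>Pairs of small triangles\<close>

lemma triangle_cong:
  assumes s: "{a, b, c} = {x, y, z}" and nc: "\<not> collinear {x, y, z}"
  shows "ccenter a b c = ccenter x y z" "crad a b c = crad x y z" "tarea a b c = tarea x y z"
proof -
  have nc': "\<not> collinear {a, b, c}" using nc s by simp
  have "{x, y, z} \<subseteq> sphere (ccenter a b c) (crad a b c)" using sphere_ccenter[OF nc'] by (simp only: s)
  from sphere_unique[OF nc this] show "ccenter a b c = ccenter x y z" "crad a b c = crad x y z" by simp_all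
  have "ennreal (tarea a b c) = ennreal (tarea x y z)" using emeasure_triangle[of a b c] emeasure_triangle[of x y z] s by simp
  then show "tarea a b c = tarea x y z" by (simp add: tarea_def)
qed

lemma exceed_cong:
  assumes s: "{a, b, c} = {x, y, z}"
  shows "exceed v S B \<xi> a b c \<longleftrightarrow> exceed v S B \<xi> x y z"
proof (cases "collinear {x, y, z}")
  case True
  then show ?thesis using s by (simp add: exceed_def empty_triple_def)
next
  case False
  then show ?thesis using triangle_cong[OF s False] s by (simp add: exceed_def empty_triple_def)
qed

definition exceed_set :: "real \<Rightarrow> real set \<Rightarrow> (real^2) set \<Rightarrow> (real^2) set \<Rightarrow> ((real^2) \<times> (real^2) \<times> (real^2)) set" where
  "exceed_set v S B \<xi> = {(x, y, z). x \<in> \<xi> \<and> y \<in> \<xi> \<and> z \<in> \<xi> \<and> exceed v S B \<xi> x y z}"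

lemma not_collinear_distinct: "\<not> collinear {x, y, z} \<Longrightarrow> x \<noteq> y \<and> y \<noteq> z \<and> x \<noteq> z"
  by (auto simp: insert_commute)

lemma num_exceed_emeasure: "num_exceed v S B \<xi> = emeasure (count_space UNIV) (exceed_set v S B \<xi>)"
proof -
  have d: "x \<noteq> y \<and> y \<noteq> z \<and> x \<noteq> z" if "exceed v S B \<xi> x y z" for x y z
    using that not_collinear_distinct[of x y z] by (auto simp: exceed_def empty_triple_def)
  have "num_exceed v S B \<xi> = (\<integral>\<^sup>+t. indicator (exceed_set v S B \<xi>) t \<partial>count_space UNIV)"
    unfolding num_exceed_def triple_sum_count
    by (rule nn_integral_cong) (auto simp: exceed_set_def indicator_def split: if_splits dest: d)
  then show ?thesis by simp
qed

lemma num_exceed_eq_0_iff: "num_exceed v S B \<xi> = 0 \<longleftrightarrow> exceed_set v S B \<xi> = {}"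
  unfolding num_exceed_emeasure by (auto simp: emeasure_count_space_eq_0)

lemma exceed_set_orderings:
  assumes t: "(x, y, z) \<in> exceed_set v S B \<xi>"
  shows "{(a, b, c). {a, b, c} = {x, y, z}} \<subseteq> exceed_set v S B \<xi>" "card {(a, b, c). {a, b, c} = {x, y, z}} = 6"
proof -
  have nc: "\<not> collinear {x, y, z}" using t by (simp add: exceed_set_def exceed_def empty_triple_def)
  show "card {(a, b, c). {a, b, c} = {x, y, z}} = 6"
    using not_collinear_distinct[OF nc] by (intro card_orderings) auto
  show "{(a, b, c). {a, b, c} = {x, y, z}} \<subseteq> exceed_set v S B \<xi>"
  proof
    fix u assume "u \<in> {(a, b, c). {a, b, c} = {x, y, z}}"
    then obtain a b c where u: "u = (a, b, c)" "{a, b, c} = {x, y, z}" by auto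
    have "{x, y, z} \<subseteq> \<xi>" using t by (simp add: exceed_set_def)
    then have "{a, b, c} \<subseteq> \<xi>" by (simp only: u(2))
    then show "u \<in> exceed_set v S B \<xi>" using exceed_cong[OF u(2)] t by (simp add: u(1) exceed_set_def)
  qed
qed

lemma num_exceed_ge_6:
  assumes "num_exceed v S B \<xi> \<noteq> 0"
  shows "6 \<le> num_exceed v S B \<xi>"
proof -
  from assms obtain t where t: "t \<in> exceed_set v S B \<xi>" unfolding num_exceed_eq_0_iff by blast
  obtain x y z where "t = (x, y, z)" by (cases t)
  with t have t: "(x, y, z) \<in> exceed_set v S B \<xi>" by simp
  let ?O = "{(a, b, c). {a, b, c} = {x, y, z}}"
  have fin: "finite ?O" using exceed_set_orderings(2)[OF t] by (intro card_ge_0_finite) simp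
  have "emeasure (count_space UNIV) ?O \<le> num_exceed v S B \<xi>"
    unfolding num_exceed_emeasure by (rule emeasure_mono[OF exceed_set_orderings(1)[OF t]]) simp
  then show ?thesis using fin exceed_set_orderings(2)[OF t] by (simp add: emeasure_count_space)
qed

text \<open>Emptiness and the position of the centre are dropped. What remains depends on the three
  points alone, so it is unaffected by the removal of points in the Mecke formula.\<close>

definition close_triple :: "real \<Rightarrow> real \<Rightarrow> (real^2) set \<Rightarrow> real^2 \<Rightarrow> real^2 \<Rightarrow> real^2 \<Rightarrow> ennreal" where
  "close_triple v K U x y z = (if {x, y, z} \<subseteq> U \<and> \<not> collinear {x, y, z} \<and> tarea x y z < v \<and> crad x y z \<le> K then 1 else 0)"

lemma close_triple_cong:
  assumes s: "{a, b, c} = {x, y, z}"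
  shows "close_triple v K U a b c = close_triple v K U x y z"
proof (cases "collinear {x, y, z}")
  case True
  then show ?thesis unfolding close_triple_def s by simp
next
  case False
  show ?thesis unfolding close_triple_def triangle_cong[OF s False] s by (rule refl)
qed

lemma close_triple_measurable [measurable]:
  assumes [measurable]: "f \<in> borel_measurable M" "g \<in> borel_measurable M" "h \<in> borel_measurable M" "U \<in> sets borel"
  shows "(\<lambda>x. close_triple v K U (f x) (g x) (h x)) \<in> borel_measurable M"
  unfolding close_triple_def det2_zero_collinear[symmetric] insert_subset by measurable

text \<open>A second triangle shares two, one or no vertices with the first one.\<close>

definition pair_sum :: "real \<Rightarrow> real \<Rightarrow> (real^2) set \<Rightarrow> real^2 \<Rightarrow> real^2 \<Rightarrow> real^2 \<Rightarrow> real^2 \<Rightarrow> ennreal" where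
  "pair_sum v K U x y z c = close_triple v K U x y c + close_triple v K U x z c + close_triple v K U y z c"

definition single_sum :: "real \<Rightarrow> real \<Rightarrow> (real^2) set \<Rightarrow> real^2 \<Rightarrow> real^2 \<Rightarrow> real^2 \<Rightarrow> real^2 \<Rightarrow> real^2 \<Rightarrow> ennreal" where
  "single_sum v K U x y z b c = close_triple v K U x b c + close_triple v K U y b c + close_triple v K U z b c"

lemma sums_measurable [measurable]:
  assumes [measurable]: "f \<in> borel_measurable M" "g \<in> borel_measurable M" "h \<in> borel_measurable M" "k \<in> borel_measurable M"
    "l \<in> borel_measurable M" "U \<in> sets borel"
  shows "(\<lambda>x. pair_sum v K U (f x) (g x) (h x) (k x)) \<in> borel_measurable M"
    "(\<lambda>x. single_sum v K U (f x) (g x) (h x) (k x) (l x)) \<in> borel_measurable M"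
  unfolding pair_sum_def single_sum_def by measurable

definition other_triples :: "real \<Rightarrow> real \<Rightarrow> (real^2) set \<Rightarrow> real^2 \<Rightarrow> real^2 \<Rightarrow> real^2 \<Rightarrow> (real^2) set \<Rightarrow> ennreal" where
  "other_triples v K U x y z \<eta> = point_sum \<eta> (pair_sum v K U x y z) + point_sum \<eta> (\<lambda>b. point_sum (\<eta> - {b}) (single_sum v K U x y z b)) +
     triple_sum \<eta> (close_triple v K U)"

lemma point_sum_ge: "c \<in> \<eta> \<Longrightarrow> f c \<le> point_sum \<eta> f"
  unfolding point_sum_def by (rule nn_integral_ge_point)

lemma other_triples_ge_1:
  assumes P: "{a, b, c} \<subseteq> \<xi>" "close_triple v K U a b c = 1" "{a, b, c} \<noteq> {x, y, z}"
    and d: "x \<noteq> y" "y \<noteq> z" "x \<noteq> z"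
  shows "1 \<le> other_triples v K U x y z (\<xi> - {x} - {y} - {z})"
proof -
  let ?\<eta> = "\<xi> - {x} - {y} - {z}"
  let ?t = "close_triple v K U"
  have abc: "a \<noteq> b" "b \<noteq> c" "a \<noteq> c" using P(2) not_collinear_distinct[of a b c] by (auto simp: close_triple_def split: if_splits)
  have h1: ?thesis if "p \<in> {x, y, z}" "q \<in> {x, y, z}" "p \<noteq> q" "r \<in> ?\<eta>" "?t p q r = 1" for p q r
  proof -
    have sym: "?t q p r = ?t p q r" by (rule close_triple_cong) auto
    have "?t x y r = 1 \<or> ?t x z r = 1 \<or> ?t y z r = 1"
      using that sym by auto
    then have "1 \<le> pair_sum v K U x y z r" unfolding pair_sum_def
      by (elim disjE) (simp_all add: add_increasing add_increasing2)
    also have "\<dots> \<le> point_sum ?\<eta> (pair_sum v K U x y z)" by (rule point_sum_ge) (rule that)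
    finally show ?thesis unfolding other_triples_def by (simp add: add_increasing2)
  qed
  have h2: ?thesis if "p \<in> {x, y, z}" "q \<in> ?\<eta>" "r \<in> ?\<eta>" "q \<noteq> r" "?t p q r = 1" for p q r
  proof -
    have "1 \<le> single_sum v K U x y z q r" unfolding single_sum_def using that(1,5)
      by (auto simp: add_increasing add_increasing2)
    also have "\<dots> \<le> point_sum (?\<eta> - {q}) (single_sum v K U x y z q)" by (rule point_sum_ge) (use that in auto)
    also have "\<dots> \<le> point_sum ?\<eta> (\<lambda>b. point_sum (?\<eta> - {b}) (single_sum v K U x y z b))"
      by (rule point_sum_ge[where f="\<lambda>b. point_sum (?\<eta> - {b}) (single_sum v K U x y z b)"]) (rule that)
    finally show ?thesis unfolding other_triples_def by (simp add: add_increasing add_increasing2)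
  qed
  have h3: ?thesis if "a \<in> ?\<eta>" "b \<in> ?\<eta>" "c \<in> ?\<eta>"
  proof -
    have "1 \<le> ?t a b c" using P by simp
    also have "\<dots> \<le> point_sum (?\<eta> - {a} - {b}) (?t a b)" by (rule point_sum_ge) (use that abc in auto)
    also have "\<dots> \<le> point_sum (?\<eta> - {a}) (\<lambda>b. point_sum (?\<eta> - {a} - {b}) (?t a b))"
      by (rule point_sum_ge[where f="\<lambda>b. point_sum (?\<eta> - {a} - {b}) (?t a b)"]) (use that abc in auto)
    also have "\<dots> \<le> triple_sum ?\<eta> ?t" unfolding triple_sum_def
      by (rule point_sum_ge[where f="\<lambda>a. point_sum (?\<eta> - {a}) (\<lambda>b. point_sum (?\<eta> - {a} - {b}) (?t a b))"]) (rule that)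
    finally show ?thesis unfolding other_triples_def by (simp add: add_increasing)
  qed
  have in_eta: "p \<in> ?\<eta>" if "p \<in> {a, b, c}" "p \<notin> {x, y, z}" for p using that P by auto
  have t: "?t a c b = 1" "?t b c a = 1" "?t b a c = 1" "?t c a b = 1" "?t a b c = 1"
    using P(2) close_triple_cong[of a c b a b c] close_triple_cong[of b c a a b c] close_triple_cong[of b a c a b c] close_triple_cong[of c a b a b c]
    by (auto simp: insert_commute)
  \<comment> \<open>Two different vertex sets of size 3 cannot be nested, so at least one vertex is
    new; this leaves seven cases.\<close>
  have "\<not> {a, b, c} \<subseteq> {x, y, z}"
  proof
    assume sub: "{a, b, c} \<subseteq> {x, y, z}"
    have "card {a, b, c} = card {x, y, z}" using abc d by simp
    then have "{a, b, c} = {x, y, z}" by (intro card_subset_eq[OF _ sub]) auto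
    then show False using P by simp
  qed
  then have ns: "\<not> (a \<in> {x,y,z} \<and> b \<in> {x,y,z} \<and> c \<in> {x,y,z})"
    by (simp only: insert_subset empty_subsetI simp_thms not_False_eq_True)
  consider "a \<in> {x,y,z}" "b \<in> {x,y,z}" "c \<notin> {x,y,z}" | "a \<in> {x,y,z}" "b \<notin> {x,y,z}" "c \<in> {x,y,z}"
    | "a \<notin> {x,y,z}" "b \<in> {x,y,z}" "c \<in> {x,y,z}" | "a \<in> {x,y,z}" "b \<notin> {x,y,z}" "c \<notin> {x,y,z}"
    | "a \<notin> {x,y,z}" "b \<in> {x,y,z}" "c \<notin> {x,y,z}" | "a \<notin> {x,y,z}" "b \<notin> {x,y,z}" "c \<in> {x,y,z}"
    | "a \<notin> {x,y,z}" "b \<notin> {x,y,z}" "c \<notin> {x,y,z}"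
    using ns by metis
  then show ?thesis
  proof cases
    case 1 then show ?thesis using h1[of a b c] in_eta[of c] abc t by simp
  next
    case 2 then show ?thesis using h1[of a c b] in_eta[of b] abc t by simp
  next
    case 3 then show ?thesis using h1[of b c a] in_eta[of a] abc t by simp
  next
    case 4 then show ?thesis using h2[of a b c] in_eta[of b] in_eta[of c] abc t by simp
  next
    case 5 then show ?thesis using h2[of b a c] in_eta[of a] in_eta[of c] abc t by simp
  next
    case 6 then show ?thesis using h2[of c a b] in_eta[of a] in_eta[of b] abc t by simp
  next
    case 7 then show ?thesis using h3 in_eta[of a] in_eta[of b] in_eta[of c] by simp
  qed
qed

lemma point_sum_mono: "(\<And>x. x \<in> \<xi> \<Longrightarrow> f x \<le> g x) \<Longrightarrow> point_sum \<xi> f \<le> point_sum \<xi> g"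
  unfolding point_sum_def by (rule nn_integral_mono) simp

lemma triple_sum_mono:
  assumes "\<And>x y z. x \<in> \<xi> \<Longrightarrow> y \<in> \<xi> \<Longrightarrow> z \<in> \<xi> \<Longrightarrow> f x y z \<le> g x y z"
  shows "triple_sum \<xi> f \<le> triple_sum \<xi> g"
  unfolding triple_sum_def by (intro point_sum_mono assms) auto

text \<open>Either all counted triples are orderings of one triangle, or each of them comes with a second small triangle.\<close>

lemma num_exceed_le:
  assumes S: "S \<subseteq> {..K}" and B: "\<And>c. c \<in> B \<Longrightarrow> cball c K \<subseteq> U"
  shows "num_exceed v S B \<xi> \<le> 6 * indicator {\<xi>. num_exceed v S B \<xi> \<noteq> 0} \<xi> +
    triple_sum \<xi> (\<lambda>x y z. close_triple v K U x y z * other_triples v K U x y z (\<xi> - {x} - {y} - {z}))"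
proof (cases "exceed_set v S B \<xi> = {}")
  case True
  then have "num_exceed v S B \<xi> = 0" unfolding num_exceed_eq_0_iff .
  then show ?thesis by simp
next
  case False
  then have n0: "num_exceed v S B \<xi> \<noteq> 0" unfolding num_exceed_eq_0_iff .
  obtain t where t: "t \<in> exceed_set v S B \<xi>" using False by blast
  obtain x0 y0 z0 where "t = (x0, y0, z0)" by (cases t)
  with t have t: "(x0, y0, z0) \<in> exceed_set v S B \<xi>" by simp
  have close: "close_triple v K U x y z = 1 \<and> x \<noteq> y \<and> y \<noteq> z \<and> x \<noteq> z" if e: "exceed v S B \<xi> x y z" for x y z
  proof -
    have nc: "\<not> collinear {x, y, z}" and c: "ccenter x y z \<in> B" "crad x y z \<le> K" "tarea x y z < v"
      using e S by (auto simp: exceed_def empty_triple_def)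
    have "{x, y, z} \<subseteq> cball (ccenter x y z) K" using sphere_ccenter[OF nc] c(2) by auto
    then have "{x, y, z} \<subseteq> U" using B[OF c(1)] by blast
    then show ?thesis using nc c not_collinear_distinct[OF nc] by (simp add: close_triple_def)
  qed
  show ?thesis
  proof (cases "\<forall>(x, y, z)\<in>exceed_set v S B \<xi>. {x, y, z} = {x0, y0, z0}")
    case True
    then have sub: "exceed_set v S B \<xi> \<subseteq> {(a, b, c). {a, b, c} = {x0, y0, z0}}" by auto
    have fin: "finite {(a, b, c). {a, b, c} = {x0, y0, z0}}" using exceed_set_orderings(2)[OF t] by (intro card_ge_0_finite) simp
    have "num_exceed v S B \<xi> \<le> emeasure (count_space UNIV) {(a, b, c). {a, b, c} = {x0, y0, z0}}"
      unfolding num_exceed_emeasure by (rule emeasure_mono[OF sub]) simp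
    also have "\<dots> = 6" using fin exceed_set_orderings(2)[OF t] by (simp add: emeasure_count_space)
    finally show ?thesis using n0 by (simp add: add_increasing2)
  next
    case False
    then obtain x1 y1 z1 where t1: "(x1, y1, z1) \<in> exceed_set v S B \<xi>" "{x1, y1, z1} \<noteq> {x0, y0, z0}" by auto
    have "num_exceed v S B \<xi> \<le> triple_sum \<xi> (\<lambda>x y z. close_triple v K U x y z * other_triples v K U x y z (\<xi> - {x} - {y} - {z}))"
      unfolding num_exceed_def
    proof (rule triple_sum_mono)
      fix x y z
      show "(if exceed v S B \<xi> x y z then 1 else 0) \<le> close_triple v K U x y z * other_triples v K U x y z (\<xi> - {x} - {y} - {z})"
      proof (cases "exceed v S B \<xi> x y z")
        case True
        \<comment> \<open>The witnesses \<open>(x0, y0, z0)\<close> and \<open>(x1, y1, z1)\<close>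
          have different vertex sets, so at least one of these differs from that of the current
          triple.\<close>
        obtain a b c where abc: "(a, b, c) \<in> exceed_set v S B \<xi>" "{a, b, c} \<noteq> {x, y, z}"
          using t t1 by metis
        then have "close_triple v K U a b c = 1" "{a, b, c} \<subseteq> \<xi>" using close by (auto simp: exceed_set_def)
        then have "1 \<le> other_triples v K U x y z (\<xi> - {x} - {y} - {z})"
          using close[OF True] abc(2) by (intro other_triples_ge_1) auto
        then show ?thesis using close[OF True] True by simp
      qed simp
    qed
    then show ?thesis by (simp add: add_increasing)
  qed
qed

section \<open>Integral estimates for a second triangle\<close>

lemma close_triple_shape:
  "close_triple v K U p b c \<le> (if det2 (b - p) (c - p) \<noteq> 0 then (if circrad (b - p) (c - p) \<in> {..K} \<and> \<bar>det2 (b - p) (c - p)\<bar> / 2 < v then 1 else 0) else 0)"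
  by (simp add: close_triple_def det2_zero_collinear crad_def tarea_def)

text \<open>With one vertex prescribed, the other two are integrated by
  \<open>triangle_shape_integral\<close>; there is no void probability, hence the first argument
  0.\<close>

lemma close_triple_two:
  "(\<integral>\<^sup>+b. \<integral>\<^sup>+c. close_triple v K U p b c \<partial>lborel \<partial>lborel) \<le> radius_tail 0 {..K} v"
proof -
  let ?F = "\<lambda>R a. if R \<in> {..K} \<and> a < v then 1 else 0 :: ennreal"
  let ?g = "\<lambda>u w. if det2 u w \<noteq> 0 then ?F (circrad u w) (\<bar>det2 u w\<bar> / 2) else 0"
  have "(\<integral>\<^sup>+b. \<integral>\<^sup>+c. close_triple v K U p b c \<partial>lborel \<partial>lborel) \<le> (\<integral>\<^sup>+b. \<integral>\<^sup>+c. ?g (b - p) (c - p) \<partial>lborel \<partial>lborel)"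
    by (intro nn_integral_mono close_triple_shape)
  also have "\<dots> = (\<integral>\<^sup>+b. \<integral>\<^sup>+c. ?g (b - p) c \<partial>lborel \<partial>lborel)"
    by (rule nn_integral_cong, rule nn_integral_translate) measurable
  also have "\<dots> = (\<integral>\<^sup>+b. \<integral>\<^sup>+c. ?g b c \<partial>lborel \<partial>lborel)"
    by (rule nn_integral_translate[of "\<lambda>b. \<integral>\<^sup>+c. ?g b c \<partial>lborel"]) measurable
  also have "\<dots> = (\<integral>\<^sup>+R. ennreal (2 * pi * R ^ 3) * indicator {0<..} R *
      (\<integral>\<^sup>+x. \<integral>\<^sup>+y. ennreal (16 * y ^ 4 / (quart x y)\<^sup>2) * ?F R (R\<^sup>2 * (2 * \<bar>y\<bar> ^ 3 / quart x y)) \<partial>lborel \<partial>lborel) \<partial>lborel)"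
    by (rule triangle_shape_integral) measurable
  also have "\<dots> = radius_tail 0 {..K} v"
    using radius_tail_shape[of 0 "{..K}" v] by simp
  finally show ?thesis .
qed

lemma close_triple_three:
  assumes [measurable]: "U \<in> sets borel"
  shows "(\<integral>\<^sup>+x. \<integral>\<^sup>+y. \<integral>\<^sup>+z. close_triple v K U x y z \<partial>lborel \<partial>lborel \<partial>lborel) \<le> emeasure lborel U * radius_tail 0 {..K} v"
proof -
  have "(\<integral>\<^sup>+y. \<integral>\<^sup>+z. close_triple v K U x y z \<partial>lborel \<partial>lborel) \<le> indicator U x * radius_tail 0 {..K} v" for x
  proof (cases "x \<in> U")
    case True then show ?thesis using close_triple_two by simp
  qed (simp add: close_triple_def)
  then have "(\<integral>\<^sup>+x. \<integral>\<^sup>+y. \<integral>\<^sup>+z. close_triple v K U x y z \<partial>lborel \<partial>lborel \<partial>lborel) \<le> (\<integral>\<^sup>+x. indicator U x * radius_tail 0 {..K} v \<partial>lborel)"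
    by (rule nn_integral_mono)
  also have "\<dots> = emeasure lborel U * radius_tail 0 {..K} v"
    by (subst nn_integral_multc) auto
  finally show ?thesis .
qed

text \<open>With a side \<open>a\<close> of length at least \<delta> prescribed, small area confines
  the third vertex to a strip of width \<open>4 * v / norm a\<close> along the side, and the bound
  on the circumradius to distance \<open>2 * K\<close>: area at most
  \<open>16 * K * v / norm a\<close>. For a shorter side membership in \<open>U\<close> is used
  instead.\<close>

lemma close_triple_one:
  assumes U [measurable]: "U \<in> sets borel" and \<delta>: "\<delta> > 0" and K: "K > 0" and v: "v > 0"
  shows "(\<integral>\<^sup>+c. close_triple v K U p q c \<partial>lborel) \<le> ennreal (16 * K * v / \<delta>) + emeasure lborel U * indicator {..<\<delta>} (dist p q)"
proof (cases "dist p q < \<delta>")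
  case True
  have "(\<integral>\<^sup>+c. close_triple v K U p q c \<partial>lborel) \<le> (\<integral>\<^sup>+c. indicator U c \<partial>lborel)"
    by (rule nn_integral_mono) (simp add: close_triple_def)
  then show ?thesis using True by (simp add: add_increasing)
next
  case False
  define a where "a = q - p"
  have na: "norm a \<ge> \<delta>" using False by (simp add: a_def dist_norm norm_minus_commute)
  then have a0: "a \<noteq> 0" "norm a > 0" using \<delta> by auto
  let ?G = "\<lambda>w. if \<bar>det2 a w\<bar> / 2 < v \<and> norm w \<le> 2 * K then 1 else 0 :: ennreal"
  \<comment> \<open>Half the side lengths of the enclosing box, in the coordinates in which the side
    \<open>a\<close> is the first unit vector.\<close>
  let ?u = "mk2 (2 * K / norm a) (2 * v / (norm a)\<^sup>2)"
  have "close_triple v K U p q c \<le> ?G (c - p)" for c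
  proof (cases "close_triple v K U p q c = 0")
    case False
    then have t: "\<not> collinear {p, q, c}" "tarea p q c < v" "crad p q c \<le> K" by (auto simp: close_triple_def split: if_splits)
    have "dist (ccenter p q c) p = crad p q c" "dist (ccenter p q c) c = crad p q c" using sphere_ccenter[OF t(1)] by auto
    then have "dist c p \<le> crad p q c + crad p q c" using dist_triangle[of c p "ccenter p q c"] by (simp add: dist_commute)
    then have "norm (c - p) \<le> 2 * K" using t by (simp add: dist_norm)
    then show ?thesis using t(2) by (simp add: close_triple_def tarea_def a_def)
  qed simp
  then have "(\<integral>\<^sup>+c. close_triple v K U p q c \<partial>lborel) \<le> (\<integral>\<^sup>+c. ?G (c - p) \<partial>lborel)" by (rule nn_integral_mono)
  also have "\<dots> = (\<integral>\<^sup>+c. ?G c \<partial>lborel)" by (rule nn_integral_translate) measurable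
  also have "\<dots> = ennreal ((norm a)\<^sup>2) * (\<integral>\<^sup>+w. ?G (cmul a w) \<partial>lborel)" by (rule nn_integral_cmul[OF _ a0(1)]) measurable
  also have "(\<integral>\<^sup>+w. ?G (cmul a w) \<partial>lborel) \<le> (\<integral>\<^sup>+w. indicator (cbox (- ?u) ?u) w \<partial>lborel)"
  proof (rule nn_integral_mono)
    fix w :: "real^2"
    show "?G (cmul a w) \<le> indicator (cbox (- ?u) ?u) w"
    proof (cases "\<bar>det2 a (cmul a w)\<bar> / 2 < v \<and> norm (cmul a w) \<le> 2 * K")
      case True
      have "(norm a)\<^sup>2 * \<bar>w$2\<bar> < 2 * v" using True by (simp add: det2_cmul abs_mult)
      then have w2: "\<bar>w$2\<bar> \<le> 2 * v / (norm a)\<^sup>2" using a0 by (simp add: le_divide_eq mult.commute)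
      have "norm a * norm w \<le> 2 * K" using True by (simp add: norm_cmul)
      then have "norm w \<le> 2 * K / norm a" using a0 by (simp add: le_divide_eq mult.commute)
      then have w1: "\<bar>w$1\<bar> \<le> 2 * K / norm a" using component_le_norm_cart[of w 1] by linarith
      have "w \<in> cbox (- ?u) ?u" using w1 w2 unfolding mem_box_cart forall_2 by (simp add: abs_le_iff) 
      then show ?thesis by simp
    next
      case False
      then have "?G (cmul a w) = 0" by (rule if_not_P)
      then show ?thesis by simp
    qed
  qed
  also have "(\<integral>\<^sup>+w. indicator (cbox (- ?u) ?u) w \<partial>lborel) = ennreal ((4 * K / norm a) * (4 * v / (norm a)\<^sup>2))"
  proof -
    have "\<forall>b\<in>Basis. (- ?u) \<bullet> b \<le> ?u \<bullet> b" using K v by (simp add: Basis_2 inner_axis)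
    then have "emeasure lborel (cbox (- ?u) ?u) = ennreal ((4 * K / norm a) * (4 * v / (norm a)\<^sup>2))"
      unfolding emeasure_lborel_cbox_eq by (simp add: prod_Basis_2 inner_axis)
    then show ?thesis by simp
  qed
  also have "ennreal ((norm a)\<^sup>2) * ennreal ((4 * K / norm a) * (4 * v / (norm a)\<^sup>2)) = ennreal (16 * K * v / norm a)"
    using a0 K v by (subst ennreal_mult[symmetric]) auto
  also have "\<dots> \<le> ennreal (16 * K * v / \<delta>)"
    using na \<delta> K v a0 by (intro ennreal_leI divide_left_mono mult_pos_pos) auto
  finally show ?thesis using False by (simp add: mult_left_mono)
qed

lemma emeasure_disc: "\<delta> \<ge> 0 \<Longrightarrow> emeasure lborel (ball (c::real^2) \<delta>) = ennreal (pi * \<delta>\<^sup>2)"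
  using emeasure_bounded_finite[of "ball c \<delta>"] circle_area[of \<delta> c] by (simp add: emeasure_eq_ennreal_measure less_top mult.commute)

text \<open>The short-side case: the conditions on area and circumradius are discarded, and a pair
  within distance \<delta> costs the area of a disc.\<close>

lemma close_pairs:
  assumes U [measurable]: "U \<in> sets borel" and \<delta>: "\<delta> > 0"
  shows "(\<integral>\<^sup>+x. \<integral>\<^sup>+y. \<integral>\<^sup>+z. close_triple v K U x y z * (indicator {..<\<delta>} (dist x y) + indicator {..<\<delta>} (dist x z) + indicator {..<\<delta>} (dist y z)) \<partial>lborel \<partial>lborel \<partial>lborel)
    \<le> 3 * ((emeasure lborel U)\<^sup>2 * ennreal (pi * \<delta>\<^sup>2))"
proof -
  let ?\<Lambda> = "emeasure lborel U" and ?d = "ennreal (pi * \<delta>\<^sup>2)"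
  have b: "(\<integral>\<^sup>+z. indicator {..<\<delta>} (dist x z) \<partial>lborel) = ?d" for x :: "real^2"
  proof -
    have "(\<integral>\<^sup>+z. indicator {..<\<delta>} (dist x z) \<partial>lborel) = (\<integral>\<^sup>+z. indicator (ball x \<delta>) z \<partial>lborel)"
      by (rule nn_integral_cong) (simp add: indicator_def)
    then show ?thesis using emeasure_disc \<delta> by simp
  qed
  have "close_triple v K U x y z * (indicator {..<\<delta>} (dist x y) + indicator {..<\<delta>} (dist x z) + indicator {..<\<delta>} (dist y z)) \<le>
     indicator U x * (indicator {..<\<delta>} (dist x y) * indicator U z) + indicator U x * (indicator U y * indicator {..<\<delta>} (dist x z)) + indicator U x * (indicator U y * indicator {..<\<delta>} (dist y z))" for x y z
  proof (cases "close_triple v K U x y z = 0")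
    case False
    then have "close_triple v K U x y z = 1" "x \<in> U" "y \<in> U" "z \<in> U" by (auto simp: close_triple_def split: if_splits)
    then show ?thesis by (simp add: indicator_def)
  qed simp
  then have "(\<integral>\<^sup>+x. \<integral>\<^sup>+y. \<integral>\<^sup>+z. close_triple v K U x y z * (indicator {..<\<delta>} (dist x y) + indicator {..<\<delta>} (dist x z) + indicator {..<\<delta>} (dist y z)) \<partial>lborel \<partial>lborel \<partial>lborel) \<le>
    (\<integral>\<^sup>+x. \<integral>\<^sup>+y. \<integral>\<^sup>+z. indicator U x * (indicator {..<\<delta>} (dist x y) * indicator U z) + indicator U x * (indicator U y * indicator {..<\<delta>} (dist x z)) + indicator U x * (indicator U y * indicator {..<\<delta>} (dist y z)) \<partial>lborel \<partial>lborel \<partial>lborel)"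
    by (intro nn_integral_mono)
  also have "\<dots> = (\<integral>\<^sup>+x. \<integral>\<^sup>+y. indicator U x * (indicator {..<\<delta>} (dist x y) * ?\<Lambda>) + indicator U x * (indicator U y * ?d) + indicator U x * (indicator U y * ?d) \<partial>lborel \<partial>lborel)"
    by (simp add: nn_integral_add nn_integral_cmult b)
  also have "\<dots> = (\<integral>\<^sup>+x. indicator U x * (?d * ?\<Lambda>) + indicator U x * (?\<Lambda> * ?d) + indicator U x * (?\<Lambda> * ?d) \<partial>lborel)"
    by (simp add: nn_integral_add nn_integral_cmult nn_integral_multc b)
  also have "\<dots> = ?\<Lambda> * (?d * ?\<Lambda>) + ?\<Lambda> * (?\<Lambda> * ?d) + ?\<Lambda> * (?\<Lambda> * ?d)"
    by (simp add: nn_integral_add nn_integral_multc)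
  also have "\<dots> = 3 * (?\<Lambda>\<^sup>2 * ?d)"
  proof -
    have "a + a + a = 3 * (a::ennreal)" for a
    proof -
      have "(3::ennreal) = 1 + 1 + 1" by simp
      then show ?thesis by (simp only: distrib_right mult_1_left)
    qed
    then show ?thesis by (simp add: power2_eq_square mult_ac)
  qed
  finally show ?thesis .
qed

section \<open>Expected number of pairs of small triangles\<close>

context planar_poisson
begin

text \<open>The parameter \<open>\<delta>\<close> is the length below which a common side of two small triangles is treated as exceptional.\<close>

definition clash :: "real \<Rightarrow> real \<Rightarrow> real \<Rightarrow> ennreal \<Rightarrow> ennreal" where
  "clash v K \<delta> \<Lambda> = ennreal (\<beta> ^ 3) * ((ennreal (48 * \<beta> * K * v / \<delta>) + ennreal (3 * \<beta>\<^sup>2) * radius_tail 0 {..K} v + ennreal (\<beta> ^ 3) * (\<Lambda> * radius_tail 0 {..K} v)) * (\<Lambda> * radius_tail 0 {..K} v)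
     + ennreal \<beta> * (\<Lambda> * (3 * (\<Lambda>\<^sup>2 * ennreal (pi * \<delta>\<^sup>2)))))"

lemma emeasure_law_lfin [simp]: "emeasure law lfin = 1"
  using prob_space.emeasure_space_1[OF prob_space_law] by simp

text \<open>\<open>mecke3\<close> integrates out the first triangle. For the second, the Mecke
  formula is applied once, twice or three times according to the number of new vertices; the first
  triangle influences the bound through short shared sides alone.\<close>

lemma clash_bound:
  assumes U [measurable]: "U \<in> sets borel" and \<delta>: "\<delta> > 0" and K: "K > 0" and v: "v > 0"
  shows "(\<integral>\<^sup>+\<xi>. triple_sum \<xi> (\<lambda>x y z. close_triple v K U x y z * other_triples v K U x y z (\<xi> - {x} - {y} - {z})) \<partial>law)
    \<le> clash v K \<delta> (emeasure lborel U)"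
    and "(\<lambda>\<xi>. triple_sum \<xi> (\<lambda>x y z. close_triple v K U x y z * other_triples v K U x y z (\<xi> - {x} - {y} - {z}))) \<in> borel_measurable cfg"
proof -
  let ?\<Lambda> = "emeasure lborel U" and ?D = "radius_tail 0 {..K} v" and ?t = "close_triple v K U"
  define g1 where "g1 = (\<lambda>(p, c, \<eta>::(real^2) set). pair_sum v K U (fst p) (fst (snd p)) (snd (snd p)) c)"
  have g1 [measurable]: "g1 \<in> borel_measurable ((borel \<Otimes>\<^sub>M (borel \<Otimes>\<^sub>M borel)) \<Otimes>\<^sub>M (borel \<Otimes>\<^sub>M cfg))"
    unfolding g1_def by measurable
  define g2 where "g2 = (\<lambda>(q, c, \<eta>::(real^2) set). single_sum v K U (fst (fst q)) (fst (snd (fst q))) (snd (snd (fst q))) (snd q) c)"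
  have g2 [measurable]: "g2 \<in> borel_measurable (((borel \<Otimes>\<^sub>M (borel \<Otimes>\<^sub>M borel)) \<Otimes>\<^sub>M borel) \<Otimes>\<^sub>M (borel \<Otimes>\<^sub>M cfg))"
    unfolding g2_def by measurable
  define g3 where "g3 = (\<lambda>(p, b, \<eta>). point_sum_last g2 ((p, b), \<eta>))"
  have g3 [measurable]: "g3 \<in> borel_measurable ((borel \<Otimes>\<^sub>M (borel \<Otimes>\<^sub>M borel)) \<Otimes>\<^sub>M (borel \<Otimes>\<^sub>M cfg))"
    unfolding g3_def by measurable
  define g4 where "g4 = (\<lambda>(x, y, z, \<eta>::(real^2) set). ?t x y z)"
  have g4 [measurable]: "g4 \<in> borel_measurable (borel \<Otimes>\<^sub>M (borel \<Otimes>\<^sub>M (borel \<Otimes>\<^sub>M cfg)))"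
    unfolding g4_def by measurable
  have c4 [measurable]: "(\<lambda>\<xi>. triple_sum \<xi> ?t) \<in> borel_measurable cfg"
    using mecke3(1)[OF g4] by (simp add: g4_def)
  define f where "f = (\<lambda>(x, y, z, \<eta>). ?t x y z * (point_sum_last g1 ((x, y, z), \<eta>) + point_sum_last g3 ((x, y, z), \<eta>) + triple_sum \<eta> ?t))"
  have f [measurable]: "f \<in> borel_measurable (borel \<Otimes>\<^sub>M (borel \<Otimes>\<^sub>M (borel \<Otimes>\<^sub>M cfg)))"
    unfolding f_def by measurable
  have fe: "f (x, y, z, \<eta>) = ?t x y z * other_triples v K U x y z \<eta>" for x y z \<eta>
    by (simp add: f_def other_triples_def point_sum_last_def g1_def g2_def g3_def)
  show "(\<lambda>\<xi>. triple_sum \<xi> (\<lambda>x y z. ?t x y z * other_triples v K U x y z (\<xi> - {x} - {y} - {z}))) \<in> borel_measurable cfg"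
    using mecke3(1)[OF f] unfolding fe .
  have cl [measurable]: "point_sum_last g1 \<in> borel_measurable ((borel \<Otimes>\<^sub>M (borel \<Otimes>\<^sub>M borel)) \<Otimes>\<^sub>M cfg)"
    "point_sum_last g3 \<in> borel_measurable ((borel \<Otimes>\<^sub>M (borel \<Otimes>\<^sub>M borel)) \<Otimes>\<^sub>M cfg)" by measurable
  have e1: "(\<integral>\<^sup>+\<xi>. point_sum_last g1 ((x, y, z), \<xi>) \<partial>law) = ennreal \<beta> * (\<integral>\<^sup>+c. pair_sum v K U x y z c \<partial>lborel)" for x y z
  proof -
    have "(\<lambda>q. g1 ((x, y, z), q)) \<in> borel_measurable (borel \<Otimes>\<^sub>M cfg)" by measurable
    from mecke[OF this] show ?thesis by (simp add: point_sum_last_def g1_def)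
  qed
  have e2: "(\<integral>\<^sup>+\<xi>. point_sum_last g3 ((x, y, z), \<xi>) \<partial>law) = ennreal \<beta> * (\<integral>\<^sup>+b. ennreal \<beta> * (\<integral>\<^sup>+c. single_sum v K U x y z b c \<partial>lborel) \<partial>lborel)" for x y z
  proof -
    have i: "(\<integral>\<^sup>+\<xi>. g3 ((x, y, z), b, \<xi>) \<partial>law) = ennreal \<beta> * (\<integral>\<^sup>+c. single_sum v K U x y z b c \<partial>lborel)" for b
    proof -
      have "(\<lambda>q. g2 (((x, y, z), b), q)) \<in> borel_measurable (borel \<Otimes>\<^sub>M cfg)" by measurable
      from mecke[OF this] show ?thesis by (simp add: g3_def point_sum_last_def g2_def)
    qed
    have "(\<lambda>q. g3 ((x, y, z), q)) \<in> borel_measurable (borel \<Otimes>\<^sub>M cfg)" by measurable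
    from mecke[OF this] show ?thesis unfolding i by (simp add: point_sum_last_def)
  qed
  have e3: "(\<integral>\<^sup>+\<xi>. triple_sum \<xi> ?t \<partial>law) = ennreal (\<beta> ^ 3) * (\<integral>\<^sup>+x. \<integral>\<^sup>+y. \<integral>\<^sup>+z. ?t x y z \<partial>lborel \<partial>lborel \<partial>lborel)"
    using mecke3(2)[OF g4] by (simp add: g4_def)
  \<comment> \<open>The part of the bound on the mean number of further triangles that is uniform in
    the first triangle; \<open>48 = 3 * 16\<close> counts its three sides. Exceptionally short sides
    are recorded separately in \<open>?i\<close>.\<close>
  define A where "A = ennreal (48 * \<beta> * K * v / \<delta>) + ennreal (3 * \<beta>\<^sup>2) * ?D + ennreal (\<beta> ^ 3) * (?\<Lambda> * ?D)"
  let ?i = "\<lambda>x y z. indicator {..<\<delta>} (dist x y) + indicator {..<\<delta>} (dist x z) + indicator {..<\<delta>} (dist y z) :: ennreal"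
  have main: "(\<integral>\<^sup>+\<xi>. f (x, y, z, \<xi>) \<partial>law) \<le> A * ?t x y z + ennreal \<beta> * ?\<Lambda> * (?t x y z * ?i x y z)" for x y z
  proof -
    have m1: "(\<lambda>\<xi>. point_sum_last g1 ((x, y, z), \<xi>)) \<in> borel_measurable law" "(\<lambda>\<xi>. point_sum_last g3 ((x, y, z), \<xi>)) \<in> borel_measurable law"
      "(\<lambda>\<xi>. triple_sum \<xi> ?t) \<in> borel_measurable law"
      by measurable
    have "(\<integral>\<^sup>+\<xi>. f (x, y, z, \<xi>) \<partial>law) = ?t x y z * (\<integral>\<^sup>+\<xi>. point_sum_last g1 ((x, y, z), \<xi>) + point_sum_last g3 ((x, y, z), \<xi>) + triple_sum \<xi> ?t \<partial>law)"
      using m1 unfolding f_def prod.case by (intro nn_integral_cmult borel_measurable_add)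
    also have "(\<integral>\<^sup>+\<xi>. point_sum_last g1 ((x, y, z), \<xi>) + point_sum_last g3 ((x, y, z), \<xi>) + triple_sum \<xi> ?t \<partial>law) =
      (\<integral>\<^sup>+\<xi>. point_sum_last g1 ((x, y, z), \<xi>) \<partial>law) + (\<integral>\<^sup>+\<xi>. point_sum_last g3 ((x, y, z), \<xi>) \<partial>law) + (\<integral>\<^sup>+\<xi>. triple_sum \<xi> ?t \<partial>law)"
      using m1 by (simp add: nn_integral_add)
    also have "\<dots> \<le> A + ennreal \<beta> * ?\<Lambda> * ?i x y z"
    proof -
      have "(\<integral>\<^sup>+c. pair_sum v K U x y z c \<partial>lborel) = (\<integral>\<^sup>+c. ?t x y c \<partial>lborel) + (\<integral>\<^sup>+c. ?t x z c \<partial>lborel) + (\<integral>\<^sup>+c. ?t y z c \<partial>lborel)"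
        unfolding pair_sum_def by (simp add: nn_integral_add)
      also have "\<dots> \<le> (ennreal (16 * K * v / \<delta>) + ?\<Lambda> * indicator {..<\<delta>} (dist x y)) + (ennreal (16 * K * v / \<delta>) + ?\<Lambda> * indicator {..<\<delta>} (dist x z)) + (ennreal (16 * K * v / \<delta>) + ?\<Lambda> * indicator {..<\<delta>} (dist y z))"
        by (intro add_mono close_triple_one assms)
      also have "\<dots> = (ennreal (16 * K * v / \<delta>) + ennreal (16 * K * v / \<delta>) + ennreal (16 * K * v / \<delta>)) + ?\<Lambda> * ?i x y z"
        by (simp only: distrib_left add_ac)
      also have "ennreal (16 * K * v / \<delta>) + ennreal (16 * K * v / \<delta>) + ennreal (16 * K * v / \<delta>) = ennreal (48 * K * v / \<delta>)"
        using K v \<delta> by (simp add: ennreal_plus[symmetric] add_divide_distrib[symmetric] del: ennreal_plus)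
      finally have "ennreal \<beta> * (\<integral>\<^sup>+c. pair_sum v K U x y z c \<partial>lborel) \<le> ennreal \<beta> * (ennreal (48 * K * v / \<delta>) + ?\<Lambda> * ?i x y z)"
        by (rule mult_left_mono) simp
      also have "\<dots> = ennreal (48 * \<beta> * K * v / \<delta>) + ennreal \<beta> * ?\<Lambda> * ?i x y z"
        using K v \<delta> intensity_pos by (simp add: distrib_left ennreal_mult[symmetric] mult_ac)
      finally have 1: "ennreal \<beta> * (\<integral>\<^sup>+c. pair_sum v K U x y z c \<partial>lborel) \<le> ennreal (48 * \<beta> * K * v / \<delta>) + ennreal \<beta> * ?\<Lambda> * ?i x y z" .
      have "(\<integral>\<^sup>+b. ennreal \<beta> * (\<integral>\<^sup>+c. single_sum v K U x y z b c \<partial>lborel) \<partial>lborel) = ennreal \<beta> * ((\<integral>\<^sup>+b. \<integral>\<^sup>+c. ?t x b c \<partial>lborel \<partial>lborel) + (\<integral>\<^sup>+b. \<integral>\<^sup>+c. ?t y b c \<partial>lborel \<partial>lborel) + (\<integral>\<^sup>+b. \<integral>\<^sup>+c. ?t z b c \<partial>lborel \<partial>lborel))"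
        unfolding single_sum_def by (simp add: nn_integral_add nn_integral_cmult)
      also have "\<dots> \<le> ennreal \<beta> * (?D + ?D + ?D)" by (intro mult_left_mono add_mono close_triple_two) auto
      finally have "ennreal \<beta> * (\<integral>\<^sup>+b. ennreal \<beta> * (\<integral>\<^sup>+c. single_sum v K U x y z b c \<partial>lborel) \<partial>lborel) \<le> ennreal \<beta> * (ennreal \<beta> * (?D + ?D + ?D))"
        by (rule mult_left_mono) simp
      also have "\<dots> = ennreal (3 * \<beta>\<^sup>2) * ?D"
      proof -
        have "?D + ?D + ?D = ennreal 3 * ?D"
        proof -
          have "ennreal 3 = 1 + 1 + 1" by simp
          then show ?thesis by (simp only: distrib_right mult_1_left)
        qed
        then have "ennreal \<beta> * (ennreal \<beta> * (?D + ?D + ?D)) = (ennreal \<beta> * (ennreal \<beta> * ennreal 3)) * ?D" by (simp only: mult.assoc)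
        also have "ennreal \<beta> * (ennreal \<beta> * ennreal 3) = ennreal (3 * \<beta>\<^sup>2)"
          using intensity_pos by (simp only: ennreal_mult[symmetric] less_imp_le zero_le_numeral mult_nonneg_nonneg) (simp add: power2_eq_square mult_ac)
        finally show ?thesis .
      qed
      finally have 2: "ennreal \<beta> * (\<integral>\<^sup>+b. ennreal \<beta> * (\<integral>\<^sup>+c. single_sum v K U x y z b c \<partial>lborel) \<partial>lborel) \<le> ennreal (3 * \<beta>\<^sup>2) * ?D" .
      have 3: "ennreal (\<beta> ^ 3) * (\<integral>\<^sup>+x. \<integral>\<^sup>+y. \<integral>\<^sup>+z. ?t x y z \<partial>lborel \<partial>lborel \<partial>lborel) \<le> ennreal (\<beta> ^ 3) * (?\<Lambda> * ?D)"
        by (intro mult_left_mono close_triple_three U) simp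
      have "(\<integral>\<^sup>+\<xi>. point_sum_last g1 ((x, y, z), \<xi>) \<partial>law) + (\<integral>\<^sup>+\<xi>. point_sum_last g3 ((x, y, z), \<xi>) \<partial>law) + (\<integral>\<^sup>+\<xi>. triple_sum \<xi> ?t \<partial>law) \<le>
         (ennreal (48 * \<beta> * K * v / \<delta>) + ennreal \<beta> * ?\<Lambda> * ?i x y z) + ennreal (3 * \<beta>\<^sup>2) * ?D + ennreal (\<beta> ^ 3) * (?\<Lambda> * ?D)"
        unfolding e1 e2 e3 by (intro add_mono 1 2 3)
      also have "\<dots> = A + ennreal \<beta> * ?\<Lambda> * ?i x y z" unfolding A_def by (simp only: add_ac)
      finally show ?thesis .
    qed
    finally have "(\<integral>\<^sup>+\<xi>. f (x, y, z, \<xi>) \<partial>law) \<le> ?t x y z * (A + ennreal \<beta> * ?\<Lambda> * ?i x y z)"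
      by (simp add: mult_left_mono)
    then show ?thesis by (simp only: distrib_left mult_ac)
  qed
  have "(\<integral>\<^sup>+x. \<integral>\<^sup>+y. \<integral>\<^sup>+z. \<integral>\<^sup>+\<xi>. f (x, y, z, \<xi>) \<partial>law \<partial>lborel \<partial>lborel \<partial>lborel) \<le>
    (\<integral>\<^sup>+x. \<integral>\<^sup>+y. \<integral>\<^sup>+z. A * ?t x y z + ennreal \<beta> * ?\<Lambda> * (?t x y z * ?i x y z) \<partial>lborel \<partial>lborel \<partial>lborel)"
    by (intro nn_integral_mono main)
  also have "\<dots> = A * (\<integral>\<^sup>+x. \<integral>\<^sup>+y. \<integral>\<^sup>+z. ?t x y z \<partial>lborel \<partial>lborel \<partial>lborel) + ennreal \<beta> * ?\<Lambda> * (\<integral>\<^sup>+x. \<integral>\<^sup>+y. \<integral>\<^sup>+z. ?t x y z * ?i x y z \<partial>lborel \<partial>lborel \<partial>lborel)"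
    by (simp add: nn_integral_add nn_integral_cmult)
  also have "\<dots> \<le> A * (?\<Lambda> * ?D) + ennreal \<beta> * ?\<Lambda> * (3 * (?\<Lambda>\<^sup>2 * ennreal (pi * \<delta>\<^sup>2)))"
    by (intro add_mono mult_left_mono close_triple_three close_pairs U \<delta>) auto
  finally have "ennreal (\<beta> ^ 3) * (\<integral>\<^sup>+x. \<integral>\<^sup>+y. \<integral>\<^sup>+z. \<integral>\<^sup>+\<xi>. f (x, y, z, \<xi>) \<partial>law \<partial>lborel \<partial>lborel \<partial>lborel) \<le>
     ennreal (\<beta> ^ 3) * (A * (?\<Lambda> * ?D) + ennreal \<beta> * ?\<Lambda> * (3 * (?\<Lambda>\<^sup>2 * ennreal (pi * \<delta>\<^sup>2))))"
    by (rule mult_left_mono) simp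
  then show "(\<integral>\<^sup>+\<xi>. triple_sum \<xi> (\<lambda>x y z. ?t x y z * other_triples v K U x y z (\<xi> - {x} - {y} - {z})) \<partial>law) \<le> clash v K \<delta> ?\<Lambda>"
    using mecke3(2)[OF f] unfolding fe clash_def A_def by (simp only: mult.assoc)
qed

end

section \<open>The constant\<close>

text \<open>Legendre's duplication formula at 1/6, transferred from the complex numbers. It trades
  the \<open>Gamma (1/6)\<close> of \<open>alpha3\<close> for the values at 1/3 and 2/3 that the
  Beta integral yields.\<close>

lemma Gamma_sixth: "Gamma (1/6) * Gamma (2/3) = 2 powr (2/3) * sqrt pi * Gamma (1/3 :: real)"
proof -
  have n: "complex_of_real (1/6) \<notin> \<int>\<^sub>\<le>\<^sub>0" "complex_of_real (1/6) + 1/2 \<notin> \<int>\<^sub>\<le>\<^sub>0"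
    by (auto elim!: nonpos_Ints_cases simp: complex_eq_iff)
  have e: "complex_of_real (1/6) + 1/2 = complex_of_real (2/3)" "2 * complex_of_real (1/6) = complex_of_real (1/3)" 
    "(1 - complex_of_real (1/3)) * complex_of_real (ln 2) = complex_of_real (2/3 * ln 2)"
    by (simp_all add: complex_eq_iff)
  have "complex_of_real (Gamma (1/6) * Gamma (2/3)) = complex_of_real (exp (2/3 * ln 2) * sqrt pi * Gamma (1/3))"
    using Gamma_legendre_duplication[OF n] unfolding e Gamma_complex_of_real exp_of_real by (simp only: of_real_mult)
  then have "Gamma (1/6) * Gamma (2/3) = exp (2/3 * ln 2) * sqrt pi * Gamma (1/3 :: real)" by (simp only: of_real_eq_iff)
  then show ?thesis by (simp add: powr_def)
qed

text \<open>The reflection formula at 1/3, with \<open>sin (pi/3) = sqrt 3 / 2\<close>.\<close>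

lemma Gamma_thirds: "Gamma (1/3) * Gamma (2/3) = 2 * pi / sqrt (3 :: real)"
proof -
  have e: "1 - complex_of_real (1/3) = complex_of_real (2/3)" "complex_of_real pi * complex_of_real (1/3) = complex_of_real (pi/3)"
    by (simp_all add: complex_eq_iff)
  have "complex_of_real (Gamma (1/3) * Gamma (2/3)) = complex_of_real (pi / sin (pi/3))"
    using Gamma_reflection_complex[of "complex_of_real (1/3)"] unfolding e Gamma_complex_of_real sin_of_real
    by (simp only: of_real_mult of_real_divide)
  then have "Gamma (1/3) * Gamma (2/3) = pi / sin (pi/3 :: real)" by (simp only: of_real_eq_iff)
  then show ?thesis by (simp add: sin_60)
qed

lemma alpha3_pos: "alpha3 > 0"
proof -
  have "Gamma (1/6 :: real) > 0" by (simp add: Gamma_real_pos)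
  then show ?thesis unfolding alpha3_def by (intro mult_pos_pos zero_less_power) auto
qed

text \<open>The left side is the limiting mean number of ordered triples for
  \<open>\<beta> = 1/2\<close> and \<open>v powr (5/3) * \<rho> = 1\<close>; the six orderings
  account for the factor 6. Eliminating \<open>Gamma (1/6)\<close> and one factor \<open>pi\<close>
  reduces both sides to multiples of \<open>Gamma (1/3) ^ 3 / Gamma (2/3)\<close>.\<close>

lemma rate_constant: "(1/2) ^ 3 * tail_const * (pi * Gamma (1/3) * (1/2 * pi) powr (-1/3)) = 6 * alpha3"
proof -
  define g h where "g = Gamma (1/3 :: real)" and "h = Gamma (2/3 :: real)"
  have pos: "g > 0" "h > 0" by (simp_all add: g_def h_def Gamma_real_pos)
  have "Gamma (1/6) * h = 2 powr (2/3) * sqrt pi * g" unfolding g_def h_def by (rule Gamma_sixth)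
  then have s6: "Gamma (1/6) = 2 powr (2/3) * sqrt pi * g / h" using pos by (simp only: eq_divide_eq) simp
  have s3: "g * h * sqrt 3 = 2 * pi" using Gamma_thirds by (simp add: g_def h_def)
  have p2: "(2 powr (2/3))\<^sup>2 = (2::real) powr (4/3)" by (simp add: power2_eq_square powr_add[symmetric])
  have p3: "(3::real) powr (-1/2) = sqrt 3 / 3"
  proof -
    have "(3::real) powr (-1/2) = 3 powr (1/2) * 3 powr (-1)" by (subst powr_add[symmetric]) simp
    then show ?thesis by (simp add: powr_half_sqrt powr_minus_divide)
  qed
  have q1: "(2::real) powr (-2/3) * 2 powr (4/3) = 2 powr (2/3)" by (simp add: powr_add[symmetric])
  have q2: "(1/2::real) powr (5/3) * (1/2) powr (-1/3) = 2 powr (2/3) / 4"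
  proof -
    have "(1/2::real) powr (5/3) * (1/2) powr (-1/3) = (1/2) powr (4/3)" by (simp add: powr_add[symmetric])
    also have "\<dots> = 2 powr (2/3 - 2)" by (simp add: powr_divide powr_minus_divide)
    also have "\<dots> = 2 powr (2/3) / 2 powr 2" by (rule powr_diff)
    finally show ?thesis by simp
  qed
  have q3: "pi * pi powr (-1/3) = pi powr (2/3)"
  proof -
    have "pi powr 1 * pi powr (-1/3) = pi powr (2/3)" by (simp only: powr_add[symmetric]; simp)
    then show ?thesis by simp
  qed
  have b: "beta_const = 3 * (g * g / h)" by (simp add: beta_const_def Beta_def g_def h_def)
  have "(1/2) ^ 3 * tail_const * (pi * Gamma (1/3) * (1/2 * pi) powr (-1/3)) =
    1/8 * (32/5 * (1/2) powr (5/3) * (3 * (g * g / h))) * (pi * g * ((1/2) powr (-1/3) * pi powr (-1/3)))"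
    unfolding tail_const_def b g_def[symmetric] by (subst powr_mult) (simp_all add: power3_eq_cube)
  also have "\<dots> = 12/5 * ((1/2) powr (5/3) * (1/2) powr (-1/3)) * (pi * pi powr (-1/3)) * (g * g * g / h)"
    by simp
  also have "\<dots> = 3/5 * 2 powr (2/3) * pi powr (2/3) * (g * g * g / h)"
    unfolding q2 q3 by simp
  finally have l: "(1/2) ^ 3 * tail_const * (pi * Gamma (1/3) * (1/2 * pi) powr (-1/3)) = 3/5 * 2 powr (2/3) * pi powr (2/3) * (g * g * g / h)" .
  have "5 powr (-1) = (1/5::real)" by (simp add: powr_minus_divide)
  then have "alpha3 = 2 powr (-2/3) * (sqrt 3 / 3) * (1/5) * pi powr (2/3) * (2 powr (2/3) * sqrt pi * g / h)\<^sup>2"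
    unfolding alpha3_def s6 p3 by simp
  also have "(2 powr (2/3) * sqrt pi * g / h)\<^sup>2 = 2 powr (4/3) * pi * g\<^sup>2 / h\<^sup>2"
    by (simp add: power_mult_distrib power_divide p2)
  also have "2 powr (-2/3) * (sqrt 3 / 3) * (1/5) * pi powr (2/3) * (2 powr (4/3) * pi * g\<^sup>2 / h\<^sup>2) =
    (2 powr (-2/3) * 2 powr (4/3)) * pi powr (2/3) * (sqrt 3 / 15) * (g\<^sup>2 / h\<^sup>2) * pi" by simp
  also have "\<dots> = 2 powr (2/3) * pi powr (2/3) * (sqrt 3 / 15) * (g\<^sup>2 / h\<^sup>2) * (g * h * sqrt 3 / 2)"
    unfolding q1 s3 by simp
  also have "\<dots> = 2 powr (2/3) * pi powr (2/3) * (sqrt 3 * sqrt 3 / 30) * (g * g * g / h)"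
    using pos by (simp add: field_simps power2_eq_square)
  finally show ?thesis unfolding l by simp
qed

section \<open>Asymptotics of the radius integrals\<close>

lemma radius_mass_LIMSEQ: "(\<lambda>j. radius_mass c {..real j}) \<longlonglongrightarrow> radius_mass c UNIV"
  unfolding radius_mass_def
proof (rule nn_integral_LIMSEQ)
  let ?g = "\<lambda>R. ennreal (2 * pi * (R powr (-1/3) * exp (- (c * R\<^sup>2)))) * indicator {0<..} R"
  show "incseq (\<lambda>j R. ?g R * indicator {..real j} R)"
    by (auto simp: incseq_def le_fun_def indicator_def intro!: mult_left_mono)
  show "(\<lambda>R. ?g R * indicator {..real j} R) \<in> borel_measurable lborel" for j by measurable
  fix R :: real
  have "eventually (\<lambda>j. ?g R * indicator {..real j} R = ?g R * indicator UNIV R) sequentially"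
    using eventually_ge_at_top[of "nat \<lceil>R\<rceil>"]
  proof eventually_elim
    case (elim j)
    then have "R \<le> real j" by linarith
    then show ?case by simp
  qed
  then show "(\<lambda>j. ?g R * indicator {..real j} R) \<longlonglongrightarrow> ?g R * indicator UNIV R"
    by (rule tendsto_eventually)
qed

text \<open>For circumradii up to \<open>K\<close> the Gaussian weight can be inserted at the price
  of \<open>exp (K^2)\<close>, so the asymptotics for positive \<open>c\<close> also control the
  pairs.\<close>

lemma radius_tail_0_le: "K \<ge> 0 \<Longrightarrow> radius_tail 0 {..K} v \<le> ennreal (exp (K\<^sup>2)) * radius_tail 1 {..K} v"
proof -
  assume K: "K \<ge> 0"
  let ?h = "\<lambda>c R. ennreal (2 * pi * R ^ 3) * indicator {0<..} R * (ennreal (exp (- (c * R\<^sup>2))) * indicator {..K} R * shape_tail (v / R\<^sup>2))"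
  have "?h 0 R \<le> ennreal (exp (K\<^sup>2)) * ?h 1 R" for R
  proof (cases "R > 0 \<and> R \<le> K")
    case True
    then have "R\<^sup>2 \<le> K\<^sup>2" by (intro power_mono) auto
    then have "1 \<le> ennreal (exp (K\<^sup>2)) * ennreal (exp (- R\<^sup>2))"
      by (simp add: ennreal_mult[symmetric] exp_add[symmetric])
    then have "1 * (ennreal (2 * pi * R ^ 3) * shape_tail (v / R\<^sup>2)) \<le> (ennreal (exp (K\<^sup>2)) * ennreal (exp (- R\<^sup>2))) * (ennreal (2 * pi * R ^ 3) * shape_tail (v / R\<^sup>2))"
      by (rule mult_right_mono) simp
    then show ?thesis using True by (simp add: mult_ac)
  qed auto
  then have "radius_tail 0 {..K} v \<le> (\<integral>\<^sup>+R. ennreal (exp (K\<^sup>2)) * ?h 1 R \<partial>lborel)"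
    unfolding radius_tail_def by (rule nn_integral_mono)
  also have "\<dots> = ennreal (exp (K\<^sup>2)) * radius_tail 1 {..K} v"
    unfolding radius_tail_def by (rule nn_integral_cmult) measurable
  finally show ?thesis .
qed

text \<open>The coupling \<open>v powr (5/3) * \<rho> = \<tau>\<close> turns
  \<open>radius_tail_limit\<close> into convergence of real numbers scaled by the area \<rho> of the
  window.\<close>

lemma radius_tail_asymptotics:
  assumes c: "c > 0" and S: "S \<in> sets borel" and \<tau>: "\<tau> > 0"
    and v: "\<And>n. v n > 0" "v \<longlonglongrightarrow> 0" and \<rho>: "\<And>n. v n powr (5/3) * \<rho> n = \<tau>"
  obtains r where "eventually (\<lambda>n. radius_tail c S (v n) = ennreal (r n)) sequentially" "\<And>n. r n \<ge> 0"
    "(\<lambda>n. \<rho> n * r n) \<longlonglongrightarrow> \<tau> * tail_const * enn2real (radius_mass c S)"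
proof
  let ?m = "enn2real (radius_mass c S)"
  have "radius_mass c S \<le> radius_mass c UNIV"
    unfolding radius_mass_def by (intro nn_integral_mono) (auto simp: indicator_def)
  then have "radius_mass c S < \<infinity>" unfolding radius_mass_UNIV[OF c] by (simp add: order_le_less_trans[OF _ ennreal_less_top])
  then have m: "radius_mass c S = ennreal ?m" by simp
  have tc: "tail_const \<ge> 0" using beta_const_nonneg by (simp add: tail_const_def)
  let ?q = "\<lambda>n. ennreal (v n powr (-5/3)) * radius_tail c S (v n)"
  have q: "?q \<longlonglongrightarrow> ennreal (tail_const * ?m)"
    using radius_tail_limit[OF c S v] m tc by (metis ennreal_mult enn2real_nonneg)
  have "eventually (\<lambda>n. ?q n < top) sequentially" by (rule order_tendstoD(2)[OF q]) simp
  then show "eventually (\<lambda>n. radius_tail c S (v n) = ennreal (enn2real (radius_tail c S (v n)))) sequentially"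
  proof eventually_elim
    case (elim n)
    have "v n powr (-5/3) > 0" using v(1)[of n] by simp
    then show ?case using elim by (auto simp: ennreal_mult_less_top)
  qed
  show "enn2real (radius_tail c S (v n)) \<ge> 0" for n by simp
  have "(\<lambda>n. enn2real (?q n)) \<longlonglongrightarrow> tail_const * ?m"
    by (rule tendsto_enn2real[OF q]) (simp add: tc)
  then have "(\<lambda>n. \<tau> * enn2real (?q n)) \<longlonglongrightarrow> \<tau> * (tail_const * ?m)" by (rule tendsto_mult_left)
  moreover have "\<tau> * enn2real (?q n) = \<rho> n * enn2real (radius_tail c S (v n))" for n
  proof -
    have "\<tau> * enn2real (?q n) = \<rho> n * (v n powr (-5/3) * v n powr (5/3)) * enn2real (radius_tail c S (v n))"
      unfolding \<rho>[of n, symmetric] by (simp add: enn2real_mult)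
    then show ?thesis unfolding powr_53_cancel[OF v(1)] by simp
  qed
  ultimately show "(\<lambda>n. \<rho> n * enn2real (radius_tail c S (v n))) \<longlonglongrightarrow> \<tau> * tail_const * ?m" by (simp add: mult.assoc)
qed

text \<open>Inverts \<open>1 / (1 - b) = 1 + b / (1 - b) \<le> exp (b / (1 - b))\<close>. It
  complements \<open>1 - b \<le> exp (- b)\<close> and serves the lower bound for products over
  blocks.\<close>

lemma exp_le_one_minus: "0 \<le> b \<Longrightarrow> b < 1 \<Longrightarrow> exp (- (b / (1 - b))) \<le> 1 - b" for b :: real
proof -
  assume b: "0 \<le> b" "b < 1"
  have "1 / (1 - b) = 1 + b / (1 - b)" using b by (simp add: field_simps)
  also have "\<dots> \<le> exp (b / (1 - b))" by (rule exp_ge_add_one_self)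
  finally show ?thesis using b by (simp add: exp_minus field_simps)
qed

lemma floor_ratio_tendsto:
  fixes s :: "nat \<Rightarrow> real"
  assumes s: "filterlim s at_top sequentially" and L: "L > 0"
  shows "(\<lambda>m. real (nat \<lfloor>s m / L\<rfloor>) / s m) \<longlonglongrightarrow> 1 / L"
proof (rule tendsto_sandwich)
  have pos: "eventually (\<lambda>m. s m > 0) sequentially" using s by (simp add: filterlim_at_top_dense)
  have "(\<lambda>m. inverse (s m)) \<longlonglongrightarrow> 0" by (rule tendsto_inverse_0_at_top[OF s])
  then have "(\<lambda>m. 1 / L - inverse (s m)) \<longlonglongrightarrow> 1 / L - 0" by (intro tendsto_intros)
  then show "(\<lambda>m. 1 / L - inverse (s m)) \<longlonglongrightarrow> 1 / L" by simp
  show "eventually (\<lambda>m. 1 / L - inverse (s m) \<le> real (nat \<lfloor>s m / L\<rfloor>) / s m) sequentially"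
    using pos
  proof eventually_elim
    case (elim m)
    have "s m / L - 1 \<le> real (nat \<lfloor>s m / L\<rfloor>)" by linarith
    then have "(s m / L - 1) / s m \<le> real (nat \<lfloor>s m / L\<rfloor>) / s m" using elim by (intro divide_right_mono) auto
    then show ?case using elim by (simp add: diff_divide_distrib inverse_eq_divide)
  qed
  show "eventually (\<lambda>m. real (nat \<lfloor>s m / L\<rfloor>) / s m \<le> 1 / L) sequentially"
    using pos
  proof eventually_elim
    case (elim m)
    have "s m / L \<ge> 0" using elim L by simp
    then have "real (nat \<lfloor>s m / L\<rfloor>) \<le> s m / L" by linarith
    then have "real (nat \<lfloor>s m / L\<rfloor>) / s m \<le> s m / L / s m" using elim by (intro divide_right_mono) auto
    then show ?case using elim by simp
  qed
qed simp

section \<open>Independent blocks\<close>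

text \<open>A triangle with centre in \<open>B\<close> and circumradius at most \<open>K\<close> has
  its vertices and its circumscribed disc in \<open>U\<close>, so points outside \<open>U\<close>
  are invisible to the count.\<close>

lemma num_exceed_local:
  assumes S: "S \<subseteq> {..K}" and B: "\<And>c. c \<in> B \<Longrightarrow> cball c K \<subseteq> U"
  shows "num_exceed v S B (\<xi> \<inter> U) = num_exceed v S B \<xi>"
proof -
  have "(x \<in> \<xi> \<inter> U \<and> y \<in> \<xi> \<inter> U \<and> z \<in> \<xi> \<inter> U \<and> exceed v S B (\<xi> \<inter> U) x y z) \<longleftrightarrow>
    (x \<in> \<xi> \<and> y \<in> \<xi> \<and> z \<in> \<xi> \<and> exceed v S B \<xi> x y z)" for x y z
  proof (cases "\<not> collinear {x, y, z} \<and> ccenter x y z \<in> B \<and> crad x y z \<in> S")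
    case True
    then have "{x, y, z} \<subseteq> cball (ccenter x y z) K" using sphere_ccenter[of x y z] S by auto
    moreover have "ball (ccenter x y z) (crad x y z) \<subseteq> cball (ccenter x y z) K" using True S by auto
    ultimately have "{x, y, z} \<subseteq> U" "ball (ccenter x y z) (crad x y z) \<subseteq> U" using B True by blast+
    then have "x \<in> U" "y \<in> U" "z \<in> U" "\<xi> \<inter> U \<inter> ball (ccenter x y z) (crad x y z) = \<xi> \<inter> ball (ccenter x y z) (crad x y z)" by auto
    then show ?thesis by (simp add: exceed_def empty_triple_def)
  qed (auto simp: exceed_def empty_triple_def)
  then have "exceed_set v S B (\<xi> \<inter> U) = exceed_set v S B \<xi>" unfolding exceed_set_def by simp
  then show ?thesis unfolding num_exceed_emeasure by simp
qed

lemma num_exceed_sum_le: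
  assumes fin: "finite I" and disj: "disjoint_family_on B I" and sub: "\<And>i. i \<in> I \<Longrightarrow> B i \<subseteq> W"
  shows "(\<Sum>i\<in>I. num_exceed v S (B i) \<xi>) \<le> num_exceed v UNIV W \<xi>"
proof -
  have "(\<Sum>i\<in>I. num_exceed v S (B i) \<xi>) = emeasure (count_space UNIV) (\<Union>i\<in>I. exceed_set v S (B i) \<xi>)"
    unfolding num_exceed_emeasure
  proof (rule sum_emeasure[OF _ _ fin])
    show "disjoint_family_on (\<lambda>i. exceed_set v S (B i) \<xi>) I"
      using disj unfolding disjoint_family_on_def exceed_set_def exceed_def by blast
  qed simp
  also have "\<dots> \<le> num_exceed v UNIV W \<xi>"
    unfolding num_exceed_emeasure using sub by (intro emeasure_mono) (auto simp: exceed_set_def exceed_def)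
  finally show ?thesis .
qed

lemma emeasure_box_mk2:
  assumes "a \<le> c" "b \<le> d"
  shows "emeasure lborel (box (mk2 a b) (mk2 c d)) = ennreal ((c - a) * (d - b))"
proof -
  have "\<forall>e\<in>Basis. mk2 a b \<bullet> e \<le> mk2 c d \<bullet> e" using assms by (simp add: Basis_2 inner_axis)
  then show ?thesis unfolding emeasure_lborel_box_eq by (simp add: prod_Basis_2 inner_axis)
qed

lemma mem_box_mk2: "p \<in> box (mk2 a b) (mk2 c d) \<longleftrightarrow> a < p$1 \<and> p$1 < c \<and> b < p$2 \<and> p$2 < d"
  by (auto simp: mem_box_cart forall_2)

text \<open>The margin \<open>K\<close> guarantees that cells of circumradius at most \<open>K\<close> with center in the shrunk block are determined by the points in the full block.\<close>

definition block :: "real \<Rightarrow> real \<Rightarrow> nat \<times> nat \<Rightarrow> (real^2) set" where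
  "block L K q = box (mk2 (real (fst q) * L + K) (real (snd q) * L + K)) (mk2 (real (Suc (fst q)) * L - K) (real (Suc (snd q)) * L - K))"

lemma block_cball: "c \<in> block L K q \<Longrightarrow> cball c K \<subseteq> block L 0 q"
proof
  fix p assume c: "c \<in> block L K q" and p: "p \<in> cball c K"
  have "\<bar>(p - c)$1\<bar> \<le> K" "\<bar>(p - c)$2\<bar> \<le> K"
    using p component_le_norm_cart[of "p - c"] by (auto simp: dist_norm norm_minus_commute intro: order_trans)
  then show "p \<in> block L 0 q" using c unfolding block_def mem_box_mk2 vector_minus_component by linarith
qed

lemma block_mono: "K \<ge> 0 \<Longrightarrow> block L K q \<subseteq> block L 0 q"
  unfolding block_def by (auto simp: mem_box_mk2)

lemma block_sets [measurable]: "block L K q \<in> sets borel"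
  by (simp add: block_def)

lemma emeasure_block: "2 * K \<le> L \<Longrightarrow> emeasure lborel (block L K q) = ennreal ((L - 2 * K)\<^sup>2)"
  unfolding block_def by (subst emeasure_box_mk2) (auto simp: power2_eq_square algebra_simps)

lemma block_index:
  fixes x L :: real
  assumes "L > 0" "real i * L < x" "x < real (Suc i) * L"
  shows "\<lfloor>x / L\<rfloor> = int i"
  using assms by (intro floor_unique) (auto simp: field_simps)

lemma block_disjoint:
  assumes L: "L > 0" and K: "K \<ge> 0"
  shows "disjoint_family_on (block L K) I"
  unfolding disjoint_family_on_def
proof (intro ballI impI)
  fix p q :: "nat \<times> nat" assume "p \<noteq> q"
  show "block L K p \<inter> block L K q = {}"
  proof (rule ccontr)
    assume "block L K p \<inter> block L K q \<noteq> {}"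
    then obtain x where x: "x \<in> block L 0 p" "x \<in> block L 0 q" using block_mono[OF K] by blast
    then have "\<lfloor>x$1 / L\<rfloor> = int (fst p)" "\<lfloor>x$1 / L\<rfloor> = int (fst q)" "\<lfloor>x$2 / L\<rfloor> = int (snd p)" "\<lfloor>x$2 / L\<rfloor> = int (snd q)"
      unfolding block_def mem_box_mk2 by (auto intro!: block_index[OF L])
    then show False using \<open>p \<noteq> q\<close> by (simp add: prod_eq_iff)
  qed
qed

lemma window_eq: 
  assumes "\<rho> \<ge> 0"
  shows "window \<rho> = cbox 0 (mk2 (sqrt \<rho>) (sqrt \<rho>))"
proof -
  have "(\<lambda>x. sqrt \<rho> *\<^sub>R x) ` cbox 0 1 = (\<lambda>x. sqrt \<rho> *\<^sub>R x + 0) ` cbox (0 :: real^2) 1" by simp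
  also have "\<dots> = cbox 0 (mk2 (sqrt \<rho>) (sqrt \<rho>))"
  proof -
    have "cbox (0::real^2) 1 \<noteq> {}" by (simp add: interval_ne_empty_cart)
    moreover have "sqrt \<rho> *\<^sub>R (1 :: real^2) = mk2 (sqrt \<rho>) (sqrt \<rho>)" by (simp add: vec_eq_iff forall_2)
    ultimately show ?thesis using assms unfolding image_affinity_cbox by simp
  qed
  finally show ?thesis unfolding window_def .
qed

lemma window_sets [measurable]: "\<rho> \<ge> 0 \<Longrightarrow> window \<rho> \<in> sets borel"
  by (simp add: window_eq)

lemma emeasure_window:
  assumes "\<rho> \<ge> 0"
  shows "emeasure lborel (window \<rho>) = ennreal \<rho>"
proof -
  have "\<forall>e\<in>Basis. (0 :: real^2) \<bullet> e \<le> mk2 (sqrt \<rho>) (sqrt \<rho>) \<bullet> e" using assms by (simp add: Basis_2 inner_axis)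
  then show ?thesis unfolding window_eq[OF assms] emeasure_lborel_cbox_eq using assms by (simp add: prod_Basis_2 inner_axis)
qed

lemma block_window:
  assumes n: "real n * L \<le> sqrt \<rho>" and \<rho>: "\<rho> \<ge> 0" and L: "L > 0" and q: "q \<in> {..<n} \<times> {..<n}"
  shows "block L 0 q \<subseteq> window \<rho>"
proof
  fix p assume p: "p \<in> block L 0 q"
  have le: "real (Suc i) * L \<le> sqrt \<rho>" if "i < n" for i
  proof -
    have "real (Suc i) * L \<le> real n * L" using that L by (intro mult_right_mono) auto
    then show ?thesis using n by simp
  qed
  have "0 \<le> real i * L" for i :: nat using L by simp
  then show "p \<in> window \<rho>"
    using p le[of "fst q"] le[of "snd q"] q order.strict_trans1[of 0 "real (fst q) * L" "p$1"] order.strict_trans1[of 0 "real (snd q) * L" "p$2"]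
    unfolding window_eq[OF \<rho>] block_def mem_box_mk2 mem_box_cart forall_2 by auto
qed

section \<open>Probabilities of small cells in blocks and in the window\<close>

context planar_poisson
begin

lemma num_exceed_measurable: "S \<in> sets borel \<Longrightarrow> B \<in> sets borel \<Longrightarrow> (\<lambda>\<omega>. num_exceed v S B (X \<omega>)) \<in> borel_measurable M"
  by (rule measurable_compose[OF X_measurable num_exceed(1)])

lemma num_exceed_expectation:
  assumes "S \<in> sets borel" "B \<in> sets borel"
  shows "(\<integral>\<^sup>+\<omega>. num_exceed v S B (X \<omega>) \<partial>M) = ennreal (\<beta> ^ 3) * emeasure lborel B * radius_tail (\<beta> * pi) S v"
  using num_exceed(2)[OF assms] unfolding integral_law[OF num_exceed(1)[OF assms]] .

definition hit :: "real \<Rightarrow> real \<Rightarrow> real \<Rightarrow> nat \<times> nat \<Rightarrow> 'w set" where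
  "hit v L K q = {\<omega> \<in> space M. num_exceed v {..K} (block L K q) (X \<omega>) \<noteq> 0}"

lemma hit_sets: "hit v L K q \<in> events"
proof -
  have [measurable]: "(\<lambda>\<omega>. num_exceed v {..K} (block L K q) (X \<omega>)) \<in> borel_measurable M" by (rule num_exceed_measurable) auto
  show ?thesis unfolding hit_def by measurable
qed

text \<open>By \<open>num_exceed_local\<close> the count in a shrunk block is a function of the
  points in the full block, and restrictions to the disjoint full blocks are independent.\<close>

lemma no_hit_prob:
  assumes L: "L > 0" and fin: "finite I" "I \<noteq> {}"
  shows "prob (\<Inter>q\<in>I. space M - hit v L K q) = (\<Prod>q\<in>I. 1 - prob (hit v L K q))"
proof -
  have loc: "num_exceed v {..K} (block L K q) (\<xi> \<inter> block L 0 q) = num_exceed v {..K} (block L K q) \<xi>" for q \<xi>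
    by (rule num_exceed_local[OF order_refl block_cball])
  have "indep_vars (\<lambda>_. cfg) (\<lambda>q \<omega>. X \<omega> \<inter> block L 0 q) I"
    using block_disjoint[OF L order_refl] fin(1) by (intro indep_restrictions) auto
  then have "indep_vars (\<lambda>_. borel) (\<lambda>q \<omega>. num_exceed v {..K} (block L K q) (X \<omega> \<inter> block L 0 q)) I"
    by (rule indep_vars_compose2) (rule num_exceed(1), auto)
  then have i: "indep_vars (\<lambda>_. borel) (\<lambda>q \<omega>. num_exceed v {..K} (block L K q) (X \<omega>)) I"
    unfolding loc .
  have e: "(\<lambda>\<omega>. num_exceed v {..K} (block L K q) (X \<omega>)) -` {0} \<inter> space M = space M - hit v L K q" for q
    by (auto simp: hit_def)
  show ?thesis using indep_varsD_finite[OF i fin(2,1), of "\<lambda>_. {0}"] unfolding e prob_compl[OF hit_sets] by simp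
qed

text \<open>The count is at least 6 on a hit, and by \<open>num_exceed_le\<close> at most 6 plus the
  contribution of pairs; taking expectations gives the two bounds.\<close>

lemma hit_prob:
  assumes v: "v > 0" and K: "K > 0" and L: "L > 2 * K" and \<delta>: "\<delta> > 0"
    and r: "radius_tail (\<beta> * pi) {..K} v = ennreal r" "r \<ge> 0" and cl: "clash v K \<delta> (ennreal (L\<^sup>2)) \<le> ennreal C" "C \<ge> 0"
  shows "6 * prob (hit v L K q) \<le> (L - 2 * K)\<^sup>2 * (\<beta> ^ 3 * r)" "(L - 2 * K)\<^sup>2 * (\<beta> ^ 3 * r) - C \<le> 6 * prob (hit v L K q)"
proof -
  let ?N = "\<lambda>\<omega>. num_exceed v {..K} (block L K q) (X \<omega>)"
  have b3: "\<beta> ^ 3 \<ge> 0" using intensity_pos by simp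
  have E: "(\<integral>\<^sup>+\<omega>. ?N \<omega> \<partial>M) = ennreal ((L - 2 * K)\<^sup>2 * (\<beta> ^ 3 * r))"
    using emeasure_block[of K L q] L r b3 by (simp add: num_exceed_expectation ennreal_mult[symmetric] mult_ac)
  have "(\<integral>\<^sup>+\<omega>. 6 * indicator (hit v L K q) \<omega> \<partial>M) = 6 * emeasure M (hit v L K q)"
    by (rule nn_integral_cmult_indicator[OF hit_sets])
  also have "\<dots> = ennreal (6 * prob (hit v L K q))" by (simp add: emeasure_eq_measure ennreal_mult)
  finally have H: "(\<integral>\<^sup>+\<omega>. 6 * indicator (hit v L K q) \<omega> \<partial>M) = ennreal (6 * prob (hit v L K q))" .
  have "(\<integral>\<^sup>+\<omega>. 6 * indicator (hit v L K q) \<omega> \<partial>M) \<le> (\<integral>\<^sup>+\<omega>. ?N \<omega> \<partial>M)"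
  proof (rule nn_integral_mono)
    fix \<omega>
    show "6 * indicator (hit v L K q) \<omega> \<le> ?N \<omega>"
      using num_exceed_ge_6[of v "{..K}" "block L K q" "X \<omega>"] by (cases "\<omega> \<in> hit v L K q") (auto simp: hit_def)
  qed
  then show "6 * prob (hit v L K q) \<le> (L - 2 * K)\<^sup>2 * (\<beta> ^ 3 * r)"
    unfolding E H using b3 r by (simp add: ennreal_le_iff)
  let ?c = "\<lambda>\<xi>. triple_sum \<xi> (\<lambda>x y z. close_triple v K (block L 0 q) x y z * other_triples v K (block L 0 q) x y z (\<xi> - {x} - {y} - {z}))"
  note cb = clash_bound[OF block_sets \<delta> K v, of L 0 q]
  have "(\<integral>\<^sup>+\<omega>. ?N \<omega> \<partial>M) \<le> (\<integral>\<^sup>+\<omega>. 6 * indicator (hit v L K q) \<omega> + ?c (X \<omega>) \<partial>M)"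
  proof (rule nn_integral_mono)
    fix \<omega> assume "\<omega> \<in> space M"
    then have "indicator {\<xi>. num_exceed v {..K} (block L K q) \<xi> \<noteq> 0} (X \<omega>) = (indicator (hit v L K q) \<omega> :: ennreal)"
      by (simp add: hit_def indicator_def)
    then show "?N \<omega> \<le> 6 * indicator (hit v L K q) \<omega> + ?c (X \<omega>)"
      using num_exceed_le[where S="{..K}" and B="block L K q" and U="block L 0 q" and v=v and \<xi>="X \<omega>", OF order_refl block_cball] by simp
  qed
  also have "\<dots> = ennreal (6 * prob (hit v L K q)) + (\<integral>\<^sup>+\<omega>. ?c (X \<omega>) \<partial>M)"
    unfolding H[symmetric]
  proof (rule nn_integral_add)
    show "(\<lambda>\<omega>. 6 * indicator (hit v L K q) \<omega> :: ennreal) \<in> borel_measurable M" using hit_sets by measurable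
    show "(\<lambda>\<omega>. ?c (X \<omega>)) \<in> borel_measurable M" by (rule measurable_compose[OF X_measurable cb(2)])
  qed
  also have "(\<integral>\<^sup>+\<omega>. ?c (X \<omega>) \<partial>M) \<le> ennreal C"
    using cb(1) cl(1) emeasure_block[of 0 L q] L K unfolding integral_law[OF cb(2)] by (auto intro: order_trans)
  finally have "ennreal ((L - 2 * K)\<^sup>2 * (\<beta> ^ 3 * r)) \<le> ennreal (6 * prob (hit v L K q) + C)"
    unfolding E using cl(2) by (simp add: add_left_mono)
  then show "(L - 2 * K)\<^sup>2 * (\<beta> ^ 3 * r) - C \<le> 6 * prob (hit v L K q)"
    using cl(2) by (subst (asm) ennreal_le_iff) auto
qed

text \<open>Upper bound: a window without small cells has no hit block, and the hits are
  independent. Lower bound: a window with a small cell but no hit block contains a triple that the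
  blocks miss, and the mean number of missed triples is
  \<open>\<beta>^3 * (\<rho> * r') - n^2 * a\<close>.\<close>

lemma no_exceed_prob_bounds:
  assumes v: "v > 0" and K: "K > 0" and L: "L > 2 * K" and \<delta>: "\<delta> > 0" and \<rho>: "\<rho> \<ge> 0" and n: "n > 0" "real n * L \<le> sqrt \<rho>"
    and r: "radius_tail (\<beta> * pi) {..K} v = ennreal r" "r \<ge> 0" and cl: "clash v K \<delta> (ennreal (L\<^sup>2)) \<le> ennreal C" "C \<ge> 0"
    and r': "radius_tail (\<beta> * pi) UNIV v = ennreal r'" "r' \<ge> 0"
  defines "P \<equiv> prob {\<omega> \<in> space M. num_exceed v UNIV (window \<rho>) (X \<omega>) = 0}" and "a \<equiv> (L - 2 * K)\<^sup>2 * (\<beta> ^ 3 * r)"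
  shows "P \<le> exp (- ((real n)\<^sup>2 * (a - C) / 6))"
    and "a < 6 \<Longrightarrow> exp (- ((real n)\<^sup>2 * ((a / 6) / (1 - a / 6)))) - (\<beta> ^ 3 * (\<rho> * r') - (real n)\<^sup>2 * a) \<le> P"
proof -
  let ?I = "{..<n} \<times> {..<n}"
  let ?p = "\<lambda>q. prob (hit v L K q)"
  let ?A = "{\<omega> \<in> space M. num_exceed v UNIV (window \<rho>) (X \<omega>) = 0}"
  let ?G = "\<Inter>q\<in>?I. space M - hit v L K q"
  let ?N = "\<lambda>q \<omega>. num_exceed v {..K} (block L K q) (X \<omega>)" and ?W = "\<lambda>\<omega>. num_exceed v UNIV (window \<rho>) (X \<omega>)"
  have I: "finite ?I" "?I \<noteq> {}" using n(1) by auto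
  have cardI: "real (card ?I) = (real n)\<^sup>2" by (simp add: power2_eq_square)
  have L0: "L > 0" using L K by simp
  have b3: "\<beta> ^ 3 \<ge> 0" using intensity_pos by simp
  have a0: "a \<ge> 0" unfolding a_def using b3 r by simp
  note hp = hit_prob[OF v K L \<delta> r cl, folded a_def]
  have Wm [measurable]: "?W \<in> borel_measurable M" using window_sets[OF \<rho>] by (intro num_exceed_measurable) auto
  have Nm [measurable]: "?N q \<in> borel_measurable M" for q by (intro num_exceed_measurable) auto
  have Aev [measurable]: "?A \<in> events" by measurable
  have Gev [measurable]: "?G \<in> events" using I hit_sets by (intro sets.finite_INT) auto
  have sum_le: "(\<Sum>q\<in>?I. ?N q \<omega>) \<le> ?W \<omega>" for \<omega>
  proof (rule num_exceed_sum_le[OF I(1)])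
    show "disjoint_family_on (block L K) ?I"
      using block_disjoint[OF L0] K by simp
    show "block L K q \<subseteq> window \<rho>" if "q \<in> ?I" for q
      using block_window[OF n(2) \<rho> L0 that] block_mono[of K L q] K by auto
  qed
  have AG: "?A \<subseteq> ?G"
  proof
    fix \<omega> assume w: "\<omega> \<in> ?A"
    then have "(\<Sum>q\<in>?I. ?N q \<omega>) = 0" using sum_le[of \<omega>] by simp
    then have "\<forall>q\<in>?I. ?N q \<omega> = 0" using I(1) by (simp only: sum_eq_0_iff)
    then show "\<omega> \<in> ?G" using w by (auto simp: hit_def)
  qed
  have "P \<le> prob ?G" unfolding P_def using AG Gev by (rule finite_measure_mono)
  also have "\<dots> = (\<Prod>q\<in>?I. 1 - ?p q)" by (rule no_hit_prob[OF L0 I])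
  also have "\<dots> \<le> (\<Prod>q\<in>?I. exp (- ((a - C) / 6)))"
  proof (rule prod_mono, rule conjI)
    fix q
    show "0 \<le> 1 - ?p q" by simp
    have "1 - ?p q \<le> 1 + (- ((a - C) / 6))" using hp(2)[of q] by simp
    also have "\<dots> \<le> exp (- ((a - C) / 6))" by (rule exp_ge_add_one_self)
    finally show "1 - ?p q \<le> exp (- ((a - C) / 6))" .
  qed
  also have "\<dots> = exp (real (card ?I) * (- ((a - C) / 6)))"
    by (simp only: prod_constant exp_of_nat_mult)
  finally show "P \<le> exp (- ((real n)\<^sup>2 * (a - C) / 6))" unfolding cardI by simp
  assume a6: "a < 6"
  have "exp (- ((real n)\<^sup>2 * ((a / 6) / (1 - a / 6)))) = (\<Prod>q\<in>?I. exp (- ((a / 6) / (1 - a / 6))))"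
    unfolding prod_constant exp_of_nat_mult[symmetric] cardI by simp
  also have "\<dots> \<le> (\<Prod>q\<in>?I. 1 - ?p q)"
  proof (rule prod_mono, rule conjI)
    fix q
    have "exp (- ((a / 6) / (1 - a / 6))) \<le> 1 - a / 6" using a0 a6 by (intro exp_le_one_minus) auto
    then show "exp (- ((a / 6) / (1 - a / 6))) \<le> 1 - ?p q" using hp(1)[of q] by simp
  qed simp
  also have "\<dots> = prob ?G" by (rule no_hit_prob[OF L0 I, symmetric])
  finally have low: "exp (- ((real n)\<^sup>2 * ((a / 6) / (1 - a / 6)))) \<le> prob ?G" .
  \<comment> \<open>Written with sums because subtraction in \<open>ennreal\<close> is truncated. If
    no block is hit but the window has a small cell, the block counts vanish and the window count is
    at least 6.\<close>
  have pw: "indicator ?G \<omega> + (\<Sum>q\<in>?I. ?N q \<omega>) \<le> indicator ?A \<omega> + ?W \<omega>" if "\<omega> \<in> space M" for \<omega>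
  proof (cases "\<omega> \<in> ?G")
    case False
    then show ?thesis using sum_le[of \<omega>] by (simp add: add_increasing)
  next
    case True
    then have "\<forall>q\<in>?I. \<omega> \<notin> hit v L K q" by blast
    then have "\<forall>q\<in>?I. ?N q \<omega> = 0" using that by (simp add: hit_def)
    then have s0: "(\<Sum>q\<in>?I. ?N q \<omega>) = 0" using I(1) by (simp only: sum_eq_0_iff)
    show ?thesis
    proof (cases "\<omega> \<in> ?A")
      case True then show ?thesis unfolding s0 by (simp add: indicator_def add_increasing2)
    next
      case False
      then have "6 \<le> ?W \<omega>" using that num_exceed_ge_6 by auto
      then have "1 \<le> ?W \<omega>" by (rule order_trans[rotated]) simp
      then show ?thesis unfolding s0 using False by (simp add: indicator_def)
    qed
  qed
  have "emeasure M ?G + (\<Sum>q\<in>?I. ennreal a) = (\<integral>\<^sup>+\<omega>. indicator ?G \<omega> + (\<Sum>q\<in>?I. ?N q \<omega>) \<partial>M)"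
  proof -
    have "(\<integral>\<^sup>+\<omega>. ?N q \<omega> \<partial>M) = ennreal a" for q
      using emeasure_block[of K L q] L r b3 by (simp add: num_exceed_expectation ennreal_mult[symmetric] mult_ac a_def)
    then have "(\<Sum>q\<in>?I. ennreal a) = (\<integral>\<^sup>+\<omega>. (\<Sum>q\<in>?I. ?N q \<omega>) \<partial>M)"
      by (subst nn_integral_sum) (auto intro: Nm)
    moreover have "(\<integral>\<^sup>+\<omega>. indicator ?G \<omega> + (\<Sum>q\<in>?I. ?N q \<omega>) \<partial>M) = (\<integral>\<^sup>+\<omega>. indicator ?G \<omega> \<partial>M) + (\<integral>\<^sup>+\<omega>. (\<Sum>q\<in>?I. ?N q \<omega>) \<partial>M)"
      by (intro nn_integral_add borel_measurable_sum borel_measurable_indicator Gev Nm)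
    ultimately show ?thesis using nn_integral_indicator[OF Gev] by simp
  qed
  also have "\<dots> \<le> (\<integral>\<^sup>+\<omega>. indicator ?A \<omega> + ?W \<omega> \<partial>M)"
    by (rule nn_integral_mono) (rule pw)
  also have "\<dots> = (\<integral>\<^sup>+\<omega>. indicator ?A \<omega> \<partial>M) + (\<integral>\<^sup>+\<omega>. ?W \<omega> \<partial>M)"
    by (rule nn_integral_add) (auto intro!: borel_measurable_indicator Aev Wm)
  also have "\<dots> = ennreal P + ennreal (\<beta> ^ 3 * (\<rho> * r'))"
  proof -
    have "(\<integral>\<^sup>+\<omega>. ?W \<omega> \<partial>M) = ennreal (\<beta> ^ 3 * (\<rho> * r'))"
      using window_sets[OF \<rho>] emeasure_window[OF \<rho>] r' b3 \<rho> by (simp add: num_exceed_expectation ennreal_mult[symmetric] mult_ac)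
    then show ?thesis using nn_integral_indicator[OF Aev] by (simp add: P_def emeasure_eq_measure)
  qed
  also have "\<dots> = ennreal (P + \<beta> ^ 3 * (\<rho> * r'))" using b3 \<rho> r' by (simp add: P_def)
  also have "emeasure M ?G + (\<Sum>q\<in>?I. ennreal a) = ennreal (prob ?G + (real n)\<^sup>2 * a)"
  proof -
    have "(\<Sum>q\<in>?I. ennreal a) = ennreal (\<Sum>q\<in>?I. a)" using a0 by (intro sum_ennreal)
    also have "(\<Sum>q\<in>?I. a) = (real n)\<^sup>2 * a" unfolding sum_constant cardI ..
    finally show ?thesis using a0 by (simp add: emeasure_eq_measure)
  qed
  finally have "prob ?G + (real n)\<^sup>2 * a \<le> P + \<beta> ^ 3 * (\<rho> * r')"
    using b3 \<rho> r' by (subst (asm) ennreal_le_iff) (auto simp: P_def)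
  then show "exp (- ((real n)\<^sup>2 * ((a / 6) / (1 - a / 6)))) - (\<beta> ^ 3 * (\<rho> * r') - (real n)\<^sup>2 * a) \<le> P" using low by simp
qed

end

section \<open>The limit\<close>

context planar_poisson
begin

definition clash_real :: "real \<Rightarrow> real \<Rightarrow> real \<Rightarrow> real \<Rightarrow> real \<Rightarrow> real" where
  "clash_real v K \<delta> l d = \<beta> ^ 3 * ((48 * \<beta> * K * v / \<delta> + 3 * \<beta>\<^sup>2 * d + \<beta> ^ 3 * (l * d)) * (l * d) + \<beta> * (l * (3 * (l\<^sup>2 * (pi * \<delta>\<^sup>2)))))"

lemma clash_real:
  assumes pos: "v > 0" "K > 0" "\<delta> > 0" "l \<ge> 0" "d \<ge> 0" and d: "radius_tail 0 {..K} v \<le> ennreal d"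
  shows "clash v K \<delta> (ennreal l) \<le> ennreal (clash_real v K \<delta> l d)" "clash_real v K \<delta> l d \<ge> 0"
proof -
  have e: "ennreal b * ((ennreal c1 + ennreal c2 * ennreal d + ennreal b * (ennreal l * ennreal d)) * (ennreal l * ennreal d) + ennreal e * (ennreal l * (3 * ((ennreal l)\<^sup>2 * ennreal g)))) =
    ennreal (b * ((c1 + c2 * d + b * (l * d)) * (l * d) + e * (l * (3 * (l\<^sup>2 * g)))))"
    if "b \<ge> 0" "c1 \<ge> 0" "c2 \<ge> 0" "e \<ge> 0" "g \<ge> 0" for b c1 c2 e g
    using that pos by (simp add: ennreal_mult power2_eq_square)
  have "clash v K \<delta> (ennreal l) \<le> ennreal (\<beta> ^ 3) * ((ennreal (48 * \<beta> * K * v / \<delta>) + ennreal (3 * \<beta>\<^sup>2) * ennreal d + ennreal (\<beta> ^ 3) * (ennreal l * ennreal d)) * (ennreal l * ennreal d)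
     + ennreal \<beta> * (ennreal l * (3 * ((ennreal l)\<^sup>2 * ennreal (pi * \<delta>\<^sup>2)))))"
    unfolding clash_def by (intro mult_left_mono add_mono mult_mono d order_refl) auto
  also have "\<dots> = ennreal (clash_real v K \<delta> l d)"
    unfolding clash_real_def using pos intensity_pos by (intro e) auto
  finally show "clash v K \<delta> (ennreal l) \<le> ennreal (clash_real v K \<delta> l d)" .
  show "clash_real v K \<delta> l d \<ge> 0" unfolding clash_real_def using pos intensity_pos by simp
qed

text \<open>A sixth of the limit of the expected number of triples counted in all shrunk blocks.\<close>

definition thin_rate :: "real \<Rightarrow> real \<Rightarrow> real \<Rightarrow> real" where
  "thin_rate \<tau> K L = (1 / L)\<^sup>2 * ((L - 2 * K)\<^sup>2 * (\<beta> ^ 3 * (\<tau> * tail_const * enn2real (radius_mass (\<beta> * pi) {..K})))) / 6"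

text \<open>\<open>K\<close> and \<open>L\<close> are fixed while the window grows. The lower limit
  loses \<open>\<kappa> - 6 * \<sigma>\<close>, the limiting mean number of ordered triples with
  circumradius above \<open>K\<close> or centre outside the shrunk blocks.\<close>

lemma block_asymptotics:
  fixes v \<rho> :: "nat \<Rightarrow> real"
  assumes K: "K > 0" and L: "L > 2 * K" and \<tau>: "\<tau> > 0"
    and v: "\<And>m. v m > 0" "v \<longlonglongrightarrow> 0" and \<rho>: "\<And>m. \<rho> m > 0" "filterlim \<rho> at_top sequentially" and v\<rho>: "\<And>m. v m powr (5/3) * \<rho> m = \<tau>"
  defines "P \<equiv> \<lambda>m. prob {\<omega> \<in> space M. num_exceed (v m) UNIV (window (\<rho> m)) (X \<omega>) = 0}"
    and "\<kappa> \<equiv> \<beta> ^ 3 * (\<tau> * tail_const * enn2real (radius_mass (\<beta> * pi) UNIV))" and "\<sigma> \<equiv> thin_rate \<tau> K L"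
  obtains u l where "eventually (\<lambda>m. P m \<le> u m \<and> l m \<le> P m) sequentially"
    "u \<longlonglongrightarrow> exp (- \<sigma>)" "l \<longlonglongrightarrow> exp (- \<sigma>) - (\<kappa> - 6 * \<sigma>)"
proof -
  have L0: "L > 0" using L K by simp
  have c: "\<beta> * pi > 0" using intensity_pos by simp
  obtain r where r: "eventually (\<lambda>m. radius_tail (\<beta> * pi) {..K} (v m) = ennreal (r m)) sequentially" "\<And>m. r m \<ge> 0"
    "(\<lambda>m. \<rho> m * r m) \<longlonglongrightarrow> \<tau> * tail_const * enn2real (radius_mass (\<beta> * pi) {..K})"
    by (rule radius_tail_asymptotics[OF c _ \<tau> v v\<rho>, of "{..K}"]) auto
  obtain r' where r': "eventually (\<lambda>m. radius_tail (\<beta> * pi) UNIV (v m) = ennreal (r' m)) sequentially" "\<And>m. r' m \<ge> 0"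
    "(\<lambda>m. \<rho> m * r' m) \<longlonglongrightarrow> \<tau> * tail_const * enn2real (radius_mass (\<beta> * pi) UNIV)"
    by (rule radius_tail_asymptotics[OF c _ \<tau> v v\<rho>, of UNIV]) auto
  obtain d0 where d0: "eventually (\<lambda>m. radius_tail 1 {..K} (v m) = ennreal (d0 m)) sequentially" "\<And>m. d0 m \<ge> 0"
    "(\<lambda>m. \<rho> m * d0 m) \<longlonglongrightarrow> \<tau> * tail_const * enn2real (radius_mass 1 {..K})"
    by (rule radius_tail_asymptotics[OF zero_less_one _ \<tau> v v\<rho>, of "{..K}"]) auto
  define d where "d m = exp (K\<^sup>2) * d0 m" for m
  \<comment> \<open>The exponent must lie strictly between 5/6 and 1, so that
    \<open>\<rho> * \<delta>^2\<close> and \<open>v / \<delta>\<close> both tend to 0; with 9/10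
    they are of order \<open>v powr (2/15)\<close> and \<open>v powr (1/10)\<close>.\<close>
  define \<delta> where "\<delta> m = v m powr (9/10)" for m
  \<comment> \<open>The number of blocks per side that fit into the window; the uncovered rest is a
    vanishing fraction of its area.\<close>
  define n where "n m = nat \<lfloor>sqrt (\<rho> m) / L\<rfloor>" for m
  define C where "C m = clash_real (v m) K (\<delta> m) (L\<^sup>2) (d m)" for m
  define a where "a m = (L - 2 * K)\<^sup>2 * (\<beta> ^ 3 * r m)" for m
  have d_nonneg: "d m \<ge> 0" and \<delta>_pos: "\<delta> m > 0" for m using d0(2) v(1)[of m] by (simp_all add: d_def \<delta>_def)
  have inv: "(\<lambda>m. inverse (\<rho> m)) \<longlonglongrightarrow> 0" by (rule tendsto_inverse_0_at_top[OF \<rho>(2)])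
  have to0: "f \<longlonglongrightarrow> 0" if "(\<lambda>m. \<rho> m * f m) \<longlonglongrightarrow> y" for f y
  proof -
    have "(\<lambda>m. \<rho> m * f m * inverse (\<rho> m)) \<longlonglongrightarrow> y * 0" by (intro tendsto_mult that inv)
    moreover have "\<rho> m * f m * inverse (\<rho> m) = f m" for m using \<rho>(1)[of m] by simp
    ultimately show ?thesis by simp
  qed
  have powr0: "(\<lambda>m. v m powr p) \<longlonglongrightarrow> 0" if "p > 0" for p
    by (rule tendsto_zero_powrI[OF v(2) tendsto_const]) (use that v(1) in \<open>auto simp: less_imp_le\<close>)
  have \<rho>d: "(\<lambda>m. \<rho> m * d m) \<longlonglongrightarrow> exp (K\<^sup>2) * (\<tau> * tail_const * enn2real (radius_mass 1 {..K}))"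
    using tendsto_mult_left[OF d0(3), of "exp (K\<^sup>2)"] by (simp add: d_def mult_ac)
  \<comment> \<open>The number of blocks is of order \<rho>, so the pair term of a single block has
    to be \<open>o(1 / \<rho>)\<close>.\<close>
  have \<rho>C: "(\<lambda>m. \<rho> m * C m) \<longlonglongrightarrow> 0"
  proof -
    let ?y = "exp (K\<^sup>2) * (\<tau> * tail_const * enn2real (radius_mass 1 {..K}))"
    have "(\<lambda>m. \<beta> ^ 3 * ((48 * \<beta> * K * v m powr (1/10) + 3 * \<beta>\<^sup>2 * d m + \<beta> ^ 3 * (L\<^sup>2 * d m)) * (L\<^sup>2 * (\<rho> m * d m)) + \<beta> * (L\<^sup>2 * (3 * ((L\<^sup>2)\<^sup>2 * (pi * (\<tau> * v m powr (2/15)))))))) \<longlonglongrightarrow>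
      \<beta> ^ 3 * ((48 * \<beta> * K * 0 + 3 * \<beta>\<^sup>2 * 0 + \<beta> ^ 3 * (L\<^sup>2 * 0)) * (L\<^sup>2 * ?y) + \<beta> * (L\<^sup>2 * (3 * ((L\<^sup>2)\<^sup>2 * (pi * (\<tau> * 0))))))"
      by (intro tendsto_intros powr0 \<rho>d to0[OF \<rho>d]) auto
    moreover have "\<beta> ^ 3 * ((48 * \<beta> * K * v m powr (1/10) + 3 * \<beta>\<^sup>2 * d m + \<beta> ^ 3 * (L\<^sup>2 * d m)) * (L\<^sup>2 * (\<rho> m * d m)) + \<beta> * (L\<^sup>2 * (3 * ((L\<^sup>2)\<^sup>2 * (pi * (\<tau> * v m powr (2/15))))))) = \<rho> m * C m" for m
    proof -
      have "v m powr (1/10) * v m powr (9/10) = v m powr 1" by (simp only: powr_add[symmetric]; simp)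
      then have 1: "48 * \<beta> * K * v m powr (1/10) = 48 * \<beta> * K * v m / \<delta> m"
        using v(1)[of m] by (simp add: \<delta>_def field_simps)
      have "v m powr (5/3) * v m powr (2/15) = v m powr (9/10) * v m powr (9/10)" by (simp only: powr_add[symmetric]; simp)
      then have 2: "\<tau> * v m powr (2/15) = \<rho> m * (\<delta> m)\<^sup>2"
        unfolding v\<rho>[of m, symmetric] \<delta>_def power2_eq_square by (metis mult.assoc mult.commute)
      show ?thesis unfolding 1 2 C_def clash_real_def by (simp only: distrib_left distrib_right mult_ac)
    qed
    ultimately show ?thesis by simp
  qed
  have a0: "a \<longlonglongrightarrow> 0" unfolding a_def
    using tendsto_mult_left[OF to0[OF r(3)], of "(L - 2 * K)\<^sup>2 * \<beta> ^ 3"] by (simp add: mult_ac)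
  have sq: "filterlim (\<lambda>m. sqrt (\<rho> m)) at_top sequentially" by (rule filterlim_compose[OF sqrt_at_top \<rho>(2)])
  have n2: "(\<lambda>m. (real (n m))\<^sup>2 / \<rho> m) \<longlonglongrightarrow> (1 / L)\<^sup>2"
    using tendsto_power[OF floor_ratio_tendsto[OF sq L0], of 2] \<rho>(1) by (simp add: power_divide n_def less_imp_le)
  have n2f: "(\<lambda>m. (real (n m))\<^sup>2 * f m) \<longlonglongrightarrow> (1 / L)\<^sup>2 * y" if "(\<lambda>m. \<rho> m * f m) \<longlonglongrightarrow> y" for f y
  proof -
    have "(real (n m))\<^sup>2 / \<rho> m * (\<rho> m * f m) = (real (n m))\<^sup>2 * f m" for m using \<rho>(1)[of m] by simp
    then show ?thesis using tendsto_mult[OF n2 that] by simp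
  qed
  have na: "(\<lambda>m. (real (n m))\<^sup>2 * a m) \<longlonglongrightarrow> 6 * \<sigma>"
  proof -
    have "(\<lambda>m. \<rho> m * a m) \<longlonglongrightarrow> (L - 2 * K)\<^sup>2 * (\<beta> ^ 3 * (\<tau> * tail_const * enn2real (radius_mass (\<beta> * pi) {..K})))"
      using tendsto_mult_left[OF r(3), of "(L - 2 * K)\<^sup>2 * \<beta> ^ 3"] unfolding a_def by (simp add: mult_ac)
    from n2f[OF this] show ?thesis by (simp add: \<sigma>_def thin_rate_def)
  qed
  have nC: "(\<lambda>m. (real (n m))\<^sup>2 * C m) \<longlonglongrightarrow> 0" using n2f[OF \<rho>C] by simp
  let ?u = "\<lambda>m. exp (- ((real (n m))\<^sup>2 * (a m - C m) / 6))"
  let ?l = "\<lambda>m. exp (- ((real (n m))\<^sup>2 * ((a m / 6) / (1 - a m / 6)))) - (\<beta> ^ 3 * (\<rho> m * r' m) - (real (n m))\<^sup>2 * a m)"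
  have "(\<lambda>m. exp (- (((real (n m))\<^sup>2 * a m - (real (n m))\<^sup>2 * C m) / 6))) \<longlonglongrightarrow> exp (- ((6 * \<sigma> - 0) / 6))"
    by (intro tendsto_intros na nC) auto
  then have u: "?u \<longlonglongrightarrow> exp (- \<sigma>)" by (simp add: right_diff_distrib)
  have "(\<lambda>m. exp (- ((real (n m))\<^sup>2 * a m / 6 / (1 - a m / 6))) - (\<beta> ^ 3 * (\<rho> m * r' m) - (real (n m))\<^sup>2 * a m)) \<longlonglongrightarrow>
    exp (- (6 * \<sigma> / 6 / (1 - 0 / 6))) - (\<beta> ^ 3 * (\<tau> * tail_const * enn2real (radius_mass (\<beta> * pi) UNIV)) - 6 * \<sigma>)"
    by (intro tendsto_intros na a0 r'(3)) auto
  then have l: "?l \<longlonglongrightarrow> exp (- \<sigma>) - (\<kappa> - 6 * \<sigma>)" by (simp add: \<kappa>_def)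
  have "eventually (\<lambda>m. a m < 6) sequentially" by (rule order_tendstoD(2)[OF a0]) simp
  moreover have "eventually (\<lambda>m. sqrt (\<rho> m) \<ge> L) sequentially" using sq by (simp add: filterlim_at_top)
  ultimately have "eventually (\<lambda>m. P m \<le> ?u m \<and> ?l m \<le> P m) sequentially"
    using r(1) r'(1) d0(1)
  proof eventually_elim
    case (elim m)
    have "1 \<le> sqrt (\<rho> m) / L" using elim(2) L0 by simp
    then have n: "n m > 0" "real (n m) \<le> sqrt (\<rho> m) / L" unfolding n_def by linarith+
    have nL: "real (n m) * L \<le> sqrt (\<rho> m)" using n(2) L0 by (simp add: field_simps)
    have "radius_tail 0 {..K} (v m) \<le> ennreal (d m)"
      using radius_tail_0_le[of K "v m"] K d0(2)[of m] unfolding elim(5) d_def by (simp add: ennreal_mult)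
    note cl = clash_real[OF v(1) K \<delta>_pos zero_le_power2 d_nonneg this, of m L, folded C_def]
    note b = no_exceed_prob_bounds[OF v(1) K L \<delta>_pos less_imp_le[OF \<rho>(1)] n(1) nL elim(3) r(2) cl elim(4) r'(2), folded a_def]
    show ?case using b(1) b(2)[OF elim(1)] unfolding P_def by (rule conjI)
  qed
  with u l show thesis by (intro that)
qed

text \<open>With \<open>K = j\<close> and \<open>L = 2 * j^2\<close> one has
  \<open>(L - 2 * K) / L = 1 - 1 / j\<close>, so the margins become negligible while the cut-off on
  the circumradius is lifted.\<close>

lemma thin_rate_LIMSEQ: "(\<lambda>j. thin_rate \<tau> (real j) (2 * (real j)\<^sup>2)) \<longlonglongrightarrow> \<beta> ^ 3 * (\<tau> * tail_const * enn2real (radius_mass (\<beta> * pi) UNIV)) / 6"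
proof -
  have c: "\<beta> * pi > 0" using intensity_pos by simp
  have m: "(\<lambda>j. enn2real (radius_mass (\<beta> * pi) {..real j})) \<longlonglongrightarrow> enn2real (radius_mass (\<beta> * pi) UNIV)"
    using radius_mass_LIMSEQ[of "\<beta> * pi"] by (intro tendsto_enn2real) (simp_all add: radius_mass_UNIV[OF c])
  have "(\<lambda>j. (1 - inverse (real j))\<^sup>2 * (\<beta> ^ 3 * (\<tau> * tail_const * enn2real (radius_mass (\<beta> * pi) {..real j}))) / 6) \<longlonglongrightarrow>
    (1 - 0)\<^sup>2 * (\<beta> ^ 3 * (\<tau> * tail_const * enn2real (radius_mass (\<beta> * pi) UNIV))) / 6"
    by (intro tendsto_intros m tendsto_inverse_0_at_top filterlim_real_sequentially) auto
  moreover have "eventually (\<lambda>j. (1 - inverse (real j))\<^sup>2 * (\<beta> ^ 3 * (\<tau> * tail_const * enn2real (radius_mass (\<beta> * pi) {..real j}))) / 6 = thin_rate \<tau> (real j) (2 * (real j)\<^sup>2)) sequentially"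
    using eventually_gt_at_top[of 0]
  proof eventually_elim
    case (elim j)
    have "(1 - inverse (real j))\<^sup>2 = (1 / (2 * (real j)\<^sup>2))\<^sup>2 * (2 * (real j)\<^sup>2 - 2 * real j)\<^sup>2"
      unfolding power_mult_distrib[symmetric] using elim by (intro arg_cong[where f="\<lambda>x. x\<^sup>2"]) (simp add: field_simps power2_eq_square)
    then show ?case unfolding thin_rate_def by simp
  qed
  ultimately show ?thesis by (simp add: tendsto_cong)
qed

text \<open>For each \<open>j \<ge> 2\<close>, \<open>block_asymptotics\<close> brackets the
  probabilities in the limit between \<open>exp (- s j) - 6 * (\<theta> - s j)\<close> and
  \<open>exp (- s j)\<close>. Both bounds tend to \<open>exp (- \<theta>)\<close>, and for a given
  target \<open>y\<close> a single suitable \<open>j\<close> suffices.\<close>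

lemma no_exceed_limit:
  fixes v \<rho> :: "nat \<Rightarrow> real"
  assumes \<tau>: "\<tau> > 0"
    and v: "\<And>m. v m > 0" "v \<longlonglongrightarrow> 0" and \<rho>: "\<And>m. \<rho> m > 0" "filterlim \<rho> at_top sequentially" and v\<rho>: "\<And>m. v m powr (5/3) * \<rho> m = \<tau>"
    and \<theta>: "\<beta> ^ 3 * (\<tau> * tail_const * enn2real (radius_mass (\<beta> * pi) UNIV)) = 6 * \<theta>"
  shows "(\<lambda>m. prob {\<omega> \<in> space M. num_exceed (v m) UNIV (window (\<rho> m)) (X \<omega>) = 0}) \<longlonglongrightarrow> exp (- \<theta>)" (is "?P \<longlonglongrightarrow> _")
proof (rule order_tendstoI)
  define s where "s j = thin_rate \<tau> (real j) (2 * (real j)\<^sup>2)" for j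
  have s: "s \<longlonglongrightarrow> \<theta>" using thin_rate_LIMSEQ[of \<tau>] unfolding s_def \<theta> by simp
  \<comment> \<open>This is \<open>L > 2 * K\<close> for \<open>K = j\<close> and
    \<open>L = 2 * j^2\<close>; equality at \<open>j = 1\<close> is why \<open>j\<close> starts at
    2.\<close>
  have LK: "2 * (real j)\<^sup>2 > 2 * real j" if "j \<ge> 2" for j
    using that by (simp add: power2_eq_square)
  fix y :: real
  assume y: "y < exp (- \<theta>)"
  have "(\<lambda>j. exp (- s j) - (6 * \<theta> - 6 * s j)) \<longlonglongrightarrow> exp (- \<theta>) - (6 * \<theta> - 6 * \<theta>)" by (intro tendsto_intros s)
  then have "(\<lambda>j. exp (- s j) - (6 * \<theta> - 6 * s j)) \<longlonglongrightarrow> exp (- \<theta>)" by simp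
  from order_tendstoD(1)[OF this y] have "eventually (\<lambda>j. j \<ge> 2 \<and> y < exp (- s j) - (6 * \<theta> - 6 * s j)) sequentially"
    using eventually_ge_at_top[of "2::nat"] by eventually_elim simp
  then obtain j where j: "j \<ge> 2" "y < exp (- s j) - (6 * \<theta> - 6 * s j)" by (auto dest: eventually_happens)
  obtain u l where ul: "eventually (\<lambda>m. ?P m \<le> u m \<and> l m \<le> ?P m) sequentially" "l \<longlonglongrightarrow> exp (- s j) - (6 * \<theta> - 6 * s j)"
    by (rule block_asymptotics[OF _ LK[OF j(1)] \<tau> v \<rho> v\<rho>]) (use j(1) in \<open>auto simp: s_def \<theta>\<close>)
  show "eventually (\<lambda>m. y < ?P m) sequentially"
    using ul(1) order_tendstoD(1)[OF ul(2) j(2)] by eventually_elim simp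
next
  define s where "s j = thin_rate \<tau> (real j) (2 * (real j)\<^sup>2)" for j
  have s: "s \<longlonglongrightarrow> \<theta>" using thin_rate_LIMSEQ[of \<tau>] unfolding s_def \<theta> by simp
  have LK: "2 * (real j)\<^sup>2 > 2 * real j" if "j \<ge> 2" for j
    using that by (simp add: power2_eq_square)
  fix y :: real
  assume y: "y > exp (- \<theta>)"
  have "(\<lambda>j. exp (- s j)) \<longlonglongrightarrow> exp (- \<theta>)" by (intro tendsto_intros s)
  from order_tendstoD(2)[OF this y] have "eventually (\<lambda>j. j \<ge> 2 \<and> exp (- s j) < y) sequentially"
    using eventually_ge_at_top[of "2::nat"] by eventually_elim simp
  then obtain j where j: "j \<ge> 2" "exp (- s j) < y" by (auto dest: eventually_happens)
  obtain u l where ul: "eventually (\<lambda>m. ?P m \<le> u m \<and> l m \<le> ?P m) sequentially" "u \<longlonglongrightarrow> exp (- s j)"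
    by (rule block_asymptotics[OF _ LK[OF j(1)] \<tau> v \<rho> v\<rho>]) (use j(1) in \<open>auto simp: s_def\<close>)
  show "eventually (\<lambda>m. ?P m < y) sequentially"
    using ul(1) order_tendstoD(2)[OF ul(2) j(2)] by eventually_elim simp
qed

end

lemma min_area_num_exceed:
  assumes "c > 0" "t \<ge> 0"
  shows "ennreal c * min_area (delaunay_cells \<xi>) \<rho> \<ge> ennreal t \<longleftrightarrow> num_exceed (t / c) UNIV (window \<rho>) \<xi> = 0"
  unfolding min_area_iff[OF assms] num_exceed_eq_0_iff exceed_set_def exceed_def by auto

theorem proposition7:
  fixes M :: "'w measure" and X :: "'w \<Rightarrow> (real^2) set" and \<beta> t :: real
  assumes "homogeneous_poisson_process M X \<beta>"
    and "tessellation_intensity M (\<lambda>\<omega>. delaunay_cells (X \<omega>)) 1"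
    and "t \<ge> 0"
  shows "((\<lambda>\<rho>::real. measure M {\<omega> \<in> space M.
            ennreal (alpha3 powr (3/5) * \<rho> powr (3/5)) * min_area (delaunay_cells (X \<omega>)) \<rho> \<ge> ennreal t})
          \<longlongrightarrow> exp (- (t powr (5/3)))) at_top"
proof (cases "t = 0")
  \<comment> \<open>\<open>t = 0\<close> is separated because the level \<open>t / c\<close> has to
    be positive below; here the event is the whole space and the limit is
    \<open>exp 0 = 1\<close>.\<close>
  case True
  interpret prob_space M using assms(1) by (simp add: homogeneous_poisson_process_def)
  show ?thesis unfolding True by (simp add: prob_space)
next
  case False
  interpret planar_poisson M X \<beta> using assms(1) by (rule planar_poisson.intro)
  have t: "t > 0" using False assms(3) by simp
  have \<beta>: "\<beta> = 1 / 2" by (rule intensity_half[OF assms(2)])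
  show ?thesis
  proof (rule tendsto_at_topI_sequentially)
    fix R :: "nat \<Rightarrow> real" assume R: "filterlim R at_top sequentially"
    \<comment> \<open>Truncation at 1 makes the window size positive for every index; it agrees with
      \<open>R\<close> eventually.\<close>
    define \<rho> where "\<rho> m = max 1 (R m)" for m
    define c where "c m = alpha3 powr (3/5) * \<rho> m powr (3/5)" for m
    have \<rho>_pos: "\<rho> m > 0" for m by (simp add: \<rho>_def less_max_iff_disj)
    have \<rho>_top: "filterlim \<rho> at_top sequentially"
      by (rule filterlim_at_top_mono[OF R]) (simp add: \<rho>_def)
    have ev: "eventually (\<lambda>m. R m = \<rho> m) sequentially"
      using R[unfolded filterlim_at_top, rule_format, of 1] by eventually_elim (simp add: \<rho>_def)
    have c_pos: "c m > 0" for m using alpha3_pos \<rho>_pos[of m] by (simp add: c_def)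
    \<comment> \<open>The level is scaled so that \<open>v powr (5/3) * \<rho>\<close> is the
      constant \<open>t powr (5/3) / alpha3\<close>, which serves as \<open>\<tau>\<close>; by
      \<open>rate_constant\<close> the limiting rate is then \<open>t powr (5/3)\<close>.\<close>
    have v53: "(t / c m) powr (5/3) * \<rho> m = t powr (5/3) / alpha3" for m
    proof -
      have "c m powr (5/3) = alpha3 * \<rho> m"
        using alpha3_pos \<rho>_pos[of m] by (simp add: c_def powr_mult powr_powr)
      then show ?thesis using t c_pos[of m] \<rho>_pos[of m] by (simp add: powr_divide)
    qed
    have "(\<lambda>m. t / alpha3 powr (3/5) * \<rho> m powr (-(3/5))) \<longlonglongrightarrow> t / alpha3 powr (3/5) * 0"
      by (intro tendsto_mult tendsto_const tendsto_neg_powr \<rho>_top) simp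
    then have v0: "(\<lambda>m. t / c m) \<longlonglongrightarrow> 0" by (simp add: c_def powr_minus_divide)
    have bp: "\<beta> * pi > 0" by (simp add: \<beta>)
    have "enn2real (radius_mass (\<beta> * pi) UNIV) = pi * Gamma (1/3) * (1/2 * pi) powr (-1/3)"
      unfolding radius_mass_UNIV[OF bp] unfolding \<beta> by (simp add: Gamma_real_nonneg)
    then have rate: "\<beta> ^ 3 * (t powr (5/3) / alpha3 * tail_const * enn2real (radius_mass (\<beta> * pi) UNIV)) = 6 * t powr (5/3)"
    proof -
      assume e: "enn2real (radius_mass (\<beta> * pi) UNIV) = pi * Gamma (1/3) * (1/2 * pi) powr (-1/3)"
      have "\<beta> ^ 3 * (t powr (5/3) / alpha3 * tail_const * enn2real (radius_mass (\<beta> * pi) UNIV)) =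
        t powr (5/3) / alpha3 * ((1/2) ^ 3 * tail_const * (pi * Gamma (1/3) * (1/2 * pi) powr (-1/3)))"
        unfolding e unfolding \<beta> by (simp only: mult_ac)
      then show ?thesis unfolding rate_constant using alpha3_pos by simp
    qed
    have "(\<lambda>m. prob {\<omega> \<in> space M. num_exceed (t / c m) UNIV (window (\<rho> m)) (X \<omega>) = 0}) \<longlonglongrightarrow> exp (- (t powr (5/3)))"
      using t c_pos alpha3_pos by (intro no_exceed_limit[OF _ _ v0 \<rho>_pos \<rho>_top v53 rate]) auto
    then have "(\<lambda>m. prob {\<omega> \<in> space M. ennreal t \<le> ennreal (c m) * min_area (delaunay_cells (X \<omega>)) (\<rho> m)}) \<longlonglongrightarrow> exp (- (t powr (5/3)))"
      unfolding min_area_num_exceed[OF c_pos assms(3)] .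
    moreover have "eventually (\<lambda>m. prob {\<omega> \<in> space M. ennreal t \<le> ennreal (c m) * min_area (delaunay_cells (X \<omega>)) (\<rho> m)} =
       measure M {\<omega> \<in> space M. ennreal (alpha3 powr (3/5) * R m powr (3/5)) * min_area (delaunay_cells (X \<omega>)) (R m) \<ge> ennreal t}) sequentially"
      using ev by eventually_elim (simp add: c_def)
    ultimately show "(\<lambda>m. measure M {\<omega> \<in> space M. ennreal (alpha3 powr (3/5) * R m powr (3/5)) * min_area (delaunay_cells (X \<omega>)) (R m) \<ge> ennreal t}) \<longlonglongrightarrow> exp (- (t powr (5/3)))"
      by (rule Lim_transform_eventually)
  qed
qed

end
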